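(* Let $\mathcal F$ be a Cauchy flux in $\Omega$ with associated measures $\sigma,\mu$, and let $F=(F_1,\dots,F_n)$ be the finite $\mathbb R^n$-valued Radon measure on $\Omega$ given by $$F_j(S)=\int_{\mathbb R}\mathcal F_{H_{j,+}^t}(S\cap\partial H_{j,+}^t)\,\mathrm dt\qquad\text{for Borel }S\subset\Omega,\ 1\le j\le n.$$ Then $F\in\mathcal{DM}^{\mathrm{ext}}(\Omega)$ and $$-\operatorname{div}F=\sigma\quad\text{in }\Omega.$$ In particular, for any open $U\Subset\Omega$, $$\mathcal F_U(\partial U)=\sigma(U)=\langle F\cdot\nu,\mathbf 1_\Omega\rangle_{\partial U}.$$
   Context: Let $n\ge2$ and let $\Omega\subset\mathbb R^n$ be open. $A\Subset\Omega$ means that $\overline A$ is compact and $\overline A\subset\Omega$. $\mathcal{DM}^{\mathrm{ext}}(\Omega)$ is the space of finite $\mathbb R^n$-valued Radon measures $F$ on $\Omega$ whose distributional divergence, $\langle\operatorname{div}F,\varphi\rangle=-\int_\Omega\nabla\varphi\cdot \mathrm dF$ for $\varphi\in C_c^\infty(\Omega)$, is a finite signed Radon measure on $\Omega$. For $F\in\mathcal{DM}^{\mathrm{ext}}(\Omega)$ and Borel $E\Subset\Omega$, the normal trace is $\langle F\cdot\nu,\phi\rangle_{\partial E}=-\int_E\phi\,\mathrm d(\operatorname{div}F)-\int_E\mathrm d\overline{\nabla\phi\cdot F}$ for $\phi\in W^{1,\infty}(\Omega)$, where $\overline{\nabla\phi\cdot F}$ is the weak* limit of $\nabla(\phi*\rho_\delta)\cdot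 F$ as $\delta\to0$ ($\rho_\delta$ a standard mollifier; in particular $\overline{\nabla\mathbf 1_\Omega\cdot F}=0$). For $U$ open and $\varepsilon>0$, $U^\varepsilon=\{x\in U:\operatorname{dist}(x,\partial U)>\varepsilon\}$. For a non-negative finite Radon measure $\mu$ on $\Omega$ (extended by zero to $\mathbb R^n$), $\mathcal O_\mu$ is the set of open $U\Subset\Omega$ with $\liminf_{\varepsilon\to0}\frac1\varepsilon\mu(U\setminus\overline{U^\varepsilon})<\infty$, and $\widetilde{\mathcal O}_\mu$ the set of open $U\Subset\Omega$ with $\limsup_{\varepsilon\to0}\frac1\varepsilon\mu(U\setminus\overline{U^\varepsilon})<\infty$. A Cauchy flux in $\Omega$ is a real-valued mapping $\mathcal F:(S,U)\mapsto\mathcal F_U(S)$ on pairs with $U\Subset\Omega$ open and $S\subset\partial U$ Borel, together with a finite signed Radon measure $\sigma$ on $\Omega$ and a non-negative finite Radon measure $\mu$ on $\Omega$, such that $\mathcal F_U(\partial U)=\sigma(U)$ for every open $U\Subset\Omega$, and: (i) for $U\in\mathcal O_\mu$ and disjoint Borel $S,T\subset\partial U$, $\mathcal F_U(S\cup T)=\mathcal F_U(S)+\mathcal F_U(T)$; (ii) for $U,V\in\mathcal O_\mu$ and open $A\subset\Omega$ with $A\cap U=A\cap V$, $\mathcal F_U(A\cap\partial U)=\mathcal F_V(A\cap\partial V)$; (iii) for $U\in\mathcal O_\mu$, $|\mathcal F_U(S)|\le\mu_U^{n-1}(S)$ for any Borel $S\subset\partial U$ and any weak* limit $\mu^{n-1}_U$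 (as measures on $\Omega$) of $\frac1{\varepsilon_k}\mu\llcorner(U\setminus\overline{U^{\varepsilon_k}})$ along a sequence $\varepsilon_k\searrow0$. Flux on half-spaces: $H_{j,+}^t=\{x\in\mathbb R^n:x_j>t\}$. Put $\widetilde\Omega^\delta=\{x\in\Omega:\operatorname{dist}(x,\partial\Omega)>\delta,\ |x|<1/\delta\}$; for $\mathcal L^1$-a.e. $\delta>0$, $\widetilde\Omega^\delta\in\widetilde{\mathcal O}_\mu$. For $\mathcal L^1$-a.e. $t$ the weak* limit $\mu^{n-1}_{H_{j,+}^t}$ of $\frac1\varepsilon\mu\llcorner(H_{j,+}^t\setminus\overline{H_{j,+}^{t+\varepsilon}})$ as $\varepsilon\to0$ exists, and for such $t$ one sets $\mathcal F_{H_{j,+}^t}(S):=\mathcal F_{H_{j,+}^t\cap\widetilde\Omega^\delta}(S)$ for Borel $S\subset\widetilde\Omega^\delta\cap\partial H_{j,+}^t$ and $\mathcal L^1$-a.e. $\delta>0$ with $\widetilde\Omega^\delta\in\widetilde{\mathcal O}_\mu$. It is known that this is independent of $\delta$ and extends uniquely to a measure on $\Omega\cap\partial H_{j,+}^t$ bounded in absolute value by $\mu^{n-1}_{H_{j,+}^t}$. The integrand in the formula for $F_j$ is set to $0$ on an exceptional $\mathcal L^1$-null set of $t$; it is known that the integrand is $\mathcal L^1$-integrable and that the formula defines finite signed Radon measures with $|F_j|\le\mu$. *)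

theory Defs
  imports "HOL-Analysis.Analysis"
begin

definition compactly_inside :: "'a::topological_space set \<Rightarrow> 'a set \<Rightarrow> bool" where
  "compactly_inside A \<Omega> \<longleftrightarrow> compact (closure A) \<and> closure A \<subseteq> \<Omega>"

section \<open>Measures on an open set\<close>

text \<open>A non-negative finite Radon measure on \<open>\<Omega>\<close> is a finite Borel measure on the whole space that
  does not charge the complement of \<open>\<Omega>\<close> (extension by zero).  Finite Borel measures on open subsets
  of Euclidean space are automatically Radon; the same applies to signed and vector measures.\<close>

definition finite_radon_on :: "'a::euclidean_space set \<Rightarrow> 'a measure \<Rightarrow> bool" where
  "finite_radon_on \<Omega> \<mu> \<longleftrightarrow> sets \<mu> = sets borel \<and> finite_measure \<mu> \<and> emeasure \<mu> (- \<Omega>) = 0"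

text \<open>Finite signed and vector measures are set functions; only their values on Borel subsets of
  \<open>A\<close> are meaningful.\<close>

definition finite_vector_measure_on ::
    "'a::euclidean_space set \<Rightarrow> ('a set \<Rightarrow> 'b::euclidean_space) \<Rightarrow> bool" where
  "finite_vector_measure_on A m \<longleftrightarrow>
     (\<forall>S::nat \<Rightarrow> 'a set. (\<forall>i. S i \<in> sets borel \<and> S i \<subseteq> A) \<longrightarrow> disjoint_family S \<longrightarrow>
        (\<lambda>i. m (S i)) sums m (\<Union>i. S i))"

text \<open>Positive part of the Jordan decomposition; \<open>ennreal\<close> sends negative numbers to \<open>0\<close>.\<close>

definition pos_variation :: "'a::euclidean_space set \<Rightarrow> ('a set \<Rightarrow> real) \<Rightarrow> 'a measure" where
  "pos_variation \<Omega> \<sigma> = measure_of UNIV (sets borel)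
     (\<lambda>S. SUP T\<in>{T \<in> sets borel. T \<subseteq> S \<inter> \<Omega>}. ennreal (\<sigma> T))"

definition signed_integral ::
    "'a::euclidean_space set \<Rightarrow> ('a set \<Rightarrow> real) \<Rightarrow> ('a \<Rightarrow> real) \<Rightarrow> real" where
  "signed_integral \<Omega> \<sigma> f =
     (LINT x|pos_variation \<Omega> \<sigma>. f x) - (LINT x|pos_variation \<Omega> (\<lambda>S. - \<sigma> S). f x)"

definition Cc :: "'a::euclidean_space set \<Rightarrow> ('a \<Rightarrow> real) set" where
  "Cc \<Omega> = {\<psi>. continuous_on UNIV \<psi> \<and> compactly_inside {x. \<psi> x \<noteq> 0} \<Omega>}"

text \<open>Weak* convergence of measures on \<open>\<Omega>\<close> along a filter, tested against \<open>Cc \<Omega>\<close>.\<close>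

definition weak_star_conv ::
    "'a::euclidean_space set \<Rightarrow> ('i \<Rightarrow> 'a measure) \<Rightarrow> 'a measure \<Rightarrow> 'i filter \<Rightarrow> bool" where
  "weak_star_conv \<Omega> M \<nu> \<F> \<longleftrightarrow> finite_radon_on \<Omega> \<nu> \<and>
     (\<forall>\<psi>\<in>Cc \<Omega>. ((\<lambda>i. LINT x|M i. \<psi> x) \<longlongrightarrow> (LINT x|\<nu>. \<psi> x)) \<F>)"

section \<open>Smooth functions, divergence and normal trace\<close>

definition partial :: "'n::finite \<Rightarrow> (real^'n \<Rightarrow> real) \<Rightarrow> real^'n \<Rightarrow> real" where
  "partial j f x = frechet_derivative f (at x) (axis j 1)"

text \<open>All iterated partial derivatives exist as differentiable functions.\<close>

definition smooth :: "(real^'n::finite \<Rightarrow> real) \<Rightarrow> bool" where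
  "smooth f \<longleftrightarrow> (\<forall>js x. foldr partial js f differentiable (at x))"

definition test_functions :: "(real^'n::finite) set \<Rightarrow> (real^'n \<Rightarrow> real) set" where
  "test_functions \<Omega> = {\<phi>. smooth \<phi> \<and> compactly_inside {x. \<phi> x \<noteq> 0} \<Omega>}"

definition distr_div ::
    "(real^'n::finite) set \<Rightarrow> ((real^'n) set \<Rightarrow> real^'n) \<Rightarrow> (real^'n \<Rightarrow> real) \<Rightarrow> real" where
  "distr_div \<Omega> F \<phi> = - (\<Sum>j\<in>UNIV. signed_integral \<Omega> (\<lambda>S. F S $ j) (partial j \<phi>))"

definition is_div_measure ::
    "(real^'n::finite) set \<Rightarrow> ((real^'n) set \<Rightarrow> real^'n) \<Rightarrow> ((real^'n) set \<Rightarrow> real) \<Rightarrow> bool" where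
  "is_div_measure \<Omega> F \<tau> \<longleftrightarrow> finite_vector_measure_on \<Omega> \<tau> \<and>
     (\<forall>\<phi>\<in>test_functions \<Omega>. distr_div \<Omega> F \<phi> = signed_integral \<Omega> \<tau> \<phi>)"

definition DM_ext :: "(real^'n::finite) set \<Rightarrow> ((real^'n) set \<Rightarrow> real^'n) set" where
  "DM_ext \<Omega> = {F. finite_vector_measure_on \<Omega> F \<and> (\<exists>\<tau>. is_div_measure \<Omega> F \<tau>)}"

text \<open>A choice, rather than a unique description, because set functions representing the same signed
  measure may differ outside the Borel subsets of \<open>\<Omega>\<close>.  On those subsets the choice is immaterial;
  the same remark applies to \<open>pairing\<close> and \<open>halfspace_flux\<close> below.\<close>

definition div_measure ::
    "(real^'n::finite) set \<Rightarrow> ((real^'n) set \<Rightarrow> real^'n) \<Rightarrow> (real^'n) set \<Rightarrow> real" where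
  "div_measure \<Omega> F = (SOME \<tau>. is_div_measure \<Omega> F \<tau>)"

definition bump :: "real^'n::finite \<Rightarrow> real" where
  "bump x = (if norm x < 1 then exp (- 1 / (1 - (norm x)\<^sup>2)) else 0)"

definition mollifier :: "real \<Rightarrow> real^'n::finite \<Rightarrow> real" where
  "mollifier \<delta> x = bump (x /\<^sub>R \<delta>) / (\<delta> ^ CARD('n) * (LINT y|lborel. bump (y :: real^'n)))"

text \<open>Convolution of a function on \<open>\<Omega>\<close>, extended by zero.  On a compact subset of \<open>\<Omega>\<close> the extension
  is not seen once \<open>\<delta>\<close> is small.\<close>

definition mollify ::
    "(real^'n::finite) set \<Rightarrow> (real^'n \<Rightarrow> real) \<Rightarrow> real \<Rightarrow> real^'n \<Rightarrow> real" where
  "mollify \<Omega> \<phi> \<delta> x = (LINT y:\<Omega>|lborel. \<phi> y * mollifier \<delta> (x - y))"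

text \<open>The weak* limit of \<open>\<nabla>(\<phi> * \<rho>\<^sub>\<delta>) \<cdot> F\<close> as \<open>\<delta> \<rightarrow> 0\<close>.\<close>

definition is_pairing ::
    "(real^'n::finite) set \<Rightarrow> ((real^'n) set \<Rightarrow> real^'n) \<Rightarrow> (real^'n \<Rightarrow> real) \<Rightarrow>
     ((real^'n) set \<Rightarrow> real) \<Rightarrow> bool" where
  "is_pairing \<Omega> F \<phi> m \<longleftrightarrow> finite_vector_measure_on \<Omega> m \<and>
     (\<forall>\<psi>\<in>Cc \<Omega>.
       ((\<lambda>\<delta>. \<Sum>j\<in>UNIV. signed_integral \<Omega> (\<lambda>S. F S $ j)
                (\<lambda>x. \<psi> x * partial j (mollify \<Omega> \<phi> \<delta>) x))
         \<longlongrightarrow> signed_integral \<Omega> m \<psi>) (at_right 0))"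

definition pairing ::
    "(real^'n::finite) set \<Rightarrow> ((real^'n) set \<Rightarrow> real^'n) \<Rightarrow> (real^'n \<Rightarrow> real) \<Rightarrow>
     (real^'n) set \<Rightarrow> real" where
  "pairing \<Omega> F \<phi> = (SOME m. is_pairing \<Omega> F \<phi> m)"

text \<open>\<open>normal_trace \<Omega> F E \<phi>\<close> is \<open>\<langle>F \<cdot> \<nu>, \<phi>\<rangle>\<close> on \<open>\<partial>E\<close>.  It is intended for \<open>F \<in> DM_ext \<Omega>\<close>, Borel \<open>E\<close>
  with \<open>compactly_inside E \<Omega>\<close>, and \<open>\<phi>\<close> the continuous representative of a \<open>W\<^sup>1\<^sup>,\<^sup>\<infinity>\<close> function on \<open>\<Omega>\<close>
  (\<open>div F\<close> may charge Lebesgue null sets).\<close>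

definition normal_trace ::
    "(real^'n::finite) set \<Rightarrow> ((real^'n) set \<Rightarrow> real^'n) \<Rightarrow> (real^'n) set \<Rightarrow>
     (real^'n \<Rightarrow> real) \<Rightarrow> real" where
  "normal_trace \<Omega> F E \<phi> =
     - signed_integral \<Omega> (div_measure \<Omega> F) (\<lambda>x. indicator E x * \<phi> x) - pairing \<Omega> F \<phi> E"

section \<open>Cauchy fluxes\<close>

text \<open>\<open>U\<^sup>\<epsilon>\<close>.  The distance to the empty set is \<open>\<infinity>\<close>, whereas \<open>infdist x {} = 0\<close>.\<close>

definition inner_set :: "'a::euclidean_space set \<Rightarrow> real \<Rightarrow> 'a set" where
  "inner_set U \<epsilon> = {x \<in> U. frontier U = {} \<or> infdist x (frontier U) > \<epsilon>}"

definition inner_layer :: "'a::euclidean_space set \<Rightarrow> real \<Rightarrow> 'a set" where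
  "inner_layer U \<epsilon> = U - closure (inner_set U \<epsilon>)"

definition O_class :: "'a::euclidean_space set \<Rightarrow> 'a measure \<Rightarrow> 'a set set" where
  "O_class \<Omega> \<mu> = {U. open U \<and> compactly_inside U \<Omega> \<and>
     Liminf (at_right 0) (\<lambda>\<epsilon>. ereal (measure \<mu> (inner_layer U \<epsilon>) / \<epsilon>)) < \<infinity>}"

definition O_class_sup :: "'a::euclidean_space set \<Rightarrow> 'a measure \<Rightarrow> 'a set set" where
  "O_class_sup \<Omega> \<mu> = {U. open U \<and> compactly_inside U \<Omega> \<and>
     Limsup (at_right 0) (\<lambda>\<epsilon>. ereal (measure \<mu> (inner_layer U \<epsilon>) / \<epsilon>)) < \<infinity>}"

text \<open>The restriction of \<open>\<mu>\<close> to \<open>B\<close>, divided by \<open>\<epsilon>\<close>.\<close>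

definition scaled_restr :: "'a::euclidean_space measure \<Rightarrow> 'a set \<Rightarrow> real \<Rightarrow> 'a measure" where
  "scaled_restr \<mu> B \<epsilon> = density \<mu> (\<lambda>x. ennreal (indicator B x / \<epsilon>))"

text \<open>\<open>\<F> U S\<close> is \<open>\<F>\<^sub>U(S)\<close>; it is meaningful for open \<open>U\<close> with \<open>compactly_inside U \<Omega>\<close> and Borel
  \<open>S \<subseteq> frontier U\<close>.\<close>

definition cauchy_flux ::
    "'a::euclidean_space set \<Rightarrow> ('a set \<Rightarrow> 'a set \<Rightarrow> real) \<Rightarrow> ('a set \<Rightarrow> real) \<Rightarrow> 'a measure \<Rightarrow> bool"
where
  "cauchy_flux \<Omega> \<F> \<sigma> \<mu> \<longleftrightarrow>
     finite_vector_measure_on \<Omega> \<sigma> \<and> finite_radon_on \<Omega> \<mu> \<and>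
     (\<forall>U. open U \<and> compactly_inside U \<Omega> \<longrightarrow> \<F> U (frontier U) = \<sigma> U) \<and>
     (\<forall>U\<in>O_class \<Omega> \<mu>. \<forall>S\<in>sets borel. \<forall>T\<in>sets borel.
        S \<subseteq> frontier U \<and> T \<subseteq> frontier U \<and> S \<inter> T = {} \<longrightarrow> \<F> U (S \<union> T) = \<F> U S + \<F> U T) \<and>
     (\<forall>U\<in>O_class \<Omega> \<mu>. \<forall>V\<in>O_class \<Omega> \<mu>. \<forall>A. open A \<and> A \<subseteq> \<Omega> \<and> A \<inter> U = A \<inter> V \<longrightarrow>
        \<F> U (A \<inter> frontier U) = \<F> V (A \<inter> frontier V)) \<and>
     (\<forall>U\<in>O_class \<Omega> \<mu>. \<forall>\<epsilon>::nat \<Rightarrow> real. \<forall>\<nu>.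
        decseq \<epsilon> \<and> (\<forall>k. \<epsilon> k > 0) \<and> \<epsilon> \<longlonglongrightarrow> 0 \<and>
        weak_star_conv \<Omega> (\<lambda>k. scaled_restr \<mu> (inner_layer U (\<epsilon> k)) (\<epsilon> k)) \<nu> sequentially \<longrightarrow>
        (\<forall>S\<in>sets borel. S \<subseteq> frontier U \<longrightarrow> \<bar>\<F> U S\<bar> \<le> measure \<nu> S))"

definition halfsp :: "'n::finite \<Rightarrow> real \<Rightarrow> (real^'n) set" where
  "halfsp j t = {x. x $ j > t}"

definition exhaustion :: "'a::euclidean_space set \<Rightarrow> real \<Rightarrow> 'a set" where
  "exhaustion \<Omega> \<delta> = {x \<in> inner_set \<Omega> \<delta>. norm x < 1 / \<delta>}"

text \<open>\<open>m\<close> is the flux through \<open>\<Omega> \<inter> frontier (halfsp j t)\<close>: the weak* limit \<open>\<nu>\<close> exists, \<open>m\<close> is a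
  measure with \<open>\<bar>m\<bar> \<le> \<nu>\<close>, and \<open>m\<close> extends the local fluxes.\<close>

definition is_halfspace_flux ::
    "(real^'n::finite) set \<Rightarrow> ((real^'n) set \<Rightarrow> (real^'n) set \<Rightarrow> real) \<Rightarrow> (real^'n) measure \<Rightarrow>
     'n \<Rightarrow> real \<Rightarrow> ((real^'n) set \<Rightarrow> real) \<Rightarrow> bool" where
  "is_halfspace_flux \<Omega> \<F> \<mu> j t m \<longleftrightarrow>
     finite_vector_measure_on (\<Omega> \<inter> frontier (halfsp j t)) m \<and>
     (\<exists>\<nu>. weak_star_conv \<Omega>
            (\<lambda>\<epsilon>. scaled_restr \<mu> (halfsp j t - closure (halfsp j (t + \<epsilon>))) \<epsilon>) \<nu> (at_right 0) \<and>
          (\<forall>S\<in>sets borel. S \<subseteq> \<Omega> \<inter> frontier (halfsp j t) \<longrightarrow> \<bar>m S\<bar> \<le> measure \<nu> S)) \<and>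
     (AE \<delta> in lebesgue. \<delta> > 0 \<and> exhaustion \<Omega> \<delta> \<in> O_class_sup \<Omega> \<mu> \<longrightarrow>
        (\<forall>S\<in>sets borel. S \<subseteq> exhaustion \<Omega> \<delta> \<inter> frontier (halfsp j t) \<longrightarrow>
           m S = \<F> (halfsp j t \<inter> exhaustion \<Omega> \<delta>) S))"

text \<open>Zero on the null set of exceptional \<open>t\<close>.\<close>

definition halfspace_flux ::
    "(real^'n::finite) set \<Rightarrow> ((real^'n) set \<Rightarrow> (real^'n) set \<Rightarrow> real) \<Rightarrow> (real^'n) measure \<Rightarrow>
     'n \<Rightarrow> real \<Rightarrow> (real^'n) set \<Rightarrow> real" where
  "halfspace_flux \<Omega> \<F> \<mu> j t S =
     (if \<exists>m. is_halfspace_flux \<Omega> \<F> \<mu> j t m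
      then (SOME m. is_halfspace_flux \<Omega> \<F> \<mu> j t m) S else 0)"

end

theory Submission
  imports Defs "HOL-Probability.Probability"
begin

text \<open>By differentiation of measures on the line, for almost every \<open>t\<close> the measures
  \<open>\<mu> \<llcorner> {t < x\<^sub>j < t + \<epsilon>} / \<epsilon>\<close> converge, which gives the half-space flux \<open>m\<^sub>j\<^sub>,\<^sub>t\<close>.  Cutting a box \<open>V\<close> along
  \<open>x\<^sub>j = t\<close> and using balance and locality gives
  \<open>m\<^sub>j\<^sub>,\<^sub>t (V \<inter> {x\<^sub>j = t}) = \<sigma> (V \<inter> {x\<^sub>j > t}) - \<F>\<^sub>V (\<partial>V \<inter> {x\<^sub>j > t})\<close>; this makes \<open>m\<^sub>j\<^sub>,\<^sub>t\<close> measurable in \<open>t\<close>.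
  For almost every \<open>x\<close> the edges of the cube \<open>x + (0, h)\<^sup>n\<close> carry no flux, so the cut formula, applied to
  the cube prolonged in the direction \<open>e\<^sub>j\<close>, expresses \<open>\<sigma> (x + (0, h)\<^sup>n)\<close> as the sum over \<open>j\<close> of the
  differences of the half-space fluxes through opposite faces.  Multiply by a test function
  \<open>\<phi> x\<close>, integrate over \<open>x\<close> and move the differences onto \<open>\<phi>\<close> by translation: by Fubini,
  \<open>\<integral> \<phi> x \<cdot> \<sigma> (x + (0, h)\<^sup>n) dx = \<Sum>\<^sub>j \<integral> \<partial>\<^sub>j \<phi> x \<cdot> F\<^sub>j (x + (0, h)\<^sup>n) dx\<close>.
  Dividing by \<open>h\<^sup>n\<close> and letting \<open>h \<rightarrow> 0\<close> yields \<open>\<integral> \<phi> d\<sigma> = \<Sum>\<^sub>j \<integral> \<partial>\<^sub>j \<phi> dF\<^sub>j\<close>.\<close>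

subsection \<open>Differentiation of measures on the line\<close>

text \<open>Bound (iii) speaks only of weak* limits that exist, so it says nothing until such limits
  are produced; hence the compactness theorem. Membership in \<open>O_class\<close> is a liminf
  along widths that depend on the set, and two sets need not share them; the sets used here have
  layers of bounded density along the single sequence \<open>1 / Suc k\<close>, a property that
  survives cutting. Balance yields the flux through a whole boundary, locality the flux through
  relatively open parts of it. Splitting a boundary into faces therefore leaves edges of codimension
  two, on which a limit of layers could concentrate; excluding this for almost every position
  (\<open>edge_ok\<close>) is the main obstacle. The cut formula needs a hyperplane through the
  interior of a box, and the faces of a cube are not in this position; prolonging the cube puts them
  there. Since \<open>F\<close> is an integral over levels, one cube tells nothing about it; only
  the integral over all positions of the cube turns fluxes through hyperplanes into values of
  \<open>F\<close>.\<close>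

lemma vitali_ball_cover:
  fixes E :: "real set"
  assumes E: "E \<in> sets borel" and G: "open G" "E \<subseteq> G"
    and fine: "\<And>x d. x \<in> E \<Longrightarrow> d > 0 \<Longrightarrow> \<exists>a r. x \<in> ball a r \<and> r < d \<and> P a r"
  obtains C :: "(real \<times> real) set" where "countable C" "disjoint_family_on (\<lambda>i. ball (fst i) (snd i)) C"
    "\<And>i. i \<in> C \<Longrightarrow> 0 < snd i \<and> ball (fst i) (snd i) \<subseteq> G \<and> P (fst i) (snd i)"
    "emeasure lborel (E - (\<Union>i\<in>C. ball (fst i) (snd i))) = 0"
proof -
  define K where "K = {(a, r). 0 < r \<and> ball a r \<subseteq> G \<and> P a r}"
  have fine': "\<exists>i. i \<in> K \<and> x \<in> ball (fst i) (snd i) \<and> snd i < d" if x: "x \<in> E" and d: "0 < d" for x d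
  proof -
    from G x obtain e where e: "e > 0" "ball x e \<subseteq> G" by (meson openE subsetD)
    \<comment> \<open>A ball of radius below \<open>e / 2\<close> that contains \<open>x\<close>
      stays inside \<open>ball x e\<close>, hence inside \<open>G\<close>.\<close>
    obtain a r where ar: "x \<in> ball a r" "r < min d (e/2)" "P a r"
      using fine[OF x, of "min d (e/2)"] d e by auto
    have "ball a r \<subseteq> ball x e"
    proof
      fix y assume "y \<in> ball a r"
      then have "dist x y < r + r" using ar(1) dist_triangle[of x y a] by (simp add: dist_commute)
      then show "y \<in> ball x e" using ar(2) by simp
    qed
    moreover have "0 < r" using ar(1) by (meson mem_ball zero_le_dist order_le_less_trans)
    ultimately have "(a, r) \<in> K" using e ar by (auto simp: K_def)
    then show ?thesis using ar by (intro exI[of _ "(a,r)"]) auto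
  qed
  obtain C where C: "countable C" "C \<subseteq> K" "pairwise (\<lambda>i j. disjnt (ball (fst i) (snd i)) (ball (fst j) (snd j))) C"
    "negligible (E - (\<Union>i\<in>C. ball (fst i) (snd i)))"
    using Vitali_covering_theorem_balls[of E K fst snd, OF fine'] by blast
  have UB: "open (\<Union>i\<in>C. ball (fst i) (snd i))" by auto
  show ?thesis
  proof (rule that[OF C(1)])
    show "disjoint_family_on (\<lambda>i. ball (fst i) (snd i)) C"
      using C(3) by (auto simp: disjoint_family_on_def pairwise_def disjnt_def)
    show "0 < snd i \<and> ball (fst i) (snd i) \<subseteq> G \<and> P (fst i) (snd i)" if "i \<in> C" for i
    proof -
      have "(fst i, snd i) \<in> K" using C(2) that by auto
      then show ?thesis unfolding K_def by (simp add: case_prod_beta)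
    qed
    show "emeasure lborel (E - (\<Union>i\<in>C. ball (fst i) (snd i))) = 0"
    proof -
      have "E - (\<Union>i\<in>C. ball (fst i) (snd i)) \<in> sets lborel" using E UB by auto
      then show ?thesis using C(4) by (simp add: negligible_iff_null_sets null_sets_completion_iff null_sets_def)
    qed
  qed
qed

text \<open>Disjoint balls inside \<open>H\<close>, each of \<open>l\<close>-mass at least
  \<open>q\<close> times its length, exhaust \<open>E\<close> up to a Lebesgue null set; add up
  their masses.\<close>

lemma vitali_lower_bound:
  fixes l :: "real measure"
  assumes sl: "sets l = sets borel" and E: "E \<in> sets borel" and H: "open H" "E \<subseteq> H" and q: "0 \<le> q"
    and dens: "\<And>x d. x \<in> E \<Longrightarrow> d > 0 \<Longrightarrow> \<exists>a r. x \<in> ball a r \<and> r < d \<and> ennreal (q * (2 * r)) \<le> emeasure l (ball a r)"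
  shows "ennreal q * emeasure lborel E \<le> emeasure l H"
proof -
  let ?B = "\<lambda>i::real \<times> real. ball (fst i) (snd i)"
  obtain C where C: "countable C" "disjoint_family_on ?B C"
    "\<And>i. i \<in> C \<Longrightarrow> 0 < snd i \<and> ?B i \<subseteq> H \<and> ennreal (q * (2 * snd i)) \<le> emeasure l (?B i)"
    "emeasure lborel (E - (\<Union>i\<in>C. ?B i)) = 0"
    using vitali_ball_cover[OF E H dens] by blast
  have UB: "(\<Union>i\<in>C. ?B i) \<in> sets borel" by (intro borel_open open_UN) auto
  have "emeasure lborel E \<le> emeasure lborel (\<Union>i\<in>C. ?B i)"
  proof -
    have "emeasure lborel E \<le> emeasure lborel ((E - (\<Union>i\<in>C. ?B i)) \<union> (\<Union>i\<in>C. ?B i))"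
      using E UB by (intro emeasure_mono) auto
    also have "\<dots> \<le> emeasure lborel (E - (\<Union>i\<in>C. ?B i)) + emeasure lborel (\<Union>i\<in>C. ?B i)"
      using E UB by (intro emeasure_subadditive) auto
    finally show ?thesis using C(4) by simp
  qed
  also have "\<dots> = (\<integral>\<^sup>+i. emeasure lborel (?B i) \<partial>count_space C)"
    by (rule emeasure_UN_countable) (use C in auto)
  finally have "ennreal q * emeasure lborel E \<le> ennreal q * (\<integral>\<^sup>+i. emeasure lborel (?B i) \<partial>count_space C)"
    by (rule mult_left_mono) simp
  also have "\<dots> = (\<integral>\<^sup>+i. ennreal q * emeasure lborel (?B i) \<partial>count_space C)"
    by (subst nn_integral_cmult) auto
  also have "\<dots> \<le> (\<integral>\<^sup>+i. emeasure l (?B i) \<partial>count_space C)"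
  proof (intro nn_integral_mono)
    fix i assume "i \<in> space (count_space C)"
    then have i: "0 < snd i" "ennreal (q * (2 * snd i)) \<le> emeasure l (?B i)" using C(3) by auto
    have "ennreal q * emeasure lborel (?B i) = ennreal (q * (2 * snd i))"
      using i q by (simp add: ball_eq_greaterThanLessThan ennreal_mult)
    then show "ennreal q * emeasure lborel (?B i) \<le> emeasure l (?B i)" using i by simp
  qed
  also have "\<dots> = emeasure l (\<Union>i\<in>C. ?B i)"
    by (rule emeasure_UN_countable[symmetric]) (use C sl in auto)
  also have "\<dots> \<le> emeasure l H"
    by (rule emeasure_mono[OF UN_least]) (use C(3) H sl in auto)
  finally show ?thesis .
qed

text \<open>\<open>l\<close> may charge the part of \<open>E\<close> missed by the covering balls,
  so the estimate concerns their union \<open>H\<close> instead of \<open>E\<close>.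
  \<open>H\<close> is open, which allows \<open>vitali_lower_bound\<close> to be applied inside it
  afterwards.\<close>

lemma vitali_upper_bound:
  fixes l :: "real measure"
  assumes sl: "sets l = sets borel" and E: "E \<in> sets borel" and G: "open G" "E \<subseteq> G" and p: "0 \<le> p"
    and dens: "\<And>x d. x \<in> E \<Longrightarrow> d > 0 \<Longrightarrow> \<exists>a r. x \<in> ball a r \<and> r < d \<and> emeasure l (ball a r) \<le> ennreal (p * (2 * r))"
  obtains H where "open H" "H \<subseteq> G" "emeasure l H \<le> ennreal p * emeasure lborel G" "emeasure lborel (E - H) = 0"
proof -
  let ?B = "\<lambda>i::real \<times> real. ball (fst i) (snd i)"
  obtain C where C: "countable C" "disjoint_family_on ?B C"
    "\<And>i. i \<in> C \<Longrightarrow> 0 < snd i \<and> ?B i \<subseteq> G \<and> emeasure l (?B i) \<le> ennreal (p * (2 * snd i))"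
    "emeasure lborel (E - (\<Union>i\<in>C. ?B i)) = 0"
    using vitali_ball_cover[OF E G dens] by blast
  have UB: "open (\<Union>i\<in>C. ?B i)" by auto
  have "emeasure l (\<Union>i\<in>C. ?B i) = (\<integral>\<^sup>+i. emeasure l (?B i) \<partial>count_space C)"
    by (rule emeasure_UN_countable) (use C sl in auto)
  also have "\<dots> \<le> (\<integral>\<^sup>+i. ennreal p * emeasure lborel (?B i) \<partial>count_space C)"
  proof (intro nn_integral_mono)
    fix i assume "i \<in> space (count_space C)"
    then have i: "0 < snd i" "emeasure l (?B i) \<le> ennreal (p * (2 * snd i))" using C(3) by auto
    have "ennreal p * emeasure lborel (?B i) = ennreal (p * (2 * snd i))"
      using i p by (simp add: ball_eq_greaterThanLessThan ennreal_mult)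
    then show "emeasure l (?B i) \<le> ennreal p * emeasure lborel (?B i)" using i by simp
  qed
  also have "\<dots> = ennreal p * (\<integral>\<^sup>+i. emeasure lborel (?B i) \<partial>count_space C)"
    by (subst nn_integral_cmult) auto
  also have "(\<integral>\<^sup>+i. emeasure lborel (?B i) \<partial>count_space C) = emeasure lborel (\<Union>i\<in>C. ?B i)"
    by (rule emeasure_UN_countable[symmetric]) (use C in auto)
  also have "ennreal p * emeasure lborel (\<Union>i\<in>C. ?B i) \<le> ennreal p * emeasure lborel G"
    by (intro mult_left_mono emeasure_mono UN_least) (use C(3) G in auto)
  finally have 1: "emeasure l (\<Union>i\<in>C. ?B i) \<le> ennreal p * emeasure lborel G" .
  show ?thesis
    by (rule that[OF UB UN_least 1 C(4)]) (use C(3) in auto)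
qed

lemma open_ball_class: "open (\<Union>{ball a r | a r. P a r})"
  by (rule open_Union) auto

text \<open>A countable intersection of open sets, so that Borel measurability is immediate. The
  balls contain the point without being centred at it; those with \<open>r \<le> 0\<close> are
  empty.\<close>

definition dens_above :: "real measure \<Rightarrow> real \<Rightarrow> real set" where
  "dens_above l q = (\<Inter>n. \<Union>{ball a r | a r. r < 1 / Suc n \<and> q * (2 * r) \<le> measure l (ball a r)})"

definition dens_below :: "real measure \<Rightarrow> real \<Rightarrow> real set" where
  "dens_below l p = (\<Inter>n. \<Union>{ball a r | a r. r < 1 / Suc n \<and> measure l (ball a r) \<le> p * (2 * r)})"

lemma dens_borel [measurable]: "dens_above l q \<in> sets borel" "dens_below l q \<in> sets borel"
  unfolding dens_above_def dens_below_def
  by (rule sets.countable_INT''; force intro: borel_open open_ball_class)+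

lemma dens_aboveD:
  assumes "x \<in> dens_above l q" "d > 0"
  shows "\<exists>a r. x \<in> ball a r \<and> r < d \<and> q * (2 * r) \<le> measure l (ball a r)"
proof -
  obtain n where "1 / Suc n < d" using assms(2) nat_approx_posE by auto
  moreover have "x \<in> \<Union>{ball a r | a r. r < 1 / Suc n \<and> q * (2 * r) \<le> measure l (ball a r)}"
    using assms(1) unfolding dens_above_def by (rule INT_D) simp
  then obtain a r where "x \<in> ball a r" "r < 1 / Suc n" "q * (2 * r) \<le> measure l (ball a r)" by blast
  ultimately show ?thesis by (meson order.strict_trans)
qed

lemma dens_belowD:
  assumes "x \<in> dens_below l q" "d > 0"
  shows "\<exists>a r. x \<in> ball a r \<and> r < d \<and> measure l (ball a r) \<le> q * (2 * r)"
proof -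
  obtain n where "1 / Suc n < d" using assms(2) nat_approx_posE by auto
  moreover have "x \<in> \<Union>{ball a r | a r. r < 1 / Suc n \<and> measure l (ball a r) \<le> q * (2 * r)}"
    using assms(1) unfolding dens_below_def by (rule INT_D) simp
  then obtain a r where "x \<in> ball a r" "r < 1 / Suc n" "measure l (ball a r) \<le> q * (2 * r)" by blast
  ultimately show ?thesis by (meson order.strict_trans)
qed

text \<open>For a bounded piece of Lebesgue measure \<alpha>, choose an open \<open>G\<close> around
  it of measure at most \<open>\<alpha> + e\<close>. Balls of low density give \<open>H\<close>
  inside \<open>G\<close> with \<open>l\<close>-mass at most \<open>p * (\<alpha> + e)\<close>;
  balls of high density inside \<open>H\<close> show that this mass is at least
  \<open>q * \<alpha>\<close>. As \<open>e\<close> tends to 0 and \<open>p < q\<close>, this forces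
  \<open>\<alpha> = 0\<close>.\<close>

lemma dens_null:
  fixes l :: "real measure"
  assumes sl: "sets l = sets borel" and fin: "finite_measure l" and pq: "0 \<le> p" "p < q"
  shows "dens_above l q \<inter> dens_below l p \<in> null_sets lborel"
proof -
  interpret finite_measure l by fact
  define E where "E N = (dens_above l q \<inter> dens_below l p) \<inter> ball 0 (real N)" for N
  have Eb: "E N \<in> sets borel" for N unfolding E_def by measurable
  have "emeasure lborel (E N) = 0" for N
  proof -
    have "emeasure lborel (E N) \<le> emeasure lborel (ball (0::real) (real N))"
      by (rule emeasure_mono) (auto simp: E_def)
    also have "\<dots> < \<infinity>" by (simp add: ball_eq_greaterThanLessThan)
    finally have Ea: "emeasure lborel (E N) = ennreal (enn2real (emeasure lborel (E N)))" by simp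
    obtain \<alpha> where \<alpha>: "emeasure lborel (E N) = ennreal \<alpha>" "\<alpha> \<ge> 0"
      by (rule that[OF Ea enn2real_nonneg])
    have key: "q * \<alpha> \<le> p * (\<alpha> + e)" if e: "e > 0" for e
    proof -
      obtain G where G: "open G" "E N \<subseteq> G" "emeasure lborel (G - E N) \<le> ennreal e"
      proof -
        obtain U where "open U" "E N \<subseteq> U" "emeasure lborel (U - E N) < ennreal e"
          by (rule outer_regular_lborel[OF Eb e])
        then show ?thesis by (intro that[of U]) auto
      qed
      have "emeasure lborel G \<le> emeasure lborel (E N) + emeasure lborel (G - E N)"
      proof -
        have "G = E N \<union> (G - E N)" using G(2) by auto
        then show ?thesis using emeasure_subadditive[of "E N" lborel "G - E N"] G(1) Eb by auto
      qed
      also have "\<dots> \<le> ennreal (\<alpha> + e)" using G \<alpha> e by (simp add: ennreal_plus)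
      finally have Ge: "emeasure lborel G \<le> ennreal (\<alpha> + e)" .
      obtain H where H: "open H" "H \<subseteq> G" "emeasure l H \<le> ennreal p * emeasure lborel G" "emeasure lborel (E N - H) = 0"
      proof (rule vitali_upper_bound[OF sl Eb G(1,2) pq(1)])
        show "\<exists>a r. x \<in> ball a r \<and> r < d \<and> emeasure l (ball a r) \<le> ennreal (p * (2 * r))" if "x \<in> E N" "d > 0" for x d
        proof -
          have "x \<in> dens_below l p" using that by (simp add: E_def)
          from dens_belowD[OF this that(2)] obtain a r where ar: "x \<in> ball a r" "r < d" "measure l (ball a r) \<le> p * (2 * r)" by blast
          from ar(3) have "emeasure l (ball a r) \<le> ennreal (p * (2 * r))" unfolding emeasure_eq_measure by (rule ennreal_leI)
          with ar(1,2) show ?thesis by blast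
        qed
      qed auto
      have EH: "E N \<inter> H \<in> sets borel" using Eb H by auto
      have "ennreal q * emeasure lborel (E N \<inter> H) \<le> emeasure l H"
      proof (rule vitali_lower_bound[OF sl EH H(1)])
        show "\<exists>a r. x \<in> ball a r \<and> r < d \<and> ennreal (q * (2 * r)) \<le> emeasure l (ball a r)" if "x \<in> E N \<inter> H" "d > 0" for x d
        proof -
          have "x \<in> dens_above l q" using that by (simp add: E_def)
          from dens_aboveD[OF this that(2)] obtain a r where ar: "x \<in> ball a r" "r < d" "q * (2 * r) \<le> measure l (ball a r)" by blast
          from ar(3) have "ennreal (q * (2 * r)) \<le> emeasure l (ball a r)" unfolding emeasure_eq_measure by (rule ennreal_leI)
          with ar(1,2) show ?thesis by blast
        qed
      qed (use pq in auto)
      moreover have "emeasure lborel (E N) \<le> emeasure lborel (E N \<inter> H)"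
        using emeasure_subadditive[of "E N \<inter> H" lborel "E N - H"] EH Eb H
        by (simp add: Un_Diff_Int Int_Diff_Un)
      ultimately have "ennreal q * ennreal \<alpha> \<le> ennreal p * emeasure lborel G"
        using H(3) \<alpha> by (metis mult_left_mono order_trans zero_le)
      also have "\<dots> \<le> ennreal p * ennreal (\<alpha> + e)" using Ge by (rule mult_left_mono) simp
      finally have "ennreal (q * \<alpha>) \<le> ennreal (p * (\<alpha> + e))" using pq \<alpha> e by (simp only: ennreal_mult)
      then show ?thesis using pq \<alpha> e by (simp del: ennreal_plus)
    qed
    have "q * \<alpha> \<le> p * \<alpha>"
    proof (rule field_le_epsilon)
      fix e :: real assume "e > 0"
      show "q * \<alpha> \<le> p * \<alpha> + e"
      proof (cases "p = 0")
        case True then show ?thesis using key[of 1] \<open>e>0\<close> by simp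
      next
        case False
        then have "p * (\<alpha> + e / p) = p * \<alpha> + e" by (simp add: distrib_left)
        then show ?thesis using key[of "e / p"] \<open>e>0\<close> pq False by simp
      qed
    qed
    then have "\<alpha> = 0" using pq \<alpha>(2) by (auto simp: mult_le_cancel_right)
    then show ?thesis using \<alpha> by simp
  qed
  then have "(\<Union>N. E N) \<in> null_sets lborel"
    using Eb by (intro null_sets_UN) (auto simp: null_sets_def)
  moreover have "(\<Union>N. E N) = dens_above l q \<inter> dens_below l p"
    unfolding E_def by (auto intro: reals_Archimedean2)
  ultimately show ?thesis by simp
qed

text \<open>\<open>vitali_lower_bound\<close> with \<open>H = UNIV\<close> bounds \<open>n\<close>
  times the Lebesgue measure of this set by the total mass of \<open>l\<close>, for every
  \<open>n\<close>.\<close>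

lemma dens_infinite_null:
  fixes l :: "real measure"
  assumes sl: "sets l = sets borel" and fin: "finite_measure l"
  shows "(\<Inter>n::nat. dens_above l (real n)) \<in> null_sets lborel"
proof -
  interpret finite_measure l by fact
  let ?E = "\<Inter>n::nat. dens_above l (real n)"
  have Eb: "?E \<in> sets borel" by measurable
  have b: "ennreal (real n) * emeasure lborel ?E \<le> emeasure l UNIV" for n
  proof (rule vitali_lower_bound[OF sl Eb])
    show "\<exists>a r. x \<in> ball a r \<and> r < d \<and> ennreal (real n * (2 * r)) \<le> emeasure l (ball a r)" if "x \<in> ?E" "d > 0" for x d
    proof -
      have "x \<in> dens_above l n" using that by simp
      from dens_aboveD[OF this that(2)] obtain a r :: real where ar: "x \<in> ball a r" "r < d" "real n * (2 * r) \<le> measure l (ball a r)" by blast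
      from ar(3) have "ennreal (real n * (2 * r)) \<le> emeasure l (ball a r)" unfolding emeasure_eq_measure by (rule ennreal_leI)
      with ar(1,2) show ?thesis by blast
    qed
  qed auto
  have "emeasure lborel ?E = 0"
  proof (rule ccontr)
    assume nz: "emeasure lborel ?E \<noteq> 0"
    have fin: "emeasure lborel ?E < \<infinity>"
    proof -
      have "emeasure lborel ?E \<le> ennreal (measure l UNIV)" using b[of 1] by (simp add: emeasure_eq_measure)
      also have "\<dots> < \<infinity>" by simp
      finally show ?thesis .
    qed
    then obtain \<alpha> where \<alpha>: "emeasure lborel ?E = ennreal \<alpha>" "\<alpha> > 0"
    proof -
      have "emeasure lborel ?E = ennreal (enn2real (emeasure lborel ?E))" using fin by simp
      moreover have "enn2real (emeasure lborel ?E) > 0" using fin nz by (simp add: enn2real_positive_iff zero_less_iff_neq_zero)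
      ultimately show ?thesis by (rule that)
    qed
    obtain n :: nat where "measure l UNIV / \<alpha> < n" using reals_Archimedean2 by blast
    then have "measure l UNIV < n * \<alpha>" using \<alpha> by (simp add: field_simps)
    moreover have "n * \<alpha> \<le> measure l UNIV"
      using b[of n] \<alpha> by (simp add: emeasure_eq_measure flip: ennreal_mult)
    ultimately show False by simp
  qed
  then show ?thesis using Eb by (auto simp: null_sets_def)
qed

text \<open>The limit is taken over all small intervals containing \<open>t\<close>, in whatever
  position; this is what one-sided quotients require. The factor \<open>2 * r\<close> is the length
  of the ball.\<close>

definition has_density_at :: "real measure \<Rightarrow> real \<Rightarrow> real \<Rightarrow> bool" where
  "has_density_at l D t \<longleftrightarrow>
     (\<forall>e>0. \<exists>d>0. \<forall>a r. t \<in> ball a r \<and> r < d \<longrightarrow> \<bar>measure l (ball a r) - D * (2 * r)\<bar> \<le> e * (2 * r))"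

text \<open>\<open>Q\<close> collects the eventual upper bounds of the mean densities at
  \<open>t\<close>. It is nonempty because the upper density is finite, and its infimum is the
  density: if the lower density were smaller, two rationals would separate the two.\<close>

lemma AE_has_density_at:
  fixes l :: "real measure"
  assumes sl: "sets l = sets borel" and fin: "finite_measure l"
  shows "AE t in lborel. \<exists>D\<ge>0. has_density_at l D t"
proof -
  have 1: "AE t in lborel. \<forall>p\<in>\<rat>. \<forall>q\<in>\<rat>. 0 \<le> p \<longrightarrow> p < q \<longrightarrow> t \<notin> dens_above l q \<inter> dens_below l p"
    using dens_null[OF sl fin] by (intro AE_ball_countable' countable_rat AE_impI AE_not_in) auto
  have 2: "AE t in lborel. t \<notin> (\<Inter>n::nat. dens_above l (real n))"
    using dens_infinite_null[OF sl fin] by (rule AE_not_in)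
  from 1 2 show ?thesis
  proof eventually_elim
    fix t
    assume a1: "\<forall>p\<in>\<rat>. \<forall>q\<in>\<rat>. 0 \<le> p \<longrightarrow> p < q \<longrightarrow> t \<notin> dens_above l q \<inter> dens_below l p"
      and a2: "t \<notin> (\<Inter>n::nat. dens_above l (real n))"
    define Q where "Q = {q. \<exists>d>0. \<forall>a r. t \<in> ball a r \<and> r < d \<longrightarrow> measure l (ball a r) \<le> q * (2 * r)}"
    have above: "q \<in> Q" if na: "t \<notin> dens_above l q" for q
    proof -
      obtain n where n: "t \<notin> \<Union>{ball a r | a r. r < 1 / Suc n \<and> q * (2 * r) \<le> measure l (ball a r)}"
        using na unfolding dens_above_def by blast
      have "measure l (ball a r) < q * (2 * r)" if "t \<in> ball a r" "r < 1 / Suc n" for a r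
        using n that unfolding not_le[symmetric] by blast
      then show ?thesis unfolding Q_def by (intro CollectI exI[of _ "1 / Suc n"]) (auto intro: less_imp_le)
    qed
    have posr: "0 < r" if "t \<in> ball a r" for a r
      using that by (meson mem_ball zero_le_dist order_le_less_trans)
    have Qne: "Q \<noteq> {}" using a2 above by auto
    have Qpos: "0 \<le> q" if qQ: "q \<in> Q" for q
    proof -
      obtain d where d: "d > 0" "\<And>a r. t \<in> ball a r \<Longrightarrow> r < d \<Longrightarrow> measure l (ball a r) \<le> q * (2 * r)"
        using qQ unfolding Q_def by blast
      from d(2)[of t "d/2"] d(1) have "0 \<le> q * d" by (simp add: order_trans[OF measure_nonneg])
      then show ?thesis using d(1) by (simp add: zero_le_mult_iff)
    qed
    have bdd: "bdd_below Q" using Qpos by (rule bdd_belowI)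
    define D where "D = Inf Q"
    have D0: "D \<ge> 0" unfolding D_def using Qne Qpos by (rule cInf_greatest)
    have "has_density_at l D t" unfolding has_density_at_def
    proof (intro allI impI)
      fix e :: real assume e: "e > 0"
      obtain q where q: "q \<in> Q" "q < D + e" using cInf_lessD[OF Qne, of "D + e"] e by (auto simp: D_def)
      then obtain d1 where d1: "d1 > 0" "\<And>a r. t \<in> ball a r \<Longrightarrow> r < d1 \<Longrightarrow> measure l (ball a r) \<le> q * (2 * r)"
        unfolding Q_def by blast
      obtain d2 where d2: "d2 > 0" "\<And>a r. t \<in> ball a r \<Longrightarrow> r < d2 \<Longrightarrow> measure l (ball a r) \<ge> (D - e) * (2 * r)"
      \<comment> \<open>The separating rationals in \<open>a1\<close> are nonnegative, so a negative
        \<open>D - e\<close> is treated apart.\<close>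
      proof (cases "D - e < 0")
        case True
        have "(D - e) * (2 * r) \<le> measure l (ball a r)" if "t \<in> ball a r" for a r
          using posr[OF that] True by (intro order_trans[OF _ measure_nonneg]) (simp add: mult_nonpos_nonneg)
        then show ?thesis using that[of 1] by auto
      next
        case False
        \<comment> \<open>\<open>q'\<close> lies below the infimum \<open>D\<close>, so it is no
          eventual upper bound and \<open>t\<close> belongs to \<open>dens_above l q'\<close>. By
          \<open>a1\<close> the point then misses \<open>dens_below l p\<close>, and
          \<open>p > D - e\<close> becomes an eventual lower bound.\<close>
        obtain p where p: "p \<in> \<rat>" "D - e < p" "p < D" using Rats_dense_in_real[of "D - e" D] e by auto
        obtain q' where q': "q' \<in> \<rat>" "p < q'" "q' < D" using Rats_dense_in_real[of p D] p by auto
        have "q' \<notin> Q" using q' bdd cInf_lower[of q' Q] by (auto simp: D_def)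
        then have "t \<in> dens_above l q'" using above by blast
        moreover have "0 \<le> p" using False p by linarith
        ultimately have "t \<notin> dens_below l p" using a1 p(1) q'(1,2) by blast
        then obtain n where n': "t \<notin> \<Union>{ball a r | a r. r < 1 / Suc n \<and> measure l (ball a r) \<le> p * (2 * r)}"
          unfolding dens_below_def by blast
        have n: "measure l (ball a r) > p * (2 * r)" if "t \<in> ball a r" "r < 1 / Suc n" for a r
          using n' that unfolding not_le[symmetric] by blast
        have "(D - e) * (2 * r) \<le> measure l (ball a r)" if "t \<in> ball a r" "r < 1 / Suc n" for a r
          using n[OF that] mult_right_mono[of "D - e" p "2 * r"] p posr[OF that(1)] by linarith
        then show ?thesis using that[of "1 / Suc n"] by auto
      qed
      show "\<exists>d>0. \<forall>a r. t \<in> ball a r \<and> r < d \<longrightarrow> \<bar>measure l (ball a r) - D * (2 * r)\<bar> \<le> e * (2 * r)"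
      proof (intro exI[of _ "min d1 d2"] conjI allI impI)
        fix a r assume ar: "t \<in> ball a r \<and> r < min d1 d2"
        have "q * (2 * r) \<le> (D + e) * (2 * r)" using q posr[of a r] ar by (intro mult_right_mono) auto
        then show "\<bar>measure l (ball a r) - D * (2 * r)\<bar> \<le> e * (2 * r)"
          using d1(2)[of a r] d2(2)[of a r] ar by (simp add: algebra_simps abs_le_iff)
      qed (use d1 d2 in auto)
    qed
    then show "\<exists>D\<ge>0. has_density_at l D t" using D0 by blast
  qed
qed

lemma has_density_at_bound:
  assumes sl: "sets l = sets borel" and fin: "finite_measure l" and D: "has_density_at l D t" "D \<ge> 0"
  shows "\<exists>M\<ge>0. \<forall>\<epsilon>>0. measure l {t - \<epsilon>..t + \<epsilon>} \<le> M * \<epsilon>"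
proof -
  interpret finite_measure l by fact
  obtain d where d: "d > 0" "\<And>a r. t \<in> ball a r \<Longrightarrow> r < d \<Longrightarrow> \<bar>measure l (ball a r) - D * (2 * r)\<bar> \<le> 1 * (2 * r)"
    using D zero_less_one unfolding has_density_at_def by blast
  \<comment> \<open>The first entry serves small \<epsilon>, where the closed interval lies in the
    ball of radius \<open>2 * \<epsilon>\<close>; the second serves
    \<open>2 * \<epsilon> \<ge> d\<close>, where the total mass suffices.\<close>
  define M where "M = max (4 * (D + 1)) (2 * measure l UNIV / d)"
  have "measure l {t - \<epsilon>..t + \<epsilon>} \<le> M * \<epsilon>" if e: "\<epsilon> > 0" for \<epsilon>
  proof (cases "2 * \<epsilon> < d")
    case True
    have "measure l {t - \<epsilon>..t + \<epsilon>} \<le> measure l (ball t (2 * \<epsilon>))"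
      using e sl by (intro finite_measure_mono) (auto simp: ball_eq_greaterThanLessThan)
    also have "\<dots> \<le> (D + 1) * (2 * (2 * \<epsilon>))" using d(2)[of t "2 * \<epsilon>"] True e by (simp add: algebra_simps)
    also have "\<dots> = (4 * (D + 1)) * \<epsilon>" by simp
    also have "\<dots> \<le> M * \<epsilon>" unfolding M_def using e by (intro mult_right_mono) auto
    finally show ?thesis .
  next
    case False
    have "measure l {t - \<epsilon>..t + \<epsilon>} \<le> measure l UNIV" using sl by (intro finite_measure_mono) auto
    also have "\<dots> \<le> (2 * measure l UNIV / d) * \<epsilon>"
      using False d(1) mult_left_mono[of d "2 * \<epsilon>" "measure l UNIV"] by (simp add: field_simps)
    also have "\<dots> \<le> M * \<epsilon>" unfolding M_def using e by (intro mult_right_mono) auto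
    finally show ?thesis .
  qed
  moreover have "M \<ge> 0" using D by (auto simp: M_def)
  ultimately show ?thesis by blast
qed

text \<open>\<open>t\<close> is outside \<open>A \<epsilon>\<close>, so the density cannot be
  applied to it directly. From above, \<open>A \<epsilon>\<close> is enlarged by
  \<open>\<theta> * \<epsilon>\<close> across \<open>t\<close>; from below, it contains a ball
  around \<open>t\<close> and reaching \<open>t + \<epsilon>\<close>, less a ball of radius
  \<open>2 * (\<theta> * \<epsilon>)\<close> about \<open>t\<close>. The errors are of order
  \<open>\<theta> * D\<close>.\<close>

lemma has_density_at_right:
  assumes sl: "sets l = sets borel" and fin: "finite_measure l" and D: "has_density_at l D t" "D \<ge> 0"
    and A: "\<And>\<epsilon>. \<epsilon> > 0 \<Longrightarrow> {t<..<t + \<epsilon>} \<subseteq> A \<epsilon> \<and> A \<epsilon> \<subseteq> {t<..t + \<epsilon>} \<and> A \<epsilon> \<in> sets borel"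
  shows "((\<lambda>\<epsilon>. measure l (A \<epsilon>) / \<epsilon>) \<longlongrightarrow> D) (at_right 0)"
proof (rule tendstoI)
  interpret finite_measure l by fact
  fix e :: real assume e: "e > 0"
  \<comment> \<open>Small enough for \<open>\<theta> * D \<le> e / 8\<close>; the summand 1 covers
    \<open>D = 0\<close>.\<close>
  define \<theta> where "\<theta> = min 1 (e / (8 * (D + 1)))"
  have th: "0 < \<theta>" "\<theta> \<le> 1" "\<theta> * D \<le> e / 8"
  proof -
    show "0 < \<theta>" using e D by (auto simp: \<theta>_def)
    have "\<theta> * D \<le> \<theta> * (D + 1)" using \<open>0 < \<theta>\<close> by simp
    also have "\<dots> \<le> e / (8 * (D + 1)) * (D + 1)" using D by (intro mult_right_mono) (auto simp: \<theta>_def)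
    also have "\<dots> = e / 8" using D by (simp add: divide_simps)
    finally show "\<theta> * D \<le> e / 8" .
  qed (simp add: \<theta>_def)
  have e16: "e / 16 > 0" using e by simp
  obtain d where d: "d > 0" "\<And>a r. t \<in> ball a r \<Longrightarrow> r < d \<Longrightarrow> \<bar>measure l (ball a r) - D * (2 * r)\<bar> \<le> e / 16 * (2 * r)"
    using D(1) e16 unfolding has_density_at_def by blast
  have "dist (measure l (A \<epsilon>) / \<epsilon>) D < e" if ep: "0 < \<epsilon>" "2 * \<epsilon> < d" for \<epsilon>
  proof -
    have te: "0 < \<theta> * \<epsilon>" "\<theta> * \<epsilon> \<le> \<epsilon>" using th ep by (auto simp: mult_left_le_one_le)
    have tD: "\<theta> * \<epsilon> * D \<le> e / 8 * \<epsilon>" using mult_right_mono[OF th(3), of \<epsilon>] ep by (simp add: mult_ac)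
    have B1: "ball (t + \<epsilon> / 2) (\<epsilon> / 2 + \<theta> * \<epsilon>) = {t - \<theta> * \<epsilon> <..< t + \<epsilon> + \<theta> * \<epsilon>}"
      by (auto simp: ball_eq_greaterThanLessThan)
    have B2: "ball (t + (\<epsilon> - \<theta> * \<epsilon>) / 2) ((\<epsilon> + \<theta> * \<epsilon>) / 2) = {t - \<theta> * \<epsilon> <..< t + \<epsilon>}"
      unfolding ball_eq_greaterThanLessThan by (rule arg_cong2[of _ _ _ _ greaterThanLessThan]) (simp_all add: field_simps)
    have B3: "ball t (2 * (\<theta> * \<epsilon>)) = {t - 2 * (\<theta> * \<epsilon>) <..< t + 2 * (\<theta> * \<epsilon>)}"
      by (auto simp: ball_eq_greaterThanLessThan)
    have "measure l (A \<epsilon>) \<le> measure l (ball (t + \<epsilon> / 2) (\<epsilon> / 2 + \<theta> * \<epsilon>))"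
      unfolding B1
    proof (intro finite_measure_mono subsetI)
      fix x assume "x \<in> A \<epsilon>"
      then have "x \<in> {t<..t + \<epsilon>}" using A[OF ep(1)] by blast
      then show "x \<in> {t - \<theta> * \<epsilon><..<t + \<epsilon> + \<theta> * \<epsilon>}" using te by auto
    qed (use sl in auto)
    also have "\<dots> \<le> D * (\<epsilon> + 2 * (\<theta> * \<epsilon>)) + e / 16 * (\<epsilon> + 2 * (\<theta> * \<epsilon>))"
      using d(2)[of "t + \<epsilon> / 2" "\<epsilon> / 2 + \<theta> * \<epsilon>"] ep te unfolding B1 by (auto simp: algebra_simps abs_le_iff)
    also have "\<dots> \<le> D * \<epsilon> + e / 4 * \<epsilon> + e / 16 * (3 * \<epsilon>)"
      using tD te e th by (intro add_mono mult_left_mono) (simp_all add: algebra_simps)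
    finally have up: "measure l (A \<epsilon>) \<le> D * \<epsilon> + e / 2 * \<epsilon>"
      using mult_pos_pos[OF e ep(1)] by (simp add: algebra_simps)
    have "measure l {t - \<theta> * \<epsilon> <..< t + \<epsilon>} \<le> measure l ({t - 2 * (\<theta> * \<epsilon>) <..< t + 2 * (\<theta> * \<epsilon>)} \<union> A \<epsilon>)"
    proof (intro finite_measure_mono subsetI)
      fix x assume x: "x \<in> {t - \<theta> * \<epsilon> <..< t + \<epsilon>}"
      show "x \<in> {t - 2 * (\<theta> * \<epsilon>) <..< t + 2 * (\<theta> * \<epsilon>)} \<union> A \<epsilon>"
      proof (cases "x \<le> t")
        case False then have "x \<in> {t<..<t + \<epsilon>}" using x by auto
        then show ?thesis using A[OF ep(1)] by blast
      qed (use x te in auto)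
    qed (use sl A[OF ep(1)] in auto)
    also have "\<dots> \<le> measure l {t - 2 * (\<theta> * \<epsilon>) <..< t + 2 * (\<theta> * \<epsilon>)} + measure l (A \<epsilon>)"
      using A[OF ep(1)] sl by (intro measure_Un_le) auto
    finally have "measure l (A \<epsilon>) \<ge> measure l {t - \<theta> * \<epsilon> <..< t + \<epsilon>} - measure l {t - 2 * (\<theta> * \<epsilon>) <..< t + 2 * (\<theta> * \<epsilon>)}" by simp
    moreover have "measure l {t - \<theta> * \<epsilon> <..< t + \<epsilon>} \<ge> D * (\<epsilon> + \<theta> * \<epsilon>) - e / 16 * (\<epsilon> + \<theta> * \<epsilon>)"
    proof -
      have "2 * ((\<epsilon> + \<theta> * \<epsilon>) / 2) = \<epsilon> + \<theta> * \<epsilon>" by simp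
      moreover have "t \<in> ball (t + (\<epsilon> - \<theta> * \<epsilon>) / 2) ((\<epsilon> + \<theta> * \<epsilon>) / 2)" unfolding B2 using te ep by auto
      moreover have "(\<epsilon> + \<theta> * \<epsilon>) / 2 < d"
      proof -
        have "\<epsilon> + \<theta> * \<epsilon> \<le> \<epsilon> * 2" using te by linarith
        then have "(\<epsilon> + \<theta> * \<epsilon>) / 2 \<le> \<epsilon>" by (simp only: pos_divide_le_eq zero_less_numeral)
        then show ?thesis using ep by linarith
      qed
      ultimately have "\<bar>measure l {t - \<theta> * \<epsilon> <..< t + \<epsilon>} - D * (\<epsilon> + \<theta> * \<epsilon>)\<bar> \<le> e / 16 * (\<epsilon> + \<theta> * \<epsilon>)"
        using d(2)[of "t + (\<epsilon> - \<theta> * \<epsilon>) / 2" "(\<epsilon> + \<theta> * \<epsilon>) / 2"] unfolding B2 by metis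
      then show ?thesis by linarith
    qed
    moreover have "measure l {t - 2 * (\<theta> * \<epsilon>) <..< t + 2 * (\<theta> * \<epsilon>)} \<le> D * (4 * (\<theta> * \<epsilon>)) + e / 16 * (4 * (\<theta> * \<epsilon>))"
    proof (cases "2 * (\<theta> * \<epsilon>) < d")
      case True
      have "2 * (2 * (\<theta> * \<epsilon>)) = 4 * (\<theta> * \<epsilon>)" by simp
      moreover have "t \<in> ball t (2 * (\<theta> * \<epsilon>))" using te by simp
      ultimately have "\<bar>measure l {t - 2 * (\<theta> * \<epsilon>) <..< t + 2 * (\<theta> * \<epsilon>)} - D * (4 * (\<theta> * \<epsilon>))\<bar> \<le> e / 16 * (4 * (\<theta> * \<epsilon>))"
        using d(2)[of t "2 * (\<theta> * \<epsilon>)"] True unfolding B3 by metis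
      then show ?thesis by linarith
    qed (use te ep in auto)
    moreover have "e / 16 * (\<epsilon> + \<theta> * \<epsilon>) \<le> e / 16 * (2 * \<epsilon>)" "e / 16 * (4 * (\<theta> * \<epsilon>)) \<le> e / 16 * (4 * \<epsilon>)"
      using te e by (intro mult_left_mono; simp)+
    moreover define dd where "dd = D * (\<theta> * \<epsilon>)"
    moreover have "D * (4 * (\<theta> * \<epsilon>)) = 4 * dd" "D * (\<epsilon> + \<theta> * \<epsilon>) = D * \<epsilon> + dd" "\<theta> * \<epsilon> * D = dd"
      by (simp_all add: dd_def algebra_simps)
    ultimately have "measure l (A \<epsilon>) \<ge> D * \<epsilon> - 3 * (\<theta> * \<epsilon> * D) - e / 16 * (6 * \<epsilon>)"
      by linarith
    then have low: "measure l (A \<epsilon>) \<ge> D * \<epsilon> - (3 / 4) * e * \<epsilon>" using tD by (simp add: algebra_simps)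
    have "measure l (A \<epsilon>) / \<epsilon> \<le> D + e / 2" "measure l (A \<epsilon>) / \<epsilon> \<ge> D - 3 / 4 * e"
      using up low ep by (simp_all add: field_simps)
    then show ?thesis using e by (auto simp: dist_real_def abs_less_iff)
  qed
  moreover have "\<forall>\<^sub>F \<epsilon> in at_right 0. 0 < \<epsilon> \<and> 2 * \<epsilon> < d"
    using d(1) unfolding eventually_at_right_field by (intro exI[of _ "d/2"]) auto
  ultimately show "\<forall>\<^sub>F \<epsilon> in at_right 0. dist (measure l (A \<epsilon>) / \<epsilon>) D < e"
    by (auto elim: eventually_mono)
qed

lemma borel_measurable_vec:
  fixes f :: "'a \<Rightarrow> real^'n::finite"
  assumes "\<And>i. (\<lambda>x. f x $ i) \<in> borel_measurable M"
  shows "f \<in> borel_measurable M"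
  using assms by (subst borel_measurable_euclidean_space) (auto simp: Basis_vec_def inner_axis)

lemma borel_measurable_vec_nth [measurable]: "(\<lambda>x::real^'n::finite. x $ i) \<in> borel_measurable borel"
  by (intro borel_measurable_continuous_onI continuous_intros)

subsection \<open>A space-filling curve with a Borel section\<close>

text \<open>The section transports measures to the line, where Helly's selection theorem gives weak* compactness;
  the continuous curve brings the limits back.\<close>

definition even_reals :: "real set" where "even_reals = range (\<lambda>k::int. 2 * of_int k)"

text \<open>The periodic function behind Schoenberg's space-filling curve: 0 near the even integers,
  1 near the odd ones, interpolated in between. Writing it through a distance makes it continuous at
  once.\<close>

definition sch :: "real \<Rightarrow> real" where
  "sch u = max 0 (min 1 (3 * infdist u even_reals - 1))"

lemma sch_bounds: "0 \<le> sch u" "sch u \<le> 1"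
  by (auto simp: sch_def)

lemma continuous_sch: "continuous_on A (\<lambda>x. sch x)"
  unfolding sch_def by (intro continuous_intros continuous_on_infdist)

lemma sch_eq_0: assumes "\<bar>v\<bar> \<le> 1/3" shows "sch (2 * of_int k + v) = 0"
proof -
  have "infdist (2 * of_int k + v) even_reals \<le> dist (2 * of_int k + v) (2 * of_int k)"
    by (rule infdist_le) (auto simp: even_reals_def)
  then show ?thesis using assms by (auto simp: sch_def dist_real_def)
qed

lemma sch_eq_1: assumes "2/3 \<le> v" "v \<le> 1" shows "sch (2 * of_int k + v) = 1"
proof -
  have "2/3 \<le> infdist (2 * of_int k + v) even_reals"
  proof -
    have "2/3 \<le> dist (2 * of_int k + v) e" if ee: "e \<in> even_reals" for e
    proof -
      obtain m where m: "e = 2 * of_int m" using ee by (auto simp: even_reals_def)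
      consider "m \<le> k" | "m \<ge> k + 1" by linarith
      then show ?thesis
      proof cases
        case 1 then have "real_of_int m \<le> of_int k" by simp
        then show ?thesis using assms m by (simp add: dist_real_def)
      next
        case 2 then have "real_of_int m \<ge> of_int k + 1" by linarith
        then show ?thesis using assms m by (simp add: dist_real_def)
      qed
    qed
    moreover have "even_reals \<noteq> {}" by (auto simp: even_reals_def)
    ultimately have "2/3 \<le> (INF e\<in>even_reals. dist (2 * of_int k + v) e)" by (intro cINF_greatest) blast+
    with \<open>even_reals \<noteq> {}\<close> show "2/3 \<le> infdist (2 * of_int k + v) even_reals"
      by (subst infdist_notempty)
  qed
  then show ?thesis by (auto simp: sch_def)
qed

lemma ternary_summable:
  fixes a :: "nat \<Rightarrow> real"
  assumes "\<And>l. a l = 0 \<or> a l = 1"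
  shows "summable (\<lambda>l. 2 * a l / 3 ^ (l + 1))"
proof (rule summable_comparison_test')
  show "summable (\<lambda>l. 2 / 3 * (1 / 3 :: real) ^ l)" by (intro summable_mult summable_geometric) auto
  show "norm (2 * a l / 3 ^ (l + 1)) \<le> 2 / 3 * (1 / 3) ^ l" if "0 \<le> l" for l
    using assms[of l] by (auto simp: power_divide)
qed

lemma ternary_bounds:
  fixes a :: "nat \<Rightarrow> real"
  assumes a: "\<And>l. a l = 0 \<or> a l = 1"
  shows "0 \<le> (\<Sum>l. 2 * a l / 3 ^ (l + 1))" "(\<Sum>l. 2 * a l / 3 ^ (l + 1)) \<le> 1"
proof -
  have nn: "0 \<le> a l" for l using a[of l] by auto
  show "0 \<le> (\<Sum>l. 2 * a l / 3 ^ (l + 1))"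
    by (rule suminf_nonneg[OF ternary_summable[OF a]]) (use nn in auto)
  have "(\<Sum>l. 2 * a l / 3 ^ (l + 1)) \<le> (\<Sum>l. 2 / 3 * (1 / 3 :: real) ^ l)"
  proof (rule suminf_le[OF _ ternary_summable[OF a]])
    show "2 * a l / 3 ^ (l + 1) \<le> 2 / 3 * (1 / 3) ^ l" for l using a[of l] by (auto simp: power_divide)
    show "summable (\<lambda>l. 2 / 3 * (1 / 3 :: real) ^ l)" by (intro summable_mult summable_geometric) auto
  qed
  also have "\<dots> = 1" by (subst suminf_mult) (auto simp: suminf_geometric summable_geometric)
  finally show "(\<Sum>l. 2 * a l / 3 ^ (l + 1)) \<le> 1" .
qed

text \<open>Multiplication by \<open>3 ^ m\<close> turns the places before \<open>m\<close> into an
  even integer, since all ternary digits are 0 or 2, keeps \<open>2 / 3 * a m\<close> and a tail in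
  \<open>[0, 1/3]\<close>. The argument thus lies on a plateau of \<open>sch\<close>, and the
  plateau is the one with value \<open>a m\<close>.\<close>

lemma sch_digit:
  fixes a :: "nat \<Rightarrow> real"
  assumes a: "\<And>l. a l = 0 \<or> a l = 1"
  shows "sch (3 ^ m * (\<Sum>l. 2 * a l / 3 ^ (l + 1))) = a m"
proof -
  let ?t = "\<lambda>l. 2 * a l / 3 ^ (l + 1)"
  have s: "summable ?t" by (rule ternary_summable[OF a])
  have tail: "3 ^ m * (\<Sum>n. ?t (n + Suc m)) = (\<Sum>l. 2 * a (l + Suc m) / 3 ^ (l + 1)) / 3"
  proof -
    have "3 ^ m * (\<Sum>n. ?t (n + Suc m)) = (\<Sum>n. 3 ^ m * ?t (n + Suc m))"
      by (intro suminf_mult[symmetric] summable_ignore_initial_segment[OF s])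
    also have "\<dots> = (\<Sum>n. (2 * a (n + Suc m) / 3 ^ (n + 1)) / 3)"
      by (intro suminf_cong) (simp add: power_add field_simps)
    also have "\<dots> = (\<Sum>n. 2 * a (n + Suc m) / 3 ^ (n + 1)) / 3"
      by (rule suminf_divide) (rule ternary_summable, rule a)
    finally show ?thesis .
  qed
  define v where "v = (\<Sum>l. 2 * a (l + Suc m) / 3 ^ (l + 1)) / 3"
  have v: "0 \<le> v" "v \<le> 1/3"
    using ternary_bounds[of "\<lambda>l. a (l + Suc m)"] a by (auto simp: v_def)
  have "(\<Sum>l. ?t l) = (\<Sum>n. ?t (n + Suc m)) + (\<Sum>l<Suc m. ?t l)"
    by (rule suminf_split_initial_segment[OF s])
  then have "3 ^ m * (\<Sum>l. ?t l) = v + 3 ^ m * (\<Sum>l<m. ?t l) + 2 / 3 * a m"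
    using tail by (simp add: v_def algebra_simps)
  moreover have "\<exists>k::int. 3 ^ m * (\<Sum>l<m. ?t l) = 2 * of_int k"
  proof -
    define b where "b l = (if a l = 0 then 0 else 1::int)" for l
    have ab: "a l = of_int (b l)" for l using a[of l] by (auto simp: b_def)
    have "3 ^ m * (\<Sum>l<m. ?t l) = (\<Sum>l<m. 2 * of_int (b l * 3 ^ (m - l - 1)))"
      unfolding sum_distrib_left
    proof (rule sum.cong)
      fix l assume l: "l \<in> {..<m}"
      then have "m = (m - l - 1) + (l + 1)" by simp
      then have "(3::real) ^ m = 3 ^ (m - l - 1) * 3 ^ (l + 1)" by (metis power_add)
      then show "3 ^ m * ?t l = 2 * of_int (b l * 3 ^ (m - l - 1))" by (simp add: ab)
    qed simp
    also have "\<dots> = 2 * of_int (\<Sum>l<m. b l * 3 ^ (m - l - 1))" by (simp add: sum_distrib_left)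
    finally show ?thesis by blast
  qed
  then obtain k :: int where "3 ^ m * (\<Sum>l<m. ?t l) = 2 * of_int k" by blast
  ultimately have e: "3 ^ m * (\<Sum>l. ?t l) = 2 * of_int k + (v + 2 / 3 * a m)" by simp
  show ?thesis
  proof (cases "a m = 0")
    case True then show ?thesis unfolding e using v by (subst sch_eq_0) auto
  next
    case False then have "a m = 1" using a[of m] by auto
    then show ?thesis unfolding e using v by (subst sch_eq_1) auto
  qed
qed

text \<open>Taking the digits from the floor function, and not from some chosen expansion, makes the
  section of the curve Borel.\<close>

definition bdigit :: "real \<Rightarrow> nat \<Rightarrow> real" where
  "bdigit y k = of_int (\<lfloor>2 ^ (k + 1) * y\<rfloor> mod 2)"

lemma bdigit_01: "bdigit y k = 0 \<or> bdigit y k = 1"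
  unfolding bdigit_def by (auto simp: mod2_eq_if)

lemma bdigit_measurable [measurable]: "(\<lambda>y. bdigit y k) \<in> borel_measurable borel"
proof -
  have "(\<lambda>y. bdigit y k) = (\<lambda>n::int. of_int (n mod 2)) \<circ> (\<lambda>y. \<lfloor>2 ^ (k + 1) * y\<rfloor>)"
    by (auto simp: bdigit_def)
  then show ?thesis by simp
qed

text \<open>The partial sums equal \<open>\<lfloor>2 ^ K * y\<rfloor> / 2 ^ K\<close>; the bounds on
  \<open>y\<close> make the integer part vanish at \<open>K = 0\<close>.\<close>

lemma bdigit_sums:
  assumes "0 \<le> y" "y < 1"
  shows "(\<lambda>k. bdigit y k / 2 ^ (k + 1)) sums y"
proof -
  have part: "(\<Sum>k<K. bdigit y k / 2 ^ (k + 1)) = of_int \<lfloor>2 ^ K * y\<rfloor> / 2 ^ K" for K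
  proof (induction K)
    case 0 then show ?case using assms by (simp add: floor_eq_iff)
  next
    case (Suc K)
    have "\<lfloor>2 ^ (K + 1) * y\<rfloor> div 2 = \<lfloor>2 ^ K * y\<rfloor>"
      using floor_divide_real_eq_div[of 2 "2 ^ (K+1) * y"] by simp
    then have "\<lfloor>2 ^ (K + 1) * y\<rfloor> = 2 * \<lfloor>2 ^ K * y\<rfloor> + \<lfloor>2 ^ (K + 1) * y\<rfloor> mod 2"
      by (metis mult_div_mod_eq)
    then have "real_of_int \<lfloor>2 ^ (K + 1) * y\<rfloor> = 2 * of_int \<lfloor>2 ^ K * y\<rfloor> + bdigit y K"
      unfolding bdigit_def by (metis of_int_add of_int_mult of_int_numeral)
    then show ?case using Suc by (simp add: field_simps)
  qed
  have "(\<lambda>K. of_int \<lfloor>2 ^ K * y\<rfloor> / 2 ^ K) \<longlonglongrightarrow> y"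
  proof (rule real_tendsto_sandwich)
    have "(\<lambda>K. y - (1 / 2) ^ K) \<longlonglongrightarrow> y - 0" by (intro tendsto_intros LIMSEQ_power_zero) auto
    then show "(\<lambda>K. y - (1 / 2) ^ K) \<longlonglongrightarrow> y" by simp
    show "\<forall>\<^sub>F K in sequentially. y - (1 / 2) ^ K \<le> of_int \<lfloor>2 ^ K * y\<rfloor> / 2 ^ K"
    proof (intro always_eventually allI)
      fix K
      have "2 ^ K * y - 1 \<le> of_int \<lfloor>2 ^ K * y\<rfloor>" by linarith
      then have "(2 ^ K * y - 1) / 2 ^ K \<le> of_int \<lfloor>2 ^ K * y\<rfloor> / 2 ^ K" by (intro divide_right_mono) auto
      moreover have "(2 ^ K * y - 1) / 2 ^ K = y - (1 / 2) ^ K" by (simp add: field_simps power_divide)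
      ultimately show "y - (1 / 2) ^ K \<le> of_int \<lfloor>2 ^ K * y\<rfloor> / 2 ^ K" by simp
    qed
    show "\<forall>\<^sub>F K in sequentially. of_int \<lfloor>2 ^ K * y\<rfloor> / 2 ^ K \<le> y"
      by (intro always_eventually allI) (simp add: field_simps)
  qed simp
  then show ?thesis unfolding sums_def part .
qed

definition coord_index :: "'n::finite \<Rightarrow> nat" where
  "coord_index = to_nat_on UNIV"

lemma coord_index_bij: "bij_betw coord_index (UNIV :: 'n::finite set) {..<CARD('n)}"
  unfolding coord_index_def by (rule to_nat_on_finite) simp

text \<open>The digits of all coordinates are interleaved: binary digit \<open>k\<close> of
  coordinate \<open>i\<close> is read off at ternary place
  \<open>CARD('n) * k + coord_index i\<close> of the parameter.\<close>

definition cube_curve :: "real \<Rightarrow> 'n::finite \<Rightarrow> real" where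
  "cube_curve u i = (\<Sum>k. sch (3 ^ (CARD('n) * k + coord_index i) * u) / 2 ^ (k + 1))"

text \<open>The inverse interleaving, with values in the Cantor set: place \<open>m\<close> stores
  digit \<open>m div CARD('n)\<close> of the coordinate with index
  \<open>m mod CARD('n)\<close>.\<close>

definition curve_param :: "('n::finite \<Rightarrow> real) \<Rightarrow> real" where
  "curve_param y = (\<Sum>m. 2 * bdigit (y (inv_into UNIV coord_index (m mod CARD('n)))) (m div CARD('n)) / 3 ^ (m + 1))"

lemma curve_param_bounds: "0 \<le> curve_param y" "curve_param y \<le> 1"
  unfolding curve_param_def by (rule ternary_bounds, rule bdigit_01)+

lemma cube_curve_param:
  fixes y :: "'n::finite \<Rightarrow> real"
  assumes "\<And>i. 0 \<le> y i \<and> y i < 1"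
  shows "cube_curve (curve_param y) i = y i"
proof -
  have ci: "coord_index i < CARD('n)" "inv_into UNIV coord_index (coord_index i) = i"
    using coord_index_bij[where 'n='n] by (auto simp: bij_betw_def)
  have "sch (3 ^ (CARD('n) * k + coord_index i) * curve_param y) = bdigit (y i) k" for k
    unfolding curve_param_def using ci by (subst sch_digit) (auto simp: bdigit_01)
  then have "cube_curve (curve_param y) i = (\<Sum>k. bdigit (y i) k / 2 ^ (k + 1))"
    by (simp add: cube_curve_def)
  also have "\<dots> = y i" using bdigit_sums[of "y i"] assms[of i] by (simp add: sums_iff)
  finally show ?thesis .
qed

lemma continuous_cube_curve: "continuous_on UNIV (\<lambda>u. cube_curve u i)"
proof -
  have "uniform_limit UNIV (\<lambda>n u. \<Sum>k<n. sch (3 ^ (CARD('a) * k + coord_index i) * u) / 2 ^ (k + 1)) (\<lambda>u. cube_curve u i) sequentially"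
    unfolding cube_curve_def
  proof (rule Weierstrass_m_test)
    show "norm (sch (3 ^ (CARD('a) * k + coord_index i) * u) / 2 ^ (k + 1)) \<le> (1 / 2) ^ (k + 1)" for k u
      using sch_bounds by (auto simp: power_divide divide_right_mono)
    show "summable (\<lambda>k. (1 / 2 :: real) ^ (k + 1))" by (subst summable_iff_shift) (auto intro: summable_geometric)
  qed
  then show ?thesis
    by (rule uniform_limit_theorem[rotated])
       (auto intro!: always_eventually continuous_intros continuous_on_compose2[OF continuous_sch[of UNIV]])
qed

text \<open>A homeomorphism of the line onto \<open>(0, 1)\<close>, which carries the curve from the
  cube to the whole space.\<close>

definition squash :: "real \<Rightarrow> real" where "squash s = 1 / 2 + arctan s / pi"
definition unsquash :: "real \<Rightarrow> real" where "unsquash s = tan (pi * (s - 1 / 2))"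

lemma squash_bounds: "0 < squash s" "squash s < 1"
proof -
  have "- (1 / 2) < arctan s / pi" "arctan s / pi < 1 / 2"
    using arctan_lbound[of s] arctan_ubound[of s] by (auto simp: field_simps)
  then show "0 < squash s" "squash s < 1" unfolding squash_def by linarith+
qed

lemma unsquash_squash: "unsquash (squash s) = s"
  by (simp add: unsquash_def squash_def tan_arctan)

lemma squash_unsquash: "0 < s \<Longrightarrow> s < 1 \<Longrightarrow> squash (unsquash s) = s"
proof -
  assume s: "0 < s" "s < 1"
  have "- (pi / 2) < pi * (s - 1 / 2)" "pi * (s - 1 / 2) < pi / 2"
    using mult_strict_left_mono[OF s(1) pi_gt_zero] mult_strict_left_mono[OF s(2) pi_gt_zero]
    by (auto simp: algebra_simps)
  then show ?thesis unfolding squash_def unsquash_def by (simp add: arctan_tan)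
qed

lemma squash_mono: "s \<le> t \<Longrightarrow> squash s \<le> squash t"
  by (simp add: squash_def divide_right_mono arctan_monotone')

lemma continuous_unsquash: "continuous_on {0<..<1} unsquash"
  unfolding unsquash_def
proof (intro continuous_intros ballI)
  fix s :: real assume "s \<in> {0<..<1}"
  then have s: "0 < s" "s < 1" by auto
  have "- (pi / 2) < pi * (s - 1 / 2)" "pi * (s - 1 / 2) < pi / 2"
    using mult_strict_left_mono[OF s(1) pi_gt_zero] mult_strict_left_mono[OF s(2) pi_gt_zero]
    by (auto simp: algebra_simps)
  then show "cos (pi * (s - 1 / 2)) \<noteq> 0" using cos_gt_zero_pi[of "pi * (s - 1 / 2)"] by simp
qed

lemma squash_measurable [measurable]: "squash \<in> borel_measurable borel"
  unfolding squash_def by measurable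

lemma unsquash_measurable [measurable]: "unsquash \<in> borel_measurable borel"
  unfolding unsquash_def tan_def
  by (intro borel_measurable_divide measurable_compose[OF _ borel_measurable_continuous_onI[OF continuous_on_sin[OF continuous_on_id]]]
     measurable_compose[OF _ borel_measurable_continuous_onI[OF continuous_on_cos[OF continuous_on_id]]]) measurable

definition unlift :: "real \<Rightarrow> real^'n::finite" where
  "unlift u = (\<chi> i. unsquash (cube_curve u i))"

definition lift :: "real^'n::finite \<Rightarrow> real" where
  "lift x = curve_param (\<lambda>i. squash (x $ i))"

text \<open>Here the curve runs in the open cube and \<open>unsquash\<close> inverts
  \<open>squash\<close>; at other parameters \<open>unlift\<close> has meaningless values.\<close>

definition lift_range :: "'n::finite itself \<Rightarrow> real set" where
  "lift_range _ = {u. \<forall>i::'n. 0 < cube_curve u i \<and> cube_curve u i < 1}"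

lemma cube_curve_lift: "cube_curve (lift x) i = squash (x $ i)"
  unfolding lift_def by (rule cube_curve_param) (use squash_bounds in \<open>auto simp: less_imp_le\<close>)

lemma unlift_lift: "unlift (lift x) = x"
  by (simp add: unlift_def cube_curve_lift unsquash_squash vec_eq_iff)

lemma lift_in_range: "lift (x::real^'n::finite) \<in> lift_range TYPE('n)"
  by (simp add: lift_range_def cube_curve_lift squash_bounds)

lemma cube_curve_measurable [measurable]: "(\<lambda>u. cube_curve u i) \<in> borel_measurable borel"
  by (rule borel_measurable_continuous_onI[OF continuous_cube_curve])

lemma unlift_measurable [measurable]: "unlift \<in> borel_measurable borel"
  by (rule borel_measurable_vec) (simp add: unlift_def)

lemma lift_measurable [measurable]: "lift \<in> borel_measurable borel"
  unfolding lift_def curve_param_def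
  by (intro borel_measurable_suminf borel_measurable_divide borel_measurable_times borel_measurable_const
      measurable_compose[OF _ bdigit_measurable] measurable_compose[OF _ squash_measurable] borel_measurable_vec_nth)

lemma open_lift_range: "open (lift_range TYPE('n::finite))"
proof -
  have "lift_range TYPE('n) = (\<Inter>i::'n. {u. 0 < cube_curve u i} \<inter> {u. cube_curve u i < 1})"
    by (auto simp: lift_range_def)
  then show ?thesis
    by (simp only:) (auto intro!: open_INT open_Int open_Collect_less continuous_intros continuous_cube_curve)
qed

lemma lift_bounds: "0 \<le> lift x" "lift x \<le> 1"
  by (auto simp: lift_def curve_param_bounds)

text \<open>A bound \<open>R\<close> on the support confines the relevant parameters to the closed
  set \<open>C\<close>, on which all coordinates of the curve stay between
  \<open>squash (- R)\<close> and \<open>squash R\<close>, hence inside \<open>lift_range\<close>.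
  The open sets \<open>lift_range\<close> and \<open>- C\<close> cover the line, and the function is
  continuous on each.\<close>

lemma continuous_lifted:
  fixes \<psi> :: "real^'n::finite \<Rightarrow> real"
  assumes c: "continuous_on UNIV \<psi>" and b: "bounded {x. \<psi> x \<noteq> 0}"
  shows "continuous_on UNIV (\<lambda>u. if u \<in> lift_range TYPE('n) then \<psi> (unlift u) else 0)" (is "continuous_on UNIV ?f")
proof -
  let ?O = "lift_range TYPE('n)"
  obtain R where R: "\<And>x. \<psi> x \<noteq> 0 \<Longrightarrow> norm x \<le> R" using b by (auto simp: bounded_iff)
  define C where "C = (\<Inter>i::'n. {u. squash (- R) \<le> cube_curve u i} \<inter> {u. cube_curve u i \<le> squash R})"
  have clC: "closed C" unfolding C_def
    by (intro closed_INT ballI closed_Int closed_Collect_le continuous_intros continuous_cube_curve)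
  have CO: "C \<subseteq> ?O"
  proof
    fix u assume "u \<in> C"
    then have "squash (- R) \<le> cube_curve u i" "cube_curve u i \<le> squash R" for i :: 'n by (auto simp: C_def)
    then have "0 < cube_curve u i" "cube_curve u i < 1" for i :: 'n
      using squash_bounds[of "-R"] squash_bounds[of R] by (meson order_less_le_trans order_le_less_trans)+
    then show "u \<in> ?O" by (auto simp: lift_range_def)
  qed
  have zero: "?f u = 0" if "u \<notin> C" for u
  proof (rule ccontr)
    assume "?f u \<noteq> 0"
    then have u: "u \<in> ?O" "\<psi> (unlift u) \<noteq> 0" by (auto split: if_splits)
    have "squash (- R) \<le> cube_curve u i \<and> cube_curve u i \<le> squash R" for i :: 'n
    proof -
      have "\<bar>(unlift u :: real^'n) $ i\<bar> \<le> R" using component_le_norm_cart[of "unlift u :: real^'n" i] R[OF u(2)] by linarith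
      then have "squash (-R) \<le> squash (unsquash (cube_curve u i)) \<and> squash (unsquash (cube_curve u i)) \<le> squash R"
        by (intro conjI squash_mono) (auto simp: unlift_def)
      then show ?thesis using u(1) by (simp add: lift_range_def squash_unsquash)
    qed
    then have "u \<in> C" by (auto simp: C_def)
    with that show False by simp
  qed
  have "continuous_on ?O (\<lambda>u. \<psi> (unlift u))"
    unfolding unlift_def
    by (intro continuous_on_compose2[OF c] continuous_on_vec_lambda continuous_on_compose2[OF continuous_unsquash]
        continuous_on_subset[OF continuous_cube_curve]) (auto simp: lift_range_def)
  then have 1: "continuous_on ?O ?f" by (rule continuous_on_eq) simp
  have 2: "continuous_on (- C) ?f"
    by (rule continuous_on_eq[OF continuous_on_const[of _ 0]]) (use zero in auto)
  have "?O \<union> - C = UNIV" using CO by auto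
  then show ?thesis using continuous_on_open_Un[OF open_lift_range[where 'n='n] _ 1 2] clC by (simp add: open_Compl)
qed

section \<open>Compactly supported continuous functions\<close>

lemma Cc_bounded_support: "\<psi> \<in> Cc \<Omega> \<Longrightarrow> bounded {x. \<psi> x \<noteq> 0}"
  unfolding Cc_def compactly_inside_def using bounded_subset[OF compact_imp_bounded closure_subset] by blast

lemma Cc_continuous: "\<psi> \<in> Cc \<Omega> \<Longrightarrow> continuous_on UNIV \<psi>"
  by (simp add: Cc_def)

lemma Cc_measurable: "\<psi> \<in> Cc \<Omega> \<Longrightarrow> \<psi> \<in> borel_measurable borel"
  by (intro borel_measurable_continuous_onI Cc_continuous)

lemma Cc_zero_outside: "\<psi> \<in> Cc \<Omega> \<Longrightarrow> x \<notin> \<Omega> \<Longrightarrow> \<psi> x = 0"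
  unfolding Cc_def compactly_inside_def using closure_subset[of "{x. \<psi> x \<noteq> 0}"] by auto

lemma Cc_bounded:
  assumes "\<psi> \<in> Cc \<Omega>"
  obtains B where "B > 0" "\<And>x. \<bar>\<psi> x\<bar> \<le> B"
proof -
  have "compact (closure {x. \<psi> x \<noteq> 0})" using assms by (auto simp: Cc_def compactly_inside_def)
  then have "bounded (\<psi> ` closure {x. \<psi> x \<noteq> 0})"
    using Cc_continuous[OF assms] by (intro compact_imp_bounded compact_continuous_image) (auto intro: continuous_on_subset)
  then obtain B where B: "B > 0" "\<And>y. y \<in> \<psi> ` closure {x. \<psi> x \<noteq> 0} \<Longrightarrow> norm y \<le> B"
    unfolding bounded_pos by blast
  have "\<bar>\<psi> x\<bar> \<le> B" for x
  proof (cases "\<psi> x = 0")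
    case False
    then have "x \<in> closure {x. \<psi> x \<noteq> 0}" using closure_subset[of "{x. \<psi> x \<noteq> 0}"] by auto
    then show ?thesis using B(2)[of "\<psi> x"] by auto
  qed (use B in auto)
  with B(1) show ?thesis by (rule that)
qed

subsection \<open>Weak* compactness of bounded sequences of measures\<close>

text \<open>The total masses converge along a first subsequence. The normalised images under
  \<open>lift\<close> live on \<open>[0, 1]\<close>, so they are tight and a further subsequence
  converges in law to some \<open>L\<close>; the limit is the image under \<open>unlift\<close> of
  \<open>L\<close>, multiplied by the limit mass. Lifted test functions are bounded and continuous,
  hence admissible in the convergence in law.\<close>

theorem weak_star_compactness:
  fixes M :: "nat \<Rightarrow> (real^'n::finite) measure"
  assumes op: "open \<Omega>" and sM: "\<And>k. sets (M k) = sets borel" and fM: "\<And>k. finite_measure (M k)"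
    and bd: "\<And>k. measure (M k) UNIV \<le> C"
  obtains r \<nu> where "strict_mono r" "weak_star_conv \<Omega> (\<lambda>k. M (r k)) \<nu> sequentially"
proof -
  have spM [simp]: "space (M k) = UNIV" for k using sets_eq_imp_space_eq[OF sM[of k]] by simp
  have mM [measurable_cong]: "sets (M k) = sets borel" for k by (rule sM)
  define m where "m k = measure (M k) UNIV" for k
  have m0: "0 \<le> m k" for k by (simp add: m_def)
  have "bounded (range m)" using bd m0 by (auto simp: bounded_iff m_def intro!: exI[of _ C])
  then obtain m' r1 where r1: "strict_mono r1" "(m \<circ> r1) \<longlonglongrightarrow> m'" using bounded_imp_convergent_subsequence by blast
  have m'0: "m' \<ge> 0" using r1(2) by (rule LIMSEQ_le_const) (auto simp: m0)
  \<comment> \<open>A measure without mass is replaced by an arbitrary probability measure; it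
    enters later only with the factor \<open>m k = 0\<close>.\<close>
  define N where "N k = (if m k = 0 then return borel 0 else density (distr (M k) borel lift) (\<lambda>_. ennreal (1 / m k)))" for k
  have dN: "real_distribution (N k)" for k
  proof -
    interpret finite_measure "M k" by (rule fM)
    have "emeasure (N k) (space (N k)) = 1" if "m k \<noteq> 0"
    proof -
      have "emeasure (N k) (space (N k)) = ennreal (1 / m k) * emeasure (M k) UNIV"
        using that by (simp add: N_def emeasure_density_const emeasure_distr)
      also have "\<dots> = 1" using that m0[of k] by (simp add: emeasure_eq_measure flip: m_def ennreal_mult)
      finally show ?thesis .
    qed
    moreover have "emeasure (N k) (space (N k)) = 1" if "m k = 0" using that by (simp add: N_def)
    ultimately have "prob_space (N k)" by (intro prob_spaceI) blast
    then show ?thesis by (intro real_distribution.intro real_distribution_axioms.intro) (auto simp: N_def)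
  qed
  \<comment> \<open>Tightness is stated with half-open intervals, so the left end lies below 0 to
    include the parameter 0.\<close>
  have N_Ioc: "1 - e < measure (N k) {-1<..1}" if "e > 0" for e :: real and k
  proof -
    interpret real_distribution "N k" by (rule dN)
    have "AE u in N k. u \<in> {-1<..1}"
    proof (cases "m k = 0")
      case True
      have "AE u in return borel (0::real). u \<in> {-1<..1}" by (subst AE_return) auto
      moreover have Nk: "N k = return borel 0" using True by (simp add: N_def)
      ultimately show ?thesis unfolding Nk by blast
    next
      case False
      have "0 \<le> lift x \<and> lift x \<le> 1" for x :: "real^'n" using lift_bounds by auto
      then have "AE x in M k. lift x \<in> {-1<..1}" by (intro AE_I2) (auto intro: less_le_trans[of _ 0])
      then have "AE u in distr (M k) borel lift. u \<in> {-1<..1}" by (subst AE_distr_iff) auto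
      moreover have Nk: "N k = density (distr (M k) borel lift) (\<lambda>_. ennreal (1 / m k))" using False by (simp add: N_def)
      ultimately show ?thesis unfolding Nk by (subst AE_density) auto
    qed
    then have "prob {-1<..1} = 1" by (subst prob_eq_1) auto
    then show ?thesis using \<open>e > 0\<close> by simp
  qed
  have "\<exists>a b::real. a < b \<and> (\<forall>k. 1 - e < measure (N k) {a<..b})" if "e > 0" for e
    using N_Ioc[OF that] by (intro exI[of _ "-1"] exI[of _ 1]) simp
  then have "tight N" unfolding tight_def using dN by blast
  then obtain r2 L where r2: "strict_mono r2" "real_distribution L" "weak_conv_m (N \<circ> r1 \<circ> r2) L"
    using tight_imp_convergent_subsubsequence[of N r1] r1(1) by blast
  interpret L: real_distribution L by (rule r2(2))
  let ?O = "lift_range TYPE('n)"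
  have [measurable]: "?O \<in> sets borel" using open_lift_range by (rule borel_open)
  have [measurable]: "\<Omega> \<in> sets borel" using op by simp
  \<comment> \<open>\<open>L\<close> may charge parameters outside \<open>lift_range\<close> or
    above points outside \<Omega>: mass that escaped in the limit. It is discarded, and the
    integrals of test functions do not change because their lifts vanish there.\<close>
  define W where "W = ?O \<inter> unlift -` \<Omega>"
  have W [measurable]: "W \<in> sets borel"
    unfolding W_def by (intro sets.Int measurable_sets_borel[OF unlift_measurable]) auto
  define \<nu> where "\<nu> = distr (density L (\<lambda>u. ennreal (m' * indicator W u))) borel (unlift :: real \<Rightarrow> real^'n)"
  have [measurable_cong]: "sets L = sets borel" by simp
  have fin: "finite_measure (density L (\<lambda>u. ennreal (m' * indicator W u)))"
  proof
    have "emeasure (density L (\<lambda>u. ennreal (m' * indicator W u))) UNIV = (\<integral>\<^sup>+u. ennreal (m' * indicator W u) \<partial>L)"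
      by (subst emeasure_density) auto
    also have "\<dots> \<le> (\<integral>\<^sup>+u. ennreal m' \<partial>L)" by (intro nn_integral_mono ennreal_leI) (auto simp: indicator_def m'0)
    also have "\<dots> < \<infinity>" by (simp add: L.emeasure_space_1[simplified])
    finally show "emeasure (density L (\<lambda>u. ennreal (m' * indicator W u))) (space (density L (\<lambda>u. ennreal (m' * indicator W u)))) \<noteq> \<infinity>"
      by simp
  qed
  have rad: "finite_radon_on \<Omega> \<nu>" unfolding finite_radon_on_def
  proof (intro conjI)
    have [measurable]: "unlift -` (- \<Omega>) \<in> sets borel"
      by (rule measurable_sets_borel[OF unlift_measurable]) auto
    show "finite_measure \<nu>" unfolding \<nu>_def by (intro finite_measure.finite_measure_distr[OF fin]) simp
    have "emeasure \<nu> (- \<Omega>) = emeasure (density L (\<lambda>u. ennreal (m' * indicator W u))) (unlift -` (- \<Omega>))"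
      unfolding \<nu>_def by (subst emeasure_distr) auto
    also have "\<dots> = (\<integral>\<^sup>+u. ennreal (m' * indicator W u) * indicator (unlift -` (- \<Omega>)) u \<partial>L)"
      by (subst emeasure_density) auto
    also have "\<dots> = (\<integral>\<^sup>+u. 0 \<partial>L)" by (intro nn_integral_cong) (auto simp: indicator_def W_def)
    finally show "emeasure \<nu> (- \<Omega>) = 0" by simp
  qed (simp add: \<nu>_def)
  have conv: "(\<lambda>k. LINT x|M ((r1 \<circ> r2) k). \<psi> x) \<longlonglongrightarrow> (LINT x|\<nu>. \<psi> x)" if psi: "\<psi> \<in> Cc \<Omega>" for \<psi>
  proof -
    define f where "f u = (if u \<in> ?O then \<psi> (unlift u) else 0)" for u
    have [measurable]: "\<psi> \<in> borel_measurable borel" by (rule Cc_measurable[OF psi])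
    obtain B where B: "B > 0" "\<And>x. \<bar>\<psi> x\<bar> \<le> B" using Cc_bounded[OF psi] by blast
    have cf: "continuous_on UNIV f"
      unfolding f_def by (rule continuous_lifted[OF Cc_continuous[OF psi] Cc_bounded_support[OF psi]])
    then have [measurable]: "f \<in> borel_measurable borel" by (rule borel_measurable_continuous_onI)
    have "(\<lambda>n. integral\<^sup>L ((N \<circ> r1 \<circ> r2) n) f) \<longlonglongrightarrow> integral\<^sup>L L f"
    proof (rule weak_conv_imp_integral_bdd_continuous_conv[OF _ r2(2,3)])
      show "real_distribution ((N \<circ> r1 \<circ> r2) n)" for n using dN by simp
      show "isCont f x" for x using cf by (simp add: continuous_on_eq_continuous_at)
      show "norm (f x) \<le> B" for x using B by (auto simp: f_def)
    qed
    moreover have "(\<lambda>n. m (r1 (r2 n))) \<longlonglongrightarrow> m'"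
      using LIMSEQ_subseq_LIMSEQ[OF r1(2) r2(1)] by (simp add: o_def)
    ultimately have lim: "(\<lambda>n. m (r1 (r2 n)) * integral\<^sup>L ((N \<circ> r1 \<circ> r2) n) f) \<longlonglongrightarrow> m' * integral\<^sup>L L f"
      by (intro tendsto_mult)
    have step: "m k * integral\<^sup>L (N k) f = (LINT x|M k. \<psi> x)" for k
    proof (cases "m k = 0")
      case True
      interpret finite_measure "M k" by (rule fM)
      have "emeasure (M k) (space (M k)) = 0" using True by (simp add: m_def emeasure_eq_measure)
      then have "AE x in M k. \<psi> x = 0" by (intro AE_I[of _ _ "space (M k)"]) auto
      then have "(LINT x|M k. \<psi> x) = (LINT x|M k. 0)" by (intro integral_cong_AE) auto
      then show ?thesis using True by simp
    next
      case False
      have "integral\<^sup>L (N k) f = integral\<^sup>L (distr (M k) borel lift) (\<lambda>u. (1 / m k) *\<^sub>R f u)"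
        using False m0[of k] by (simp only: N_def if_False) (subst integral_density, auto)
      also have "\<dots> = (LINT x|M k. (1 / m k) *\<^sub>R f (lift x))" by (subst integral_distr) auto
      also have "\<dots> = (LINT x|M k. (1 / m k) *\<^sub>R \<psi> x)"
        by (simp add: f_def lift_in_range unlift_lift)
      finally show ?thesis using False by simp
    qed
    have "(LINT x|\<nu>. \<psi> x) = (LINT u|density L (\<lambda>u. ennreal (m' * indicator W u)). \<psi> (unlift u))"
      unfolding \<nu>_def by (subst integral_distr) auto
    also have "\<dots> = (LINT u|L. (m' * indicator W u) *\<^sub>R \<psi> (unlift u))"
      by (subst integral_density) (auto simp: m'0)
    also have "\<dots> = (LINT u|L. m' * f u)"
      by (intro Bochner_Integration.integral_cong) (auto simp: f_def indicator_def W_def Cc_zero_outside[OF psi])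
    also have "\<dots> = m' * integral\<^sup>L L f" by simp
    finally show ?thesis using lim by (simp add: step o_def)
  qed
  show ?thesis
  proof (rule that)
    show "strict_mono (r1 \<circ> r2)" using r1(1) r2(1) by (rule strict_mono_o)
    show "weak_star_conv \<Omega> (\<lambda>k. M ((r1 \<circ> r2) k)) \<nu> sequentially"
      unfolding weak_star_conv_def using rad conv by blast
  qed
qed

subsection \<open>Finite signed measures\<close>

abbreviation "fvm \<equiv> finite_vector_measure_on"

lemma fvmD:
  fixes S :: "nat \<Rightarrow> 'a::euclidean_space set"
  assumes "fvm \<Omega> m" "\<And>i. S i \<in> sets borel" "\<And>i. S i \<subseteq> \<Omega>" "disjoint_family S"
  shows "(\<lambda>i. m (S i)) sums m (\<Union>i. S i)"
  using assms unfolding finite_vector_measure_on_def by blast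

lemma fvmI:
  fixes m :: "'a::euclidean_space set \<Rightarrow> 'b::euclidean_space"
  assumes "\<And>S :: nat \<Rightarrow> 'a set. (\<And>i. S i \<in> sets borel) \<Longrightarrow> (\<And>i. S i \<subseteq> \<Omega>) \<Longrightarrow> disjoint_family S \<Longrightarrow>
    (\<lambda>i. m (S i)) sums m (\<Union>i. S i)"
  shows "fvm \<Omega> m"
  using assms unfolding finite_vector_measure_on_def by blast

lemma fvm_empty:
  assumes "fvm \<Omega> m" shows "m {} = 0"
proof -
  have "(\<lambda>i::nat. m {}) sums m (\<Union>i::nat. {})"
    by (rule fvmD[OF assms]) (auto simp: disjoint_family_on_def)
  then have "(\<lambda>i::nat. m {}) \<longlonglongrightarrow> 0" by (intro summable_LIMSEQ_zero) (auto simp: sums_iff)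
  then show ?thesis by (simp add: LIMSEQ_const_iff)
qed

lemma fvm_Un:
  assumes m: "fvm \<Omega> m" and "A \<in> sets borel" "B \<in> sets borel" "A \<subseteq> \<Omega>" "B \<subseteq> \<Omega>" "A \<inter> B = {}"
  shows "m (A \<union> B) = m A + m B"
proof -
  have "(\<lambda>i. m (binaryset A B i)) sums m (\<Union>i. binaryset A B i)"
    by (rule fvmD[OF m]) (use assms in \<open>auto simp: binaryset_def disjoint_family_on_def\<close>)
  moreover have "(\<lambda>i. m (binaryset A B i)) sums (m A + m B)"
    using binaryset_sums[of m A B] fvm_empty[OF m] by simp
  ultimately show ?thesis using sums_unique2 by (metis UN_binaryset_eq)
qed

lemma fvm_Diff:
  assumes m: "fvm \<Omega> m" and "A \<in> sets borel" "B \<in> sets borel" "A \<subseteq> B" "B \<subseteq> \<Omega>"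
  shows "m (B - A) = m B - m A"
proof -
  have "m (A \<union> (B - A)) = m A + m (B - A)" using assms by (intro fvm_Un[OF m]) auto
  moreover have "A \<union> (B - A) = B" using assms by auto
  ultimately show ?thesis by simp
qed

lemma fvm_UN:
  assumes m: "fvm \<Omega> m" and fin: "finite I" and "\<And>i. i \<in> I \<Longrightarrow> S i \<in> sets borel \<and> S i \<subseteq> \<Omega>" and "disjoint_family_on S I"
  shows "m (\<Union>i\<in>I. S i) = (\<Sum>i\<in>I. m (S i))"
  using fin assms(3,4)
proof (induction I)
  case empty then show ?case using fvm_empty[OF m] by simp
next
  case (insert i I)
  have "m (S i \<union> (\<Union>i\<in>I. S i)) = m (S i) + m (\<Union>i\<in>I. S i)"
    using insert by (intro fvm_Un[OF m] sets.finite_UN) (auto simp: disjoint_family_on_def)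
  moreover have "m (\<Union>i\<in>I. S i) = (\<Sum>i\<in>I. m (S i))" using insert by (auto simp: disjoint_family_on_def)
  ultimately show ?case using insert by simp
qed

lemma fvm_subset:
  fixes m :: "'a::euclidean_space set \<Rightarrow> 'b::euclidean_space"
  assumes "fvm \<Omega> m" "A \<subseteq> \<Omega>" shows "fvm A m"
proof (rule fvmI)
  fix S :: "nat \<Rightarrow> 'a set" assume S: "\<And>i. S i \<in> sets borel" "\<And>i. S i \<subseteq> A" "disjoint_family S"
  have "S i \<subseteq> \<Omega>" for i using S(2) assms(2) by (rule subset_trans)
  then show "(\<lambda>i. m (S i)) sums m (\<Union>i. S i)" by (rule fvmD[OF assms(1) S(1) _ S(3)])
qed

lemma fvm_restrict:
  assumes "fvm \<Omega> m" "X \<in> sets borel" "X \<subseteq> \<Omega>"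
  shows "fvm UNIV (\<lambda>S. m (S \<inter> X))"
proof (rule fvmI)
  fix S :: "nat \<Rightarrow> 'a set" assume S: "\<And>i. S i \<in> sets borel" "disjoint_family S"
  have "(\<lambda>i. m (S i \<inter> X)) sums m (\<Union>i. S i \<inter> X)"
    using assms S by (intro fvmD[OF assms(1)] disjoint_family_subset[OF S(2)]) auto
  then show "(\<lambda>i. m (S i \<inter> X)) sums m ((\<Union>i. S i) \<inter> X)" by (simp add: Int_UN_distrib2)
qed

lemma fvm_uminus: "fvm \<Omega> m \<Longrightarrow> fvm \<Omega> (\<lambda>S. - m S)"
  by (rule fvmI, rule sums_minus, rule fvmD)

lemma fvm_zero: "fvm \<Omega> (\<lambda>S. 0)"
  by (intro fvmI) simp

lemma disjoint_family_lessThan: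
  assumes "disjoint_family S" shows "(\<Union>i<n::nat. S i) \<inter> S n = {}"
proof -
  have "S i \<inter> S n = {}" if "i < n" for i
    using disjoint_family_onD[OF assms, of i n] that by simp
  then show ?thesis by blast
qed

text \<open>The error after \<open>n\<close> pieces is the charge of the remaining union, dominated
  by its \<nu>-measure, and that tends to 0 because \<nu> is countably additive.\<close>

lemma fvm_dominatedI:
  fixes m :: "'a::euclidean_space set \<Rightarrow> real"
  assumes \<Omega>: "\<Omega> \<in> sets borel" and sn: "sets \<nu> = sets borel" and fn: "finite_measure \<nu>"
    and add: "\<And>A B. A \<in> sets borel \<Longrightarrow> B \<in> sets borel \<Longrightarrow> A \<subseteq> \<Omega> \<Longrightarrow> B \<subseteq> \<Omega> \<Longrightarrow> A \<inter> B = {} \<Longrightarrow> m (A \<union> B) = m A + m B"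
    and dom: "\<And>A. A \<in> sets borel \<Longrightarrow> A \<subseteq> \<Omega> \<Longrightarrow> \<bar>m A\<bar> \<le> measure \<nu> A"
  shows "fvm \<Omega> m"
proof (rule fvmI)
  interpret finite_measure \<nu> by fact
  fix S :: "nat \<Rightarrow> 'a set" assume S: "\<And>i. S i \<in> sets borel" "\<And>i. S i \<subseteq> \<Omega>" "disjoint_family S"
  have m0: "m {} = 0" using add[of "{}" "{}"] by simp
  have part: "m (\<Union>i<n. S i) = (\<Sum>i<n. m (S i))" for n
  proof (induction n)
    case (Suc n)
    have "m ((\<Union>i<n. S i) \<union> S n) = m (\<Union>i<n. S i) + m (S n)"
      using S by (intro add sets.finite_UN disjoint_family_lessThan[OF S(3)]) auto
    moreover have "(\<Union>i<Suc n. S i) = (\<Union>i<n. S i) \<union> S n" by (auto simp: less_Suc_eq)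
    ultimately show ?case using Suc by simp
  qed (simp add: m0)
  let ?U = "\<Union>i. S i"
  have U: "?U \<in> sets borel" "?U \<subseteq> \<Omega>" using S by auto
  have bound: "\<bar>m ?U - (\<Sum>i<n. m (S i))\<bar> \<le> measure \<nu> ?U - (\<Sum>i<n. measure \<nu> (S i))" for n
  proof -
    let ?P = "\<Union>i<n. S i"
    have P: "?P \<in> sets borel" "?P \<subseteq> ?U" using S by auto
    have "m (?P \<union> (?U - ?P)) = m ?P + m (?U - ?P)" using P U by (intro add) auto
    moreover have "?P \<union> (?U - ?P) = ?U" using P by auto
    moreover have "\<bar>m (?U - ?P)\<bar> \<le> measure \<nu> (?U - ?P)" using P U by (intro dom) auto
    moreover have "measure \<nu> (?U - ?P) = measure \<nu> ?U - measure \<nu> ?P"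
      using P U sn by (intro finite_measure_Diff) auto
    moreover have "measure \<nu> ?P = (\<Sum>i<n. measure \<nu> (S i))"
      using S sn by (intro finite_measure_finite_Union) (auto simp: disjoint_family_on_def)
    ultimately show ?thesis using part by simp
  qed
  have "(\<lambda>i. measure \<nu> (S i)) sums measure \<nu> ?U"
    using S sn by (intro finite_measure_UNION) auto
  then have "(\<lambda>n. measure \<nu> ?U - (\<Sum>i<n. measure \<nu> (S i))) \<longlonglongrightarrow> measure \<nu> ?U - measure \<nu> ?U"
    unfolding sums_def by (intro tendsto_intros)
  then have z: "(\<lambda>n. measure \<nu> ?U - (\<Sum>i<n. measure \<nu> (S i))) \<longlonglongrightarrow> 0" by simp
  have "\<forall>\<^sub>F n in sequentially. norm (m ?U - (\<Sum>i<n. m (S i))) \<le> measure \<nu> ?U - (\<Sum>i<n. measure \<nu> (S i))"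
    using bound by simp
  then have "(\<lambda>n. m ?U - (\<Sum>i<n. m (S i))) \<longlonglongrightarrow> 0" using z by (rule Lim_null_comparison)
  then have "(\<lambda>n. m ?U - (m ?U - (\<Sum>i<n. m (S i)))) \<longlonglongrightarrow> m ?U - 0" by (intro tendsto_intros)
  then show "(\<lambda>i. m (S i)) sums m ?U" unfolding sums_def by simp
qed

subsection \<open>Jordan decomposition\<close>

text \<open>If \<open>|\<sigma>|\<close> were unbounded, one could peel off infinitely many disjoint pieces each of charge at
  least one in absolute value.\<close>

lemma fvm_bounded:
  fixes \<sigma> :: "'a::euclidean_space set \<Rightarrow> real"
  assumes m: "fvm \<Omega> \<sigma>" and \<Omega>: "\<Omega> \<in> sets borel"
  obtains C where "\<And>S. S \<in> sets borel \<Longrightarrow> S \<subseteq> \<Omega> \<Longrightarrow> \<bar>\<sigma> S\<bar> \<le> C"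
proof -
  define bad where "bad S \<longleftrightarrow> S \<in> sets borel \<and> S \<subseteq> \<Omega> \<and> (\<forall>C. \<exists>T\<in>sets borel. T \<subseteq> S \<and> \<bar>\<sigma> T\<bar> > C)" for S
  have notbad: "\<exists>C. \<forall>A\<in>sets borel. A \<subseteq> X \<longrightarrow> \<bar>\<sigma> A\<bar> \<le> C" if "\<not> bad X" "X \<in> sets borel" "X \<subseteq> \<Omega>" for X
    using that unfolding bad_def by (simp add: not_less)
  have peel: "\<exists>S'. bad S' \<and> S' \<subseteq> S \<and> \<bar>\<sigma> (S - S')\<bar> \<ge> 1" if bS: "bad S" for S
  proof -
    have S: "S \<in> sets borel" "S \<subseteq> \<Omega>" using bS by (auto simp: bad_def)
    \<comment> \<open>With a charge this large, both \<open>T\<close> and \<open>S - T\<close> have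
      charge at least 1 in absolute value; so whichever of the two is bad may be kept and the other
      peeled off.\<close>
    obtain T where T: "T \<in> sets borel" "T \<subseteq> S" "\<bar>\<sigma> T\<bar> > \<bar>\<sigma> S\<bar> + 1" using bS unfolding bad_def by blast
    have d: "\<sigma> (S - T) = \<sigma> S - \<sigma> T" using S T by (intro fvm_Diff[OF m]) auto
    have b1: "\<bar>\<sigma> (S - T)\<bar> \<ge> 1" "\<bar>\<sigma> T\<bar> \<ge> 1" using T(3) d by auto
    have "bad T \<or> bad (S - T)"
    proof (rule ccontr)
      assume "\<not> (bad T \<or> bad (S - T))"
      then obtain C1 C2 where C: "\<And>A. A \<in> sets borel \<Longrightarrow> A \<subseteq> T \<Longrightarrow> \<bar>\<sigma> A\<bar> \<le> C1"
        "\<And>A. A \<in> sets borel \<Longrightarrow> A \<subseteq> S - T \<Longrightarrow> \<bar>\<sigma> A\<bar> \<le> C2"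
        using notbad[of T] notbad[of "S - T"] S T
        by (metis Diff_subset sets.Diff subset_trans)
      obtain A where A: "A \<in> sets borel" "A \<subseteq> S" "\<bar>\<sigma> A\<bar> > C1 + C2" using bS unfolding bad_def by blast
      have "\<sigma> (A \<inter> T \<union> (A - T)) = \<sigma> (A \<inter> T) + \<sigma> (A - T)"
        using A S T by (intro fvm_Un[OF m]) auto
      moreover have "A \<inter> T \<union> (A - T) = A" by auto
      moreover have "\<bar>\<sigma> (A \<inter> T)\<bar> \<le> C1" "\<bar>\<sigma> (A - T)\<bar> \<le> C2" using A T by (auto intro!: C)
      ultimately show False using A(3) by simp
    qed
    then show ?thesis
    proof
      assume "bad T" then show ?thesis using T b1 by (intro exI[of _ T]) auto
    next
      assume "bad (S - T)"
      moreover have "S - (S - T) = T" using T by auto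
      ultimately show ?thesis using b1 by (intro exI[of _ "S - T"]) auto
    qed
  qed
  have "\<not> bad \<Omega>"
  proof
    assume b: "bad \<Omega>"
    have "\<exists>f. \<forall>S. bad S \<longrightarrow> bad (f S) \<and> f S \<subseteq> S \<and> \<bar>\<sigma> (S - f S)\<bar> \<ge> 1"
      by (rule choice) (use peel in blast)
    then obtain f where f: "\<And>S. bad S \<Longrightarrow> bad (f S) \<and> f S \<subseteq> S \<and> \<bar>\<sigma> (S - f S)\<bar> \<ge> 1" by auto
    define E where "E n = (f ^^ n) \<Omega>" for n
    have bE: "bad (E n)" for n by (induction n) (auto simp: E_def b f)
    have E1: "E (Suc n) \<subseteq> E n" "\<bar>\<sigma> (E n - E (Suc n))\<bar> \<ge> 1" for n
      using f[OF bE[of n]] by (auto simp: E_def)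
    have dec: "E n \<subseteq> E k" if "k \<le> n" for k n using E1(1) that by (rule lift_Suc_antimono_le)
    have Eb: "E n \<in> sets borel" "E n \<subseteq> \<Omega>" for n using bE[of n] by (auto simp: bad_def)
    have "disjoint_family (\<lambda>n. E n - E (Suc n))"
      unfolding disjoint_family_on_def
    proof (intro ballI impI)
      fix i j :: nat assume "i \<noteq> j"
      then consider "Suc i \<le> j" | "Suc j \<le> i" by linarith
      then show "(E i - E (Suc i)) \<inter> (E j - E (Suc j)) = {}" using dec by cases blast+
    qed
    then have "(\<lambda>n. \<sigma> (E n - E (Suc n))) sums \<sigma> (\<Union>n. E n - E (Suc n))"
      using Eb by (intro fvmD[OF m]) auto
    then have "(\<lambda>n. \<sigma> (E n - E (Suc n))) \<longlonglongrightarrow> 0" by (intro summable_LIMSEQ_zero) (auto simp: sums_iff)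
    then have "\<forall>\<^sub>F n in sequentially. dist (\<sigma> (E n - E (Suc n))) 0 < 1" by (rule tendstoD) simp
    then have "\<forall>\<^sub>F n in sequentially. \<bar>\<sigma> (E n - E (Suc n))\<bar> < 1" by simp
    then obtain n where "\<bar>\<sigma> (E n - E (Suc n))\<bar> < 1" using eventually_happens by force
    then show False using E1(2)[of n] by simp
  qed
  from notbad[OF this \<Omega>] obtain C where "\<forall>A\<in>sets borel. A \<subseteq> \<Omega> \<longrightarrow> \<bar>\<sigma> A\<bar> \<le> C" by auto
  then show ?thesis by (intro that[of C]) simp
qed

lemma ennreal_add_le: "ennreal (a + b) \<le> ennreal a + ennreal b"
proof (cases "0 \<le> a \<and> 0 \<le> b")
  case False
  then consider "a < 0" | "b < 0" by linarith
  then show ?thesis by cases (auto intro!: ennreal_leI simp: ennreal_neg)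
qed simp

lemma ennreal_sum_le: "finite I \<Longrightarrow> ennreal (\<Sum>i\<in>I. f i) \<le> (\<Sum>i\<in>I. ennreal (f i))"
proof (induction I rule: finite_induct)
  case (insert i I)
  have "ennreal (f i + (\<Sum>i\<in>I. f i)) \<le> ennreal (f i) + ennreal (\<Sum>i\<in>I. f i)" by (rule ennreal_add_le)
  also have "\<dots> \<le> ennreal (f i) + (\<Sum>i\<in>I. ennreal (f i))" using insert by (intro add_left_mono)
  finally show ?case using insert by simp
qed simp

text \<open>\<open>measure_of\<close> takes over the supremum formula only if that formula is
  countably additive. Competitors for disjoint sets join to a competitor for the union, which gives
  superadditivity; cutting a competitor for the union along the pieces gives the reverse
  inequality.\<close>

lemma emeasure_pos_variation:
  fixes \<sigma> :: "'a::euclidean_space set \<Rightarrow> real"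
  assumes m: "fvm \<Omega> \<sigma>" and \<Omega>: "\<Omega> \<in> sets borel" and S: "S \<in> sets borel"
  shows "emeasure (pos_variation \<Omega> \<sigma>) S = (SUP T\<in>{T \<in> sets borel. T \<subseteq> S \<inter> \<Omega>}. ennreal (\<sigma> T))"
proof -
  define D where "D S = {T \<in> sets borel. T \<subseteq> S \<inter> \<Omega>}" for S :: "'a set"
  define p where "p S = (SUP T\<in>D S. ennreal (\<sigma> T))" for S :: "'a set"
  have De: "{} \<in> D S" for S by (auto simp: D_def)
  have pge: "T \<in> D S \<Longrightarrow> ennreal (\<sigma> T) \<le> p S" for T S unfolding p_def by (rule SUP_upper)
  have pmono: "A \<subseteq> B \<Longrightarrow> p A \<le> p B" for A B
    unfolding p_def by (rule SUP_subset_mono) (auto simp: D_def)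
  have super: "p A + p B \<le> p (A \<union> B)" if AB: "A \<inter> B = {}" for A B
  proof -
    have "ennreal (\<sigma> T1) + ennreal (\<sigma> T2) \<le> p (A \<union> B)" if T: "T1 \<in> D A" "T2 \<in> D B" for T1 T2
    \<comment> \<open>A negative charge counts as 0 in \<open>ennreal\<close>, and then the other
      competitor alone is already a competitor for the union.\<close>
    proof (cases "0 \<le> \<sigma> T1 \<and> 0 \<le> \<sigma> T2")
      case True
      then have "ennreal (\<sigma> T1) + ennreal (\<sigma> T2) = ennreal (\<sigma> T1 + \<sigma> T2)" by simp
      also have "\<sigma> T1 + \<sigma> T2 = \<sigma> (T1 \<union> T2)"
        using T AB by (intro fvm_Un[OF m, symmetric]) (auto simp: D_def)
      also have "ennreal \<dots> \<le> p (A \<union> B)" using T by (intro pge) (auto simp: D_def)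
      finally show ?thesis .
    next
      case False
      moreover have "ennreal (\<sigma> T1) \<le> p (A \<union> B)" "ennreal (\<sigma> T2) \<le> p (A \<union> B)"
        using T by (auto intro!: pge simp: D_def)
      moreover have "ennreal (\<sigma> T1) = 0 \<or> ennreal (\<sigma> T2) = 0" using False by (auto simp: ennreal_neg)
      ultimately show ?thesis by auto
    qed
    then have "ennreal (\<sigma> T1) + p B \<le> p (A \<union> B)" if "T1 \<in> D A" for T1
      unfolding p_def[of B] using that De[of B] by (subst ennreal_SUP_add_right) (auto intro!: SUP_least)
    then show ?thesis
      unfolding p_def[of A] using De[of A] by (subst ennreal_SUP_add_left[symmetric]) (auto intro!: SUP_least)
  qed
  have pos: "positive (sets borel) p"
    unfolding positive_def p_def D_def
    by (auto intro!: antisym SUP_least simp: fvm_empty[OF m] le_bot)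
  have ca: "countably_additive (sets borel) p"
    unfolding countably_additive_def
  proof (intro allI impI)
    fix A :: "nat \<Rightarrow> 'a set" assume A: "range A \<subseteq> sets borel" "disjoint_family A" "(\<Union>i. A i) \<in> sets borel"
    have "(\<Sum>i<n. p (A i)) \<le> p (\<Union>i<n. A i)" for n
    proof (induction n)
      case (Suc n)
      have "(\<Sum>i<Suc n. p (A i)) \<le> p (\<Union>i<n. A i) + p (A n)" using Suc by (simp add: add_right_mono)
      also have "\<dots> \<le> p ((\<Union>i<n. A i) \<union> A n)" by (intro super disjoint_family_lessThan[OF A(2)])
      also have "(\<Union>i<n. A i) \<union> A n = (\<Union>i<Suc n. A i)" by (auto simp: less_Suc_eq)
      finally show ?case .
    qed simp
    also have "p (\<Union>i<n. A i) \<le> p (\<Union>i. A i)" for n by (rule pmono) auto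
    finally have le1: "(\<Sum>i. p (A i)) \<le> p (\<Union>i. A i)" by (intro suminf_le_const[OF summableI])
    have le2: "p (\<Union>i. A i) \<le> (\<Sum>i. p (A i))"
      unfolding p_def[of "\<Union>i. A i"]
    proof (rule SUP_least)
      fix T assume T: "T \<in> D (\<Union>i. A i)"
      have "(\<lambda>i. \<sigma> (T \<inter> A i)) sums \<sigma> (\<Union>i. T \<inter> A i)"
        using T A by (intro fvmD[OF m] disjoint_family_subset[OF A(2)]) (auto simp: D_def)
      also have "(\<Union>i. T \<inter> A i) = T" using T by (auto simp: D_def)
      finally have "(\<lambda>n. ennreal (\<Sum>i<n. \<sigma> (T \<inter> A i))) \<longlonglongrightarrow> ennreal (\<sigma> T)"
        unfolding sums_def by (rule tendsto_ennrealI)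
      moreover have "ennreal (\<Sum>i<n. \<sigma> (T \<inter> A i)) \<le> (\<Sum>i. p (A i))" for n
      proof -
        have "ennreal (\<Sum>i<n. \<sigma> (T \<inter> A i)) \<le> (\<Sum>i<n. ennreal (\<sigma> (T \<inter> A i)))" by (rule ennreal_sum_le) simp
        also have "\<dots> \<le> (\<Sum>i<n. p (A i))" using T A by (intro sum_mono pge) (auto simp: D_def)
        also have "\<dots> \<le> (\<Sum>i. p (A i))" by (intro sum_le_suminf summableI) auto
        finally show ?thesis .
      qed
      ultimately show "ennreal (\<sigma> T) \<le> (\<Sum>i. p (A i))" by (intro LIMSEQ_le_const2) auto
    qed
    from le1 le2 show "(\<Sum>i. p (A i)) = p (\<Union>i. A i)" by (rule antisym)
  qed
  have sa: "sigma_algebra UNIV (sets (borel :: 'a measure))"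
    using sets.sigma_algebra_axioms[of "borel :: 'a measure"] by simp
  have "pos_variation \<Omega> \<sigma> = measure_of UNIV (sets borel) p"
    unfolding pos_variation_def p_def D_def ..
  then show ?thesis
    using emeasure_measure_of_sigma[OF sa pos ca S] by (simp add: p_def D_def)
qed

lemma sets_pos_variation [simp, measurable_cong]: "sets (pos_variation \<Omega> \<sigma>) = sets borel"
proof -
  have "sigma_sets UNIV (sets (borel::'a measure)) = sets borel"
    using sets.sigma_sets_eq[of "borel :: 'a measure"] by simp
  then show ?thesis by (simp add: pos_variation_def sets_measure_of)
qed

lemma space_pos_variation [simp]: "space (pos_variation \<Omega> \<sigma>) = UNIV"
  by (simp add: pos_variation_def space_measure_of_conv)

lemma finite_radon_pos_variation:
  fixes \<sigma> :: "'a::euclidean_space set \<Rightarrow> real"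
  assumes m: "fvm \<Omega> \<sigma>" and \<Omega>: "\<Omega> \<in> sets borel"
  shows "finite_radon_on \<Omega> (pos_variation \<Omega> \<sigma>)"
proof -
  obtain C where C: "\<And>S. S \<in> sets borel \<Longrightarrow> S \<subseteq> \<Omega> \<Longrightarrow> \<bar>\<sigma> S\<bar> \<le> C" using fvm_bounded[OF m \<Omega>] by blast
  have "emeasure (pos_variation \<Omega> \<sigma>) UNIV \<le> ennreal C"
    using C by (subst emeasure_pos_variation[OF m \<Omega>]) (auto intro!: SUP_least ennreal_leI simp: abs_le_iff)
  then have "emeasure (pos_variation \<Omega> \<sigma>) UNIV < \<infinity>" by (rule le_less_trans) simp
  then have "finite_measure (pos_variation \<Omega> \<sigma>)" by (intro finite_measureI) auto
  moreover have "emeasure (pos_variation \<Omega> \<sigma>) (- \<Omega>) = 0"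
    using \<Omega> by (subst emeasure_pos_variation[OF m \<Omega>]) (auto simp: fvm_empty[OF m] intro!: antisym SUP_least)
  ultimately show ?thesis by (simp add: finite_radon_on_def)
qed

text \<open>For \<open>T \<subseteq> S\<close>,
  \<open>\<sigma> T = \<sigma> S - \<sigma> (S - T)\<close>, and \<open>- \<sigma> (S - T)\<close>
  is at most the negative variation of \<open>S\<close>. Applied to \<sigma> and to
  \<open>- \<sigma>\<close>, this gives the two halves of the Jordan identity.\<close>

lemma pos_variation_le:
  fixes \<sigma> :: "'a::euclidean_space set \<Rightarrow> real"
  assumes m: "fvm \<Omega> \<sigma>" and \<Omega>: "\<Omega> \<in> sets borel" and S: "S \<in> sets borel" "S \<subseteq> \<Omega>"
  shows "measure (pos_variation \<Omega> \<sigma>) S \<le> \<sigma> S + measure (pos_variation \<Omega> (\<lambda>S. - \<sigma> S)) S"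
proof -
  let ?P = "pos_variation \<Omega> \<sigma>" and ?N = "pos_variation \<Omega> (\<lambda>S. - \<sigma> S)"
  interpret P: finite_measure ?P using finite_radon_pos_variation[OF m \<Omega>] by (simp add: finite_radon_on_def)
  interpret N: finite_measure ?N using finite_radon_pos_variation[OF fvm_uminus[OF m] \<Omega>] by (simp add: finite_radon_on_def)
  have Nge: "- \<sigma> T \<le> measure ?N S" if T: "T \<in> sets borel" "T \<subseteq> S" for T
  proof -
    have "ennreal (- \<sigma> T) \<le> ennreal (measure ?N S)"
      unfolding N.emeasure_eq_measure[symmetric] emeasure_pos_variation[OF fvm_uminus[OF m] \<Omega> S(1)]
      using T S by (intro SUP_upper2[of T]) auto
    then show ?thesis by (simp add: ennreal_le_iff)
  qed
  have nn: "0 \<le> \<sigma> S + measure ?N S" using Nge[of S] S by simp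
  have "ennreal (measure ?P S) \<le> ennreal (\<sigma> S + measure ?N S)"
    unfolding P.emeasure_eq_measure[symmetric] emeasure_pos_variation[OF m \<Omega> S(1)]
  proof (intro SUP_least ennreal_leI)
    fix T assume "T \<in> {T \<in> sets borel. T \<subseteq> S \<inter> \<Omega>}"
    then have T: "T \<in> sets borel" "T \<subseteq> S" by auto
    have "\<sigma> (S - T) = \<sigma> S - \<sigma> T" using S T by (intro fvm_Diff[OF m]) auto
    moreover have "- \<sigma> (S - T) \<le> measure ?N S" using S T by (intro Nge) auto
    ultimately show "\<sigma> T \<le> \<sigma> S + measure ?N S" by simp
  qed
  then show ?thesis using nn by (simp add: ennreal_le_iff)
qed

theorem jordan_decomposition:
  fixes \<sigma> :: "'a::euclidean_space set \<Rightarrow> real"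
  assumes m: "fvm \<Omega> \<sigma>" and \<Omega>: "\<Omega> \<in> sets borel" and S: "S \<in> sets borel" "S \<subseteq> \<Omega>"
  shows "\<sigma> S = measure (pos_variation \<Omega> \<sigma>) S - measure (pos_variation \<Omega> (\<lambda>S. - \<sigma> S)) S"
  using pos_variation_le[OF m \<Omega> S] pos_variation_le[OF fvm_uminus[OF m] \<Omega> S] by simp


section \<open>Integration against signed measures\<close>

lemma finite_radon_onD:
  assumes "finite_radon_on \<Omega> \<mu>"
  shows "sets \<mu> = sets borel" "space \<mu> = UNIV" "finite_measure \<mu>" "emeasure \<mu> (- \<Omega>) = 0"
  using assms sets_eq_imp_space_eq[of \<mu> borel] by (auto simp: finite_radon_on_def)

lemma AE_in_carrier:
  assumes "finite_radon_on \<Omega> \<mu>" "\<Omega> \<in> sets borel" shows "AE x in \<mu>. x \<in> \<Omega>"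
  by (rule AE_I[of _ _ "- \<Omega>"]) (use finite_radon_onD[OF assms(1)] assms(2) in auto)

lemma measure_carrier:
  assumes "finite_radon_on \<Omega> \<mu>" "\<Omega> \<in> sets borel" "S \<in> sets borel" shows "measure \<mu> (S \<inter> \<Omega>) = measure \<mu> S"
  by (rule measure_eq_AE) (use AE_in_carrier[OF assms(1,2)] finite_radon_onD[OF assms(1)] assms in auto)

lemma signed_integral_uminus: "signed_integral \<Omega> (\<lambda>S. - \<sigma> S) f = - signed_integral \<Omega> \<sigma> f"
  by (simp add: signed_integral_def)

lemma signed_integral_zero: "signed_integral \<Omega> (\<lambda>S. 0) f = 0"
  by (simp add: signed_integral_def)

lemma signed_integral_zero_fun: "signed_integral \<Omega> \<sigma> (\<lambda>x. 0) = 0"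
  by (simp add: signed_integral_def)

lemma signed_integral_cong_measure:
  fixes \<sigma> :: "'a::euclidean_space set \<Rightarrow> real"
  assumes eq: "\<And>S. S \<in> sets borel \<Longrightarrow> S \<subseteq> \<Omega> \<Longrightarrow> \<sigma> S = \<tau> S"
  shows "signed_integral \<Omega> \<sigma> f = signed_integral \<Omega> \<tau> f"
proof -
  have "pos_variation \<Omega> \<sigma> = pos_variation \<Omega> \<tau>" if "\<And>S. S \<in> sets borel \<Longrightarrow> S \<subseteq> \<Omega> \<Longrightarrow> \<sigma> S = \<tau> S" for \<sigma> \<tau> :: "'a set \<Rightarrow> real"
  proof -
    have "(SUP T\<in>{T \<in> sets borel. T \<subseteq> S \<inter> \<Omega>}. ennreal (\<sigma> T)) = (SUP T\<in>{T \<in> sets borel. T \<subseteq> S \<inter> \<Omega>}. ennreal (\<tau> T))" for S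
      by (rule SUP_cong) (auto simp: that)
    then show ?thesis unfolding pos_variation_def by presburger
  qed
  from this[of \<sigma> \<tau>] this[of "\<lambda>S. - \<sigma> S" "\<lambda>S. - \<tau> S"] show ?thesis
    unfolding signed_integral_def using eq by simp
qed

lemma signed_integral_indicator:
  fixes \<sigma> :: "'a::euclidean_space set \<Rightarrow> real"
  assumes m: "fvm \<Omega> \<sigma>" and \<Omega>: "\<Omega> \<in> sets borel" and S: "S \<in> sets borel" "S \<subseteq> \<Omega>"
  shows "signed_integral \<Omega> \<sigma> (indicator S) = \<sigma> S"
proof -
  note PN = finite_radon_onD[OF finite_radon_pos_variation[OF m \<Omega>]] finite_radon_onD[OF finite_radon_pos_variation[OF fvm_uminus[OF m] \<Omega>]]
  show ?thesis unfolding signed_integral_def jordan_decomposition[OF m \<Omega> S]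
    using S PN by (simp add: integral_indicator)
qed

text \<open>Both Jordan parts of the upper sections decrease with \<open>t\<close>, and monotone
  functions are Borel.\<close>

lemma measurable_upper_section:
  fixes \<Phi> :: "'a::euclidean_space set \<Rightarrow> real" and f :: "'a \<Rightarrow> real"
  assumes m: "fvm UNIV \<Phi>" and [measurable]: "f \<in> borel_measurable borel" and A: "A \<in> sets borel"
  shows "(\<lambda>t. \<Phi> (A \<inter> {x. t < f x})) \<in> borel_measurable borel"
proof -
  have sec: "A \<inter> {x. t < f x} \<in> sets borel" for t using A by measurable
  have "(\<lambda>t. measure M (A \<inter> {x. t < f x})) \<in> borel_measurable borel" if M: "finite_radon_on UNIV M" for M :: "'a measure"
  proof -
    interpret finite_measure M by (rule finite_radon_onD[OF M])
    have "mono (\<lambda>t. - measure M (A \<inter> {x. t < f x}))"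
    proof (rule monoI)
      fix s t :: real assume "s \<le> t"
      then have "A \<inter> {x. t < f x} \<subseteq> A \<inter> {x. s < f x}" by auto
      then have "measure M (A \<inter> {x. t < f x}) \<le> measure M (A \<inter> {x. s < f x})"
        using sec finite_radon_onD(1)[OF M] by (intro finite_measure_mono) auto
      then show "- measure M (A \<inter> {x. s < f x}) \<le> - measure M (A \<inter> {x. t < f x})" by simp
    qed
    then have "(\<lambda>t. - measure M (A \<inter> {x. t < f x})) \<in> borel_measurable borel" by (rule borel_measurable_mono)
    then have "(\<lambda>t. - (- measure M (A \<inter> {x. t < f x}))) \<in> borel_measurable borel" by (rule borel_measurable_uminus)
    then show ?thesis by simp
  qed
  from borel_measurable_diff[OF this[OF finite_radon_pos_variation[OF m]] this[OF finite_radon_pos_variation[OF fvm_uminus[OF m]]]]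
  show ?thesis
    by (subst jordan_decomposition[OF m _ sec]) auto
qed

subsection \<open>Testing measures against compactly supported functions\<close>

text \<open>The complement of \<open>UNIV\<close> is empty and would have \<open>infdist\<close>
  equal to 0, hence the positive constant in that case.\<close>

definition open_dist :: "'a::euclidean_space set \<Rightarrow> 'a \<Rightarrow> real" where
  "open_dist V x = (if V = UNIV then 1 else infdist x (- V))"

text \<open>The first factor keeps the support away from the complement of \<open>V\<close>, the
  second within radius \<open>k\<close>; together they make it compact in \<open>V\<close>.\<close>

definition open_approx :: "'a::euclidean_space set \<Rightarrow> nat \<Rightarrow> 'a \<Rightarrow> real" where
  "open_approx V k x = max 0 (min 1 (real k * open_dist V x - 1)) * max 0 (min 1 (real k - norm x))"

lemma continuous_open_dist: "continuous_on UNIV (open_dist V)"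
  by (cases "V = UNIV") (auto simp: open_dist_def [abs_def] intro!: continuous_intros)

lemma open_dist_pos: "open V \<Longrightarrow> 0 < open_dist V x \<longleftrightarrow> x \<in> V"
  using in_closed_iff_infdist_zero[of "- V" x] infdist_nonneg[of x "- V"]
  by (auto simp: open_dist_def less_le)

lemma open_approx_bounds: "0 \<le> open_approx V k x" "open_approx V k x \<le> 1"
  unfolding open_approx_def by (auto intro!: mult_nonneg_nonneg mult_le_one)

lemma open_approx_Cc:
  assumes "open V" shows "open_approx V k \<in> Cc V"
proof -
  have cont: "continuous_on UNIV (open_approx V k)"
    unfolding open_approx_def by (intro continuous_intros continuous_open_dist)
  let ?K = "{x. 1 \<le> real k * open_dist V x} \<inter> cball 0 (real k)"
  have "closed {x. 1 \<le> real k * open_dist V x}"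
    by (intro closed_Collect_le continuous_intros continuous_open_dist)
  then have K: "compact ?K" by (intro closed_Int_compact compact_cball)
  have sub: "{x. open_approx V k x \<noteq> 0} \<subseteq> ?K"
    by (auto simp: open_approx_def max_def min_def split: if_splits)
  have KV: "?K \<subseteq> V"
  proof
    fix x assume "x \<in> ?K"
    then have "1 \<le> real k * open_dist V x" by simp
    then have "0 < open_dist V x" using mult_nonneg_nonpos[of "real k" "open_dist V x"] by linarith
    then show "x \<in> V" using open_dist_pos[OF assms] by simp
  qed
  have cl: "closure {x. open_approx V k x \<noteq> 0} \<subseteq> ?K"
    using sub K by (intro closure_minimal compact_imp_closed)
  then have "?K \<inter> closure {x. open_approx V k x \<noteq> 0} = closure {x. open_approx V k x \<noteq> 0}" by (rule Int_absorb1)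
  then have "compact (closure {x. open_approx V k x \<noteq> 0})" using compact_Int_closed[OF K closed_closure] by metis
  then have "compactly_inside {x. open_approx V k x \<noteq> 0} V"
    unfolding compactly_inside_def using cl KV by (auto intro: subset_trans)
  then show ?thesis using cont by (simp add: Cc_def)
qed

lemma open_approx_tendsto:
  assumes "open V" shows "(\<lambda>k. open_approx V k x) \<longlonglongrightarrow> indicator V x"
proof (cases "x \<in> V")
  case False
  then have "open_dist V x \<le> 0" using open_dist_pos[OF assms, of x] by simp
  then have "open_approx V k x = 0" for k
  proof -
    have "real k * open_dist V x \<le> 0" using \<open>open_dist V x \<le> 0\<close> by (intro mult_nonneg_nonpos) auto
    then have "max 0 (min 1 (real k * open_dist V x - 1)) = 0" by simp
    then show ?thesis unfolding open_approx_def by simp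
  qed
  then show ?thesis using False by simp
next
  case True
  then have d: "0 < open_dist V x" using open_dist_pos[OF assms] by simp
  obtain k1 :: nat where k1: "2 / open_dist V x < k1" using reals_Archimedean2 by blast
  obtain k2 :: nat where k2: "norm x + 1 < k2" using reals_Archimedean2 by blast
  have "open_approx V k x = 1" if "k \<ge> max k1 k2" for k
  proof -
    have "2 / open_dist V x < real k" "norm x + 1 < real k" using that k1 k2 by auto
    then have "2 \<le> real k * open_dist V x" "1 \<le> real k - norm x" using d by (auto simp: field_simps)
    then show ?thesis by (simp add: open_approx_def)
  qed
  then have "\<forall>\<^sub>F k in sequentially. open_approx V k x = 1"
    unfolding eventually_sequentially by (intro exI[of _ "max k1 k2"]) simp
  then show ?thesis using True by (simp add: tendsto_eventually)
qed

lemma Cc_mono: "V \<subseteq> \<Omega> \<Longrightarrow> \<psi> \<in> Cc V \<Longrightarrow> \<psi> \<in> Cc \<Omega>"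
  by (auto simp: Cc_def compactly_inside_def)

lemma Cc_integrable:
  assumes "\<psi> \<in> Cc V" "sets \<nu> = sets borel" "finite_measure \<nu>" shows "integrable \<nu> \<psi>"
proof -
  interpret finite_measure \<nu> by fact
  obtain B where "B > 0" "\<And>x. \<bar>\<psi> x\<bar> \<le> B" using Cc_bounded[OF assms(1)] by blast
  then show ?thesis using Cc_measurable[OF assms(1)] assms(2)
    by (intro integrable_const_bound[where B=B]) (auto simp: measurable_cong_sets[OF assms(2) refl])
qed

lemma integral_open_approx:
  assumes "open V" "sets \<nu> = sets borel" "finite_measure \<nu>"
  shows "(\<lambda>k. LINT x|\<nu>. open_approx V k x) \<longlonglongrightarrow> measure \<nu> V"
proof -
  interpret finite_measure \<nu> by fact
  have [measurable_cong]: "sets \<nu> = sets borel" by fact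
  have [measurable]: "open_approx V k \<in> borel_measurable borel" for k
    by (rule Cc_measurable[OF open_approx_Cc[OF assms(1)]])
  have [measurable]: "V \<in> sets borel" using assms by auto
  have "(\<lambda>k. LINT x|\<nu>. open_approx V k x) \<longlonglongrightarrow> (LINT x|\<nu>. indicator V x)"
  proof (rule integral_dominated_convergence[where w="\<lambda>_. 1"])
    show "AE x in \<nu>. (\<lambda>k. open_approx V k x) \<longlonglongrightarrow> indicator V x" using open_approx_tendsto[OF assms(1)] by simp
    show "AE x in \<nu>. norm (open_approx V k x) \<le> 1" for k by (simp add: open_approx_bounds)
  qed auto
  also have "(LINT x|\<nu>. indicator V x) = measure \<nu> V"
    using sets_eq_imp_space_eq[OF assms(2)] by simp
  finally show ?thesis .
qed

lemma open_measure_leI: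
  assumes "open V" "sets \<nu> = sets borel" "finite_measure \<nu>"
    and "\<And>\<psi>. \<psi> \<in> Cc V \<Longrightarrow> (\<And>x. 0 \<le> \<psi> x \<and> \<psi> x \<le> 1) \<Longrightarrow> (LINT x|\<nu>. \<psi> x) \<le> c"
  shows "measure \<nu> V \<le> c"
proof (rule LIMSEQ_le_const2[OF integral_open_approx[OF assms(1-3)]])
  have "(LINT x|\<nu>. open_approx V k x) \<le> c" for k
    using open_approx_bounds[of V k] by (intro assms(4) open_approx_Cc[OF assms(1)]) auto
  then show "\<exists>N. \<forall>k\<ge>N. (LINT x|\<nu>. open_approx V k x) \<le> c" by simp
qed

text \<open>Cutoffs increasing to indicators settle open subsets of \<open>W\<close>; outer
  regularity of \<beta> passes to Borel sets. The approximating open sets are intersected with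
  \<open>W\<close> so that their cutoffs belong to \<open>Cc W\<close>.\<close>

lemma measure_le_of_integrals_le:
  fixes \<alpha> \<beta> :: "'a::euclidean_space measure"
  assumes W: "open W" and a: "sets \<alpha> = sets borel" "finite_measure \<alpha>" and b: "sets \<beta> = sets borel" "finite_measure \<beta>"
    and le: "\<And>\<psi>. \<psi> \<in> Cc W \<Longrightarrow> (\<And>x. 0 \<le> \<psi> x \<and> \<psi> x \<le> 1) \<Longrightarrow> (LINT x|\<alpha>. \<psi> x) \<le> (LINT x|\<beta>. \<psi> x)"
    and S: "S \<in> sets borel" "S \<subseteq> W"
  shows "measure \<alpha> S \<le> measure \<beta> S"
proof -
  interpret A: finite_measure \<alpha> by fact
  interpret B: finite_measure \<beta> by fact
  have op: "measure \<alpha> V \<le> measure \<beta> V" if V: "open V" "V \<subseteq> W" for V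
  proof (rule LIMSEQ_le[OF integral_open_approx[OF V(1) a] integral_open_approx[OF V(1) b]])
    have "(LINT x|\<alpha>. open_approx V k x) \<le> (LINT x|\<beta>. open_approx V k x)" for k
      using open_approx_bounds[of V k] by (intro le Cc_mono[OF V(2) open_approx_Cc[OF V(1)]]) auto
    then show "\<exists>N. \<forall>k\<ge>N. (LINT x|\<alpha>. open_approx V k x) \<le> (LINT x|\<beta>. open_approx V k x)" by blast
  qed
  have "emeasure \<alpha> S \<le> (INF U\<in>{U. S \<subseteq> U \<and> open U}. emeasure \<beta> U)"
  proof (rule INF_greatest)
    fix U assume "U \<in> {U. S \<subseteq> U \<and> open U}"
    then have U: "S \<subseteq> U \<inter> W" "open (U \<inter> W)" using S W by auto
    have "measure \<alpha> S \<le> measure \<alpha> (U \<inter> W)" using U S a by (intro A.finite_measure_mono) auto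
    also have "\<dots> \<le> measure \<beta> (U \<inter> W)" using U by (intro op) auto
    also have "\<dots> \<le> measure \<beta> U" using \<open>U \<in> _\<close> b by (intro B.finite_measure_mono) auto
    finally show "emeasure \<alpha> S \<le> emeasure \<beta> U" by (simp add: A.emeasure_eq_measure B.emeasure_eq_measure)
  qed
  also have "\<dots> = emeasure \<beta> S"
    by (rule outer_regular[symmetric]) (use b S B.emeasure_finite in auto)
  finally show ?thesis by (simp add: A.emeasure_eq_measure B.emeasure_eq_measure)
qed

subsection \<open>Boxes with corners on a dense grid\<close>

text \<open>Prescribing countably many admissible values per coordinate later forces all faces onto
  good levels, while the boxes still generate the Borel sets when these values are dense.\<close>

definition grid_box :: "('n::finite \<Rightarrow> real set) \<Rightarrow> real^'n \<Rightarrow> real^'n \<Rightarrow> bool" where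
  "grid_box D a b \<longleftrightarrow> (\<forall>i. a $ i \<in> D i \<and> b $ i \<in> D i)"

lemma mem_box_vec: "x \<in> box a b \<longleftrightarrow> (\<forall>i. a $ i < x $ i \<and> x $ i < b $ i)" for x :: "real^'n::finite"
  by (auto simp: mem_box_cart)

lemma mem_cbox_vec: "x \<in> cbox a b \<longleftrightarrow> (\<forall>i. a $ i \<le> x $ i \<and> x $ i \<le> b $ i)" for x :: "real^'n::finite"
  by (auto simp: mem_box_cart)

lemma box_Int_vec:
  fixes a b c d :: "real^'n::finite"
  shows "box a b \<inter> box c d = box (\<chi> i. max (a $ i) (c $ i)) (\<chi> i. min (b $ i) (d $ i))"
  by (auto simp: mem_box_vec)

lemma grid_box_exists:
  fixes x :: "real^'n::finite"
  assumes dense: "\<And>i s t. s < t \<Longrightarrow> \<exists>d\<in>D i. s < d \<and> d < t" and \<Omega>: "open \<Omega>" "x \<in> \<Omega>"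
  obtains a b where "grid_box D a b" "x \<in> box a b" "cbox a b \<subseteq> \<Omega>"
proof -
  obtain e where e: "e > 0" "cball x e \<subseteq> \<Omega>" using \<Omega> open_contains_cball by blast
  \<comment> \<open>If all coordinates differ by at most \<open>r\<close>, then the sum norm, and
    with it the Euclidean norm, is at most \<open>e\<close>.\<close>
  define r where "r = e / CARD('n)"
  have r: "r > 0" using e by (simp add: r_def)
  have "\<forall>i. \<exists>d\<in>D i. x $ i - r < d \<and> d < x $ i" "\<forall>i. \<exists>d\<in>D i. x $ i < d \<and> d < x $ i + r"
    using dense r by simp_all
  then obtain p q where p: "\<And>i. p i \<in> D i \<and> x $ i - r < p i \<and> p i < x $ i" and q: "\<And>i. q i \<in> D i \<and> x $ i < q i \<and> q i < x $ i + r"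
    by metis
  show ?thesis
  proof (rule that[of "vec_lambda p" "vec_lambda q"])
    show "grid_box D (vec_lambda p) (vec_lambda q)" using p q by (simp add: grid_box_def)
    show "x \<in> box (vec_lambda p) (vec_lambda q)" using p q by (simp add: mem_box_vec)
    show "cbox (vec_lambda p) (vec_lambda q) \<subseteq> \<Omega>"
    proof
      fix y assume "y \<in> cbox (vec_lambda p) (vec_lambda q)"
      then have y: "p i \<le> y $ i \<and> y $ i \<le> q i" for i by (simp add: mem_cbox_vec)
      have "\<bar>(x - y) $ i\<bar> \<le> r" for i using y[of i] p[of i] q[of i] by auto
      then have "(\<Sum>i\<in>UNIV. \<bar>(x - y) $ i\<bar>) \<le> (\<Sum>i\<in>(UNIV::'n set). r)" by (intro sum_mono)
      then have "norm (x - y) \<le> e" using norm_le_l1_cart[of "x - y"] by (simp add: r_def)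
      then show "y \<in> \<Omega>" using e by (auto simp: dist_norm)
    qed
  qed
qed

lemma countable_grid:
  fixes D :: "'n::finite \<Rightarrow> real set"
  assumes "\<And>i. countable (D i)" shows "countable {a::real^'n. \<forall>i. a $ i \<in> D i}"
proof -
  have "countable (PiE UNIV D)" using assms by (intro countable_PiE) auto
  moreover have "{a::real^'n. \<forall>i. a $ i \<in> D i} \<subseteq> vec_lambda ` PiE UNIV D"
  proof
    fix a :: "real^'n" assume "a \<in> {a. \<forall>i. a $ i \<in> D i}"
    then show "a \<in> vec_lambda ` PiE UNIV D" by (intro image_eqI[of _ _ "\<lambda>i. a $ i"]) auto
  qed
  ultimately show ?thesis by (rule countable_subset[OF _ countable_image, rotated])
qed

lemma grid_boxes_enum:
  fixes \<Omega> :: "(real^'n::finite) set"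
  assumes dense: "\<And>i s t. s < t \<Longrightarrow> \<exists>d\<in>D i. s < d \<and> d < t" and D: "\<And>i. countable (D i)" and \<Omega>: "open \<Omega>" "\<Omega> \<noteq> {}"
  shows "\<exists>A B :: nat \<Rightarrow> real^'n. (\<forall>k. grid_box D (A k) (B k)) \<and> (\<forall>k. cbox (A k) (B k) \<subseteq> \<Omega>) \<and> (\<Union>k. box (A k) (B k)) = \<Omega>"
proof -
  define Q where "Q = {(a, b). grid_box D a b \<and> cbox a b \<subseteq> \<Omega>}"
  have "Q \<subseteq> {a. \<forall>i. a $ i \<in> D i} \<times> {a. \<forall>i. a $ i \<in> D i}" by (auto simp: Q_def grid_box_def)
  then have cQ: "countable Q"
    by (rule countable_subset) (intro countable_SIGMA countable_grid D)
  have ex: "\<exists>p\<in>Q. x \<in> box (fst p) (snd p)" if x: "x \<in> \<Omega>" for x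
  proof -
    obtain a b where "grid_box D a b" "x \<in> box a b" "cbox a b \<subseteq> \<Omega>"
      by (rule grid_box_exists[where D=D, OF dense \<Omega>(1) x])
    then show ?thesis by (intro bexI[of _ "(a, b)"]) (auto simp: Q_def)
  qed
  then have "Q \<noteq> {}" using \<Omega>(2) by blast
  then have r: "range (from_nat_into Q) = Q" using cQ by (rule range_from_nat_into)
  have inQ: "from_nat_into Q k \<in> Q" for k using \<open>Q \<noteq> {}\<close> by (rule from_nat_into)
  show ?thesis
  proof (rule exI[of _ "\<lambda>k. fst (from_nat_into Q k)"], rule exI[of _ "\<lambda>k. snd (from_nat_into Q k)"], intro conjI allI)
    show g: "grid_box D (fst (from_nat_into Q k)) (snd (from_nat_into Q k))" for k using inQ[of k] by (auto simp: Q_def)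
    show c: "cbox (fst (from_nat_into Q k)) (snd (from_nat_into Q k)) \<subseteq> \<Omega>" for k using inQ[of k] by (auto simp: Q_def)
    show "(\<Union>k. box (fst (from_nat_into Q k)) (snd (from_nat_into Q k))) = \<Omega>"
    proof (intro equalityI UN_least subsetI)
      show "x \<in> \<Omega>" if "x \<in> box (fst (from_nat_into Q k)) (snd (from_nat_into Q k))" for x k
        using that c[of k] box_subset_cbox by blast
      fix x assume "x \<in> \<Omega>"
      then obtain p where "p \<in> Q" "x \<in> box (fst p) (snd p)" using ex by blast
      then have "p \<in> range (from_nat_into Q)" using r by simp
      then obtain k where "p = from_nat_into Q k" by (rule rangeE)
      then show "x \<in> (\<Union>k. box (fst (from_nat_into Q k)) (snd (from_nat_into Q k)))" using \<open>x \<in> box (fst p) (snd p)\<close> by auto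
    qed
  qed
qed

lemma sigma_sets_grid_boxes:
  assumes dense: "\<And>i s t. s < t \<Longrightarrow> \<exists>d\<in>D i. s < d \<and> d < t" and D: "\<And>i::'n::finite. countable (D i)"
  shows "sigma_sets UNIV {box a b | a b. grid_box D a b} = sets (borel :: (real^'n) measure)"
proof (rule antisym)
  let ?G = "{box a b | a b. grid_box D a b}"
  have "?G \<subseteq> sets borel" by auto
  then show "sigma_sets UNIV ?G \<subseteq> sets borel"
    using sets.sigma_sets_subset[of ?G "borel :: (real^'n) measure"] by simp
  have "U \<in> sigma_sets UNIV ?G" if U: "open U" for U :: "(real^'n) set"
  proof (cases "U = {}")
    case False
    obtain A B where AB: "\<And>k::nat. grid_box D (A k) (B k)" "\<And>k. cbox (A k) (B k) \<subseteq> U" "(\<Union>k. box (A k) (B k)) = U"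
      using grid_boxes_enum[where D=D, OF dense D U False] by auto
    have "(\<Union>k. box (A k) (B k)) \<in> sigma_sets UNIV ?G"
      using AB(1) by (intro sigma_sets.Union sigma_sets.Basic) auto
    then show ?thesis using AB(3) by simp
  qed (simp add: sigma_sets.Empty)
  then have "sigma_sets UNIV {U. open U} \<subseteq> sigma_sets UNIV ?G" by (intro sigma_sets_mono) auto
  then show "sets borel \<subseteq> sigma_sets UNIV ?G" by (simp add: borel_def)
qed

text \<open>The open set \<open>\<Omega>\<close> itself need not have the property to begin with.\<close>

lemma borel_box_induct:
  fixes \<Omega> :: "(real^'n::finite) set"
  assumes dense: "\<And>i s t. s < t \<Longrightarrow> \<exists>d\<in>D i. s < d \<and> d < t" and D: "\<And>i. countable (D i)" and \<Omega>: "open \<Omega>"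
    and empty: "P {}"
    and box: "\<And>a b. grid_box D a b \<Longrightarrow> cbox a b \<subseteq> \<Omega> \<Longrightarrow> box a b \<noteq> {} \<Longrightarrow> P (box a b)"
    and diff: "\<And>A B. A \<in> sets borel \<Longrightarrow> B \<in> sets borel \<Longrightarrow> A \<subseteq> B \<Longrightarrow> B \<subseteq> \<Omega> \<Longrightarrow> P A \<Longrightarrow> P B \<Longrightarrow> P (B - A)"
    and union: "\<And>A :: nat \<Rightarrow> _. (\<And>i. A i \<in> sets borel) \<Longrightarrow> (\<And>i. A i \<subseteq> \<Omega>) \<Longrightarrow> disjoint_family A \<Longrightarrow> (\<And>i. P (A i)) \<Longrightarrow> P (\<Union>i. A i)"
    and S: "S \<in> sets borel" "S \<subseteq> \<Omega>"
  shows "P S"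
proof (cases "\<Omega> = {}")
  case True then show ?thesis using S empty by simp
next
  case False
  let ?G = "{box a b | a b. grid_box D a b}"
  have sG: "sigma_sets UNIV ?G = sets borel" by (rule sigma_sets_grid_boxes[OF dense D])
  have IG: "Int_stable ?G"
  proof (rule Int_stableI)
    fix X Y assume "X \<in> ?G" "Y \<in> ?G"
    then obtain a b c d where "X = box a b" "Y = box c d" "grid_box D a b" "grid_box D c d" by auto
    then have "X \<inter> Y = box (\<chi> i. max (a $ i) (c $ i)) (\<chi> i. min (b $ i) (d $ i))"
      "grid_box D (\<chi> i. max (a $ i) (c $ i)) (\<chi> i. min (b $ i) (d $ i))"
      by (simp_all add: box_Int_vec grid_box_def max_def min_def)
    then show "X \<inter> Y \<in> ?G" by blast
  qed
  have gP: "?G \<subseteq> Pow UNIV" by simp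
  \<comment> \<open>Inside a fixed box, complements are relative to that box, for which the property
    is known; complements relative to \<Omega> would presuppose it for \<Omega>.\<close>
  have loc: "P (X \<inter> box c d)" if X: "X \<in> sets borel" and cd: "grid_box D c d" "cbox c d \<subseteq> \<Omega>" for X c d
  proof (cases "box c d = {}")
    case True then show ?thesis using empty by simp
  next
    case False
    have Pcd: "P (box c d)" using cd False by (rule box)
    have bs: "box c d \<subseteq> \<Omega>" using cd box_subset_cbox by blast
    have "X \<in> sigma_sets UNIV ?G" using X sG by simp
    from IG gP this show ?thesis
    proof (induction rule: sigma_sets_induct_disjoint)
      case (basic Y)
      then obtain a b where ab: "Y = box a b" "grid_box D a b" by auto
      let ?a = "\<chi> i. max (a $ i) (c $ i)" and ?b = "\<chi> i. min (b $ i) (d $ i)"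
      have e: "Y \<inter> box c d = box ?a ?b" unfolding ab(1) by (rule box_Int_vec)
      show ?case
      proof (cases "box ?a ?b = {}")
        case True then show ?thesis using e empty by simp
      next
        case nonempty: False
        have "grid_box D ?a ?b" using ab(2) cd(1) by (auto simp: grid_box_def max_def min_def)
        moreover have "cbox ?a ?b \<subseteq> \<Omega>" using cd(2) by (auto simp: mem_cbox_vec subset_iff)
        ultimately show ?thesis unfolding e using nonempty by (rule box)
      qed
    next
      case empty then show ?case using \<open>P {}\<close> by simp
    next
      case (compl A)
      have "(UNIV - A) \<inter> box c d = box c d - A \<inter> box c d" by auto
      moreover have "P (box c d - A \<inter> box c d)" using compl sG bs Pcd by (intro diff) auto
      ultimately show ?case by simp
    next
      case (union A)
      have "P (\<Union>i. A i \<inter> box c d)"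
      proof (rule assms(7))
        show "A i \<inter> box c d \<in> sets borel" for i using union(2) sG by auto
        show "disjoint_family (\<lambda>i. A i \<inter> box c d)" using union(1) by (rule disjoint_family_subset) auto
      qed (use union bs in auto)
      then show ?case by (simp add: Int_UN_distrib2)
    qed
  qed
  obtain A B where AB: "\<And>k::nat. grid_box D (A k) (B k)" "\<And>k. cbox (A k) (B k) \<subseteq> \<Omega>" "(\<Union>k. box (A k) (B k)) = \<Omega>"
    using grid_boxes_enum[where D=D, OF dense D \<Omega> False] by auto
  \<comment> \<open>Countably many grid boxes fill \<Omega>. Made disjoint, they cut
    \<open>S\<close> into pieces to which \<open>loc\<close> applies.\<close>
  define C where "C k = box (A k) (B k)" for k
  have "P (S \<inter> disjointed C k)" for k
  proof -
    have "P ((S \<inter> disjointed C k) \<inter> box (A k) (B k))"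
      by (rule loc) (use S AB in \<open>auto simp: disjointed_def C_def\<close>)
    moreover have "(S \<inter> disjointed C k) \<inter> box (A k) (B k) = S \<inter> disjointed C k" using disjointed_subset[of C k] by (auto simp: C_def)
    ultimately show ?thesis by simp
  qed
  then have "P (\<Union>k. S \<inter> disjointed C k)"
    using S by (intro union disjoint_family_subset[OF disjoint_family_disjointed[of C]]) (auto simp: disjointed_def C_def)
  moreover have "(\<Union>k. S \<inter> disjointed C k) = S"
  proof -
    have "(\<Union>k. disjointed C k) = \<Omega>" using UN_disjointed_eq[of C] AB(3) by (simp add: C_def)
    then show ?thesis using S(2) by blast
  qed
  ultimately show ?thesis by simp
qed

lemma rats_dense: "s < t \<Longrightarrow> \<exists>d\<in>\<rat>. s < d \<and> d < t" for s t :: real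
  using Rats_dense_in_real by blast

lemma fvm_eq_on_boxes:
  fixes m1 m2 :: "(real^'n::finite) set \<Rightarrow> 'b::euclidean_space"
  assumes m: "fvm \<Omega> m1" "fvm \<Omega> m2" and \<Omega>: "open \<Omega>"
    and eq: "\<And>a b. cbox a b \<subseteq> \<Omega> \<Longrightarrow> box a b \<noteq> {} \<Longrightarrow> m1 (box a b) = m2 (box a b)"
    and S: "S \<in> sets borel" "S \<subseteq> \<Omega>"
  shows "m1 S = m2 S"
proof (rule borel_box_induct[where D="\<lambda>_. \<rat>" and \<Omega>=\<Omega> and P="\<lambda>S. m1 S = m2 S", OF rats_dense countable_rat \<Omega> _ _ _ _ S])
  show "m1 {} = m2 {}" using fvm_empty[OF m(1)] fvm_empty[OF m(2)] by simp
  show "m1 (B - A) = m2 (B - A)" if "A \<in> sets borel" "B \<in> sets borel" "A \<subseteq> B" "B \<subseteq> \<Omega>" "m1 A = m2 A" "m1 B = m2 B" for A B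
    using fvm_Diff[OF m(1) that(1-4)] fvm_Diff[OF m(2) that(1-4)] that by simp
  show "m1 (\<Union>i. A i) = m2 (\<Union>i. A i)" if "\<And>i. A i \<in> sets borel" "\<And>i. A i \<subseteq> \<Omega>" "disjoint_family A" "\<And>i. m1 (A i) = m2 (A i)" for A :: "nat \<Rightarrow> _"
    using fvmD[OF m(1) that(1-3)] fvmD[OF m(2) that(1-3)] that(4) by (simp add: sums_iff)
qed (use eq in auto)


subsection \<open>Smooth approximations of boxes\<close>

text \<open>With \<open>u = 1 / s\<close>, differentiating \<open>p u * exp (- u)\<close> in
  \<open>s\<close> gives \<open>u ^ 2 * (p u - p' u) * exp (- u)\<close>; this is the
  recursion.\<close>

fun exp_poly :: "nat \<Rightarrow> real poly" where
  "exp_poly 0 = 1"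
| "exp_poly (Suc k) = monom 1 2 * (exp_poly k - pderiv (exp_poly k))"

text \<open>The \<open>k\<close>-th derivative of \<open>exp (-1/s)\<close>, extended by zero to \<open>s \<le> 0\<close>.\<close>

definition flat_exp :: "nat \<Rightarrow> real \<Rightarrow> real" where
  "flat_exp k s = (if 0 < s then poly (exp_poly k) (1 / s) * exp (- 1 / s) else 0)"

lemma poly_exp_tendsto_0: "((\<lambda>u. poly p u * exp (- u)) \<longlongrightarrow> 0) at_top" for p :: "real poly"
proof -
  have "((\<lambda>u. \<Sum>i\<le>degree p. coeff p i * (u ^ i / exp u)) \<longlongrightarrow> (\<Sum>i\<le>degree p. coeff p i * 0)) at_top"
    by (intro tendsto_sum tendsto_mult tendsto_const tendsto_power_div_exp_0)
  moreover have "(\<Sum>i\<le>degree p. coeff p i * (u ^ i / exp u)) = poly p u * exp (- u)" for u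
    by (simp add: poly_altdef sum_distrib_right exp_minus divide_inverse mult.assoc)
  ultimately show ?thesis by simp
qed

lemma flat_exp_deriv: "(flat_exp k has_real_derivative flat_exp (Suc k) s) (at s)"
proof -
  consider "s > 0" | "s < 0" | "s = 0" by linarith
  then show ?thesis
  proof cases
    case 1
    have "((\<lambda>s. poly (exp_poly k) (1 / s) * exp (- 1 / s)) has_real_derivative flat_exp (Suc k) s) (at s)"
    proof -
      have d: "((\<lambda>s. 1 / s) has_real_derivative - (1 / s^2)) (at s)"
        using 1 by (auto intro!: derivative_eq_intros simp: power2_eq_square)
      have e: "((\<lambda>s. - 1 / s) has_real_derivative 1 / s^2) (at s)"
        using 1 by (auto intro!: derivative_eq_intros simp: power2_eq_square)
      have "((\<lambda>s. poly (exp_poly k) (1 / s)) has_real_derivative poly (pderiv (exp_poly k)) (1 / s) * - (1 / s^2)) (at s)"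
        by (rule DERIV_chain2[OF poly_DERIV d])
      from DERIV_mult[OF this DERIV_chain2[OF DERIV_exp e]]
      show ?thesis using 1 by (simp add: flat_exp_def poly_monom algebra_simps power_divide)
    qed
    then show ?thesis
      by (rule has_field_derivative_transform_within_open[of _ _ _ "{0<..}"]) (use 1 in \<open>auto simp: flat_exp_def\<close>)
  next
    case 2
    have "((\<lambda>_. 0) has_real_derivative flat_exp (Suc k) s) (at s)" using 2 by (simp add: flat_exp_def)
    then show ?thesis
      by (rule has_field_derivative_transform_within_open[of _ _ _ "{..<0}"]) (use 2 in \<open>auto simp: flat_exp_def\<close>)
  next
    case 3
    have "((\<lambda>h. (flat_exp k (0 + h) - flat_exp k 0) / h) \<longlongrightarrow> 0) (at 0)"
      unfolding filterlim_at_split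
    proof
      have "((\<lambda>h. 0) \<longlongrightarrow> (0::real)) (at_left 0)" by simp
      then show "((\<lambda>h. (flat_exp k (0 + h) - flat_exp k 0) / h) \<longlongrightarrow> 0) (at_left 0)"
        by (rule Lim_transform_eventually) (auto simp: eventually_at_left_field flat_exp_def intro!: exI[of _ "-1"])
      \<comment> \<open>In terms of \<open>u = inverse h\<close> the difference quotient at 0 is
        \<open>u * p u * exp (- u)\<close>, and \<open>u\<close> tends to infinity.\<close>
      have "((\<lambda>h. poly ([:0, 1:] * exp_poly k) (inverse h) * exp (- inverse h)) \<longlongrightarrow> 0) (at_right (0::real))"
        by (rule filterlim_compose[OF poly_exp_tendsto_0 filterlim_inverse_at_top_right])
      then show "((\<lambda>h. (flat_exp k (0 + h) - flat_exp k 0) / h) \<longlongrightarrow> 0) (at_right 0)"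
        by (rule Lim_transform_eventually)
           (auto simp: eventually_at_right_field flat_exp_def divide_inverse intro!: exI[of _ 1])
    qed
    then show ?thesis using 3 by (simp add: DERIV_def flat_exp_def)
  qed
qed

lemma flat_exp_0: "flat_exp 0 s = (if 0 < s then exp (- 1 / s) else 0)"
  by (simp add: flat_exp_def)

text \<open>Counting orders of differentiability permits inductions on \<open>k\<close> for sums and
  products; the lists of directions in \<open>smooth\<close> do not decompose as
  conveniently.\<close>

primrec times_diff :: "nat \<Rightarrow> (real^'n::finite \<Rightarrow> real) \<Rightarrow> bool" where
  "times_diff 0 f \<longleftrightarrow> (\<forall>x. f differentiable (at x))"
| "times_diff (Suc k) f \<longleftrightarrow> (\<forall>x. f differentiable (at x)) \<and> (\<forall>j. times_diff k (partial j f))"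

lemma times_diff_differentiable: "times_diff k f \<Longrightarrow> f differentiable (at x)"
  by (cases k) auto

lemma times_diff_Suc: "times_diff (Suc k) f \<Longrightarrow> times_diff k f"
  by (induction k arbitrary: f) auto

lemma smoothI:
  fixes f :: "real^'n::finite \<Rightarrow> real"
  assumes "\<And>k. times_diff k f" shows "smooth f"
proof -
  have "times_diff (length js) f \<Longrightarrow> times_diff 0 (foldr partial js f)" for js :: "'n list"
  \<comment> \<open>\<open>foldr\<close> differentiates first in the direction of the last list
    entry, hence induction from the right.\<close>
  proof (induction js arbitrary: f rule: rev_induct)
    case (snoc j js) then show ?case by simp
  qed simp
  then show ?thesis using assms unfolding smooth_def by (meson times_diff_differentiable)
qed

lemma partial_eq: "(f has_derivative f') (at x) \<Longrightarrow> partial j f x = f' (axis j 1)"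
  unfolding partial_def using frechet_derivative_at by metis

lemma times_diff_const: "times_diff k (\<lambda>x. c)"
proof (induction k arbitrary: c)
  case (Suc k)
  have "partial j (\<lambda>x. c) = (\<lambda>x. 0)" for j :: 'a
    using partial_eq[OF has_derivative_const] by (intro ext)
  then show ?case using Suc by simp
qed simp

lemma partial_add:
  assumes "f differentiable (at x)" "g differentiable (at x)"
  shows "partial j (\<lambda>x. f x + g x) x = partial j f x + partial j g x"
  using partial_eq[OF has_derivative_add[OF assms[THEN frechet_derivative_works[THEN iffD1]]]]
  by (simp only: partial_def)

lemma partial_mult:
  assumes "f differentiable (at x)" "g differentiable (at x)"
  shows "partial j (\<lambda>x. f x * g x) x = f x * partial j g x + partial j f x * g x"
  using partial_eq[OF has_derivative_mult[OF assms[THEN frechet_derivative_works[THEN iffD1]]]]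
  by (simp only: partial_def)

lemma times_diff_add: "times_diff k f \<Longrightarrow> times_diff k g \<Longrightarrow> times_diff k (\<lambda>x. f x + g x)"
proof (induction k arbitrary: f g)
  case (Suc k)
  then have "partial j (\<lambda>x. f x + g x) = (\<lambda>x. partial j f x + partial j g x)" for j
    by (intro ext partial_add) auto
  then show ?case using Suc by simp
qed simp

lemma times_diff_mult: "times_diff k f \<Longrightarrow> times_diff k g \<Longrightarrow> times_diff k (\<lambda>x. f x * g x)"
proof (induction k arbitrary: f g)
  case (Suc k)
  then have "partial j (\<lambda>x. f x * g x) = (\<lambda>x. f x * partial j g x + partial j f x * g x)" for j
    by (intro ext partial_mult) auto
  moreover have "times_diff k (\<lambda>x. f x * partial j g x + partial j f x * g x)" for j
    using Suc times_diff_Suc[of k f] times_diff_Suc[of k g] by (intro times_diff_add Suc.IH) auto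
  ultimately show ?case using Suc by simp
qed simp

lemma times_diff_prod: "finite I \<Longrightarrow> (\<And>i. i \<in> I \<Longrightarrow> times_diff k (f i)) \<Longrightarrow> times_diff k (\<lambda>x. \<Prod>i\<in>I. f i x)"
  by (induction I rule: finite_induct) (auto intro: times_diff_const times_diff_mult)

lemma times_diff_flat_exp: "times_diff k (\<lambda>x::real^'n::finite. flat_exp m (c * (x $ i) + d))"
proof (induction k arbitrary: m)
  case 0
  have "((\<lambda>x::real^'n. flat_exp m (c * (x $ i) + d)) has_derivative (\<lambda>h. (c * (h $ i)) * flat_exp (Suc m) (c * (x $ i) + d))) (at x)" for x
    by (rule has_derivative_compose[OF _ flat_exp_deriv[unfolded has_field_derivative_def], THEN has_derivative_eq_rhs])
       (auto intro!: derivative_eq_intros bounded_linear.has_derivative[OF bounded_linear_vec_nth])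
  then show ?case by (auto simp: differentiable_def)
next
  case (Suc k)
  have d: "((\<lambda>x::real^'n. flat_exp m (c * (x $ i) + d)) has_derivative (\<lambda>h. (c * (h $ i)) * flat_exp (Suc m) (c * (x $ i) + d))) (at x)" for x
    by (rule has_derivative_compose[OF _ flat_exp_deriv[unfolded has_field_derivative_def], THEN has_derivative_eq_rhs])
       (auto intro!: derivative_eq_intros bounded_linear.has_derivative[OF bounded_linear_vec_nth])
  have "partial j (\<lambda>x::real^'n. flat_exp m (c * (x $ i) + d)) = (\<lambda>x. (c * (axis j 1 $ i)) * flat_exp (Suc m) (c * (x $ i) + d))" for j
    using partial_eq[OF d] by (intro ext)
  moreover have "times_diff k (\<lambda>x::real^'n. (c * (axis j 1 $ i)) * flat_exp (Suc m) (c * (x $ i) + d))" for j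
    by (intro times_diff_mult times_diff_const Suc.IH)
  ultimately show ?case using d by (auto simp: differentiable_def)
qed

text \<open>The argument is scaled and the box kept: the bump vanishes outside the box for every
  \<open>k\<close>, while inside each factor \<open>exp (- 1 / (k * s))\<close> tends to 1.\<close>

definition box_bump :: "real^'n::finite \<Rightarrow> real^'n \<Rightarrow> nat \<Rightarrow> real^'n \<Rightarrow> real" where
  "box_bump a b k x = (\<Prod>i\<in>UNIV. flat_exp 0 (real k * (x $ i) + real k * - (a $ i)) * flat_exp 0 (- real k * (x $ i) + real k * b $ i))"

lemma smooth_box_bump: "smooth (box_bump a b k)"
  unfolding box_bump_def [abs_def]
  by (intro smoothI times_diff_prod times_diff_mult times_diff_flat_exp) auto

lemma flat_exp_01: "0 \<le> flat_exp 0 s" "flat_exp 0 s \<le> 1"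
  by (auto simp: flat_exp_0)

lemma box_bump_01: "0 \<le> box_bump a b k x" "box_bump a b k x \<le> 1"
  unfolding box_bump_def using flat_exp_01 by (auto intro!: prod_nonneg prod_le_1 mult_nonneg_nonneg mult_le_one)

lemma box_bump_outside: "x \<notin> box a b \<Longrightarrow> box_bump a b k x = 0"
proof -
  assume "x \<notin> box a b"
  then obtain i where "x $ i \<le> a $ i \<or> b $ i \<le> x $ i" by (auto simp: mem_box_vec not_less)
  then have "real k * (x $ i) + real k * - (a $ i) \<le> 0 \<or> - real k * (x $ i) + real k * b $ i \<le> 0"
    by (auto intro: mult_left_mono)
  then have "flat_exp 0 (real k * (x $ i) + real k * - (a $ i)) * flat_exp 0 (- real k * (x $ i) + real k * b $ i) = 0"
    by (auto simp: flat_exp_0)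
  then show ?thesis unfolding box_bump_def by (intro prod_zero) auto
qed

lemma flat_exp_scaled_tendsto: "s > 0 \<Longrightarrow> (\<lambda>k. flat_exp 0 (real k * s)) \<longlonglongrightarrow> 1"
proof -
  assume s: "s > 0"
  have "(\<lambda>k. - (1 / s) * inverse (real k)) \<longlonglongrightarrow> - (1 / s) * 0"
    by (intro tendsto_mult tendsto_const lim_inverse_n)
  then have "(\<lambda>k. exp (- (1 / s) * inverse (real k))) \<longlonglongrightarrow> exp 0" by (intro tendsto_exp) simp
  then have "(\<lambda>k. exp (- (1 / s) * inverse (real k))) \<longlonglongrightarrow> 1" by simp
  then show ?thesis
    by (rule Lim_transform_eventually)
       (use s in \<open>auto simp: flat_exp_0 field_simps eventually_sequentially intro!: exI[of _ 1]\<close>)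
qed

lemma box_bump_tendsto: "(\<lambda>k. box_bump a b k x) \<longlonglongrightarrow> indicator (box a b) x"
proof (cases "x \<in> box a b")
  case False then show ?thesis by (simp add: box_bump_outside)
next
  case True
  then have "(\<lambda>k. \<Prod>i\<in>UNIV. flat_exp 0 (real k * (x $ i - a $ i)) * flat_exp 0 (real k * (b $ i - x $ i))) \<longlonglongrightarrow> (\<Prod>i\<in>(UNIV::'a set). 1 * 1)"
    by (intro tendsto_prod tendsto_mult flat_exp_scaled_tendsto) (auto simp: mem_box_vec)
  then show ?thesis using True by (simp add: box_bump_def algebra_simps)
qed

lemma compactly_inside_box:
  fixes a b :: "'a::euclidean_space"
  assumes "cbox a b \<subseteq> \<Omega>" "S \<subseteq> cbox a b" shows "compactly_inside S \<Omega>"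
proof -
  have cl: "closure S \<subseteq> cbox a b" using assms(2) by (intro closure_minimal) auto
  then have "compact (closure S)" using compact_cbox by (metis closed_closure compact_Int_closed inf.absorb_iff2)
  then show ?thesis using cl assms(1) by (auto simp: compactly_inside_def)
qed

lemma box_bump_test:
  assumes "cbox a b \<subseteq> \<Omega>" shows "box_bump a b k \<in> test_functions \<Omega>"
proof -
  have "x \<in> cbox a b" if "box_bump a b k x \<noteq> 0" for x
    using that box_bump_outside[of x a b k] box_subset_cbox[of a b] by auto
  then have "compactly_inside {x. box_bump a b k x \<noteq> 0} \<Omega>"
    by (intro compactly_inside_box[OF assms]) auto
  then show ?thesis by (simp add: test_functions_def smooth_box_bump)
qed

lemma smooth_continuous: "smooth f \<Longrightarrow> continuous_on UNIV f"
  unfolding smooth_def continuous_on_eq_continuous_at[OF open_UNIV]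
  by (metis differentiable_imp_continuous_within foldr_Nil id_apply)

lemma smooth_partial: "smooth f \<Longrightarrow> smooth (partial j f)"
proof -
  assume f: "smooth f"
  have "foldr partial js (partial j f) differentiable (at x)" for js x
    using f[unfolded smooth_def, rule_format, of "js @ [j]" x] by simp
  then show ?thesis by (simp add: smooth_def)
qed

lemma test_function_Cc: "\<phi> \<in> test_functions \<Omega> \<Longrightarrow> \<phi> \<in> Cc \<Omega>"
  by (auto simp: test_functions_def Cc_def smooth_continuous)

text \<open>The bumps of a box converge boundedly to its indicator, so the measures agree on boxes
  and hence on Borel sets. This is why the choices made in \<open>div_measure\<close> and
  \<open>pairing\<close> are harmless.\<close>

theorem signed_measure_eq_of_test_functions:
  fixes \<sigma> \<tau> :: "(real^'n::finite) set \<Rightarrow> real"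
  assumes \<Omega>: "open \<Omega>" and m: "fvm \<Omega> \<sigma>" "fvm \<Omega> \<tau>"
    and eq: "\<And>\<phi>. \<phi> \<in> test_functions \<Omega> \<Longrightarrow> signed_integral \<Omega> \<sigma> \<phi> = signed_integral \<Omega> \<tau> \<phi>"
    and S: "S \<in> sets borel" "S \<subseteq> \<Omega>"
  shows "\<sigma> S = \<tau> S"
proof (rule fvm_eq_on_boxes[OF m \<Omega> _ S])
  have \<Omega>b: "\<Omega> \<in> sets borel" using \<Omega> by auto
  fix a b :: "real^'n" assume ab: "cbox a b \<subseteq> \<Omega>"
  have lim: "(\<lambda>k. signed_integral \<Omega> \<rho> (box_bump a b k)) \<longlonglongrightarrow> \<rho> (box a b)" if \<rho>: "fvm \<Omega> \<rho>" for \<rho> :: "(real^'n) set \<Rightarrow> real"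
  proof -
    have "(\<lambda>k. integral\<^sup>L (pos_variation \<Omega> \<rho>) (box_bump a b k)) \<longlonglongrightarrow> integral\<^sup>L (pos_variation \<Omega> \<rho>) (indicator (box a b))"
      if \<rho>: "fvm \<Omega> \<rho>" for \<rho> :: "(real^'n) set \<Rightarrow> real"
    proof (rule integral_dominated_convergence[where w="\<lambda>_. 1"])
      interpret finite_measure "pos_variation \<Omega> \<rho>" using finite_radon_onD[OF finite_radon_pos_variation[OF \<rho> \<Omega>b]] by simp
      show "integrable (pos_variation \<Omega> \<rho>) (\<lambda>_. 1::real)" by simp
      have "box_bump a b k \<in> borel_measurable borel" for k by (rule Cc_measurable[OF test_function_Cc[OF box_bump_test[OF ab]]])
      then show "box_bump a b k \<in> borel_measurable (pos_variation \<Omega> \<rho>)" for k by simp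
      show "AE x in pos_variation \<Omega> \<rho>. norm (box_bump a b k x) \<le> 1" for k by (simp add: box_bump_01)
    qed (auto intro: box_bump_tendsto)
    from tendsto_diff[OF this[OF \<rho>] this[OF fvm_uminus[OF \<rho>]]]
    have "(\<lambda>k. signed_integral \<Omega> \<rho> (box_bump a b k)) \<longlonglongrightarrow> signed_integral \<Omega> \<rho> (indicator (box a b))"
      by (simp only: signed_integral_def)
    moreover have "box a b \<subseteq> \<Omega>" using ab box_subset_cbox[of a b] by (rule subset_trans[rotated])
    ultimately show ?thesis using signed_integral_indicator[OF \<rho> \<Omega>b, of "box a b"] by simp
  qed
  have "(\<lambda>k. signed_integral \<Omega> \<sigma> (box_bump a b k)) \<longlonglongrightarrow> \<tau> (box a b)"
    using lim[OF m(2)] eq[OF box_bump_test[OF ab]] by simp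
  then show "\<sigma> (box a b) = \<tau> (box a b)" using lim[OF m(1)] LIMSEQ_unique by blast
qed

subsection \<open>The pairing with the constant function\<close>

lemma bump_measurable [measurable]: "bump \<in> borel_measurable borel"
  unfolding bump_def [abs_def] by measurable

lemma mollifier_measurable [measurable]: "mollifier \<delta> \<in> borel_measurable borel"
  unfolding mollifier_def [abs_def] by measurable

lemma mollifier_support: "\<delta> > 0 \<Longrightarrow> mollifier \<delta> x \<noteq> 0 \<Longrightarrow> norm x < \<delta>"
  by (auto simp: mollifier_def bump_def field_simps split: if_splits)

lemma integral_reflect_translate:
  fixes f :: "real^'n::finite \<Rightarrow> real"
  assumes [measurable]: "f \<in> borel_measurable borel"
  shows "(LINT y|lborel. f (x - y)) = (LINT y|lborel. f y)"
proof -
  have "(lborel :: (real^'n) measure) = density (distr lborel borel (\<lambda>y. x + - 1 *\<^sub>R y)) (\<lambda>_. ennreal (\<bar>- 1\<bar> ^ DIM(real^'n)))"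
    by (rule lborel_affine) simp
  also have "\<dots> = distr lborel borel (\<lambda>y. x - y)" by (simp add: density_1)
  finally have eq: "distr lborel borel (\<lambda>y. x - y) = lborel" by (rule sym)
  have "(LINT y|distr lborel borel (\<lambda>y. x - y). f y) = (LINT y|lborel. f (x - y))" by (rule integral_distr) auto
  then show ?thesis unfolding eq by (rule sym)
qed

text \<open>For small \<delta>, mollification near the support of \<psi> does not see the complement
  of \<Omega>. There the mollified indicator is the constant integral of the mollifier, so its
  gradient vanishes; elsewhere \<psi> does.\<close>

lemma mollify_indicator_near:
  fixes \<psi> :: "real^'n::finite \<Rightarrow> real"
  assumes \<Omega>: "open \<Omega>" and \<psi>: "\<psi> \<in> Cc \<Omega>"
  shows "\<forall>\<^sub>F \<delta> in at_right 0. \<forall>x j. \<psi> x * partial j (mollify \<Omega> (indicator \<Omega>) \<delta>) x = 0"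
proof -
  have "compact (closure {x. \<psi> x \<noteq> 0})" "closure {x. \<psi> x \<noteq> 0} \<subseteq> \<Omega>"
    using \<psi> by (auto simp: Cc_def compactly_inside_def)
  then obtain r where r: "r > 0" "(\<Union>x\<in>closure {x. \<psi> x \<noteq> 0}. ball x r) \<subseteq> \<Omega>"
    using compact_subset_open_imp_ball_epsilon_subset[OF _ \<Omega>] by metis
  \<comment> \<open>One half of \<open>r\<close> is for moving the point, since a derivative
    requires constancy on a whole ball, the other for the radius of the mollifier.\<close>
  have "\<psi> x * partial j (mollify \<Omega> (indicator \<Omega>) \<delta>) x = 0" if d: "0 < \<delta>" "\<delta> < r / 2" for \<delta> x j
  proof (cases "\<psi> x = 0")
    case False
    then have "x \<in> closure {x. \<psi> x \<noteq> 0}" using closure_subset[of "{x. \<psi> x \<noteq> 0}"] by auto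
    then have xr: "ball x r \<subseteq> \<Omega>" using r(2) by auto
    have c: "(LINT y|lborel. mollifier \<delta> (y::real^'n)) = mollify \<Omega> (indicator \<Omega>) \<delta> x'" if x': "x' \<in> ball x (r / 2)" for x'
    proof -
      have eq: "indicator \<Omega> y *\<^sub>R (indicator \<Omega> y * mollifier \<delta> (x' - y)) = mollifier \<delta> (x' - y)" for y
      proof (cases "mollifier \<delta> (x' - y) = 0")
        case False
        then have "dist x' y < \<delta>" using mollifier_support[OF d(1)] by (simp add: dist_norm)
        then have "y \<in> ball x r" using x' d dist_triangle[of x y x'] by simp
        then show ?thesis using xr by auto
      qed simp
      have "mollify \<Omega> (indicator \<Omega>) \<delta> x' = (LINT y|lborel. mollifier \<delta> (x' - y))"
        unfolding mollify_def set_lebesgue_integral_def eq ..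
      then show ?thesis by (simp only: integral_reflect_translate mollifier_measurable)
    qed
    have "((\<lambda>_. LINT y|lborel. mollifier \<delta> (y::real^'n)) has_derivative (\<lambda>_. 0)) (at x)" by simp
    then have "(mollify \<Omega> (indicator \<Omega>) \<delta> has_derivative (\<lambda>_. 0)) (at x)"
      by (rule has_derivative_transform_within_open[of _ _ _ _ "ball x (r/2)"]) (use r(1) c in auto)
    then show ?thesis by (simp add: partial_eq)
  qed simp
  then show ?thesis using r(1) unfolding eventually_at_right_field by (intro exI[of _ "r/2"]) auto
qed

text \<open>The zero measure is a pairing, and test functions determine a pairing on Borel subsets
  of \<Omega>; so the chosen one vanishes there as well.\<close>

lemma pairing_indicator:
  fixes F :: "(real^'n::finite) set \<Rightarrow> real^'n"
  assumes \<Omega>: "open \<Omega>" and S: "S \<in> sets borel" "S \<subseteq> \<Omega>"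
  shows "pairing \<Omega> F (indicator \<Omega>) S = 0"
proof -
  have lim: "((\<lambda>\<delta>. \<Sum>j\<in>UNIV. signed_integral \<Omega> (\<lambda>S. F S $ j)
                (\<lambda>x. \<psi> x * partial j (mollify \<Omega> (indicator \<Omega>) \<delta>) x)) \<longlongrightarrow> 0) (at_right 0)"
    if \<psi>: "\<psi> \<in> Cc \<Omega>" for \<psi>
  proof (rule tendsto_eventually)
    show "\<forall>\<^sub>F \<delta> in at_right 0. (\<Sum>j\<in>UNIV. signed_integral \<Omega> (\<lambda>S. F S $ j)
                (\<lambda>x. \<psi> x * partial j (mollify \<Omega> (indicator \<Omega>) \<delta>) x)) = 0"
      using mollify_indicator_near[OF \<Omega> \<psi>]
    proof eventually_elim
      fix \<delta> assume "\<forall>x j. \<psi> x * partial j (mollify \<Omega> (indicator \<Omega>) \<delta>) x = 0"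
      then have "(\<lambda>x. \<psi> x * partial j (mollify \<Omega> (indicator \<Omega>) \<delta>) x) = (\<lambda>x. 0)" for j by (intro ext) blast
      then show "(\<Sum>j\<in>UNIV. signed_integral \<Omega> (\<lambda>S. F S $ j)
                (\<lambda>x. \<psi> x * partial j (mollify \<Omega> (indicator \<Omega>) \<delta>) x)) = 0"
        by (simp only: signed_integral_zero_fun sum.neutral_const)
    qed
  qed
  have "is_pairing \<Omega> F (indicator \<Omega>) (\<lambda>_. 0)"
    unfolding is_pairing_def using lim by (simp add: fvm_zero signed_integral_zero)
  then have p: "is_pairing \<Omega> F (indicator \<Omega>) (pairing \<Omega> F (indicator \<Omega>))"
    unfolding pairing_def by (rule someI[of "is_pairing \<Omega> F (indicator \<Omega>)"])
  then have m: "fvm \<Omega> (pairing \<Omega> F (indicator \<Omega>))" by (simp add: is_pairing_def)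
  have "signed_integral \<Omega> (pairing \<Omega> F (indicator \<Omega>)) \<phi> = signed_integral \<Omega> (\<lambda>_. 0) \<phi>"
    if "\<phi> \<in> test_functions \<Omega>" for \<phi>
  proof -
    have \<phi>: "\<phi> \<in> Cc \<Omega>" using that by (rule test_function_Cc)
    have "((\<lambda>\<delta>. \<Sum>j\<in>UNIV. signed_integral \<Omega> (\<lambda>S. F S $ j)
                (\<lambda>x. \<phi> x * partial j (mollify \<Omega> (indicator \<Omega>) \<delta>) x))
         \<longlongrightarrow> signed_integral \<Omega> (pairing \<Omega> F (indicator \<Omega>)) \<phi>) (at_right 0)"
      using p \<phi> unfolding is_pairing_def by blast
    then show ?thesis using tendsto_unique[OF _ _ lim[OF \<phi>]] by (simp add: signed_integral_zero)
  qed
  then show ?thesis by (rule signed_measure_eq_of_test_functions[OF \<Omega> m fvm_zero _ S])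
qed

subsection \<open>Boundary layers\<close>

lemma inner_layer_near:
  assumes "y \<in> inner_layer U \<epsilon>"
  shows "y \<in> U" "\<exists>z\<in>frontier U. dist y z \<le> \<epsilon>"
proof -
  show yU: "y \<in> U" using assms by (simp add: inner_layer_def)
  have "y \<notin> inner_set U \<epsilon>" using assms closure_subset[of "inner_set U \<epsilon>"] by (auto simp: inner_layer_def)
  then have n: "frontier U \<noteq> {}" "infdist y (frontier U) \<le> \<epsilon>" using yU by (auto simp: inner_set_def)
  obtain z where "z \<in> frontier U" "infdist y (frontier U) = dist y z"
    using infdist_attains_inf[of "frontier U" y] n(1) by auto
  then show "\<exists>z\<in>frontier U. dist y z \<le> \<epsilon>" using n(2) by auto
qed

text \<open>The inequality between the widths is strict because the layer omits the closure of the
  inner set, which may contain points at distance exactly \<epsilon>' from the frontier.\<close>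

lemma near_frontier_in_layer:
  assumes "x \<in> U" "z \<in> frontier U" "dist x z \<le> \<epsilon>" "\<epsilon> < \<epsilon>'"
  shows "x \<in> inner_layer U \<epsilon>'"
proof -
  have ne: "frontier U \<noteq> {}" using assms by auto
  have cl: "closed {y. \<epsilon>' \<le> infdist y (frontier U)}"
    by (intro closed_Collect_le continuous_intros)
  have "closure (inner_set U \<epsilon>') \<subseteq> {y. \<epsilon>' \<le> infdist y (frontier U)}"
    by (rule closure_minimal[OF _ cl]) (auto simp: inner_set_def ne)
  moreover have "infdist x (frontier U) \<le> \<epsilon>" using infdist_le[OF assms(2), of x] assms(3) by simp
  ultimately have "x \<notin> closure (inner_set U \<epsilon>')" using assms(4) by auto
  then show ?thesis using assms(1) by (simp add: inner_layer_def)
qed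

lemma inner_layer_open: "open U \<Longrightarrow> open (inner_layer U \<epsilon>)"
  unfolding inner_layer_def by (intro open_Diff closed_closure)

lemma inner_layer_borel: "open U \<Longrightarrow> inner_layer U \<epsilon> \<in> sets borel"
  by (simp add: inner_layer_open borel_open)

lemma frontier_open_eq: "open U \<Longrightarrow> frontier U = closure U - U"
  by (simp add: frontier_def interior_open)

lemma Int_frontier_Int:
  assumes "open A" "open B" shows "A \<inter> frontier (A \<inter> B) = A \<inter> frontier B"
proof -
  have "A \<inter> closure B \<subseteq> closure (A \<inter> B)" using open_Int_closure_subset[OF assms(1)] by blast
  moreover have "closure (A \<inter> B) \<subseteq> closure B" by (rule closure_mono) simp
  ultimately show ?thesis using assms by (auto simp: frontier_open_eq open_Int)
qed

lemma compactly_inside_subset: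
  assumes "compactly_inside V \<Omega>" "U \<subseteq> V" shows "compactly_inside U \<Omega>"
proof -
  have cl: "closure U \<subseteq> closure V" using assms(2) by (rule closure_mono)
  then have "closure V \<inter> closure U = closure U" by (rule Int_absorb1)
  then have "compact (closure U)"
    using assms(1) compact_Int_closed[OF _ closed_closure, of "closure V" U] by (simp add: compactly_inside_def)
  then show ?thesis using cl assms(1) by (auto simp: compactly_inside_def)
qed

lemma frontier_compactly_inside: "compactly_inside U \<Omega> \<Longrightarrow> frontier U \<subseteq> \<Omega>"
  by (auto simp: compactly_inside_def frontier_def)

lemma sets_scaled_restr [simp]: "sets (scaled_restr \<mu> B \<epsilon>) = sets \<mu>"
  by (simp add: scaled_restr_def)

lemma emeasure_scaled_restr:
  assumes "sets \<mu> = sets borel" "B \<in> sets borel" "S \<in> sets borel" "\<epsilon> > 0"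
  shows "emeasure (scaled_restr \<mu> B \<epsilon>) S = emeasure \<mu> (B \<inter> S) / ennreal \<epsilon>"
proof -
  have [measurable_cong]: "sets \<mu> = sets borel" by fact
  have [measurable]: "B \<in> sets borel" "S \<in> sets borel" by fact+
  have "emeasure (scaled_restr \<mu> B \<epsilon>) S = (\<integral>\<^sup>+x. ennreal (indicator B x / \<epsilon>) * indicator S x \<partial>\<mu>)"
    unfolding scaled_restr_def using assms by (subst emeasure_density) auto
  also have "\<dots> = (\<integral>\<^sup>+x. indicator (B \<inter> S) x * ennreal (1 / \<epsilon>) \<partial>\<mu>)"
    by (intro nn_integral_cong) (auto simp: indicator_def)
  also have "\<dots> = emeasure \<mu> (B \<inter> S) * ennreal (1 / \<epsilon>)"
    using assms by (subst nn_integral_multc) auto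
  also have "\<dots> = emeasure \<mu> (B \<inter> S) / ennreal \<epsilon>"
    using assms(4) by (simp add: divide_ennreal_def inverse_ennreal inverse_eq_divide)
  finally show ?thesis .
qed

lemma measure_scaled_restr:
  assumes "sets \<mu> = sets borel" "B \<in> sets borel" "S \<in> sets borel" "\<epsilon> > 0"
  shows "measure (scaled_restr \<mu> B \<epsilon>) S = measure \<mu> (B \<inter> S) / \<epsilon>"
  unfolding measure_def emeasure_scaled_restr[OF assms] using assms(4)
  by (simp add: divide_ennreal_def enn2real_mult inverse_ennreal divide_inverse)

lemma finite_scaled_restr:
  assumes "sets \<mu> = sets borel" "finite_measure \<mu>" "B \<in> sets borel" "\<epsilon> > 0"
  shows "finite_measure (scaled_restr \<mu> B \<epsilon>)"
proof (rule finite_measureI)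
  interpret finite_measure \<mu> by fact
  have "emeasure (scaled_restr \<mu> B \<epsilon>) UNIV \<noteq> \<infinity>"
    using assms by (subst emeasure_scaled_restr) (auto simp: ennreal_divide_eq_top_iff)
  moreover have "space (scaled_restr \<mu> B \<epsilon>) = UNIV"
    using sets_eq_imp_space_eq[OF assms(1)] by (simp add: scaled_restr_def)
  ultimately show "emeasure (scaled_restr \<mu> B \<epsilon>) (space (scaled_restr \<mu> B \<epsilon>)) \<noteq> \<infinity>" by simp
qed

lemma integral_scaled_restr:
  fixes f :: "'a::euclidean_space \<Rightarrow> real"
  assumes "sets \<mu> = sets borel" "B \<in> sets borel" "f \<in> borel_measurable borel" "\<epsilon> > 0"
  shows "(LINT x|scaled_restr \<mu> B \<epsilon>. f x) = (LINT x|\<mu>. indicator B x * f x) / \<epsilon>"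
proof -
  have [measurable_cong]: "sets \<mu> = sets borel" by fact
  have [measurable]: "B \<in> sets borel" "f \<in> borel_measurable borel" by fact+
  have "(LINT x|scaled_restr \<mu> B \<epsilon>. f x) = (LINT x|\<mu>. (indicator B x / \<epsilon>) *\<^sub>R f x)"
    unfolding scaled_restr_def using assms(4) by (intro integral_density) auto
  also have "\<dots> = (LINT x|\<mu>. (indicator B x * f x) / \<epsilon>)" by simp
  also have "\<dots> = (LINT x|\<mu>. indicator B x * f x) / \<epsilon>" by (rule integral_divide_zero)
  finally show ?thesis .
qed

text \<open>A liminf above \<open>M\<close> would make the quotients exceed \<open>M\<close> at all
  small widths, in particular at some \<open>1 / Suc k\<close>.\<close>

lemma O_classI:
  assumes U: "open U" "compactly_inside U \<Omega>"
    and bd: "\<And>k::nat. measure \<mu> (inner_layer U (1 / real (Suc k))) \<le> M / real (Suc k)"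
  shows "U \<in> O_class \<Omega> \<mu>"
proof -
  let ?f = "\<lambda>\<epsilon>. ereal (measure \<mu> (inner_layer U \<epsilon>) / \<epsilon>)"
  have "Liminf (at_right 0) ?f \<le> ereal M"
  proof (rule ccontr)
    assume "\<not> Liminf (at_right 0) ?f \<le> ereal M"
    then have "\<forall>\<^sub>F \<epsilon> in at_right 0. ereal M < ?f \<epsilon>" by (intro less_LiminfD) simp
    moreover have "filterlim (\<lambda>k. 1 / real (Suc k)) (at_right 0) sequentially"
      using LIMSEQ_inverse_real_of_nat
      by (auto simp: filterlim_at inverse_eq_divide intro!: always_eventually)
    ultimately have "\<forall>\<^sub>F k in sequentially. ereal M < ?f (1 / real (Suc k))"
      by (rule eventually_compose_filterlim)
    then obtain k where "ereal M < ?f (1 / real (Suc k))" using eventually_happens by force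
    then show False using bd[of k] by (simp add: field_simps)
  qed
  then show ?thesis using U by (auto simp: O_class_def less_eq_ereal_def)
qed

section \<open>The flux of a set as a measure on its boundary\<close>

locale flux =
  fixes \<Omega> :: "(real^'n::finite) set" and \<F> :: "(real^'n) set \<Rightarrow> (real^'n) set \<Rightarrow> real"
    and \<sigma> :: "(real^'n) set \<Rightarrow> real" and \<mu> :: "(real^'n) measure"
  assumes open_\<Omega>: "open \<Omega>" and cauchy_flux: "cauchy_flux \<Omega> \<F> \<sigma> \<mu>"
begin

lemma \<Omega>_borel [measurable]: "\<Omega> \<in> sets borel" using open_\<Omega> by auto

lemma fvm_\<sigma>: "fvm \<Omega> \<sigma>" and radon_\<mu>: "finite_radon_on \<Omega> \<mu>"
  and balance: "\<And>U. open U \<Longrightarrow> compactly_inside U \<Omega> \<Longrightarrow> \<F> U (frontier U) = \<sigma> U"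
  and flux_add: "\<And>U S T. U \<in> O_class \<Omega> \<mu> \<Longrightarrow> S \<in> sets borel \<Longrightarrow> T \<in> sets borel \<Longrightarrow>
    S \<subseteq> frontier U \<Longrightarrow> T \<subseteq> frontier U \<Longrightarrow> S \<inter> T = {} \<Longrightarrow> \<F> U (S \<union> T) = \<F> U S + \<F> U T"
  and flux_local: "\<And>U V A. U \<in> O_class \<Omega> \<mu> \<Longrightarrow> V \<in> O_class \<Omega> \<mu> \<Longrightarrow> open A \<Longrightarrow> A \<subseteq> \<Omega> \<Longrightarrow> A \<inter> U = A \<inter> V \<Longrightarrow>
    \<F> U (A \<inter> frontier U) = \<F> V (A \<inter> frontier V)"
  and flux_bound: "\<And>U \<epsilon> \<nu> S. U \<in> O_class \<Omega> \<mu> \<Longrightarrow> decseq \<epsilon> \<Longrightarrow> (\<And>k::nat. \<epsilon> k > 0) \<Longrightarrow> \<epsilon> \<longlonglongrightarrow> 0 \<Longrightarrow>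
    weak_star_conv \<Omega> (\<lambda>k. scaled_restr \<mu> (inner_layer U (\<epsilon> k)) (\<epsilon> k)) \<nu> sequentially \<Longrightarrow>
    S \<in> sets borel \<Longrightarrow> S \<subseteq> frontier U \<Longrightarrow> \<bar>\<F> U S\<bar> \<le> measure \<nu> S"
proof -
  note c1 = cauchy_flux[unfolded cauchy_flux_def]
  note c2 = c1[THEN conjunct2]
  note c3 = c2[THEN conjunct2]
  note c4 = c3[THEN conjunct2]
  note c5 = c4[THEN conjunct2]
  note c6 = c5[THEN conjunct2]
  show "fvm \<Omega> \<sigma>" by (rule c1[THEN conjunct1])
  show "finite_radon_on \<Omega> \<mu>" by (rule c2[THEN conjunct1])
  show "\<F> U (frontier U) = \<sigma> U" if "open U" "compactly_inside U \<Omega>" for U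
    by (rule c3[THEN conjunct1, rule_format, OF conjI[OF that]])
  show "\<F> U (S \<union> T) = \<F> U S + \<F> U T" if "U \<in> O_class \<Omega> \<mu>" "S \<in> sets borel" "T \<in> sets borel"
    "S \<subseteq> frontier U" "T \<subseteq> frontier U" "S \<inter> T = {}" for U S T
    by (rule c4[THEN conjunct1, rule_format, OF that(1-3) conjI[OF that(4) conjI[OF that(5,6)]]])
  show "\<F> U (A \<inter> frontier U) = \<F> V (A \<inter> frontier V)" if "U \<in> O_class \<Omega> \<mu>" "V \<in> O_class \<Omega> \<mu>" "open A"
    "A \<subseteq> \<Omega>" "A \<inter> U = A \<inter> V" for U V A
    by (rule c5[THEN conjunct1, rule_format, OF that(1-2) conjI[OF that(3) conjI[OF that(4,5)]]])
  show "\<bar>\<F> U S\<bar> \<le> measure \<nu> S" if "U \<in> O_class \<Omega> \<mu>" "decseq \<epsilon>" "\<And>k::nat. \<epsilon> k > 0" "\<epsilon> \<longlonglongrightarrow> 0"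
    "weak_star_conv \<Omega> (\<lambda>k. scaled_restr \<mu> (inner_layer U (\<epsilon> k)) (\<epsilon> k)) \<nu> sequentially"
    "S \<in> sets borel" "S \<subseteq> frontier U" for U \<epsilon> \<nu> S
  proof -
    have "decseq \<epsilon> \<and> (\<forall>k. 0 < \<epsilon> k) \<and> \<epsilon> \<longlonglongrightarrow> 0 \<and>
      weak_star_conv \<Omega> (\<lambda>k. scaled_restr \<mu> (inner_layer U (\<epsilon> k)) (\<epsilon> k)) \<nu> sequentially"
      using that(2-5) by blast
    from c6[rule_format, OF that(1) this that(6,7)] show ?thesis .
  qed
qed

lemma sets_\<mu> [measurable_cong, simp]: "sets \<mu> = sets borel"
  and space_\<mu> [simp]: "space \<mu> = UNIV" and finite_\<mu>: "finite_measure \<mu>"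
  using finite_radon_onD[OF radon_\<mu>] by auto

sublocale \<mu>: finite_measure \<mu> by (rule finite_\<mu>)

text \<open>The sets for which the layers of width \<open>1/k\<close> have density bounded in \<open>k\<close>; along this fixed
  sequence of widths, finite intersections are easy to handle, unlike in \<open>O_class\<close>.\<close>

definition thin :: "(real^'n) set \<Rightarrow> bool" where
  "thin U \<longleftrightarrow> open U \<and> compactly_inside U \<Omega> \<and>
     (\<exists>M. \<forall>k::nat. measure \<mu> (inner_layer U (1 / real (Suc k))) \<le> M / real (Suc k))"

lemma thin_O_class: "thin U \<Longrightarrow> U \<in> O_class \<Omega> \<mu>"
  unfolding thin_def using O_classI by metis

lemma eventually_bound_all:
  assumes ev: "\<forall>\<^sub>F k in sequentially. measure \<mu> (A k) \<le> M / real (Suc k)"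
  shows "\<exists>M. \<forall>k. measure \<mu> (A k) \<le> M / real (Suc k)"
proof -
  obtain K where K: "\<And>k. k \<ge> K \<Longrightarrow> measure \<mu> (A k) \<le> M / real (Suc k)"
    using ev by (auto simp: eventually_sequentially)
  \<comment> \<open>The second entry absorbs the finitely many \<open>k\<close> below
    \<open>K\<close>, for which only the total mass is available.\<close>
  define M' where "M' = max M (measure \<mu> UNIV * real (Suc K))"
  have "measure \<mu> (A k) \<le> M' / real (Suc k)" for k
  proof (cases "k \<ge> K")
    case True
    have "M / real (Suc k) \<le> M' / real (Suc k)" by (intro divide_right_mono) (auto simp: M'_def)
    then show ?thesis using K[OF True] by simp
  next
    case False
    have "measure \<mu> (A k) * real (Suc k) \<le> measure \<mu> UNIV * real (Suc K)"
      using \<mu>.bounded_measure[of "A k"] False by (intro mult_mono) auto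
    also have "\<dots> \<le> M'" by (simp add: M'_def)
    finally show ?thesis by (simp add: pos_le_divide_eq del: of_nat_Suc)
  qed
  then show ?thesis by blast
qed

definition layer_limit :: "(real^'n) set \<Rightarrow> (nat \<Rightarrow> nat) \<Rightarrow> (real^'n) measure \<Rightarrow> bool" where
  "layer_limit U r \<nu> \<longleftrightarrow> strict_mono r \<and>
     weak_star_conv \<Omega> (\<lambda>k. scaled_restr \<mu> (inner_layer U (1 / real (Suc (r k)))) (1 / real (Suc (r k)))) \<nu> sequentially"

lemma layer_limit_exists:
  assumes U: "thin U"
  shows "\<exists>r \<nu>. layer_limit U r \<nu>"
proof -
  obtain M where M: "\<And>k::nat. measure \<mu> (inner_layer U (1 / real (Suc k))) \<le> M / real (Suc k)" and op: "open U"
    using U by (auto simp: thin_def)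
  have b: "inner_layer U \<epsilon> \<in> sets borel" for \<epsilon> using op by (rule inner_layer_borel)
  obtain r \<nu> where "strict_mono r"
    "weak_star_conv \<Omega> (\<lambda>k. scaled_restr \<mu> (inner_layer U (1 / real (Suc (r k)))) (1 / real (Suc (r k)))) \<nu> sequentially"
  proof (rule weak_star_compactness[OF open_\<Omega>, of "\<lambda>k. scaled_restr \<mu> (inner_layer U (1 / real (Suc k))) (1 / real (Suc k))" M])
    show "sets (scaled_restr \<mu> (inner_layer U (1 / real (Suc k))) (1 / real (Suc k))) = sets borel" for k by simp
    show "finite_measure (scaled_restr \<mu> (inner_layer U (1 / real (Suc k))) (1 / real (Suc k)))" for k
      by (rule finite_scaled_restr) (use b finite_\<mu> in auto)
    show "measure (scaled_restr \<mu> (inner_layer U (1 / real (Suc k))) (1 / real (Suc k))) UNIV \<le> M" for k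
      using M[of k] b by (subst measure_scaled_restr) (auto simp: field_simps)
  qed auto
  then show ?thesis by (auto simp: layer_limit_def)
qed

lemma layer_limit_radon: "layer_limit U r \<nu> \<Longrightarrow> finite_radon_on \<Omega> \<nu>"
  by (simp add: layer_limit_def weak_star_conv_def)

lemma layer_limit_bound:
  assumes U: "thin U" and L: "layer_limit U r \<nu>" and S: "S \<in> sets borel" "S \<subseteq> frontier U"
  shows "\<bar>\<F> U S\<bar> \<le> measure \<nu> S"
proof (rule flux_bound[OF thin_O_class[OF U] _ _ _ _ S])
  have r: "strict_mono r" using L by (simp add: layer_limit_def)
  show "weak_star_conv \<Omega> (\<lambda>k. scaled_restr \<mu> (inner_layer U (1 / real (Suc (r k)))) (1 / real (Suc (r k)))) \<nu> sequentially"
    using L by (simp add: layer_limit_def)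
  show "decseq (\<lambda>k. 1 / real (Suc (r k)))"
    using strict_mono_leD[OF r] by (intro decseq_SucI) (simp add: frac_le)
  show "(\<lambda>k. 1 / real (Suc (r k))) \<longlonglongrightarrow> 0"
    using LIMSEQ_subseq_LIMSEQ[OF LIMSEQ_inverse_real_of_nat r] by (simp add: o_def inverse_eq_divide)
qed simp

lemma layer_limit_integral:
  assumes U: "thin U" and L: "layer_limit U r \<nu>" and \<psi>: "\<psi> \<in> Cc \<Omega>"
  shows "(\<lambda>k. (LINT x|\<mu>. indicator (inner_layer U (1 / real (Suc (r k)))) x * \<psi> x) * real (Suc (r k))) \<longlonglongrightarrow> (LINT x|\<nu>. \<psi> x)"
proof -
  have op: "open U" using U by (simp add: thin_def)
  have "(LINT x|scaled_restr \<mu> (inner_layer U (1 / real (Suc (r k)))) (1 / real (Suc (r k))). \<psi> x) =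
     (LINT x|\<mu>. indicator (inner_layer U (1 / real (Suc (r k)))) x * \<psi> x) * real (Suc (r k))" for k
    using inner_layer_borel[OF op] Cc_measurable[OF \<psi>] by (subst integral_scaled_restr) auto
  moreover have "(\<lambda>k. LINT x|scaled_restr \<mu> (inner_layer U (1 / real (Suc (r k)))) (1 / real (Suc (r k))). \<psi> x) \<longlonglongrightarrow> (LINT x|\<nu>. \<psi> x)"
    using L \<psi> unfolding layer_limit_def weak_star_conv_def by blast
  ultimately show ?thesis by (simp only:)
qed

text \<open>A test function supported in \<open>W\<close> sees only the part of the layers inside
  \<open>W\<close>. The bound holds for almost all widths \<open>1 / Suc k\<close>, hence along any
  subsequence \<open>r\<close>.\<close>

lemma layer_limit_open_le:
  assumes U: "thin U" and L: "layer_limit U r \<nu>" and W: "open W"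
    and ev: "\<forall>\<^sub>F k in sequentially. measure \<mu> (inner_layer U (1 / real (Suc k)) \<inter> W) \<le> c / real (Suc k)"
  shows "measure \<nu> W \<le> c"
proof -
  note \<nu> = finite_radon_onD[OF layer_limit_radon[OF L]]
  have op: "open U" using U by (simp add: thin_def)
  have "measure \<nu> (W \<inter> \<Omega>) \<le> c"
  proof (rule open_measure_leI[OF _ \<nu>(1,3)])
    show "open (W \<inter> \<Omega>)" using W open_\<Omega> by auto
    fix \<psi> assume \<psi>: "\<psi> \<in> Cc (W \<inter> \<Omega>)" "\<And>x. 0 \<le> \<psi> x \<and> \<psi> x \<le> 1"
    have \<psi>': "\<psi> \<in> Cc \<Omega>" by (rule Cc_mono[OF _ \<psi>(1)]) simp
    let ?B = "\<lambda>k. inner_layer U (1 / real (Suc k))"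
    have [measurable]: "?B k \<in> sets borel" for k using op by (rule inner_layer_borel)
    have [measurable]: "\<psi> \<in> borel_measurable borel" by (rule Cc_measurable[OF \<psi>'])
    have [measurable]: "W \<in> sets borel" using W by auto
    have le: "(LINT x|\<mu>. indicator (?B k) x * \<psi> x) \<le> measure \<mu> (?B k \<inter> W)" for k
    proof -
      have "(LINT x|\<mu>. indicator (?B k) x * \<psi> x) \<le> (LINT x|\<mu>. indicator (?B k \<inter> W) x)"
      proof (rule integral_mono)
        show "integrable \<mu> (\<lambda>x. indicator (?B k) x * \<psi> x)"
        proof (rule \<mu>.integrable_const_bound[where B=1])
          show "AE x in \<mu>. norm (indicator (?B k) x * \<psi> x) \<le> 1"
            using \<psi>(2) by (auto simp: indicator_def)
        qed measurable
        show "integrable \<mu> (indicator (?B k \<inter> W) :: _ \<Rightarrow> real)"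
          using sets.Int[OF inner_layer_borel[OF op] borel_open[OF W]]
          by (intro integrable_real_indicator) (simp_all add: \<mu>.emeasure_eq_measure del: of_nat_Suc)
        show "indicator (?B k) x * \<psi> x \<le> indicator (?B k \<inter> W) x" for x
          using \<psi>(2)[of x] Cc_zero_outside[OF \<psi>(1), of x] by (auto simp: indicator_def)
      qed
      then show ?thesis by simp
    qed
    have ev': "\<forall>\<^sub>F k in sequentially. (LINT x|\<mu>. indicator (?B k) x * \<psi> x) * real (Suc k) \<le> c"
      using ev
    proof eventually_elim
      case (elim k)
      then have "(LINT x|\<mu>. indicator (?B k) x * \<psi> x) \<le> c / real (Suc k)" using le[of k] by linarith
      then show ?case by (simp add: pos_le_divide_eq del: of_nat_Suc)
    qed
    have "strict_mono r" using L by (simp add: layer_limit_def)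
    then have "\<forall>\<^sub>F k in sequentially. (LINT x|\<mu>. indicator (?B (r k)) x * \<psi> x) * real (Suc (r k)) \<le> c"
      using eventually_compose_filterlim[OF ev' filterlim_subseq] by simp
    then show "(LINT x|\<nu>. \<psi> x) \<le> c"
      by (rule tendsto_upperbound[OF layer_limit_integral[OF U L \<psi>']]) simp
  qed
  moreover have "measure \<nu> (W \<inter> \<Omega>) = measure \<nu> W"
    using W by (intro measure_carrier[OF layer_limit_radon[OF L]]) auto
  ultimately show ?thesis by simp
qed

text \<open>Condition (i) supplies finite additivity and (iii) domination by a layer limit, which
  exists by compactness; together they give countable additivity.\<close>

lemma flux_fvm: "thin U \<Longrightarrow> fvm (frontier U) (\<F> U)"
proof -
  assume U: "thin U"
  obtain r \<nu> where L: "layer_limit U r \<nu>" using layer_limit_exists[OF U] by blast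
  show ?thesis
    by (rule fvm_dominatedI[OF _ finite_radon_onD(1,3)[OF layer_limit_radon[OF L]]])
       (use flux_add[OF thin_O_class[OF U]] layer_limit_bound[OF U L] in \<open>auto intro: borel_closed\<close>)
qed

text \<open>Extended to the whole space, fluxes of sets with different boundaries become measures
  that can be compared with each other.\<close>

definition total_flux :: "(real^'n) set \<Rightarrow> (real^'n) set \<Rightarrow> real" where
  "total_flux U S = \<F> U (S \<inter> frontier U)"

lemma total_flux_fvm: "thin U \<Longrightarrow> fvm UNIV (total_flux U)"
  unfolding total_flux_def [abs_def] by (rule fvm_restrict[OF flux_fvm]) (auto intro: borel_closed)

lemma total_flux_bound:
  "thin U \<Longrightarrow> layer_limit U r \<nu> \<Longrightarrow> S \<in> sets borel \<Longrightarrow> \<bar>total_flux U S\<bar> \<le> measure \<nu> S"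
proof -
  assume U: "thin U" and L: "layer_limit U r \<nu>" and S: "S \<in> sets borel"
  note \<nu> = finite_radon_onD[OF layer_limit_radon[OF L]]
  interpret finite_measure \<nu> by (rule \<nu>(3))
  have "\<bar>total_flux U S\<bar> \<le> measure \<nu> (S \<inter> frontier U)"
    unfolding total_flux_def using S by (intro layer_limit_bound[OF U L]) (auto intro: borel_closed)
  also have "\<dots> \<le> measure \<nu> S" using S \<nu> by (intro finite_measure_mono) auto
  finally show ?thesis .
qed

lemma total_flux_UNIV: "thin U \<Longrightarrow> total_flux U UNIV = \<sigma> U"
  using balance by (simp add: total_flux_def thin_def)

lemma total_flux_local:
  assumes "thin U" "thin V" "open A" "A \<subseteq> \<Omega>" "A \<inter> U = A \<inter> V"
  shows "total_flux U A = total_flux V A"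
  unfolding total_flux_def by (rule flux_local[OF thin_O_class[OF assms(1)] thin_O_class[OF assms(2)] assms(3-5)])

text \<open>Both boundaries lie in \<Omega>, so the part of \<open>A\<close> outside \<Omega>
  carries no flux and \<open>A\<close> may be cut down to \<Omega>.\<close>

lemma total_flux_local':
  assumes U: "thin U" "thin V" and A: "open A" "A \<inter> U = A \<inter> V"
  shows "total_flux U A = total_flux V A"
proof -
  have "frontier U \<subseteq> \<Omega>" "frontier V \<subseteq> \<Omega>" using U frontier_compactly_inside by (auto simp: thin_def)
  then have "total_flux U A = total_flux U (A \<inter> \<Omega>)" "total_flux V A = total_flux V (A \<inter> \<Omega>)"
    unfolding total_flux_def by (metis Int_assoc inf.absorb_iff2 inf.commute)+
  moreover have "total_flux U (A \<inter> \<Omega>) = total_flux V (A \<inter> \<Omega>)"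
    using A open_\<Omega> by (intro total_flux_local[OF U]) auto
  ultimately show ?thesis by simp
qed

end

section \<open>Half-spaces and the exhaustion of \<Omega>\<close>

lemma frontier_halfsp: "frontier (halfsp j t) = {x. x $ j = t}"
  using frontier_halfspace_gt[of "axis j 1 :: real^'a" t]
  by (simp add: halfsp_def inner_axis' axis_eq_0_iff)

lemma closure_halfsp: "closure (halfsp j t) = {x. x $ j \<ge> t}"
  using closure_halfspace_gt[of "axis j 1 :: real^'a" t]
  by (simp add: halfsp_def inner_axis' axis_eq_0_iff)

lemma open_halfsp: "open (halfsp j t)"
  unfolding halfsp_def by (intro open_Collect_less continuous_intros)

lemma halfsp_layer: "halfsp j t - closure (halfsp j (t + \<epsilon>)) = {x. t < x $ j \<and> x $ j < t + \<epsilon>}"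
  by (auto simp: closure_halfsp halfsp_def)

lemma exhaustion_open: assumes "open \<Omega>" shows "open (exhaustion \<Omega> \<delta>)"
proof (cases "frontier \<Omega> = {}")
  case True
  then have "exhaustion \<Omega> \<delta> = \<Omega> \<inter> {x. norm x < 1 / \<delta>}" by (auto simp: exhaustion_def inner_set_def)
  then show ?thesis using assms by (auto intro!: open_Int open_Collect_less continuous_intros)
next
  case False
  then have "exhaustion \<Omega> \<delta> = \<Omega> \<inter> {x. infdist x (frontier \<Omega>) > \<delta>} \<inter> {x. norm x < 1 / \<delta>}"
    by (auto simp: exhaustion_def inner_set_def)
  then show ?thesis using assms by (auto intro!: open_Int open_Collect_less continuous_intros)
qed

lemma exhaustion_antimono: "0 < \<delta> \<Longrightarrow> \<delta> \<le> \<delta>' \<Longrightarrow> exhaustion \<Omega> \<delta>' \<subseteq> exhaustion \<Omega> \<delta>"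
  by (auto simp: exhaustion_def inner_set_def intro: less_le_trans[OF _ frac_le])

lemma exhaustion_closure:
  assumes "open \<Omega>" "0 < \<delta>" "x \<in> closure (exhaustion \<Omega> \<delta>)"
  shows "x \<in> \<Omega>" "norm x \<le> 1 / \<delta>" "frontier \<Omega> = {} \<or> \<delta> \<le> infdist x (frontier \<Omega>)"
proof -
  have "closed {x. norm x \<le> 1 / \<delta>}" by (intro closed_Collect_le continuous_intros)
  then have "closure (exhaustion \<Omega> \<delta>) \<subseteq> {x. norm x \<le> 1 / \<delta>}"
    by (rule closure_minimal[rotated]) (auto simp: exhaustion_def)
  then show "norm x \<le> 1 / \<delta>" using assms(3) by auto
  have "closed {x. \<delta> \<le> infdist x (frontier \<Omega>)}" by (intro closed_Collect_le continuous_intros)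
  then have "closure (exhaustion \<Omega> \<delta>) \<subseteq> {x. \<delta> \<le> infdist x (frontier \<Omega>)}" if "frontier \<Omega> \<noteq> {}"
    by (rule closure_minimal[rotated]) (use that in \<open>auto simp: exhaustion_def inner_set_def\<close>)
  then show *: "frontier \<Omega> = {} \<or> \<delta> \<le> infdist x (frontier \<Omega>)" using assms(3) by auto
  have "x \<notin> frontier \<Omega>"
  proof
    assume "x \<in> frontier \<Omega>"
    then have "infdist x (frontier \<Omega>) = 0" by simp
    then show False using * \<open>x \<in> frontier \<Omega>\<close> assms(2) by auto
  qed
  moreover have "x \<in> closure \<Omega>"
    using closure_mono[of "exhaustion \<Omega> \<delta>" \<Omega>] assms(3) by (auto simp: exhaustion_def inner_set_def)
  ultimately show "x \<in> \<Omega>" using assms(1) by (simp add: frontier_open_eq)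
qed

lemma exhaustion_compactly_inside:
  assumes "open \<Omega>" "0 < \<delta>" shows "compactly_inside (exhaustion \<Omega> \<delta>) \<Omega>"
proof -
  have "closure (exhaustion \<Omega> \<delta>) \<subseteq> cball 0 (1 / \<delta>)" using exhaustion_closure(2)[OF assms] by auto
  then have "compact (closure (exhaustion \<Omega> \<delta>))"
    by (simp add: compact_eq_bounded_closed bounded_subset[OF bounded_cball])
  then show ?thesis using exhaustion_closure(1)[OF assms] by (auto simp: compactly_inside_def)
qed

lemma exhaustion_covers:
  assumes \<Omega>: "open \<Omega>" and x: "x \<in> \<Omega>"
  obtains r where "r > 0" "\<And>\<delta>. 0 < \<delta> \<Longrightarrow> \<delta> < r \<Longrightarrow> x \<in> exhaustion \<Omega> \<delta>"
proof -
  define d where "d = (if frontier \<Omega> = {} then 1 else infdist x (frontier \<Omega>))"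
  have "x \<notin> frontier \<Omega>" using \<Omega> x by (simp add: frontier_open_eq)
  then have d: "d > 0" using infdist_pos_not_in_closed[of "frontier \<Omega>" x] by (auto simp: d_def)
  show ?thesis
  proof (rule that[of "min d (1 / (norm x + 1))"])
    have n: "0 < norm x + 1" using norm_ge_zero[of x] by linarith
    then show "min d (1 / (norm x + 1)) > 0" using d by simp
    fix \<delta> :: real assume \<delta>: "0 < \<delta>" "\<delta> < min d (1 / (norm x + 1))"
    have "norm x < 1 / \<delta>" using \<delta> n by (simp add: field_simps)
    moreover have "frontier \<Omega> = {} \<or> infdist x (frontier \<Omega>) > \<delta>"
      using \<delta> by (cases "frontier \<Omega> = {}") (simp_all add: d_def)
    ultimately show "x \<in> exhaustion \<Omega> \<delta>" using x by (auto simp: exhaustion_def inner_set_def)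
  qed
qed

lemma exhaustion_covers_compact:
  assumes \<Omega>: "open \<Omega>" and K: "compact K" "K \<subseteq> \<Omega>"
  obtains r where "r > 0" "\<And>\<delta>. 0 < \<delta> \<Longrightarrow> \<delta> < r \<Longrightarrow> K \<subseteq> exhaustion \<Omega> \<delta>"
proof -
  have "K \<subseteq> (\<Union>k::nat. exhaustion \<Omega> (1 / Suc k))"
  proof
    fix x assume "x \<in> K"
    then obtain r where r: "r > 0" "\<And>\<delta>. 0 < \<delta> \<Longrightarrow> \<delta> < r \<Longrightarrow> x \<in> exhaustion \<Omega> \<delta>"
      using exhaustion_covers[OF \<Omega>, of x] K by (metis subsetD)
    obtain k where "1 / Suc k < r" using r(1) nat_approx_posE by auto
    then show "x \<in> (\<Union>k::nat. exhaustion \<Omega> (1 / Suc k))" using r(2)[of "1 / Suc k"] by auto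
  qed
  then obtain I where I: "finite I" "K \<subseteq> (\<Union>k\<in>I. exhaustion \<Omega> (1 / Suc k))"
    using compactE_image[OF K(1), of UNIV "\<lambda>k. exhaustion \<Omega> (1 / Suc k)"] exhaustion_open[OF \<Omega>] by metis
  define m where "m = Max (insert 0 I)"
  have "exhaustion \<Omega> (1 / Suc k) \<subseteq> exhaustion \<Omega> \<delta>" if "k \<in> I" "0 < \<delta>" "\<delta> < 1 / Suc m" for k \<delta>
  proof (rule exhaustion_antimono[OF that(2)])
    have "k \<le> m" using I(1) that(1) by (auto simp: m_def)
    then have "1 / real (Suc m) \<le> 1 / real (Suc k)" by (intro frac_le) auto
    then show "\<delta> \<le> 1 / Suc k" using that(3) by simp
  qed
  then show ?thesis using I(2) by (intro that[of "1 / Suc m"]) (auto, blast)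
qed

lemma frontier_exhaustion:
  assumes "open \<Omega>" "0 < \<delta>" "z \<in> frontier (exhaustion \<Omega> \<delta>)"
  shows "frontier \<Omega> \<noteq> {} \<and> infdist z (frontier \<Omega>) = \<delta> \<or> norm z = 1 / \<delta>"
proof -
  have z: "z \<in> closure (exhaustion \<Omega> \<delta>)" "z \<notin> exhaustion \<Omega> \<delta>"
    using assms by (auto simp: frontier_open_eq exhaustion_open)
  show ?thesis using z(2) exhaustion_closure[OF assms(1,2) z(1)] by (auto simp: exhaustion_def inner_set_def)
qed

section \<open>Slabs around almost every level\<close>

lemma AE_lborel_small:
  assumes "AE \<delta> in lebesgue. P \<delta>" "r > (0::real)"
  shows "\<exists>\<delta>. 0 < \<delta> \<and> \<delta> < r \<and> P \<delta>"
proof (rule ccontr)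
  assume n: "\<not> ?thesis"
  have "AE \<delta> in lebesgue. \<delta> \<notin> {0<..<r}" using assms(1) by eventually_elim (use n in auto)
  then have "emeasure lebesgue {0<..<r} = 0" by (subst (asm) AE_iff_null_sets[symmetric]) auto
  then show False using assms(2) by simp
qed

text \<open>Differentiation of the image of \<mu> under \<open>g\<close>. The function is kept
  general because coordinates, the distance to the frontier of \<Omega> and the inverse norm all
  occur.\<close>

lemma AE_slab_bound:
  fixes \<mu> :: "'a::euclidean_space measure"
  assumes s: "sets \<mu> = sets borel" and fin: "finite_measure \<mu>" and g: "g \<in> borel_measurable borel"
  shows "AE t in lborel. \<exists>M\<ge>0. \<forall>\<epsilon>>0. measure \<mu> {x. \<bar>g x - t\<bar> \<le> \<epsilon>} \<le> M * \<epsilon>"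
proof -
  interpret finite_measure \<mu> by fact
  have sp: "space \<mu> = UNIV" using sets_eq_imp_space_eq[OF s] by simp
  have g': "g \<in> \<mu> \<rightarrow>\<^sub>M borel" using g s by (simp cong: measurable_cong_sets)
  let ?l = "distr \<mu> borel g"
  have l: "sets ?l = sets borel" "finite_measure ?l" using finite_measure_distr[OF g'] by auto
  from AE_has_density_at[OF l] show ?thesis
  proof eventually_elim
    case (elim t)
    then obtain M where M: "M \<ge> 0" "\<And>\<epsilon>. \<epsilon> > 0 \<Longrightarrow> measure ?l {t - \<epsilon>..t + \<epsilon>} \<le> M * \<epsilon>"
      using has_density_at_bound[OF l] by blast
    have "measure ?l {t - \<epsilon>..t + \<epsilon>} = measure \<mu> {x. \<bar>g x - t\<bar> \<le> \<epsilon>}" for \<epsilon>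
      using g' by (subst measure_distr) (auto simp: sp intro!: arg_cong[where f="measure \<mu>"])
    then show ?case using M by auto
  qed
qed

lemma AE_slab_density:
  fixes \<mu> :: "'a::euclidean_space measure"
  assumes s: "sets \<mu> = sets borel" and fin: "finite_measure \<mu>" and g: "g \<in> borel_measurable borel" and Q: "Q \<in> sets borel"
  shows "AE t in lborel. \<exists>D. ((\<lambda>\<epsilon>. measure \<mu> (Q \<inter> {x. t < g x \<and> g x < t + \<epsilon>}) / \<epsilon>) \<longlongrightarrow> D) (at_right 0)"
proof -
  interpret finite_measure \<mu> by fact
  have sp: "space \<mu> = UNIV" using sets_eq_imp_space_eq[OF s] by simp
  let ?r = "density \<mu> (indicator Q)"
  have r: "sets ?r = sets borel" "space ?r = UNIV" using s sp by auto
  have fr: "finite_measure ?r"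
    by (rule finite_measureI) (use s Q sp in \<open>simp add: emeasure_restricted emeasure_eq_measure\<close>)
  have g': "g \<in> ?r \<rightarrow>\<^sub>M borel" using g s by (simp cong: measurable_cong_sets)
  let ?l = "distr ?r borel g"
  have l: "sets ?l = sets borel" "finite_measure ?l" using finite_measure.finite_measure_distr[OF fr g'] by auto
  from AE_has_density_at[OF l] show ?thesis
  proof eventually_elim
    case (elim t)
    then obtain D where D: "D \<ge> 0" "has_density_at ?l D t" by blast
    have "((\<lambda>\<epsilon>. measure ?l {t<..<t + \<epsilon>} / \<epsilon>) \<longlongrightarrow> D) (at_right 0)"
      by (rule has_density_at_right[OF l D(2,1)]) auto
    moreover have "measure ?l {t<..<t + \<epsilon>} = measure \<mu> (Q \<inter> {x. t < g x \<and> g x < t + \<epsilon>})" for \<epsilon>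
    proof -
      have B: "g -` {t<..<t + \<epsilon>} \<in> sets borel" using g by (rule measurable_sets_borel) simp
      have "measure ?l {t<..<t + \<epsilon>} = measure ?r (g -` {t<..<t + \<epsilon>})"
        using g' r(2) by (subst measure_distr) auto
      also have "\<dots> = measure \<mu> (Q \<inter> g -` {t<..<t + \<epsilon>})"
        using B Q s by (simp add: measure_restricted)
      also have "Q \<inter> g -` {t<..<t + \<epsilon>} = Q \<inter> {x. t < g x \<and> g x < t + \<epsilon>}" by auto
      finally show ?thesis .
    qed
    ultimately show ?case by auto
  qed
qed

subsection \<open>Uniform approximation by functions constant on cubes\<close>

lemma Cc_uniformly_continuous:
  fixes \<psi> :: "'a::euclidean_space \<Rightarrow> real"
  assumes \<psi>: "\<psi> \<in> Cc \<Omega>" and \<eta>: "\<eta> > 0"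
  obtains d where "d > 0" "\<And>x y. dist x y < d \<Longrightarrow> \<bar>\<psi> x - \<psi> y\<bar> < \<eta>"
proof -
  obtain R where R: "\<And>x. \<psi> x \<noteq> 0 \<Longrightarrow> norm x \<le> R" using Cc_bounded_support[OF \<psi>] by (auto simp: bounded_iff)
  have "uniformly_continuous_on (cball 0 (R + 1)) \<psi>"
    using Cc_continuous[OF \<psi>] by (intro compact_uniformly_continuous) (auto intro: continuous_on_subset)
  then obtain d where d: "d > 0" "\<And>x y. x \<in> cball 0 (R + 1) \<Longrightarrow> y \<in> cball 0 (R + 1) \<Longrightarrow> dist y x < d \<Longrightarrow> dist (\<psi> y) (\<psi> x) < \<eta>"
    using \<eta> unfolding uniformly_continuous_on_def by metis
  show ?thesis
  proof (rule that[of "min d 1"])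
    fix x y :: 'a assume xy: "dist x y < min d 1"
    have t: "norm x \<le> norm y + dist x y" "norm y \<le> norm x + dist x y"
      using norm_triangle_sub[of x y] norm_triangle_sub[of y x] by (simp_all add: dist_norm norm_minus_commute)
    show "\<bar>\<psi> x - \<psi> y\<bar> < \<eta>"
    proof (cases "norm x \<le> R + 1 \<and> norm y \<le> R + 1")
      case True then show ?thesis using d(2)[of y x] xy by (simp add: dist_real_def)
    next
      case False
      then have "norm x > R" "norm y > R" using t xy by auto
      then have "\<psi> x = 0" "\<psi> y = 0" using R by (force simp: not_less)+
      then show ?thesis using \<eta> by simp
    qed
  qed (use d in auto)
qed

definition cell :: "nat \<Rightarrow> ('n::finite \<Rightarrow> int) \<Rightarrow> (real^'n) set" where
  "cell N z = {x. \<forall>i. \<lfloor>real N * x $ i\<rfloor> = z i}"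

lemma cell_borel [measurable]: "cell N z \<in> sets borel"
proof -
  have "cell N z = (\<Inter>i. {x. \<lfloor>real N * x $ i\<rfloor> = z i})" by (auto simp: cell_def)
  moreover have "{x::real^'a. \<lfloor>real N * x $ i\<rfloor> = z i} \<in> sets borel" for i by measurable
  ultimately show ?thesis by auto
qed

text \<open>The cells of all orders \<open>N\<close> form one countable family independent of
  \<psi>. Convergence on every cell can therefore be required at almost every level, and it then
  serves all test functions simultaneously.\<close>

lemma Cc_cell_approx:
  fixes \<psi> :: "real^'n::finite \<Rightarrow> real"
  assumes \<psi>: "\<psi> \<in> Cc \<Omega>" and \<eta>: "\<eta> > 0"
  obtains N Z c where "finite Z" "\<And>x. \<bar>\<psi> x - (\<Sum>z\<in>Z. c z * indicator (cell N z) x)\<bar> \<le> \<eta>"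
proof -
  obtain d where d: "d > 0" "\<And>x y. dist x y < d \<Longrightarrow> \<bar>\<psi> x - \<psi> y\<bar> < \<eta>" using Cc_uniformly_continuous[OF \<psi> \<eta>] by blast
  obtain R where R: "\<And>x. \<psi> x \<noteq> 0 \<Longrightarrow> norm x \<le> R" using Cc_bounded_support[OF \<psi>] by (auto simp: bounded_iff)
  \<comment> \<open>A cell has side \<open>1 / N\<close>, so its points are within
    \<open>CARD('n) / N < d\<close> of its corner.\<close>
  obtain N :: nat where N: "CARD('n) / d < N" using reals_Archimedean2 by blast
  have N0: "real N > 0" using N d(1) by (metis divide_nonneg_pos le_less_trans of_nat_0_le_iff)
  \<comment> \<open>These are enough cells to cover the support; the summand 1 allows for the
    rounding of the floor.\<close>
  define Z where "Z = {z :: 'n \<Rightarrow> int. \<forall>i. \<bar>real_of_int (z i)\<bar> \<le> N * R + 1}"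
  define c where "c z = \<psi> (\<chi> i. of_int (z i) / N)" for z :: "'n \<Rightarrow> int"
  have "Z \<subseteq> PiE UNIV (\<lambda>_. {- \<lceil>N * R + 1\<rceil>..\<lceil>N * R + 1\<rceil>})"
  proof
    fix z :: "'n \<Rightarrow> int" assume "z \<in> Z"
    then have "\<bar>real_of_int (z i)\<bar> \<le> of_int \<lceil>N * R + 1\<rceil>" for i
      using le_of_int_ceiling[of "N * R + 1"] by (auto simp: Z_def intro: order_trans)
    then have "\<bar>z i\<bar> \<le> \<lceil>N * R + 1\<rceil>" for i by (simp only: of_int_abs[symmetric] of_int_le_iff)
    then have "- \<lceil>N * R + 1\<rceil> \<le> z i \<and> z i \<le> \<lceil>N * R + 1\<rceil>" for i by (metis abs_le_iff minus_le_iff)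
    then show "z \<in> PiE UNIV (\<lambda>_. {- \<lceil>N * R + 1\<rceil>..\<lceil>N * R + 1\<rceil>})" by auto
  qed
  then have finZ: "finite Z" by (rule finite_subset) (auto intro!: finite_PiE)
  have "\<bar>\<psi> x - (\<Sum>z\<in>Z. c z * indicator (cell N z) x)\<bar> \<le> \<eta>" for x
  proof -
    define z where "z i = \<lfloor>real N * x $ i\<rfloor>" for i
    have xz: "x \<in> cell N z' \<longleftrightarrow> z' = z" for z' by (auto simp: cell_def z_def)
    have "(\<Sum>z'\<in>Z. c z' * indicator (cell N z') x) = (\<Sum>z'\<in>Z. if z' = z then c z else 0)"
      by (rule sum.cong) (auto simp: indicator_def xz)
    then have s: "(\<Sum>z'\<in>Z. c z' * indicator (cell N z') x) = (if z \<in> Z then c z else 0)"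
      using finZ by simp
    have "\<bar>(x - (\<chi> i. of_int (z i) / N)) $ i\<bar> \<le> 1 / N" for i
    proof -
      have "of_int (z i) \<le> real N * x $ i" "real N * x $ i \<le> of_int (z i) + 1" by (simp_all add: z_def)
      then have "\<bar>real N * x $ i - of_int (z i)\<bar> / real N \<le> 1 / real N" by (intro divide_right_mono) auto
      moreover have "(x - (\<chi> i. of_int (z i) / N)) $ i = (real N * x $ i - of_int (z i)) / real N"
        using N0 by (simp add: diff_divide_distrib)
      ultimately show ?thesis using N0 by (simp only: abs_divide abs_of_nat)
    qed
    then have "(\<Sum>i\<in>UNIV. \<bar>(x - (\<chi> i. of_int (z i) / N)) $ i\<bar>) \<le> (\<Sum>i\<in>(UNIV :: 'n set). 1 / real N)" by (intro sum_mono)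
    then have "dist x (\<chi> i. of_int (z i) / N) \<le> CARD('n) / real N"
      using norm_le_l1_cart[of "x - (\<chi> i. of_int (z i) / N)"] by (simp add: dist_norm)
    also have "\<dots> < d" using N N0 d(1) by (simp add: field_simps)
    finally have "\<bar>\<psi> x - c z\<bar> < \<eta>" unfolding c_def by (rule d(2))
    moreover have "\<psi> x = 0" if "z \<notin> Z"
    proof (rule ccontr)
      assume "\<psi> x \<noteq> 0"
      then have "\<bar>x $ i\<bar> \<le> R" for i using R component_le_norm_cart[of x i] by (meson order_trans)
      have "\<bar>real_of_int (z i)\<bar> \<le> N * R + 1" for i
      proof -
        have "\<bar>real N * x $ i\<bar> \<le> N * R" using \<open>\<And>i. \<bar>x $ i\<bar> \<le> R\<close>[of i] by (simp add: abs_mult mult_left_mono)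
        then show ?thesis unfolding z_def by linarith
      qed
      then show False using that by (simp add: Z_def)
    qed
    ultimately show ?thesis unfolding s using \<eta> by auto
  qed
  with finZ show ?thesis by (rule that)
qed


section \<open>Limits of slices at almost every level\<close>

context flux
begin

definition slab_ok :: "'n \<Rightarrow> real \<Rightarrow> bool" where
  "slab_ok j t \<longleftrightarrow> (\<exists>M\<ge>0. \<forall>\<epsilon>>0. measure \<mu> {x. \<bar>x $ j - t\<bar> \<le> \<epsilon>} \<le> M * \<epsilon>)"

lemma AE_slab_ok: "AE t in lborel. slab_ok j t"
  unfolding slab_ok_def by (rule AE_slab_bound[OF sets_\<mu> finite_\<mu> borel_measurable_vec_nth])

lemma slab_borel [measurable]: "{x::real^'n. \<bar>x $ j - t\<bar> \<le> \<epsilon>} \<in> sets borel"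
  by measurable

lemma slice_borel [measurable]: "{x::real^'n. t < x $ j \<and> x $ j < s} \<in> sets borel"
  by measurable

lemma slab_ok_slice:
  assumes "slab_ok j t"
  obtains M where "M \<ge> 0" "\<And>\<epsilon>. \<epsilon> > 0 \<Longrightarrow> measure \<mu> {x. t < x $ j \<and> x $ j < t + \<epsilon>} \<le> M * \<epsilon>"
proof -
  obtain M where M: "M \<ge> 0" "\<And>\<epsilon>. \<epsilon> > 0 \<Longrightarrow> measure \<mu> {x. \<bar>x $ j - t\<bar> \<le> \<epsilon>} \<le> M * \<epsilon>"
    using assms by (auto simp: slab_ok_def)
  have "measure \<mu> {x. t < x $ j \<and> x $ j < t + \<epsilon>} \<le> measure \<mu> {x. \<bar>x $ j - t\<bar> \<le> \<epsilon>}" for \<epsilon>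
    by (rule \<mu>.finite_measure_mono) auto
  with M show ?thesis by (intro that[of M]) (auto intro: order_trans)
qed

definition slice_limit :: "'n \<Rightarrow> real \<Rightarrow> (real^'n) measure \<Rightarrow> bool" where
  "slice_limit j t \<nu> \<longleftrightarrow> weak_star_conv \<Omega>
     (\<lambda>\<epsilon>. scaled_restr \<mu> (halfsp j t - closure (halfsp j (t + \<epsilon>))) \<epsilon>) \<nu> (at_right 0)"

lemma inverse_Suc_at_right: "filterlim (\<lambda>k. 1 / real (Suc k)) (at_right 0) sequentially"
  using LIMSEQ_inverse_real_of_nat
  by (auto simp: filterlim_at inverse_eq_divide intro!: always_eventually)

text \<open>Compactness only gives a limit \<nu> along a subsequence. On functions constant on cells
  the quotients converge in full, and cell approximation changes a quotient by at most
  \<open>\<eta> * M\<close>, uniformly in \<epsilon>; so the full limit exists and equals the one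
  along the subsequence.\<close>

lemma slice_limit_exists:
  assumes slab: "slab_ok j t"
    and dens: "\<And>N z. \<exists>D. ((\<lambda>\<epsilon>. measure \<mu> (cell N z \<inter> {x. t < x $ j \<and> x $ j < t + \<epsilon>}) / \<epsilon>) \<longlongrightarrow> D) (at_right 0)"
  shows "\<exists>\<nu>. slice_limit j t \<nu>"
proof -
  define B where "B \<epsilon> = {x::real^'n. t < x $ j \<and> x $ j < t + \<epsilon>}" for \<epsilon>
  have B [measurable]: "B \<epsilon> \<in> sets borel" for \<epsilon> unfolding B_def by measurable
  obtain M where M: "M \<ge> 0" "\<And>\<epsilon>. \<epsilon> > 0 \<Longrightarrow> measure \<mu> (B \<epsilon>) \<le> M * \<epsilon>"
    unfolding B_def using slab_ok_slice[OF slab] by blast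
  obtain r \<nu> where r: "strict_mono r"
    and \<nu>: "weak_star_conv \<Omega> (\<lambda>k. scaled_restr \<mu> (B (1 / real (Suc (r k)))) (1 / real (Suc (r k)))) \<nu> sequentially"
  proof (rule weak_star_compactness[OF open_\<Omega>, of "\<lambda>k. scaled_restr \<mu> (B (1 / real (Suc k))) (1 / real (Suc k))" M])
    show "sets (scaled_restr \<mu> (B (1 / real (Suc k))) (1 / real (Suc k))) = sets borel" for k by simp
    show "finite_measure (scaled_restr \<mu> (B (1 / real (Suc k))) (1 / real (Suc k)))" for k
      by (rule finite_scaled_restr) (use finite_\<mu> in auto)
    show "measure (scaled_restr \<mu> (B (1 / real (Suc k))) (1 / real (Suc k))) UNIV \<le> M" for k
      using M(2)[of "1 / real (Suc k)"] by (subst measure_scaled_restr) (auto simp: field_simps)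
  qed auto
  have rl: "filterlim (\<lambda>k. 1 / real (Suc (r k))) (at_right 0) sequentially"
    using filterlim_compose[OF inverse_Suc_at_right filterlim_subseq[OF r]] by simp
  have "((\<lambda>\<epsilon>. LINT x|scaled_restr \<mu> (B \<epsilon>) \<epsilon>. \<psi> x) \<longlongrightarrow> (LINT x|\<nu>. \<psi> x)) (at_right 0)" if \<psi>: "\<psi> \<in> Cc \<Omega>" for \<psi>
  proof (rule tendstoI)
    fix e :: real assume e: "e > 0"
    \<comment> \<open>Each of the three errors, \<open>I\<close> against \<open>J\<close>,
      \<open>J\<close> against \<open>l\<close>, and \<open>l\<close> against the integral for
      \<nu>, is then at most \<open>e / 4\<close>.\<close>
    define \<eta> where "\<eta> = e / (4 * (M + 1))"
    have \<eta>: "\<eta> > 0" "\<eta> * M \<le> e / 4"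
    proof -
      show "\<eta> > 0" using e M(1) by (simp add: \<eta>_def)
      then have "\<eta> * M \<le> \<eta> * (M + 1)" by simp
      also have "\<dots> = e / 4" using M(1) by (simp add: \<eta>_def divide_simps)
      finally show "\<eta> * M \<le> e / 4" .
    qed
    have [measurable]: "\<psi> \<in> borel_measurable borel" by (rule Cc_measurable[OF \<psi>])
    obtain Bd where Bd: "Bd > 0" "\<And>x. \<bar>\<psi> x\<bar> \<le> Bd" using Cc_bounded[OF \<psi>] by blast
    obtain N Z c where c: "finite Z" "\<And>x. \<bar>\<psi> x - (\<Sum>z\<in>Z. c z * indicator (cell N z) x)\<bar> \<le> \<eta>"
      by (rule Cc_cell_approx[OF \<psi> \<eta>(1)]) (rule that)
    define I where "I \<epsilon> = (LINT x|scaled_restr \<mu> (B \<epsilon>) \<epsilon>. \<psi> x)" for \<epsilon>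
    define J where "J \<epsilon> = (\<Sum>z\<in>Z. c z * (measure \<mu> (cell N z \<inter> B \<epsilon>) / \<epsilon>))" for \<epsilon>
    have "\<forall>z. \<exists>D. ((\<lambda>\<epsilon>. measure \<mu> (cell N z \<inter> B \<epsilon>) / \<epsilon>) \<longlongrightarrow> D) (at_right 0)" using dens by (simp add: B_def)
    then obtain D where D: "\<And>z. ((\<lambda>\<epsilon>. measure \<mu> (cell N z \<inter> B \<epsilon>) / \<epsilon>) \<longlongrightarrow> D z) (at_right 0)" by metis
    define l where "l = (\<Sum>z\<in>Z. c z * D z)"
    have J: "(J \<longlongrightarrow> l) (at_right 0)" unfolding J_def l_def by (intro tendsto_sum tendsto_mult tendsto_const D)
    have IJ: "\<bar>I \<epsilon> - J \<epsilon>\<bar> \<le> e / 4" if \<epsilon>: "\<epsilon> > 0" for \<epsilon>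
    proof -
      have i1: "integrable \<mu> (\<lambda>x. indicator (B \<epsilon>) x * \<psi> x)"
      proof (rule \<mu>.integrable_const_bound[where B=Bd])
        show "AE x in \<mu>. norm (indicator (B \<epsilon>) x * \<psi> x) \<le> Bd" using Bd by (auto simp: indicator_def)
      qed measurable
      have ic: "integrable \<mu> (indicator (cell N z \<inter> B \<epsilon>) :: _ \<Rightarrow> real)" for z
        by (rule integrable_real_indicator) (simp_all add: \<mu>.emeasure_eq_measure)
      have i2: "integrable \<mu> (\<lambda>x. \<Sum>z\<in>Z. c z * indicator (cell N z \<inter> B \<epsilon>) x)"
        by (intro Bochner_Integration.integrable_sum integrable_mult_right ic)
      have "(LINT x|\<mu>. (\<Sum>z\<in>Z. c z * indicator (cell N z \<inter> B \<epsilon>) x)) = (\<Sum>z\<in>Z. c z * measure \<mu> (cell N z \<inter> B \<epsilon>))"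
        by (subst Bochner_Integration.integral_sum) (auto intro!: integrable_mult_right ic)
      then have J': "J \<epsilon> = (LINT x|\<mu>. (\<Sum>z\<in>Z. c z * indicator (cell N z \<inter> B \<epsilon>) x)) / \<epsilon>"
        by (simp add: J_def sum_divide_distrib)
      have "I \<epsilon> = (LINT x|\<mu>. indicator (B \<epsilon>) x * \<psi> x) / \<epsilon>"
        unfolding I_def using \<epsilon> by (intro integral_scaled_restr) auto
      then have "I \<epsilon> - J \<epsilon> = (LINT x|\<mu>. indicator (B \<epsilon>) x * \<psi> x - (\<Sum>z\<in>Z. c z * indicator (cell N z \<inter> B \<epsilon>) x)) / \<epsilon>"
        unfolding J' using i1 i2 by (simp add: diff_divide_distrib)
      moreover have "\<bar>LINT x|\<mu>. indicator (B \<epsilon>) x * \<psi> x - (\<Sum>z\<in>Z. c z * indicator (cell N z \<inter> B \<epsilon>) x)\<bar>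
        \<le> (LINT x|\<mu>. \<eta> * indicator (B \<epsilon>) x)"
      proof (rule order_trans[OF integral_abs_bound integral_mono])
        show "integrable \<mu> (\<lambda>x. \<bar>indicator (B \<epsilon>) x * \<psi> x - (\<Sum>z\<in>Z. c z * indicator (cell N z \<inter> B \<epsilon>) x)\<bar>)"
          by (intro integrable_abs Bochner_Integration.integrable_diff i1 i2)
        show "integrable \<mu> (\<lambda>x. \<eta> * indicator (B \<epsilon>) x)"
          by (intro integrable_mult_right integrable_real_indicator) (simp_all add: \<mu>.emeasure_eq_measure)
        show "\<bar>indicator (B \<epsilon>) x * \<psi> x - (\<Sum>z\<in>Z. c z * indicator (cell N z \<inter> B \<epsilon>) x)\<bar> \<le> \<eta> * indicator (B \<epsilon>) x" for x
          using c(2)[of x] by (cases "x \<in> B \<epsilon>") (simp_all add: indicator_inter_arith)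
      qed
      moreover have "(LINT x|\<mu>. \<eta> * indicator (B \<epsilon>) x) \<le> e / 4 * \<epsilon>"
      proof -
        have "(LINT x|\<mu>. \<eta> * indicator (B \<epsilon>) x) = \<eta> * measure \<mu> (B \<epsilon>)" by simp
        also have "\<dots> \<le> \<eta> * (M * \<epsilon>)" using \<eta>(1) M(2)[OF \<epsilon>] by (intro mult_left_mono) auto
        also have "\<dots> = (\<eta> * M) * \<epsilon>" by simp
        also have "\<dots> \<le> e / 4 * \<epsilon>" using \<eta>(2) \<epsilon> by (intro mult_right_mono) auto
        finally show ?thesis .
      qed
      ultimately have "\<bar>I \<epsilon> - J \<epsilon>\<bar> \<le> (e / 4 * \<epsilon>) / \<epsilon>"
        using \<epsilon> by (simp only: abs_divide abs_of_pos) (intro divide_right_mono, auto)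
      then show ?thesis using \<epsilon> by simp
    qed
    have "(\<lambda>k. I (1 / real (Suc (r k)))) \<longlonglongrightarrow> (LINT x|\<nu>. \<psi> x)"
      using \<nu> \<psi> unfolding weak_star_conv_def I_def by blast
    moreover have "(\<lambda>k. J (1 / real (Suc (r k)))) \<longlonglongrightarrow> l" using J rl by (rule filterlim_compose)
    ultimately have "(\<lambda>k. \<bar>I (1 / real (Suc (r k))) - J (1 / real (Suc (r k)))\<bar>) \<longlonglongrightarrow> \<bar>(LINT x|\<nu>. \<psi> x) - l\<bar>"
      by (intro tendsto_intros)
    then have lim: "\<bar>(LINT x|\<nu>. \<psi> x) - l\<bar> \<le> e / 4"
      by (rule tendsto_upperbound) (use IJ in simp_all)
    have "\<forall>\<^sub>F \<epsilon> in at_right 0. dist (J \<epsilon>) l < e / 4" using J e by (intro tendstoD) auto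
    moreover have "\<forall>\<^sub>F \<epsilon> in at_right 0. (0::real) < \<epsilon>" by (auto simp: eventually_at_right_field intro: exI[of _ 1])
    ultimately show "\<forall>\<^sub>F \<epsilon> in at_right 0. dist (LINT x|scaled_restr \<mu> (B \<epsilon>) \<epsilon>. \<psi> x) (LINT x|\<nu>. \<psi> x) < e"
    proof eventually_elim
      case (elim \<epsilon>)
      have "dist (I \<epsilon>) (LINT x|\<nu>. \<psi> x) \<le> \<bar>I \<epsilon> - J \<epsilon>\<bar> + \<bar>J \<epsilon> - l\<bar> + \<bar>(LINT x|\<nu>. \<psi> x) - l\<bar>"
        by (simp add: dist_real_def)
      also have "\<dots> < e" using IJ[OF elim(2)] elim(1) lim e by (simp add: dist_real_def)
      finally show ?case by (simp add: I_def)
    qed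
  qed
  then have "slice_limit j t \<nu>"
    using \<nu> unfolding slice_limit_def weak_star_conv_def halfsp_layer B_def[symmetric] by blast
  then show ?thesis by blast
qed

lemma AE_slice_limit: "AE t in lborel. \<exists>\<nu>. slice_limit j t \<nu>"
proof -
  have "AE t in lborel. \<forall>N (z :: 'n \<Rightarrow> int). \<exists>D. ((\<lambda>\<epsilon>. measure \<mu> (cell N z \<inter> {x. t < x $ j \<and> x $ j < t + \<epsilon>}) / \<epsilon>) \<longlongrightarrow> D) (at_right 0)"
    unfolding AE_all_countable
    by (intro allI AE_slab_density[OF sets_\<mu> finite_\<mu> borel_measurable_vec_nth cell_borel])
  with AE_slab_ok[of j] show ?thesis by eventually_elim (rule slice_limit_exists; blast)
qed

subsection \<open>The flux through half-spaces\<close>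

text \<open>On the boundary of the exhausting set the distance to the frontier of \<Omega> is
  \<delta> or the norm is \<open>1 / \<delta>\<close>. Using the inverse of the norm makes the
  second condition a level \<delta> too, so both slab bounds hold for almost every \<delta>.\<close>

lemma AE_exhaustion_good: "AE \<delta> in lborel. 0 < \<delta> \<longrightarrow> exhaustion \<Omega> \<delta> \<in> O_class_sup \<Omega> \<mu>"
proof -
  let ?g1 = "\<lambda>x. infdist x (frontier \<Omega>)" and ?g2 = "\<lambda>x::real^'n. inverse (norm x)"
  have g: "?g1 \<in> borel_measurable borel" "?g2 \<in> borel_measurable borel"
    by (auto intro!: borel_measurable_continuous_onI continuous_intros)
  from AE_slab_bound[OF sets_\<mu> finite_\<mu> g(1)] AE_slab_bound[OF sets_\<mu> finite_\<mu> g(2)]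
  show ?thesis
  proof eventually_elim
    case (elim \<delta>)
    obtain M1 where M1: "M1 \<ge> 0" "\<And>\<epsilon>. \<epsilon> > 0 \<Longrightarrow> measure \<mu> {x. \<bar>?g1 x - \<delta>\<bar> \<le> \<epsilon>} \<le> M1 * \<epsilon>" using elim(1) by blast
    obtain M2 where M2: "M2 \<ge> 0" "\<And>\<epsilon>. \<epsilon> > 0 \<Longrightarrow> measure \<mu> {x. \<bar>?g2 x - \<delta>\<bar> \<le> \<epsilon>} \<le> M2 * \<epsilon>" using elim(2) by blast
    show ?case
    proof
      assume \<delta>: "0 < \<delta>"
      let ?E = "exhaustion \<Omega> \<delta>"
      \<comment> \<open>The restriction on \<epsilon> keeps points near the sphere of radius
        \<open>1 / \<delta>\<close> at norm at least \<open>1 / (2 * \<delta>)\<close>. There the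
        inverse norm differs from \<delta> by at most
        \<open>\<epsilon> * (\<delta> * (2 * \<delta>))\<close>.\<close>
      have bound: "measure \<mu> (inner_layer ?E \<epsilon>) / \<epsilon> \<le> M1 + M2 * (2 * \<delta>\<^sup>2)" if \<epsilon>: "0 < \<epsilon>" "\<epsilon> < 1 / (2 * \<delta>)" for \<epsilon>
      proof -
        have sub: "inner_layer ?E \<epsilon> \<subseteq> {x. \<bar>?g1 x - \<delta>\<bar> \<le> \<epsilon>} \<union> {x. \<bar>?g2 x - \<delta>\<bar> \<le> 2 * \<delta>\<^sup>2 * \<epsilon>}"
        proof
          fix x assume x: "x \<in> inner_layer ?E \<epsilon>"
          obtain z where z: "z \<in> frontier ?E" "dist x z \<le> \<epsilon>" using inner_layer_near(2)[OF x] by blast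
          have xE: "norm x < 1 / \<delta>" using inner_layer_near(1)[OF x] by (simp add: exhaustion_def)
          from frontier_exhaustion[OF open_\<Omega> \<delta> z(1)]
          show "x \<in> {x. \<bar>?g1 x - \<delta>\<bar> \<le> \<epsilon>} \<union> {x. \<bar>?g2 x - \<delta>\<bar> \<le> 2 * \<delta>\<^sup>2 * \<epsilon>}"
          proof
            assume "frontier \<Omega> \<noteq> {} \<and> infdist z (frontier \<Omega>) = \<delta>"
            then have "\<bar>?g1 x - \<delta>\<bar> \<le> dist x z" using infdist_triangle_abs[of x "frontier \<Omega>" z] by simp
            then show ?thesis using z(2) by simp
          next
            assume nz: "norm z = 1 / \<delta>"
            have "1 / \<delta> - norm x \<le> \<epsilon>" using norm_triangle_sub[of z x] z(2) nz by (simp add: dist_norm norm_minus_commute)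
            moreover from this have nx: "1 / (2 * \<delta>) \<le> norm x" using \<epsilon>(2) by (simp add: field_simps)
            moreover have x0: "norm x > 0" using nx \<delta> by (smt (verit) divide_pos_pos)
            moreover have "(1 / \<delta> - norm x) * (\<delta> / norm x) = inverse (norm x) - \<delta>" using \<delta> x0 by (simp add: field_simps)
            ultimately have "inverse (norm x) - \<delta> \<le> \<epsilon> * (\<delta> / norm x)"
              using \<delta> mult_right_mono[of "1 / \<delta> - norm x" \<epsilon> "\<delta> / norm x"] by simp
            also have "\<dots> \<le> \<epsilon> * (\<delta> * (2 * \<delta>))"
              using \<epsilon>(1) \<delta> nx x0 by (intro mult_left_mono) (auto simp: field_simps)
            finally have "inverse (norm x) - \<delta> \<le> 2 * \<delta>\<^sup>2 * \<epsilon>" by (simp add: power2_eq_square algebra_simps)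
            moreover have "inverse (norm x) \<ge> \<delta>" using xE x0 \<delta> by (simp add: field_simps)
            ultimately show ?thesis by simp
          qed
        qed
        have m [measurable]: "{x. \<bar>?g1 x - \<delta>\<bar> \<le> \<epsilon>} \<in> sets borel" "{x. \<bar>?g2 x - \<delta>\<bar> \<le> 2 * \<delta>\<^sup>2 * \<epsilon>} \<in> sets borel" using g by measurable
        have "measure \<mu> (inner_layer ?E \<epsilon>) \<le> measure \<mu> ({x. \<bar>?g1 x - \<delta>\<bar> \<le> \<epsilon>} \<union> {x. \<bar>?g2 x - \<delta>\<bar> \<le> 2 * \<delta>\<^sup>2 * \<epsilon>})"
          using sub m by (intro \<mu>.finite_measure_mono) auto
        also have "\<dots> \<le> measure \<mu> {x. \<bar>?g1 x - \<delta>\<bar> \<le> \<epsilon>} + measure \<mu> {x. \<bar>?g2 x - \<delta>\<bar> \<le> 2 * \<delta>\<^sup>2 * \<epsilon>}"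
          using m by (intro measure_Un_le) auto
        also have "\<dots> \<le> M1 * \<epsilon> + M2 * (2 * \<delta>\<^sup>2 * \<epsilon>)" using \<epsilon> \<delta> by (intro add_mono M1 M2) auto
        finally show ?thesis using \<epsilon>(1) by (simp add: field_simps)
      qed
      have "\<forall>\<^sub>F \<epsilon> in at_right 0. ereal (measure \<mu> (inner_layer ?E \<epsilon>) / \<epsilon>) \<le> ereal (M1 + M2 * (2 * \<delta>\<^sup>2))"
        unfolding eventually_at_right_field using bound \<delta> by (intro exI[of _ "1 / (2 * \<delta>)"]) auto
      then have "Limsup (at_right 0) (\<lambda>\<epsilon>. ereal (measure \<mu> (inner_layer ?E \<epsilon>) / \<epsilon>)) \<le> ereal (M1 + M2 * (2 * \<delta>\<^sup>2))"
        by (rule Limsup_bounded)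
      also have "\<dots> < \<infinity>" by simp
      finally show "?E \<in> O_class_sup \<Omega> \<mu>"
        using exhaustion_open[OF open_\<Omega>] exhaustion_compactly_inside[OF open_\<Omega> \<delta>] by (simp add: O_class_sup_def)
    qed
  qed
qed

text \<open>The boundary of the intersection lies in the hyperplane or in the frontier of
  \<open>E\<close>, and points near the latter lie in the layer of \<open>E\<close> of double width.
  A finite limsup controls that layer at all small widths, among them \<open>2 / Suc k\<close>; a
  finite liminf would not.\<close>

lemma thin_halfsp_Int:
  assumes E: "E \<in> O_class_sup \<Omega> \<mu>" and t: "slab_ok j t"
  shows "thin (halfsp j t \<inter> E)"
proof -
  have opE: "open E" and ciE: "compactly_inside E \<Omega>"
    and ls: "Limsup (at_right 0) (\<lambda>\<epsilon>. ereal (measure \<mu> (inner_layer E \<epsilon>) / \<epsilon>)) < \<infinity>"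
    using E by (auto simp: O_class_sup_def)
  obtain n :: nat where "Limsup (at_right 0) (\<lambda>\<epsilon>. ereal (measure \<mu> (inner_layer E \<epsilon>) / \<epsilon>)) < ereal (real n)"
    using ls less_PInf_Ex_of_nat by auto
  then have ev: "\<forall>\<^sub>F \<epsilon> in at_right 0. ereal (measure \<mu> (inner_layer E \<epsilon>) / \<epsilon>) < ereal (real n)"
    by (rule Limsup_lessD)
  have "filterlim (\<lambda>k. 2 * (1 / real (Suc k))) (at_right 0) sequentially"
    using tendsto_mult[OF tendsto_const[of "2::real"] LIMSEQ_inverse_real_of_nat]
    by (auto simp: filterlim_at inverse_eq_divide intro!: always_eventually)
  from eventually_compose_filterlim[OF ev this]
  have ev2: "\<forall>\<^sub>F k in sequentially. measure \<mu> (inner_layer E (2 * (1 / real (Suc k)))) \<le> 2 * real n / real (Suc k)"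
    by eventually_elim (simp add: field_simps)
  obtain M where M: "M \<ge> 0" "\<And>\<epsilon>. \<epsilon> > 0 \<Longrightarrow> measure \<mu> {x. \<bar>x $ j - t\<bar> \<le> \<epsilon>} \<le> M * \<epsilon>"
    using t by (auto simp: slab_ok_def)
  have sub: "inner_layer (halfsp j t \<inter> E) \<epsilon> \<subseteq> {x. \<bar>x $ j - t\<bar> \<le> \<epsilon>} \<union> inner_layer E (2 * \<epsilon>)" if "\<epsilon> > 0" for \<epsilon>
  proof
    fix x assume x: "x \<in> inner_layer (halfsp j t \<inter> E) \<epsilon>"
    obtain z where z: "z \<in> frontier (halfsp j t \<inter> E)" "dist x z \<le> \<epsilon>" using inner_layer_near(2)[OF x] by blast
    then have "z \<in> frontier (halfsp j t) \<or> z \<in> frontier E" using frontier_Int_subset[of "halfsp j t" E] by auto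
    then show "x \<in> {x. \<bar>x $ j - t\<bar> \<le> \<epsilon>} \<union> inner_layer E (2 * \<epsilon>)"
    proof
      assume "z \<in> frontier (halfsp j t)"
      then have "\<bar>x $ j - t\<bar> \<le> dist x z" using dist_vec_nth_le[of x j z] by (simp add: frontier_halfsp dist_real_def)
      then show ?thesis using z(2) by simp
    next
      assume "z \<in> frontier E"
      then have "x \<in> inner_layer E (2 * \<epsilon>)"
        using inner_layer_near(1)[OF x] z(2) that by (intro near_frontier_in_layer[of x E z \<epsilon>]) auto
      then show ?thesis by simp
    qed
  qed
  have "\<forall>\<^sub>F k in sequentially. measure \<mu> (inner_layer (halfsp j t \<inter> E) (1 / real (Suc k))) \<le> (M + 2 * real n) / real (Suc k)"
    using ev2
  proof eventually_elim
    case (elim k)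
    let ?\<epsilon> = "1 / real (Suc k)"
    have e: "?\<epsilon> > 0" by simp
    have "measure \<mu> (inner_layer (halfsp j t \<inter> E) ?\<epsilon>) \<le> measure \<mu> ({x. \<bar>x $ j - t\<bar> \<le> ?\<epsilon>} \<union> inner_layer E (2 * ?\<epsilon>))"
      using sub[OF e] inner_layer_borel[OF opE] by (intro \<mu>.finite_measure_mono) auto
    also have "\<dots> \<le> measure \<mu> {x. \<bar>x $ j - t\<bar> \<le> ?\<epsilon>} + measure \<mu> (inner_layer E (2 * ?\<epsilon>))"
      using inner_layer_borel[OF opE] by (intro measure_Un_le) auto
    also have "\<dots> \<le> M * ?\<epsilon> + 2 * real n / real (Suc k)" using M(2)[OF e] elim by simp
    also have "\<dots> = (M + 2 * real n) / real (Suc k)" by (simp add: add_divide_distrib)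
    finally show ?case .
  qed
  from eventually_bound_all[OF this] show ?thesis
    unfolding thin_def using opE open_halfsp[of j t] compactly_inside_subset[OF ciE, of "halfsp j t \<inter> E"] by auto
qed

definition half :: "'n \<Rightarrow> real \<Rightarrow> (real^'n) set \<Rightarrow> (real^'n) set" where
  "half j t E = halfsp j t \<inter> E"

lemma open_O_sup: "E \<in> O_class_sup \<Omega> \<mu> \<Longrightarrow> open E"
  by (simp add: O_class_sup_def)

lemma Int_frontier_half: "open E \<Longrightarrow> E \<inter> frontier (half j t E) = E \<inter> {x. x $ j = t}"
  using Int_frontier_Int[of E "halfsp j t"] open_halfsp[of j t]
  by (simp add: half_def frontier_halfsp Int_commute)

lemma hyperplane_borel [measurable]: "{x::real^'n. x $ j = t} \<in> sets borel"
  by measurable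

text \<open>Away from the frontier of \<open>E\<close>, the layer of \<open>half j t E\<close> is
  part of a slice above the hyperplane. Against functions supported in \<open>E\<close> the layer
  limit is therefore at most \<nu>, and this comparison passes to Borel subsets of
  \<open>E\<close>.\<close>

lemma half_flux_dominated:
  assumes E: "E \<in> O_class_sup \<Omega> \<mu>" and t: "slab_ok j t" and \<nu>: "slice_limit j t \<nu>"
    and S: "S \<in> sets borel" "S \<subseteq> E" "S \<subseteq> {x. x $ j = t}"
  shows "\<bar>\<F> (half j t E) S\<bar> \<le> measure \<nu> S"
proof -
  have U: "thin (half j t E)" unfolding half_def by (rule thin_halfsp_Int[OF E t])
  have opE: "open E" by (rule open_O_sup[OF E])
  have E\<Omega>: "E \<subseteq> \<Omega>" using E closure_subset[of E] by (auto simp: O_class_sup_def compactly_inside_def)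
  obtain r \<nu>' where L: "layer_limit (half j t E) r \<nu>'" using layer_limit_exists[OF U] by blast
  note n' = finite_radon_onD[OF layer_limit_radon[OF L]]
  have "finite_radon_on \<Omega> \<nu>" using \<nu> by (simp add: slice_limit_def weak_star_conv_def)
  note n = finite_radon_onD[OF this]
  have "S \<subseteq> frontier (half j t E)" using Int_frontier_half[OF opE, of j t] S by auto
  then have "\<bar>\<F> (half j t E) S\<bar> \<le> measure \<nu>' S" by (rule layer_limit_bound[OF U L S(1)])
  also have "\<dots> \<le> measure \<nu> S"
  proof (rule measure_le_of_integrals_le[OF opE n'(1,3) n(1,3) _ S(1,2)])
    fix \<psi> assume \<psi>: "\<psi> \<in> Cc E" "\<And>x. 0 \<le> \<psi> x \<and> \<psi> x \<le> 1"
    have \<psi>\<Omega>: "\<psi> \<in> Cc \<Omega>" using E\<Omega> \<psi>(1) by (rule Cc_mono)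
    have [measurable]: "\<psi> \<in> borel_measurable borel" by (rule Cc_measurable[OF \<psi>(1)])
    have "compact (closure {x. \<psi> x \<noteq> 0})" "closure {x. \<psi> x \<noteq> 0} \<subseteq> E"
      using \<psi>(1) by (auto simp: Cc_def compactly_inside_def)
    then obtain \<rho> where \<rho>: "\<rho> > 0" "(\<Union>x\<in>closure {x. \<psi> x \<noteq> 0}. ball x \<rho>) \<subseteq> E"
      using compact_subset_open_imp_ball_epsilon_subset[OF _ opE] by metis
    define B where "B \<epsilon> = {x::real^'n. t < x $ j \<and> x $ j < t + \<epsilon>}" for \<epsilon>
    have B [measurable]: "B \<epsilon> \<in> sets borel" for \<epsilon> unfolding B_def by measurable
    have [measurable]: "inner_layer (half j t E) \<epsilon> \<in> sets borel" for \<epsilon>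
      using U by (intro inner_layer_borel) (simp add: thin_def)
    define I where "I \<epsilon> = (LINT x|scaled_restr \<mu> (B \<epsilon>) \<epsilon>. \<psi> x)" for \<epsilon>
    have Ilim: "(I \<longlongrightarrow> (LINT x|\<nu>. \<psi> x)) (at_right 0)"
      using \<nu> \<psi>\<Omega> unfolding slice_limit_def weak_star_conv_def I_def halfsp_layer B_def[symmetric] by blast
    \<comment> \<open>Points of the layer satisfy \<open>x $ j - t \<le> \<epsilon>\<close>, whereas
      the slice \<open>B\<close> is open on the far side; the factor \<open>1 + \<theta>\<close>
      makes room and is removed at the end.\<close>
    have in_slice: "x \<in> B ((1 + \<theta>) * \<epsilon>)"
      if x: "x \<in> inner_layer (half j t E) \<epsilon>" and nz: "\<psi> x \<noteq> 0" and \<epsilon>: "0 < \<epsilon>" "\<epsilon> < \<rho>" and \<theta>: "0 < \<theta>" for x \<theta> \<epsilon>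
    proof -
      have xU: "x \<in> half j t E" by (rule inner_layer_near(1)[OF x])
      obtain z where z: "z \<in> frontier (half j t E)" "dist x z \<le> \<epsilon>" using inner_layer_near(2)[OF x] by blast
      have "x \<in> closure {x. \<psi> x \<noteq> 0}" using nz closure_subset[of "{x. \<psi> x \<noteq> 0}"] by auto
      moreover have "z \<in> ball x \<rho>" using z(2) \<epsilon> by simp
      ultimately have "z \<in> E" using \<rho>(2) by blast
      then have "z $ j = t" using Int_frontier_half[OF opE, of j t] z(1) by auto
      then have "x $ j - t \<le> \<epsilon>" using dist_vec_nth_le[of x j z] z(2) by (simp add: dist_real_def)
      moreover have "\<epsilon> < (1 + \<theta>) * \<epsilon>" using \<epsilon>(1) \<theta> by simp
      ultimately have "x $ j < t + (1 + \<theta>) * \<epsilon>" by linarith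
      then show ?thesis using xU by (simp add: B_def half_def halfsp_def)
    qed
    have le: "(LINT x|\<nu>'. \<psi> x) \<le> (1 + \<theta>) * (LINT x|\<nu>. \<psi> x)" if \<theta>: "\<theta> > 0" for \<theta>
    proof (rule tendsto_le[OF _ _ layer_limit_integral[OF U L \<psi>\<Omega>]])
      have r: "strict_mono r" using L by (simp add: layer_limit_def)
      have el: "filterlim (\<lambda>k. 1 / real (Suc (r k))) (at_right 0) sequentially"
        using filterlim_compose[OF inverse_Suc_at_right filterlim_subseq[OF r]] by simp
      have tl: "filterlim (\<lambda>\<epsilon>. (1 + \<theta>) * \<epsilon>) (at_right 0) (at_right (0::real))"
        using \<theta> by (simp add: filterlim_at eventually_at_right_field tendsto_mult_right_zero)
          (intro conjI tendsto_mult_right_zero tendsto_ident_at exI[of _ 1], auto)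
      have "(\<lambda>k. (1 + \<theta>) * I ((1 + \<theta>) * (1 / real (Suc (r k))))) \<longlonglongrightarrow> (1 + \<theta>) * (LINT x|\<nu>. \<psi> x)"
        by (intro tendsto_mult tendsto_const filterlim_compose[OF Ilim filterlim_compose[OF tl el]])
      then show "(\<lambda>k. (1 + \<theta>) * I ((1 + \<theta>) * (1 / real (Suc (r k))))) \<longlonglongrightarrow> (1 + \<theta>) * (LINT x|\<nu>. \<psi> x)" .
      have "\<forall>\<^sub>F \<epsilon> in at_right 0. \<epsilon> < \<rho> \<and> 0 < \<epsilon>"
        using \<rho>(1) by (auto simp: eventually_at_right_field intro: exI[of _ \<rho>])
      from eventually_compose_filterlim[OF this el]
      show "\<forall>\<^sub>F k in sequentially. (LINT x|\<mu>. indicator (inner_layer (half j t E) (1 / real (Suc (r k)))) x * \<psi> x) * real (Suc (r k))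
         \<le> (1 + \<theta>) * I ((1 + \<theta>) * (1 / real (Suc (r k))))"
      proof eventually_elim
        case (elim k)
        let ?\<epsilon> = "1 / real (Suc (r k))"
        have pos: "(1 + \<theta>) * ?\<epsilon> > 0" using elim \<theta> by simp
        have "(LINT x|\<mu>. indicator (inner_layer (half j t E) ?\<epsilon>) x * \<psi> x) \<le> (LINT x|\<mu>. indicator (B ((1 + \<theta>) * ?\<epsilon>)) x * \<psi> x)"
        proof (rule integral_mono)
          have bi: "integrable \<mu> (\<lambda>x. indicator C x * \<psi> x)" if [measurable]: "C \<in> sets borel" for C
          proof (rule \<mu>.integrable_const_bound[where B=1])
            show "AE x in \<mu>. norm (indicator C x * \<psi> x) \<le> 1" using \<psi>(2) by (auto simp: indicator_def)
          qed measurable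
          show "integrable \<mu> (\<lambda>x. indicator (inner_layer (half j t E) ?\<epsilon>) x * \<psi> x)" by (rule bi) measurable
          show "integrable \<mu> (\<lambda>x. indicator (B ((1 + \<theta>) * ?\<epsilon>)) x * \<psi> x)" by (rule bi) measurable
          show "indicator (inner_layer (half j t E) ?\<epsilon>) x * \<psi> x \<le> indicator (B ((1 + \<theta>) * ?\<epsilon>)) x * \<psi> x" for x
            using in_slice[of x ?\<epsilon> \<theta>] elim \<theta> \<psi>(2)[of x] by (cases "\<psi> x = 0") (auto simp: indicator_def)
        qed
        also have "\<dots> = I ((1 + \<theta>) * ?\<epsilon>) * ((1 + \<theta>) * ?\<epsilon>)"
          unfolding I_def using pos by (subst integral_scaled_restr) auto
        finally have "(LINT x|\<mu>. indicator (inner_layer (half j t E) ?\<epsilon>) x * \<psi> x) * real (Suc (r k)) \<le> I ((1 + \<theta>) * ?\<epsilon>) * ((1 + \<theta>) * ?\<epsilon>) * real (Suc (r k))"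
          by (rule mult_right_mono) simp
        also have "\<dots> = (1 + \<theta>) * I ((1 + \<theta>) * ?\<epsilon>)" by simp
        finally show ?case .
      qed
    qed simp
    have nn: "0 \<le> (LINT x|\<nu>. \<psi> x)" using \<psi>(2) by simp
    show "(LINT x|\<nu>'. \<psi> x) \<le> (LINT x|\<nu>. \<psi> x)"
    proof (rule field_le_epsilon)
      fix e :: real assume e: "e > 0"
      \<comment> \<open>\<theta> is chosen so that its product with the integral of \<psi> stays
        below \<open>e\<close>; the summand 1 covers a vanishing integral.\<close>
      have "(LINT x|\<nu>'. \<psi> x) \<le> (1 + e / ((LINT x|\<nu>. \<psi> x) + 1)) * (LINT x|\<nu>. \<psi> x)"
        using e nn by (intro le) simp
      also have "\<dots> = (LINT x|\<nu>. \<psi> x) + e * ((LINT x|\<nu>. \<psi> x) / ((LINT x|\<nu>. \<psi> x) + 1))" by (simp add: distrib_right)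
      also have "\<dots> \<le> (LINT x|\<nu>. \<psi> x) + e * 1"
        using e nn by (intro add_left_mono mult_left_mono) (auto simp: divide_le_eq_1)
      finally show "(LINT x|\<nu>'. \<psi> x) \<le> (LINT x|\<nu>. \<psi> x) + e" by simp
    qed
  qed
  finally show ?thesis .
qed

text \<open>Locality compares fluxes on open sets. Boxes inside \<open>E1\<close> are enough, since
  two measures that agree on them agree on all Borel subsets of \<open>E1\<close>.\<close>

lemma half_flux_consistent:
  assumes E: "E1 \<in> O_class_sup \<Omega> \<mu>" "E2 \<in> O_class_sup \<Omega> \<mu>" "E1 \<subseteq> E2" and t: "slab_ok j t"
    and S: "S \<in> sets borel" "S \<subseteq> E1" "S \<subseteq> {x. x $ j = t}"
  shows "\<F> (half j t E1) S = \<F> (half j t E2) S"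
proof -
  have th: "thin (half j t E1)" "thin (half j t E2)" unfolding half_def by (auto intro!: thin_halfsp_Int E t)
  have op: "open E1" "open E2" using E by (auto intro: open_O_sup)
  have fr: "S \<inter> frontier (half j t E1) = S" "S \<inter> frontier (half j t E2) = S"
  proof -
    have "S \<subseteq> E1 \<inter> {x. x $ j = t}" "S \<subseteq> E2 \<inter> {x. x $ j = t}" using S E(3) by auto
    then show "S \<inter> frontier (half j t E1) = S" "S \<inter> frontier (half j t E2) = S"
      unfolding Int_frontier_half[OF op(1), of j t, symmetric] Int_frontier_half[OF op(2), of j t, symmetric] by blast+
  qed
  have "total_flux (half j t E1) S = total_flux (half j t E2) S"
  proof (rule fvm_eq_on_boxes[OF _ _ op(1) _ S(1,2)])
    show "fvm E1 (total_flux (half j t E1))" "fvm E1 (total_flux (half j t E2))"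
      by (auto intro!: fvm_subset[OF total_flux_fvm] th)
    fix a b assume "cbox a b \<subseteq> E1"
    then have "box a b \<subseteq> E1" using box_subset_cbox[of a b] by (rule subset_trans[rotated])
    then show "total_flux (half j t E1) (box a b) = total_flux (half j t E2) (box a b)"
      using E(3) by (intro total_flux_local' th) (auto simp: half_def)
  qed
  then show ?thesis by (simp add: total_flux_def fr)
qed

lemma exhausting_sequence:
  shows "\<exists>d :: nat \<Rightarrow> real. (\<forall>k. 0 < d k) \<and> (\<forall>k. exhaustion \<Omega> (d k) \<in> O_class_sup \<Omega> \<mu>) \<and> (\<Union>k. exhaustion \<Omega> (d k)) = \<Omega>"
proof -
  have AE: "AE \<delta> in lebesgue. 0 < \<delta> \<longrightarrow> exhaustion \<Omega> \<delta> \<in> O_class_sup \<Omega> \<mu>"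
    using AE_exhaustion_good by (rule AE_completion)
  have "\<forall>k::nat. \<exists>\<delta>. 0 < \<delta> \<and> \<delta> < 1 / Suc k \<and> (0 < \<delta> \<longrightarrow> exhaustion \<Omega> \<delta> \<in> O_class_sup \<Omega> \<mu>)"
    by (intro allI AE_lborel_small[OF AE]) simp
  then obtain d where d: "\<And>k. 0 < d k" "\<And>k. d k < 1 / Suc k" "\<And>k. exhaustion \<Omega> (d k) \<in> O_class_sup \<Omega> \<mu>" by metis
  have "(\<Union>k. exhaustion \<Omega> (d k)) = \<Omega>"
  proof (intro equalityI UN_least subsetI)
    fix x assume "x \<in> \<Omega>"
    then obtain r where r: "r > 0" "\<And>\<delta>. 0 < \<delta> \<Longrightarrow> \<delta> < r \<Longrightarrow> x \<in> exhaustion \<Omega> \<delta>"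
      using exhaustion_covers[OF open_\<Omega>] by metis
    obtain k where "1 / Suc k < r" using r(1) nat_approx_posE by auto
    then have "x \<in> exhaustion \<Omega> (d k)" using d(1,2)[of k] by (intro r(2)) auto
    then show "x \<in> (\<Union>k. exhaustion \<Omega> (d k))" by blast
  qed (auto simp: exhaustion_def inner_set_def)
  with d show ?thesis by blast
qed

text \<open>The local fluxes are glued along a disjoint decomposition of \<Omega> coming from an
  exhausting sequence; domination by \<nu> makes the series converge. Consistency on overlaps shows
  that the result extends the local flux for every admissible \<delta>, also those outside the
  sequence.\<close>

lemma halfspace_flux_exists:
  assumes t: "slab_ok j t" and \<nu>: "slice_limit j t \<nu>"
  shows "\<exists>m. is_halfspace_flux \<Omega> \<F> \<mu> j t m"
proof -
  obtain d :: "nat \<Rightarrow> real" where d: "\<And>k. 0 < d k" "\<And>k. exhaustion \<Omega> (d k) \<in> O_class_sup \<Omega> \<mu>" "(\<Union>k. exhaustion \<Omega> (d k)) = \<Omega>"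
    using exhausting_sequence by auto
  define E where "E k = exhaustion \<Omega> (d k)" for k
  let ?H = "{x::real^'n. x $ j = t}"
  have Eb [measurable]: "E k \<in> sets borel" for k unfolding E_def by (intro borel_open exhaustion_open open_\<Omega>)
  have Db [measurable]: "disjointed E k \<in> sets borel" for k by (simp add: disjointed_def)
  have "finite_radon_on \<Omega> \<nu>" using \<nu> by (simp add: slice_limit_def weak_star_conv_def)
  note n = finite_radon_onD[OF this]
  interpret N: finite_measure \<nu> by (rule n(3))
  define m where "m S = (\<Sum>k. \<F> (half j t (E k)) (S \<inter> disjointed E k))" for S
  have UD: "(\<Union>k. disjointed E k) = \<Omega>" using UN_disjointed_eq[of E] d(3) by (simp add: E_def)
  have b: "\<bar>\<F> (half j t (E k)) (S \<inter> disjointed E k)\<bar> \<le> measure \<nu> (S \<inter> disjointed E k)"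
    if "S \<in> sets borel" "S \<subseteq> ?H" for S k
    unfolding E_def
    by (rule half_flux_dominated[OF d(2) t \<nu>]) (use that disjointed_subset[of E k] in \<open>auto simp: E_def[symmetric]\<close>)
  have s\<nu>: "(\<lambda>k. measure \<nu> (S \<inter> disjointed E k)) sums measure \<nu> S" if S: "S \<in> sets borel" "S \<subseteq> \<Omega>" for S
  proof -
    have "(\<lambda>k. measure \<nu> (S \<inter> disjointed E k)) sums measure \<nu> (\<Union>k. S \<inter> disjointed E k)"
      using S n(1) by (intro N.finite_measure_UNION disjoint_family_subset[OF disjoint_family_disjointed[of E]]) auto
    moreover have "(\<Union>k. S \<inter> disjointed E k) = S" using UD S(2) by blast
    ultimately show ?thesis by simp
  qed
  have sm: "summable (\<lambda>k. \<F> (half j t (E k)) (S \<inter> disjointed E k))" if S: "S \<in> sets borel" "S \<subseteq> \<Omega> \<inter> ?H" for S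
    by (rule summable_comparison_test'[of "\<lambda>k. measure \<nu> (S \<inter> disjointed E k)" 0])
       (use s\<nu>[of S] b[of S] S in \<open>auto simp: sums_iff\<close>)
  have dom: "\<bar>m S\<bar> \<le> measure \<nu> S" if S: "S \<in> sets borel" "S \<subseteq> \<Omega> \<inter> ?H" for S
  proof -
    have sa: "summable (\<lambda>k. \<bar>\<F> (half j t (E k)) (S \<inter> disjointed E k)\<bar>)"
      by (rule summable_comparison_test'[of "\<lambda>k. measure \<nu> (S \<inter> disjointed E k)" 0])
         (use s\<nu>[of S] b[of S] S in \<open>auto simp: sums_iff\<close>)
    have "\<bar>m S\<bar> \<le> (\<Sum>k. \<bar>\<F> (half j t (E k)) (S \<inter> disjointed E k)\<bar>)"
      unfolding m_def by (rule summable_rabs[OF sa])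
    also have "\<dots> \<le> (\<Sum>k. measure \<nu> (S \<inter> disjointed E k))"
      by (rule suminf_le[OF _ sa]) (use s\<nu>[of S] b[of S] S in \<open>auto simp: sums_iff\<close>)
    also have "\<dots> = measure \<nu> S" using s\<nu>[of S] S by (simp add: sums_iff)
    finally show ?thesis .
  qed
  have Ufvm: "fvm UNIV (total_flux (half j t (exhaustion \<Omega> \<delta>)))" if "exhaustion \<Omega> \<delta> \<in> O_class_sup \<Omega> \<mu>" for \<delta>
    unfolding half_def by (intro total_flux_fvm thin_halfsp_Int that t)
  have tot: "total_flux (half j t (exhaustion \<Omega> \<delta>)) S = \<F> (half j t (exhaustion \<Omega> \<delta>)) S"
    if "S \<subseteq> exhaustion \<Omega> \<delta>" "S \<subseteq> ?H" for S \<delta>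
  proof -
    have "S \<inter> frontier (half j t (exhaustion \<Omega> \<delta>)) = S"
      using Int_frontier_half[OF exhaustion_open[OF open_\<Omega>, of \<delta>], of j t] that by auto
    then show ?thesis by (simp add: total_flux_def)
  qed
  have add: "m (A \<union> B) = m A + m B" if A: "A \<in> sets borel" "B \<in> sets borel" "A \<subseteq> \<Omega> \<inter> ?H" "B \<subseteq> \<Omega> \<inter> ?H" "A \<inter> B = {}" for A B
  proof -
    have "\<F> (half j t (E k)) ((A \<union> B) \<inter> disjointed E k) =
      \<F> (half j t (E k)) (A \<inter> disjointed E k) + \<F> (half j t (E k)) (B \<inter> disjointed E k)" for k
    proof -
      have sub: "disjointed E k \<subseteq> exhaustion \<Omega> (d k)" using disjointed_subset[of E k] by (simp add: E_def)
      have "total_flux (half j t (E k)) (A \<inter> disjointed E k \<union> B \<inter> disjointed E k) =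
        total_flux (half j t (E k)) (A \<inter> disjointed E k) + total_flux (half j t (E k)) (B \<inter> disjointed E k)"
        using A by (intro fvm_Un[OF Ufvm[OF d(2)[of k], folded E_def]]) auto
      moreover have "(A \<union> B) \<inter> disjointed E k = A \<inter> disjointed E k \<union> B \<inter> disjointed E k" by auto
      ultimately show ?thesis
        using A sub by (subst (1 2 3) tot[of _ "d k", folded E_def, symmetric]) (auto simp: E_def)
    qed
    then show ?thesis unfolding m_def using sm[OF A(1,3)] sm[OF A(2,4)] by (simp add: suminf_add)
  qed
  have agree: "m S = \<F> (half j t (exhaustion \<Omega> \<delta>)) S"
    if \<delta>: "0 < \<delta>" "exhaustion \<Omega> \<delta> \<in> O_class_sup \<Omega> \<mu>" and S: "S \<in> sets borel" "S \<subseteq> exhaustion \<Omega> \<delta> \<inter> ?H" for S \<delta>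
  proof -
    let ?T = "total_flux (half j t (exhaustion \<Omega> \<delta>))"
    have S\<Omega>: "S \<subseteq> \<Omega>" using S by (auto simp: exhaustion_def inner_set_def)
    have eq: "?T (S \<inter> disjointed E k) = \<F> (half j t (E k)) (S \<inter> disjointed E k)" for k
    proof -
      have sub: "S \<inter> disjointed E k \<subseteq> exhaustion \<Omega> \<delta>" "S \<inter> disjointed E k \<subseteq> E k" "S \<inter> disjointed E k \<subseteq> ?H"
        "S \<inter> disjointed E k \<in> sets borel"
        using S disjointed_subset[of E k] by auto
      have "\<F> (half j t (exhaustion \<Omega> \<delta>)) (S \<inter> disjointed E k) = \<F> (half j t (E k)) (S \<inter> disjointed E k)"
      \<comment> \<open>Exhausting sets are nested, and the smaller parameter belongs to the larger
        set.\<close>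
      proof (cases "\<delta> \<le> d k")
        case True
        show ?thesis
          using half_flux_consistent[OF d(2)[of k] \<delta>(2) exhaustion_antimono[OF \<delta>(1) True] t sub(4) _ sub(3)] sub(2)
          by (simp add: E_def)
      next
        case False
        then have "d k \<le> \<delta>" by simp
        from half_flux_consistent[OF \<delta>(2) d(2)[of k] exhaustion_antimono[OF d(1) this] t sub(4,1,3)]
        show ?thesis by (simp add: E_def)
      qed
      then show ?thesis using tot[OF sub(1,3)] by simp
    qed
    have "(\<lambda>k. ?T (S \<inter> disjointed E k)) sums ?T (\<Union>k. S \<inter> disjointed E k)"
      using S by (intro fvmD[OF Ufvm[OF \<delta>(2)]] disjoint_family_subset[OF disjoint_family_disjointed[of E]]) auto
    moreover have "(\<Union>k. S \<inter> disjointed E k) = S" using UD S\<Omega> by blast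
    ultimately have "?T S = m S" by (simp add: eq m_def sums_iff)
    then show ?thesis using tot[of S \<delta>] S by simp
  qed
  have "is_halfspace_flux \<Omega> \<F> \<mu> j t m"
    unfolding is_halfspace_flux_def frontier_halfsp
  proof (intro conjI exI[of _ \<nu>])
    show "fvm (\<Omega> \<inter> ?H) m"
      by (rule fvm_dominatedI[OF _ n(1,3)]) (use add dom in auto)
    show "weak_star_conv \<Omega> (\<lambda>\<epsilon>. scaled_restr \<mu> (halfsp j t - closure (halfsp j (t + \<epsilon>))) \<epsilon>) \<nu> (at_right 0)"
      using \<nu> by (simp add: slice_limit_def)
    show "\<forall>S\<in>sets borel. S \<subseteq> \<Omega> \<inter> ?H \<longrightarrow> \<bar>m S\<bar> \<le> measure \<nu> S" using dom by blast
    show "AE \<delta> in lebesgue. 0 < \<delta> \<and> exhaustion \<Omega> \<delta> \<in> O_class_sup \<Omega> \<mu> \<longrightarrow>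
        (\<forall>S\<in>sets borel. S \<subseteq> exhaustion \<Omega> \<delta> \<inter> ?H \<longrightarrow> m S = \<F> (halfsp j t \<inter> exhaustion \<Omega> \<delta>) S)"
      using agree by (intro AE_I2) (simp add: half_def)
  qed
  then show ?thesis by blast
qed

end

subsection \<open>Fluxes through the faces of a box\<close>

lemma frontier_box_vec:
  fixes a b :: "real^'n::finite"
  assumes "z \<in> frontier (box a b)"
  shows "z \<in> cbox a b" "\<exists>i. z $ i = a $ i \<or> z $ i = b $ i"
proof -
  have ne: "box a b \<noteq> {}" using assms by auto
  then have "z \<in> cbox a b" "z \<notin> box a b" using assms by (auto simp: frontier_box)
  then show "z \<in> cbox a b" by simp
  from \<open>z \<notin> box a b\<close> obtain i where i: "\<not> (a $ i < z $ i \<and> z $ i < b $ i)" by (auto simp: mem_box_vec)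
  have "a $ i \<le> z $ i \<and> z $ i \<le> b $ i" using \<open>z \<in> cbox a b\<close> by (simp add: mem_cbox_vec)
  then have "z $ i = a $ i \<or> z $ i = b $ i" using i by linarith
  then show "\<exists>i. z $ i = a $ i \<or> z $ i = b $ i" by blast
qed

lemma inner_layer_box:
  fixes a b :: "real^'n::finite"
  shows "inner_layer (box a b) \<epsilon> \<subseteq> (\<Union>i. {x. \<bar>x $ i - a $ i\<bar> \<le> \<epsilon>} \<union> {x. \<bar>x $ i - b $ i\<bar> \<le> \<epsilon>})"
proof
  fix x assume x: "x \<in> inner_layer (box a b) \<epsilon>"
  obtain z where z: "z \<in> frontier (box a b)" "dist x z \<le> \<epsilon>" using inner_layer_near(2)[OF x] by blast
  obtain i where i: "z $ i = a $ i \<or> z $ i = b $ i" using frontier_box_vec(2)[OF z(1)] by blast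
  have "\<bar>x $ i - z $ i\<bar> \<le> \<epsilon>" using dist_vec_nth_le[of x i z] z(2) by (simp add: dist_real_def)
  then have "x \<in> {x. \<bar>x $ i - a $ i\<bar> \<le> \<epsilon>} \<union> {x. \<bar>x $ i - b $ i\<bar> \<le> \<epsilon>}" using i by auto
  then show "x \<in> (\<Union>i. {x. \<bar>x $ i - a $ i\<bar> \<le> \<epsilon>} \<union> {x. \<bar>x $ i - b $ i\<bar> \<le> \<epsilon>})" by blast
qed

text \<open>A translation along the diagonal: for \<open>h > 0\<close>, \<open>x\<close> and
  \<open>shift x h\<close> are opposite corners of a cube of side \<open>h\<close>.\<close>

definition shift :: "real^'n::finite \<Rightarrow> real \<Rightarrow> real^'n" where
  "shift x h = (\<chi> i. x $ i + h)"

context flux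
begin

text \<open>The mass of \<open>\<mu>\<close> in thin slabs around \<open>{x\<^sub>i = t}\<close>, relative to their width, does not
  concentrate at the edge \<open>{x\<^sub>i = t, x\<^sub>j = s}\<close>.\<close>

definition edge_ok :: "'n \<Rightarrow> 'n \<Rightarrow> real \<Rightarrow> real \<Rightarrow> bool" where
  "edge_ok i j t s \<longleftrightarrow> (\<forall>n::nat. \<exists>r::nat. \<exists>k0::nat. \<forall>k\<ge>k0.
     measure \<mu> {x. \<bar>x $ i - t\<bar> \<le> 1 / real (Suc k) \<and> \<bar>x $ j - s\<bar> < 1 / real (Suc r)} \<le> 1 / (real (Suc n) * real (Suc k)))"

definition good_box :: "real^'n \<Rightarrow> real^'n \<Rightarrow> bool" where
  "good_box a b \<longleftrightarrow> (\<forall>i. a $ i < b $ i) \<and> cbox a b \<subseteq> \<Omega> \<and> (\<forall>i. slab_ok i (a $ i) \<and> slab_ok i (b $ i))"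

lemma good_box_thin:
  assumes "good_box a b" shows "thin (box a b)"
proof -
  have "\<forall>i. \<exists>M. \<forall>\<epsilon>>0. measure \<mu> {x. \<bar>x $ i - a $ i\<bar> \<le> \<epsilon>} \<le> M * \<epsilon>"
    "\<forall>i. \<exists>M. \<forall>\<epsilon>>0. measure \<mu> {x. \<bar>x $ i - b $ i\<bar> \<le> \<epsilon>} \<le> M * \<epsilon>"
    using assms unfolding good_box_def slab_ok_def by blast+
  then obtain Ma Mb where M: "\<And>i \<epsilon>. \<epsilon> > 0 \<Longrightarrow> measure \<mu> {x. \<bar>x $ i - a $ i\<bar> \<le> \<epsilon>} \<le> Ma i * \<epsilon>"
    "\<And>i \<epsilon>. \<epsilon> > 0 \<Longrightarrow> measure \<mu> {x. \<bar>x $ i - b $ i\<bar> \<le> \<epsilon>} \<le> Mb i * \<epsilon>" by metis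
  have "measure \<mu> (inner_layer (box a b) (1 / real (Suc k))) \<le> (\<Sum>i\<in>UNIV. Ma i + Mb i) / real (Suc k)" for k
  proof -
    let ?\<epsilon> = "1 / real (Suc k)"
    let ?A = "\<lambda>i. {x::real^'n. \<bar>x $ i - a $ i\<bar> \<le> ?\<epsilon>}" and ?B = "\<lambda>i. {x::real^'n. \<bar>x $ i - b $ i\<bar> \<le> ?\<epsilon>}"
    have e: "?\<epsilon> > 0" by simp
    have "measure \<mu> (inner_layer (box a b) ?\<epsilon>) \<le> measure \<mu> (\<Union>i. ?A i \<union> ?B i)"
      by (intro \<mu>.finite_measure_mono inner_layer_box) auto
    also have "\<dots> \<le> (\<Sum>i\<in>UNIV. measure \<mu> (?A i \<union> ?B i))"
      by (intro measure_UNION_le) auto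
    also have "\<dots> \<le> (\<Sum>i\<in>UNIV. Ma i * ?\<epsilon> + Mb i * ?\<epsilon>)"
    proof (rule sum_mono)
      fix i
      have "measure \<mu> (?A i \<union> ?B i) \<le> measure \<mu> (?A i) + measure \<mu> (?B i)" by (intro measure_Un_le) auto
      also have "\<dots> \<le> Ma i * ?\<epsilon> + Mb i * ?\<epsilon>" using M[OF e] by (intro add_mono)
      finally show "measure \<mu> (?A i \<union> ?B i) \<le> Ma i * ?\<epsilon> + Mb i * ?\<epsilon>" .
    qed
    also have "\<dots> = (\<Sum>i\<in>UNIV. Ma i + Mb i) / real (Suc k)"
      by (simp add: sum_divide_distrib add_divide_distrib del: of_nat_Suc)
    finally show ?thesis .
  qed
  moreover have "compactly_inside (box a b) \<Omega>"
    using assms by (intro compactly_inside_box[of a b]) (auto simp: good_box_def box_subset_cbox)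
  ultimately show ?thesis unfolding thin_def by auto
qed

text \<open>Near the edge, the layers of the box come from slabs around its faces. By the three
  alternatives, each face \<open>{y. y $ l = v}\<close> either does not concentrate near
  \<open>{y. y $ j = s}\<close>, or not near \<open>{y. y $ k = u}\<close>, or is parallel to the
  former and at a positive distance. Neighbourhoods of the edge thus have arbitrarily small
  \<nu>-measure.\<close>

lemma null_edge:
  assumes G: "good_box a b" and L: "layer_limit (box a b) r \<nu>" and jk: "j \<noteq> k"
    and ok: "\<And>l v. v = a $ l \<or> v = b $ l \<Longrightarrow>
      (l \<noteq> j \<and> edge_ok l j v s) \<or> (l \<noteq> k \<and> edge_ok l k v u) \<or> (l = j \<and> v \<noteq> s)"
  shows "measure \<nu> {y. y $ j = s \<and> y $ k = u} = 0"
proof -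
  note U = good_box_thin[OF G]
  note n = finite_radon_onD[OF layer_limit_radon[OF L]]
  interpret N: finite_measure \<nu> by (rule n(3))
  define W where "W R = {y::real^'n. \<bar>y $ j - s\<bar> < 1 / real (Suc R) \<and> \<bar>y $ k - u\<bar> < 1 / real (Suc R)}" for R
  have opW: "open (W R)" for R
    unfolding W_def by (intro open_Collect_conj open_Collect_less continuous_intros)
  have Wb [measurable]: "W R \<in> sets borel" for R using opW by auto
  have le: "measure \<nu> {y. y $ j = s \<and> y $ k = u} \<le> real (2 * CARD('n)) * inverse (real (Suc n))" for n
  proof -
    \<comment> \<open>Valid for all larger indices, so that finitely many faces can share one
      \<open>R\<close> and one \<open>k0\<close>.\<close>
    let ?P = "\<lambda>l v R k0. \<forall>R'\<ge>R. \<forall>k\<ge>k0. measure \<mu> ({x. \<bar>x $ l - v\<bar> \<le> 1 / real (Suc k)} \<inter> W R') \<le> 1 / (real (Suc n) * real (Suc k))"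
    have ex: "\<exists>R k0. ?P l v R k0" if v: "v = a $ l \<or> v = b $ l" for l v
    proof -
      have edge: "\<exists>R k0. ?P l v R k0" if e: "edge_ok l i v w" and i: "\<And>R. W R \<subseteq> {y. \<bar>y $ i - w\<bar> < 1 / real (Suc R)}" for i w
      proof -
        obtain R k0 where R: "\<And>k. k \<ge> k0 \<Longrightarrow> measure \<mu> {x. \<bar>x $ l - v\<bar> \<le> 1 / real (Suc k) \<and> \<bar>x $ i - w\<bar> < 1 / real (Suc R)} \<le> 1 / (real (Suc n) * real (Suc k))"
          using e unfolding edge_ok_def by blast
        have "measure \<mu> ({x. \<bar>x $ l - v\<bar> \<le> 1 / real (Suc k)} \<inter> W R') \<le> 1 / (real (Suc n) * real (Suc k))"
          if "R' \<ge> R" "k \<ge> k0" for R' k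
        proof (rule order_trans[OF \<mu>.finite_measure_mono R[OF that(2)]])
          have "1 / real (Suc R') \<le> 1 / real (Suc R)" using that(1) by (intro frac_le) auto
          then show "{x. \<bar>x $ l - v\<bar> \<le> 1 / real (Suc k)} \<inter> W R' \<subseteq>
            {x. \<bar>x $ l - v\<bar> \<le> 1 / real (Suc k) \<and> \<bar>x $ i - w\<bar> < 1 / real (Suc R)}"
            using i[of R'] by (auto intro: less_le_trans)
        qed measurable
        then show ?thesis by blast
      qed
      consider "edge_ok l j v s" | "edge_ok l k v u" | "l = j" "v \<noteq> s" using ok[OF v] by blast
      then show ?thesis
      proof cases
        case 1 then show ?thesis by (rule edge) (auto simp: W_def)
      next
        case 2 then show ?thesis by (rule edge) (auto simp: W_def)
      next
        case 3
        \<comment> \<open>The distance is shared between the width of the slab around the face and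
          the radius of the neighbourhood, which then do not meet.\<close>
        have "\<bar>v - s\<bar> / 2 > 0" using 3 by simp
        then obtain R where R: "1 / real (Suc R) < \<bar>v - s\<bar> / 2" using nat_approx_posE by blast
        have "{x. \<bar>x $ l - v\<bar> \<le> 1 / real (Suc k)} \<inter> W R' = {}" if "R' \<ge> R" "k \<ge> R" for R' k
        proof -
          have "1 / real (Suc R') \<le> 1 / real (Suc R)" "1 / real (Suc k) \<le> 1 / real (Suc R)" using that by (auto intro!: frac_le)
          then have "1 / real (Suc R') + 1 / real (Suc k) \<le> 1 / real (Suc R) + 1 / real (Suc R)" by (rule add_mono)
          also have "\<dots> < \<bar>v - s\<bar>" using add_strict_mono[OF R R] by (simp only: field_sum_of_halves)
          finally have "1 / real (Suc R') + 1 / real (Suc k) < \<bar>v - s\<bar>" .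
          then show ?thesis using 3(1) by (auto simp: W_def simp del: of_nat_Suc)
        qed
        then show ?thesis by (intro exI[of _ R]) simp
      qed
    qed
    define Q where "Q l v R k0 \<longleftrightarrow> ?P l v R k0" for l v R k0
    have "\<forall>l. \<exists>R k0. Q l (a $ l) R k0" "\<forall>l. \<exists>R k0. Q l (b $ l) R k0" using ex unfolding Q_def by simp_all
    then obtain RA kA RB kB where "\<And>l. Q l (a $ l) (RA l) (kA l)" "\<And>l. Q l (b $ l) (RB l) (kB l)" by metis
    then have A: "\<And>l. ?P l (a $ l) (RA l) (kA l)" and B: "\<And>l. ?P l (b $ l) (RB l) (kB l)" unfolding Q_def by blast+
    \<comment> \<open>A sum of naturals dominates each summand, so it serves all faces at
      once.\<close>
    define R where "R = (\<Sum>l\<in>UNIV. RA l + RB l)"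
    define k0 where "k0 = (\<Sum>l\<in>UNIV. kA l + kB l)"
    have Rge: "RA l \<le> R" "RB l \<le> R" and kge: "kA l \<le> k0" "kB l \<le> k0" for l
      using member_le_sum[of l UNIV "\<lambda>l. RA l + RB l"] member_le_sum[of l UNIV "\<lambda>l. kA l + kB l"]
      by (simp_all add: R_def k0_def)
    have "measure \<nu> (W R) \<le> real (2 * CARD('n)) * inverse (real (Suc n))"
    proof (rule layer_limit_open_le[OF U L opW])
      show "\<forall>\<^sub>F k in sequentially. measure \<mu> (inner_layer (box a b) (1 / real (Suc k)) \<inter> W R) \<le> real (2 * CARD('n)) * inverse (real (Suc n)) / real (Suc k)"
        unfolding eventually_sequentially
      proof (intro exI[of _ k0] allI impI)
        fix k assume k: "k \<ge> k0"
        let ?A = "\<lambda>l. {x::real^'n. \<bar>x $ l - a $ l\<bar> \<le> 1 / real (Suc k)} \<inter> W R" and ?B = "\<lambda>l. {x::real^'n. \<bar>x $ l - b $ l\<bar> \<le> 1 / real (Suc k)} \<inter> W R"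
        have "measure \<mu> (inner_layer (box a b) (1 / real (Suc k)) \<inter> W R) \<le> measure \<mu> (\<Union>l. ?A l \<union> ?B l)"
          using inner_layer_box[of a b "1 / real (Suc k)"] by (intro \<mu>.finite_measure_mono) (blast, measurable)
        also have "\<dots> \<le> (\<Sum>l\<in>UNIV. measure \<mu> (?A l \<union> ?B l))"
          by (intro measure_UNION_le) auto
        also have "\<dots> \<le> (\<Sum>l\<in>(UNIV::'n set). 2 * (1 / (real (Suc n) * real (Suc k))))"
        proof (rule sum_mono)
          fix l
          have "measure \<mu> (?A l \<union> ?B l) \<le> measure \<mu> (?A l) + measure \<mu> (?B l)" by (intro measure_Un_le) auto
          also have "\<dots> \<le> 1 / (real (Suc n) * real (Suc k)) + 1 / (real (Suc n) * real (Suc k))"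
            using A[of l] B[of l] Rge[of l] kge[of l] k by (intro add_mono) (meson order_trans)+
          finally show "measure \<mu> (?A l \<union> ?B l) \<le> 2 * (1 / (real (Suc n) * real (Suc k)))" by (simp only: mult_2)
        qed
        also have "\<dots> = real (2 * CARD('n)) * inverse (real (Suc n)) / real (Suc k)"
          by (simp add: divide_inverse del: of_nat_Suc)
        finally show "measure \<mu> (inner_layer (box a b) (1 / real (Suc k)) \<inter> W R) \<le> real (2 * CARD('n)) * inverse (real (Suc n)) / real (Suc k)" .
      qed
    qed
    moreover have "measure \<nu> {y. y $ j = s \<and> y $ k = u} \<le> measure \<nu> (W R)"
      by (rule N.finite_measure_mono) (auto simp: W_def n(1))
    ultimately show ?thesis by simp
  qed
  have "(\<lambda>n. real (2 * CARD('n)) * inverse (real (Suc n))) \<longlonglongrightarrow> real (2 * CARD('n)) * 0"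
    by (intro tendsto_mult tendsto_const LIMSEQ_inverse_real_of_nat)
  then have "measure \<nu> {y. y $ j = s \<and> y $ k = u} \<le> real (2 * CARD('n)) * 0"
    by (rule LIMSEQ_le_const) (use le in blast)
  then show ?thesis by (simp add: order_antisym measure_nonneg)
qed

lemma total_flux_Int_frontier: "total_flux U (S \<inter> frontier U) = total_flux U S"
  by (simp add: total_flux_def Int_assoc)

lemma total_flux_cong: "S \<inter> frontier U = T \<inter> frontier U \<Longrightarrow> total_flux U S = total_flux U T"
  by (simp add: total_flux_def)

lemma total_flux_null:
  assumes U: "thin U" and L: "layer_limit U r \<nu>" and S: "S \<in> sets borel"
    and P: "finite P" "\<And>p. p \<in> P \<Longrightarrow> Z p \<in> sets borel" "\<And>p. p \<in> P \<Longrightarrow> measure \<nu> (Z p) = 0"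
      "S \<inter> frontier U \<subseteq> (\<Union>p\<in>P. Z p)"
  shows "total_flux U S = 0"
proof -
  note n = finite_radon_onD[OF layer_limit_radon[OF L]]
  interpret N: finite_measure \<nu> by (rule n(3))
  have "\<bar>total_flux U (S \<inter> frontier U)\<bar> \<le> measure \<nu> (S \<inter> frontier U)"
    using S by (intro total_flux_bound[OF U L]) (auto intro: borel_closed)
  also have "\<dots> \<le> measure \<nu> (\<Union>p\<in>P. Z p)"
    using P(1,2,4) n(1) by (intro N.finite_measure_mono sets.finite_UN) auto
  also have "\<dots> \<le> (\<Sum>p\<in>P. measure \<nu> (Z p))" using P n(1) by (intro measure_UNION_le) auto
  also have "\<dots> = 0" using P(3) by simp
  finally show ?thesis by (simp add: total_flux_Int_frontier)
qed

definition flux_ok :: "'n \<Rightarrow> real \<Rightarrow> bool" where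
  "flux_ok j t \<longleftrightarrow> (\<exists>m. is_halfspace_flux \<Omega> \<F> \<mu> j t m)"

abbreviation "hf \<equiv> halfspace_flux \<Omega> \<F> \<mu>"

lemma flux_ok_is_halfspace_flux: "flux_ok j t \<Longrightarrow> is_halfspace_flux \<Omega> \<F> \<mu> j t (hf j t)"
  unfolding flux_ok_def halfspace_flux_def [abs_def] by (simp add: someI_ex[of "is_halfspace_flux \<Omega> \<F> \<mu> j t"])

lemma AE_flux_ok: "AE t in lborel. flux_ok j t"
  using AE_slab_ok[of j] AE_slice_limit[of j] unfolding flux_ok_def
  by eventually_elim (use halfspace_flux_exists in blast)

text \<open>The extension property holds for almost every \<delta>, hence for one so small that the
  exhausting set swallows \<open>K\<close>.\<close>

lemma flux_ok_local:
  assumes ok: "flux_ok j t" and K: "compact K" "K \<subseteq> \<Omega>"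
  obtains E where "E \<in> O_class_sup \<Omega> \<mu>" "K \<subseteq> E"
    "\<And>S. S \<in> sets borel \<Longrightarrow> S \<subseteq> E \<Longrightarrow> S \<subseteq> {x. x $ j = t} \<Longrightarrow> hf j t S = \<F> (half j t E) S"
proof -
  obtain r where r: "r > 0" "\<And>\<delta>. 0 < \<delta> \<Longrightarrow> \<delta> < r \<Longrightarrow> K \<subseteq> exhaustion \<Omega> \<delta>"
    using exhaustion_covers_compact[OF open_\<Omega> K] by metis
  have "AE \<delta> in lebesgue. 0 < \<delta> \<and> exhaustion \<Omega> \<delta> \<in> O_class_sup \<Omega> \<mu> \<longrightarrow>
        (\<forall>S\<in>sets borel. S \<subseteq> exhaustion \<Omega> \<delta> \<inter> {x. x $ j = t} \<longrightarrow> hf j t S = \<F> (halfsp j t \<inter> exhaustion \<Omega> \<delta>) S)"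
    using flux_ok_is_halfspace_flux[OF ok] unfolding is_halfspace_flux_def frontier_halfsp by blast
  moreover have "AE \<delta> in lebesgue. 0 < \<delta> \<longrightarrow> exhaustion \<Omega> \<delta> \<in> O_class_sup \<Omega> \<mu>"
    using AE_exhaustion_good by (rule AE_completion)
  ultimately have "AE \<delta> in lebesgue. 0 < \<delta> \<longrightarrow> exhaustion \<Omega> \<delta> \<in> O_class_sup \<Omega> \<mu> \<and>
        (\<forall>S\<in>sets borel. S \<subseteq> exhaustion \<Omega> \<delta> \<inter> {x. x $ j = t} \<longrightarrow> hf j t S = \<F> (halfsp j t \<inter> exhaustion \<Omega> \<delta>) S)"
    by eventually_elim blast
  from AE_lborel_small[OF this r(1)] obtain \<delta> where \<delta>: "0 < \<delta>" "\<delta> < r" "exhaustion \<Omega> \<delta> \<in> O_class_sup \<Omega> \<mu>"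
    "\<forall>S\<in>sets borel. S \<subseteq> exhaustion \<Omega> \<delta> \<inter> {x. x $ j = t} \<longrightarrow> hf j t S = \<F> (halfsp j t \<inter> exhaustion \<Omega> \<delta>) S" by auto
  show ?thesis
    by (rule that[OF \<delta>(3) r(2)[OF \<delta>(1,2)]]) (use \<delta>(4) in \<open>simp add: half_def\<close>)
qed

definition set_coord :: "real^'n \<Rightarrow> 'n \<Rightarrow> real \<Rightarrow> real^'n" where
  "set_coord a j t = (\<chi> i. if i = j then t else a $ i)"

lemma box_set_coord: "a $ j \<le> t \<Longrightarrow> box (set_coord a j t) b = box a b \<inter> halfsp j t"
  by (auto simp: mem_box_vec set_coord_def halfsp_def split: if_splits) (metis le_less_trans)

text \<open>Balance gives the whole flux of the upper part \<open>?U\<close> of the box. Above the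
  hyperplane, locality identifies its flux with that of the box; on the relatively open cut face,
  with that of the half-space. The remainder of the boundary is the rim of the cut face, which lies
  in edges without flux.\<close>

lemma halfspace_flux_box:
  assumes G: "good_box a b" and t: "a $ j < t" "t < b $ j" "slab_ok j t" "flux_ok j t"
    and e: "\<And>k u. k \<noteq> j \<Longrightarrow> u = a $ k \<or> u = b $ k \<Longrightarrow> edge_ok j k t u \<and> edge_ok k j u t"
  shows "hf j t (box a b \<inter> {x. x $ j = t}) = \<sigma> (box a b \<inter> {x. t < x $ j}) - total_flux (box a b) {x. t < x $ j}"
proof -
  let ?V = "box a b" and ?U = "box (set_coord a j t) b"
  have H: "halfsp j t = {x. t < x $ j}" by (simp add: halfsp_def)
  have Ueq: "?U = ?V \<inter> halfsp j t" using t by (intro box_set_coord) simp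
  have GU: "good_box (set_coord a j t) b"
    using G t by (auto simp: good_box_def set_coord_def mem_cbox_vec subset_iff) (metis order_trans less_imp_le)
  note U = good_box_thin[OF GU] and V = good_box_thin[OF G]
  obtain r \<nu> where L: "layer_limit ?U r \<nu>" using layer_limit_exists[OF U] by blast
  have fU: "fvm UNIV (total_flux ?U)" by (rule total_flux_fvm[OF U])
  have opH: "open (halfsp j t)" by (rule open_halfsp)
  have HB [measurable]: "halfsp j t \<in> sets borel" using opH by auto
  have loc1: "total_flux ?U (halfsp j t) = total_flux ?V (halfsp j t)"
    by (rule total_flux_local'[OF U V opH]) (auto simp: Ueq)
  have cV: "cbox a b \<subseteq> \<Omega>" using G by (simp add: good_box_def)
  obtain E where E: "E \<in> O_class_sup \<Omega> \<mu>" "cbox a b \<subseteq> E"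
    "\<And>S. S \<in> sets borel \<Longrightarrow> S \<subseteq> E \<Longrightarrow> S \<subseteq> {x. x $ j = t} \<Longrightarrow> hf j t S = \<F> (half j t E) S"
    using flux_ok_local[OF t(4) compact_cbox cV] by blast
  have VE: "?V \<subseteq> E" using E(2) box_subset_cbox[of a b] by auto
  have thE: "thin (half j t E)" unfolding half_def by (rule thin_halfsp_Int[OF E(1) t(3)])
  have "total_flux ?U ?V = total_flux (half j t E) ?V"
    by (rule total_flux_local'[OF U thE]) (use VE in \<open>auto simp: Ueq half_def\<close>)
  also have "\<dots> = \<F> (half j t E) (?V \<inter> {x. x $ j = t})"
  proof -
    have "?V \<inter> frontier (half j t E) = ?V \<inter> (E \<inter> frontier (half j t E))" using VE by auto
    also have "\<dots> = ?V \<inter> {x. x $ j = t}" unfolding Int_frontier_half[OF open_O_sup[OF E(1)]] using VE by auto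
    finally show ?thesis by (simp add: total_flux_def)
  qed
  also have "\<dots> = hf j t (?V \<inter> {x. x $ j = t})" using VE by (intro E(3)[symmetric]) auto
  finally have face: "total_flux ?U ?V = hf j t (?V \<inter> {x. x $ j = t})" .
  have "total_flux ?U UNIV = total_flux ?U (halfsp j t) + total_flux ?U (?V - halfsp j t) + total_flux ?U (- (?V \<union> halfsp j t))"
  proof -
    have "total_flux ?U (halfsp j t \<union> (?V - halfsp j t)) = total_flux ?U (halfsp j t) + total_flux ?U (?V - halfsp j t)"
      by (rule fvm_Un[OF fU]) auto
    moreover have "total_flux ?U ((halfsp j t \<union> (?V - halfsp j t)) \<union> - (?V \<union> halfsp j t)) =
      total_flux ?U (halfsp j t \<union> (?V - halfsp j t)) + total_flux ?U (- (?V \<union> halfsp j t))"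
      by (rule fvm_Un[OF fU]) auto
    moreover have "(halfsp j t \<union> (?V - halfsp j t)) \<union> - (?V \<union> halfsp j t) = UNIV" by auto
    ultimately show ?thesis by simp
  qed
  \<comment> \<open>Additivity needs disjoint pieces, locality an open set. The two sets differ only
    by points of \<open>?U\<close>, which are not on its boundary.\<close>
  moreover have "total_flux ?U (?V - halfsp j t) = total_flux ?U ?V"
  proof (rule total_flux_cong)
    have "?U \<inter> frontier ?U = {}" by (auto simp: frontier_open_eq open_box)
    then show "(?V - halfsp j t) \<inter> frontier ?U = ?V \<inter> frontier ?U" unfolding Ueq by blast
  qed
  \<comment> \<open>Boundary points of \<open>?U\<close> outside both open sets have height exactly
    \<open>t\<close> and a further coordinate on a face of the box: they form the rim.\<close>
  moreover have "total_flux ?U (- (?V \<union> halfsp j t)) = 0"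
  proof (rule total_flux_null[OF U L, where P = "(UNIV - {j}) \<times> UNIV" and
        Z = "\<lambda>(k, c). {y. y $ j = t \<and> y $ k = (if c then a $ k else b $ k)}"])
    show "- (?V \<union> halfsp j t) \<in> sets borel" by measurable
    fix p :: "'n \<times> bool" assume p: "p \<in> (UNIV - {j}) \<times> UNIV"
    obtain k c where pk: "p = (k, c)" "k \<noteq> j" using p by auto
    show "(case p of (k, c) \<Rightarrow> {y::real^'n. y $ j = t \<and> y $ k = (if c then a $ k else b $ k)}) \<in> sets borel"
      unfolding pk by simp
    have "measure \<nu> {y. y $ j = t \<and> y $ k = (if c then a $ k else b $ k)} = 0"
    proof (rule null_edge[OF GU L pk(2)[symmetric]])
      fix l v assume v: "v = set_coord a j t $ l \<or> v = b $ l"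
      show "l \<noteq> j \<and> edge_ok l j v t \<or> l \<noteq> k \<and> edge_ok l k v (if c then a $ k else b $ k) \<or> l = j \<and> v \<noteq> t"
      proof (cases "l = j")
        case True
        then show ?thesis using v pk(2) e[OF pk(2)] t(2) by (auto simp: set_coord_def)
      next
        case False
        then show ?thesis using v e[OF False] by (auto simp: set_coord_def)
      qed
    qed
    then show "measure \<nu> (case p of (k, c) \<Rightarrow> {y. y $ j = t \<and> y $ k = (if c then a $ k else b $ k)}) = 0"
      by (simp add: pk)
  next
    show "- (?V \<union> halfsp j t) \<inter> frontier ?U \<subseteq> (\<Union>p\<in>(UNIV - {j}) \<times> UNIV. case p of (k, c) \<Rightarrow> {y. y $ j = t \<and> y $ k = (if c then a $ k else b $ k)})"
    proof
      fix y assume y: "y \<in> - (?V \<union> halfsp j t) \<inter> frontier ?U"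
      then have "y \<in> frontier ?U" by simp
      from frontier_box_vec(1)[OF this] have c: "y \<in> cbox (set_coord a j t) b" .
      have yj: "y $ j = t" using c y by (auto simp: mem_cbox_vec set_coord_def halfsp_def intro!: antisym dest: spec[of _ j])
      have bd: "a $ k \<le> y $ k \<and> y $ k \<le> b $ k" if "k \<noteq> j" for k
        using c that by (simp add: mem_cbox_vec set_coord_def) (metis (full_types))
      have "y \<notin> ?V" using y by auto
      then obtain k where k: "\<not> (a $ k < y $ k \<and> y $ k < b $ k)" by (auto simp: mem_box_vec)
      have "k \<noteq> j" using k yj t by auto
      then have "y $ k = a $ k \<or> y $ k = b $ k" using bd[of k] k by auto
      then show "y \<in> (\<Union>p\<in>(UNIV - {j}) \<times> UNIV. case p of (k, c) \<Rightarrow> {y. y $ j = t \<and> y $ k = (if c then a $ k else b $ k)})"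
        using \<open>k \<noteq> j\<close> yj by (intro UN_I[of "(k, y $ k = a $ k)"]) auto
    qed
  qed simp
  ultimately have "\<sigma> ?U = total_flux ?V (halfsp j t) + hf j t (?V \<inter> {x. x $ j = t})"
    using total_flux_UNIV[OF U] loc1 face by simp
  then show ?thesis by (simp add: Ueq H)
qed

definition face :: "real^'n \<Rightarrow> real \<Rightarrow> 'n \<Rightarrow> real \<Rightarrow> (real^'n) set" where
  "face x h j t = {y. y $ j = t \<and> (\<forall>i. i \<noteq> j \<longrightarrow> x $ i < y $ i \<and> y $ i < x $ i + h)}"

text \<open>The offsets are the levels of all faces that occur: 0 and \<open>h\<close> for the cube,
  \<open>- h\<close> and \<open>2 * h\<close> for the ends of the boxes prolonged in one direction.
  The last condition keeps \<sigma> from charging the upper cut planes.\<close>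

definition generic :: "real^'n \<Rightarrow> real \<Rightarrow> bool" where
  "generic x h \<longleftrightarrow>
     (\<forall>i. \<forall>s\<in>{- h, 0, h, 2 * h}. slab_ok i (x $ i + s)) \<and>
     (\<forall>i j. i \<noteq> j \<longrightarrow> (\<forall>s\<in>{- h, 0, h, 2 * h}. \<forall>s'\<in>{- h, 0, h, 2 * h}. edge_ok i j (x $ i + s) (x $ j + s'))) \<and>
     (\<forall>i. flux_ok i (x $ i) \<and> flux_ok i (x $ i + h)) \<and>
     (\<forall>i. measure (pos_variation \<Omega> \<sigma>) {y. y $ i = x $ i + h} = 0 \<and>
          measure (pos_variation \<Omega> (\<lambda>S. - \<sigma> S)) {y. y $ i = x $ i + h} = 0)"

lemma \<sigma>_slice_null:
  assumes "measure (pos_variation \<Omega> \<sigma>) Z = 0" "measure (pos_variation \<Omega> (\<lambda>S. - \<sigma> S)) Z = 0"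
    and Z: "Z \<in> sets borel" "S \<in> sets borel" "S \<subseteq> Z" "S \<subseteq> \<Omega>"
  shows "\<sigma> S = 0"
proof -
  note P = finite_radon_onD[OF finite_radon_pos_variation[OF fvm_\<sigma> \<Omega>_borel]]
  note N = finite_radon_onD[OF finite_radon_pos_variation[OF fvm_uminus[OF fvm_\<sigma>] \<Omega>_borel]]
  have "measure (pos_variation \<Omega> \<sigma>) S \<le> measure (pos_variation \<Omega> \<sigma>) Z"
    using Z by (intro finite_measure.finite_measure_mono[OF P(3)]) auto
  moreover have "measure (pos_variation \<Omega> (\<lambda>S. - \<sigma> S)) S \<le> measure (pos_variation \<Omega> (\<lambda>S. - \<sigma> S)) Z"
    using Z by (intro finite_measure.finite_measure_mono[OF N(3)]) auto
  ultimately have "measure (pos_variation \<Omega> \<sigma>) S = 0" "measure (pos_variation \<Omega> (\<lambda>S. - \<sigma> S)) S = 0"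
    using assms by (auto intro!: antisym)
  then show ?thesis using jordan_decomposition[OF fvm_\<sigma> \<Omega>_borel Z(2,4)] by simp
qed

text \<open>Closed faces of a cube overlap in edges; where those carry no charge, the charge of the
  union is still the sum.\<close>

lemma fvm_overlap_sum:
  fixes \<Phi> :: "(real^'n) set \<Rightarrow> real"
  assumes m: "fvm UNIV \<Phi>" and J: "finite J" and C: "\<And>j. j \<in> J \<Longrightarrow> C j \<in> sets borel"
    and null: "\<And>j S. j \<in> J \<Longrightarrow> S \<in> sets borel \<Longrightarrow> S \<subseteq> C j \<inter> (\<Union>k\<in>J - {j}. C k) \<Longrightarrow> \<Phi> S = 0"
  shows "\<Phi> (\<Union>j\<in>J. C j) = (\<Sum>j\<in>J. \<Phi> (C j))"
  using J C null
proof (induction J)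
  case empty then show ?case using fvm_empty[OF m] by simp
next
  case (insert j J)
  have CB: "C j \<in> sets borel" "(\<Union>k\<in>J. C k) \<in> sets borel" using insert by auto
  have IH: "\<Phi> (\<Union>k\<in>J. C k) = (\<Sum>k\<in>J. \<Phi> (C k))"
  proof (rule insert.IH)
    fix k S assume "k \<in> J" "S \<in> sets borel" "S \<subseteq> C k \<inter> (\<Union>l\<in>J - {k}. C l)"
    then show "\<Phi> S = 0" by (intro insert.prems(2)[of k]) auto
  qed (use insert.prems(1) in auto)
  have "\<Phi> (C j) = \<Phi> (C j - (\<Union>k\<in>J. C k)) + \<Phi> (C j \<inter> (\<Union>k\<in>J. C k))"
  proof -
    have "\<Phi> ((C j - (\<Union>k\<in>J. C k)) \<union> (C j \<inter> (\<Union>k\<in>J. C k))) = \<Phi> (C j - (\<Union>k\<in>J. C k)) + \<Phi> (C j \<inter> (\<Union>k\<in>J. C k))"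
      by (rule fvm_Un[OF m]) (use CB in auto)
    then show ?thesis by (simp add: Un_Diff_Int)
  qed
  moreover have "\<Phi> (C j \<inter> (\<Union>k\<in>J. C k)) = 0"
  proof -
    have "insert j J - {j} = J" using insert.hyps(2) by auto
    then show ?thesis using insert.prems(2)[of j "C j \<inter> (\<Union>k\<in>J. C k)"] CB by simp
  qed
  moreover have "\<Phi> ((C j - (\<Union>k\<in>J. C k)) \<union> (\<Union>k\<in>J. C k)) = \<Phi> (C j - (\<Union>k\<in>J. C k)) + \<Phi> (\<Union>k\<in>J. C k)"
    using CB by (intro fvm_Un[OF m]) auto
  moreover have "(C j - (\<Union>k\<in>J. C k)) \<union> (\<Union>k\<in>J. C k) = (\<Union>k\<in>insert j J. C k)" by auto
  ultimately show ?case using IH insert.hyps by simp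
qed

text \<open>For fixed \<open>j\<close>, the cuts of the long box at \<open>x $ j\<close> and
  \<open>x $ j + h\<close> are subtracted. The difference is \<sigma> of the cube minus the flux
  through the lateral boundary between the planes. By locality this lateral flux is that of the
  cube, so what remains is the flux of the cube through its two faces orthogonal to
  \<open>axis j\<close>.\<close>

lemma box_flux_balance:
  assumes h: "h > 0" and g: "generic x h" and sub: "cbox (shift x (- h)) (shift x (2 * h)) \<subseteq> \<Omega>"
  shows "\<sigma> (box x (shift x h)) = (\<Sum>j\<in>UNIV. hf j (x $ j) (face x h j (x $ j)) - hf j (x $ j + h) (face x h j (x $ j + h)))"
proof -
  let ?I = "box x (shift x h)"
  let ?O = "{- h, 0, h, 2 * h}"
  note g1 = g[unfolded generic_def]
  note g2 = g1[THEN conjunct2]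
  note g3 = g2[THEN conjunct2]
  have slab: "slab_ok i (x $ i + s)" if "s \<in> ?O" for i s
    by (rule g1[THEN conjunct1, rule_format, OF that])
  have edge: "edge_ok i j (x $ i + s) (x $ j + s')" if "i \<noteq> j" "s \<in> ?O" "s' \<in> ?O" for i j s s'
    by (rule g2[THEN conjunct1, rule_format, OF that])
  have slab0: "slab_ok i (x $ i)" for i using slab[of 0 i] by simp
  have fl: "flux_ok i (x $ i)" "flux_ok i (x $ i + h)" for i
    using g3[THEN conjunct1] by simp_all
  have slice: "measure (pos_variation \<Omega> \<sigma>) {y. y $ i = x $ i + h} = 0"
    "measure (pos_variation \<Omega> (\<lambda>S. - \<sigma> S)) {y. y $ i = x $ i + h} = 0" for i
    using g3[THEN conjunct2] by simp_all
  have GI: "good_box x (shift x h)"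
  proof -
    have "cbox x (shift x h) \<subseteq> cbox (shift x (- h)) (shift x (2 * h))"
    proof
      fix y assume y: "y \<in> cbox x (shift x h)"
      have "x $ i - h \<le> y $ i \<and> y $ i \<le> x $ i + 2 * h" for i
        using y[unfolded mem_cbox_vec, rule_format, of i] h by (simp add: shift_def)
      then show "y \<in> cbox (shift x (- h)) (shift x (2 * h))" by (simp add: mem_cbox_vec shift_def)
    qed
    then have "cbox x (shift x h) \<subseteq> \<Omega>" using sub by (rule subset_trans)
    then show ?thesis using h slab0 slab[of h] by (simp add: good_box_def shift_def)
  qed
  note I = good_box_thin[OF GI]
  obtain r \<nu> where LI: "layer_limit ?I r \<nu>" using layer_limit_exists[OF I] by blast
  have fI: "fvm UNIV (total_flux ?I)" by (rule total_flux_fvm[OF I])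
  \<comment> \<open>On the boundary of the cube, the complement of the open slab picks out the two
    closed faces orthogonal to \<open>axis j\<close>. All these complements together cover exactly
    the outside of the cube.\<close>
  define C where "C j = - {y::real^'n. x $ j < y $ j \<and> y $ j < x $ j + h}" for j
  have CB: "C j \<in> sets borel" for j unfolding C_def by measurable
  have per_face: "total_flux ?I (C j) = hf j (x $ j) (face x h j (x $ j)) - hf j (x $ j + h) (face x h j (x $ j + h))" for j
  proof -
    define a where "a = set_coord x j (x $ j - h)"
    define b where "b = set_coord (shift x h) j (x $ j + 2 * h)"
    have ab: "a $ j = x $ j + - h" "b $ j = x $ j + 2 * h" "\<And>k. k \<noteq> j \<Longrightarrow> a $ k = x $ k + 0" "\<And>k. k \<noteq> j \<Longrightarrow> b $ k = x $ k + h"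
      by (simp_all add: a_def b_def set_coord_def shift_def)
    have off: "\<exists>s\<in>?O. v = x $ k + s" if "v = a $ k \<or> v = b $ k" for k v
      using that ab by (cases "k = j") auto
    have G: "good_box a b"
    proof -
      have "cbox a b \<subseteq> cbox (shift x (- h)) (shift x (2 * h))"
      proof
        fix y assume y: "y \<in> cbox a b"
        have "x $ i - h \<le> y $ i \<and> y $ i \<le> x $ i + 2 * h" for i
          using y[unfolded mem_cbox_vec, rule_format, of i] h ab by (cases "i = j") auto
        then show "y \<in> cbox (shift x (- h)) (shift x (2 * h))" by (simp add: mem_cbox_vec shift_def)
      qed
      then have "cbox a b \<subseteq> \<Omega>" using sub by (rule subset_trans)
      have sl: "slab_ok i v" if iv: "v = a $ i \<or> v = b $ i" for i v
      proof -
        obtain s where "s \<in> ?O" "v = x $ i + s" using off[OF iv] by blast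
        then show ?thesis using slab by blast
      qed
      have "slab_ok i (a $ i) \<and> slab_ok i (b $ i)" for i using sl[of "a $ i" i] sl[of "b $ i" i] by blast
      moreover have "a $ i < b $ i" for i using ab h by (cases "i = j") auto
      ultimately show ?thesis using \<open>cbox a b \<subseteq> \<Omega>\<close> by (simp add: good_box_def)
    qed
    note V = good_box_thin[OF G]
    have fV: "fvm UNIV (total_flux (box a b))" by (rule total_flux_fvm[OF V])
    have cut: "hf j t (box a b \<inter> {y. y $ j = t}) = \<sigma> (box a b \<inter> {y. t < y $ j}) - total_flux (box a b) {y. t < y $ j}"
      if t: "t = x $ j + s" "s = 0 \<or> s = h" "flux_ok j t" for t s
    proof (rule halfspace_flux_box[OF G _ _ _ t(3)])
      show "a $ j < t" "t < b $ j" using t ab h by auto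
      show "slab_ok j t" using slab[of s j] t by auto
      show "edge_ok j k t u \<and> edge_ok k j u t" if k: "k \<noteq> j" "u = a $ k \<or> u = b $ k" for k u
      proof -
        obtain s' where s': "s' \<in> ?O" "u = x $ k + s'" using off[OF k(2)] by blast
        have s: "s \<in> ?O" using t(2) by auto
        show ?thesis unfolding t(1) s'(2)
          using edge[OF k(1)[symmetric] s s'(1)] edge[OF k(1) s'(1) s] by (rule conjI)
      qed
    qed
    have split: "(\<forall>i. P i) \<longleftrightarrow> P j \<and> (\<forall>i. i \<noteq> j \<longrightarrow> P i)" for P :: "'n \<Rightarrow> bool" by metis
    have mem_ab: "y \<in> box a b \<longleftrightarrow> (x $ j - h < y $ j \<and> y $ j < x $ j + 2 * h) \<and> (\<forall>i. i \<noteq> j \<longrightarrow> x $ i < y $ i \<and> y $ i < x $ i + h)" for y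
      unfolding mem_box_vec split[of "\<lambda>i. a $ i < y $ i \<and> y $ i < b $ i"] using ab by simp
    have mem_I: "y \<in> ?I \<longleftrightarrow> (x $ j < y $ j \<and> y $ j < x $ j + h) \<and> (\<forall>i. i \<noteq> j \<longrightarrow> x $ i < y $ i \<and> y $ i < x $ i + h)" for y
      unfolding mem_box_vec split[of "\<lambda>i. x $ i < y $ i \<and> y $ i < shift x h $ i"] by (simp add: shift_def)
    have f0: "box a b \<inter> {y. y $ j = x $ j} = face x h j (x $ j)" and fh: "box a b \<inter> {y. y $ j = x $ j + h} = face x h j (x $ j + h)"
      using h by (auto simp: mem_ab face_def)
    define S where "S = {y::real^'n. x $ j < y $ j \<and> y $ j \<le> x $ j + h}"
    have SB [measurable]: "S \<in> sets borel" unfolding S_def by measurable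
    have V\<Omega>: "box a b \<subseteq> \<Omega>" using G box_subset_cbox[of a b] by (auto simp: good_box_def)
    have "\<sigma> (box a b \<inter> {y. x $ j < y $ j} - box a b \<inter> {y. x $ j + h < y $ j}) = \<sigma> (box a b \<inter> {y. x $ j < y $ j}) - \<sigma> (box a b \<inter> {y. x $ j + h < y $ j})"
      using V\<Omega> h by (intro fvm_Diff[OF fvm_\<sigma>]) auto
    moreover have "box a b \<inter> {y. x $ j < y $ j} - box a b \<inter> {y. x $ j + h < y $ j} = ?I \<union> (box a b \<inter> {y. y $ j = x $ j + h})"
      using h by (auto simp: mem_ab mem_I)
    moreover have "\<sigma> (?I \<union> (box a b \<inter> {y. y $ j = x $ j + h})) = \<sigma> ?I + \<sigma> (box a b \<inter> {y. y $ j = x $ j + h})"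
    proof (rule fvm_Un[OF fvm_\<sigma>])
      show "?I \<subseteq> \<Omega>" using GI box_subset_cbox[of x "shift x h"] by (auto simp: good_box_def)
      show "?I \<inter> (box a b \<inter> {y. y $ j = x $ j + h}) = {}" by (auto simp: mem_I)
    qed (use V\<Omega> in auto)
    \<comment> \<open>The difference of the two upper parts contains the upper cut plane besides the
      open cube; \<open>generic\<close> makes this plane uncharged.\<close>
    moreover have "\<sigma> (box a b \<inter> {y. y $ j = x $ j + h}) = 0"
      using V\<Omega> by (intro \<sigma>_slice_null[OF slice[of j]]) auto
    ultimately have \<sigma>eq: "\<sigma> (box a b \<inter> {y. x $ j < y $ j}) - \<sigma> (box a b \<inter> {y. x $ j + h < y $ j}) = \<sigma> ?I" by simp
    have "total_flux (box a b) ({y. x $ j < y $ j} - {y. x $ j + h < y $ j}) = total_flux (box a b) {y. x $ j < y $ j} - total_flux (box a b) {y. x $ j + h < y $ j}"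
      using h by (intro fvm_Diff[OF fV]) auto
    moreover have "{y::real^'n. x $ j < y $ j} - {y. x $ j + h < y $ j} = {y. x $ j < y $ j \<and> y $ j < x $ j + h} \<union> {y. y $ j = x $ j + h}"
      using h by auto
    moreover have "total_flux (box a b) ({y. x $ j < y $ j \<and> y $ j < x $ j + h} \<union> {y. y $ j = x $ j + h}) =
      total_flux (box a b) {y. x $ j < y $ j \<and> y $ j < x $ j + h} + total_flux (box a b) {y. y $ j = x $ j + h}"
      by (rule fvm_Un[OF fV]) auto
    \<comment> \<open>This plane crosses the interior of the long box, so it meets the boundary only
      where a second coordinate is on a face: in edges.\<close>
    moreover have "total_flux (box a b) {y. y $ j = x $ j + h} = 0"
    proof -
      obtain r' \<nu>' where L: "layer_limit (box a b) r' \<nu>'" using layer_limit_exists[OF V] by blast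
      show ?thesis
      proof (rule total_flux_null[OF V L, where P = "(UNIV - {j}) \<times> UNIV" and
        Z = "\<lambda>(k, c). {y. y $ j = x $ j + h \<and> y $ k = (if c then a $ k else b $ k)}"])
        fix p :: "'n \<times> bool" assume p: "p \<in> (UNIV - {j}) \<times> UNIV"
        obtain k c where pk: "p = (k, c)" "k \<noteq> j" using p by auto
        show "(case p of (k, c) \<Rightarrow> {y::real^'n. y $ j = x $ j + h \<and> y $ k = (if c then a $ k else b $ k)}) \<in> sets borel"
          unfolding pk by simp
        have "measure \<nu>' {y. y $ j = x $ j + h \<and> y $ k = (if c then a $ k else b $ k)} = 0"
        proof (rule null_edge[OF G L pk(2)[symmetric]])
          fix l v assume v: "v = a $ l \<or> v = b $ l"
          show "l \<noteq> j \<and> edge_ok l j v (x $ j + h) \<or> l \<noteq> k \<and> edge_ok l k v (if c then a $ k else b $ k) \<or> l = j \<and> v \<noteq> x $ j + h"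
          proof (cases "l = j")
            case True then show ?thesis using v ab h by auto
          next
            case False
            obtain s where s: "s \<in> ?O" "v = x $ l + s" using off[OF v] by blast
            have "h \<in> ?O" by simp
            from edge[OF False s(1) this] False show ?thesis unfolding s(2) by (intro disjI1 conjI)
          qed
        qed
        then show "measure \<nu>' (case p of (k, c) \<Rightarrow> {y. y $ j = x $ j + h \<and> y $ k = (if c then a $ k else b $ k)}) = 0"
          by (simp add: pk)
      next
        show "{y. y $ j = x $ j + h} \<inter> frontier (box a b) \<subseteq> (\<Union>p\<in>(UNIV - {j}) \<times> UNIV. case p of (k, c) \<Rightarrow> {y. y $ j = x $ j + h \<and> y $ k = (if c then a $ k else b $ k)})"
        proof
          fix y assume y: "y \<in> {y. y $ j = x $ j + h} \<inter> frontier (box a b)"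
          then obtain k where k: "y $ k = a $ k \<or> y $ k = b $ k" using frontier_box_vec(2)[of y a b] by auto
          have "k \<noteq> j" using k y ab h by auto
          then show "y \<in> (\<Union>p\<in>(UNIV - {j}) \<times> UNIV. case p of (k, c) \<Rightarrow> {y. y $ j = x $ j + h \<and> y $ k = (if c then a $ k else b $ k)})"
            using y k by (intro UN_I[of "(k, y $ k = a $ k)"]) auto
        qed
      qed auto
    qed
    \<comment> \<open>Over the open slab the long box and the cube coincide, so locality identifies
      their lateral fluxes.\<close>
    moreover have "total_flux (box a b) {y. x $ j < y $ j \<and> y $ j < x $ j + h} = total_flux ?I {y. x $ j < y $ j \<and> y $ j < x $ j + h}"
    proof (rule total_flux_local'[OF V I])
      show "open {y::real^'n. x $ j < y $ j \<and> y $ j < x $ j + h}"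
        by (intro open_Collect_conj open_Collect_less continuous_intros)
      show "{y. x $ j < y $ j \<and> y $ j < x $ j + h} \<inter> box a b = {y. x $ j < y $ j \<and> y $ j < x $ j + h} \<inter> ?I"
        using h by (auto simp: mem_ab mem_I)
    qed
    moreover have "total_flux ?I (C j) = \<sigma> ?I - total_flux ?I {y. x $ j < y $ j \<and> y $ j < x $ j + h}"
      using fvm_Diff[OF fI, of "{y. x $ j < y $ j \<and> y $ j < x $ j + h}" UNIV] total_flux_UNIV[OF I]
      by (simp add: C_def Compl_eq_Diff_UNIV)
    ultimately show ?thesis
      using cut[of "x $ j" 0] cut[of "x $ j + h" h] fl[of j] \<sigma>eq unfolding f0 fh by simp
  qed
  have "total_flux ?I (\<Union>j\<in>UNIV. C j) = (\<Sum>j\<in>UNIV. total_flux ?I (C j))"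
  proof (rule fvm_overlap_sum[OF fI finite CB])
    fix j S assume S: "S \<in> sets borel" "S \<subseteq> C j \<inter> (\<Union>k\<in>UNIV - {j}. C k)"
    show "total_flux ?I S = 0"
    proof (rule total_flux_null[OF I LI S(1), where P = "(UNIV - {j}) \<times> (UNIV \<times> UNIV)" and
        Z = "\<lambda>(k, c, d). {y. y $ j = x $ j + (if c then 0 else h) \<and> y $ k = x $ k + (if d then 0 else h)}"])
      fix p :: "'n \<times> bool \<times> bool" assume p: "p \<in> (UNIV - {j}) \<times> (UNIV \<times> UNIV)"
      obtain k c d where pk: "p = (k, c, d)" "k \<noteq> j" using p by auto
      show "(case p of (k, c, d) \<Rightarrow> {y::real^'n. y $ j = x $ j + (if c then 0 else h) \<and> y $ k = x $ k + (if d then 0 else h)}) \<in> sets borel"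
        unfolding pk by simp
      have "measure \<nu> {y. y $ j = x $ j + (if c then 0 else h) \<and> y $ k = x $ k + (if d then 0 else h)} = 0"
      proof (rule null_edge[OF GI LI pk(2)[symmetric]])
        fix l v assume v: "v = x $ l \<or> v = shift x h $ l"
        then have "v = x $ l + 0 \<or> v = x $ l + h" by (simp add: shift_def)
        then obtain s where s: "s \<in> ?O" "v = x $ l + s" by blast
        have cd: "(if c then 0 else h) \<in> ?O" "(if d then 0 else h) \<in> ?O" by simp_all
        show "l \<noteq> j \<and> edge_ok l j v (x $ j + (if c then 0 else h)) \<or> l \<noteq> k \<and> edge_ok l k v (x $ k + (if d then 0 else h))
          \<or> l = j \<and> v \<noteq> x $ j + (if c then 0 else h)"
        proof (cases "l = j")
          case True
          then have "l \<noteq> k" using pk(2) by simp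
          with edge[OF this s(1) cd(2)] show ?thesis unfolding s(2) by (intro disjI2 disjI1 conjI)
        next
          case False
          with edge[OF this s(1) cd(1)] show ?thesis unfolding s(2) by (intro disjI1 conjI)
        qed
      qed
      then show "measure \<nu> (case p of (k, c, d) \<Rightarrow> {y. y $ j = x $ j + (if c then 0 else h) \<and> y $ k = x $ k + (if d then 0 else h)}) = 0"
        by (simp add: pk)
    next
      show "S \<inter> frontier ?I \<subseteq> (\<Union>p\<in>(UNIV - {j}) \<times> (UNIV \<times> UNIV). case p of (k, c, d) \<Rightarrow> {y. y $ j = x $ j + (if c then 0 else h) \<and> y $ k = x $ k + (if d then 0 else h)})"
      proof
        fix y assume y: "y \<in> S \<inter> frontier ?I"
        then have cb: "y \<in> cbox x (shift x h)" using frontier_box_vec(1) by auto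
        obtain k where k: "k \<noteq> j" "y \<in> C j" "y \<in> C k" using y S(2) by blast
        have ends: "y $ l = x $ l \<or> y $ l = x $ l + h" if "y \<in> C l" for l
          using that cb[unfolded mem_cbox_vec, rule_format, of l] by (auto simp: C_def shift_def)
        show "y \<in> (\<Union>p\<in>(UNIV - {j}) \<times> (UNIV \<times> UNIV). case p of (k, c, d) \<Rightarrow> {y. y $ j = x $ j + (if c then 0 else h) \<and> y $ k = x $ k + (if d then 0 else h)})"
          using ends[OF k(2)] ends[OF k(3)] k(1) by (intro UN_I[of "(k, y $ j = x $ j, y $ k = x $ k)"]) auto
      qed
    qed auto
  qed
  moreover have "(\<Union>j\<in>UNIV. C j) = UNIV - ?I" by (auto simp: C_def mem_box_vec shift_def)
  moreover have "total_flux ?I (UNIV - ?I) = \<sigma> ?I - total_flux ?I ?I"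
    using fvm_Diff[OF fI, of ?I UNIV] total_flux_UNIV[OF I] by simp
  moreover have "total_flux ?I ?I = 0"
  proof -
    have "?I \<inter> frontier ?I = {}" by (auto simp: frontier_open_eq open_box)
    then show ?thesis using fvm_empty[OF flux_fvm[OF I]] by (simp add: total_flux_def)
  qed
  ultimately show ?thesis by (simp add: per_face)
qed

end

subsection \<open>Almost every point is generic\<close>

lemma AE_lborel_E:
  assumes "AE t in lborel. P t"
  obtains N :: "'a::euclidean_space set" where "N \<in> sets borel" "emeasure lborel N = 0" "\<And>t. t \<notin> N \<Longrightarrow> P t"
proof -
  obtain N where N: "{t \<in> space lborel. \<not> P t} \<subseteq> N" "emeasure lborel N = 0" "N \<in> sets lborel" using assms by (rule AE_E)
  show ?thesis by (rule that[of N]) (use N in auto)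
qed

lemma AE_lborel_translate:
  fixes c :: "'a::euclidean_space"
  assumes "AE t in lborel. P t" shows "AE t in lborel. P (c + t)"
proof -
  have "AE t in distr lborel borel ((+) c). P t" using assms by (subst lborel_distr_plus)
  then show ?thesis by (rule AE_distrD[rotated]) simp
qed

lemma AE_lborel_exists:
  assumes "AE x in lborel. P (x::'a::euclidean_space)" shows "\<exists>x. P x"
proof -
  have "ae_filter (lborel :: 'a measure) \<noteq> bot" by (simp add: ae_filter_eq_bot_iff)
  then show ?thesis using eventually_happens' assms by blast
qed

text \<open>Fubini and translation invariance: after exchanging the quantifiers, the inner condition
  is the same for every \<open>s\<close>. This reduces statements about almost every point to one
  variable at a time.\<close>

lemma AE_line_iff:
  fixes P :: "real^'n::finite \<Rightarrow> bool" and e :: "real^'n"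
  assumes [measurable]: "Measurable.pred borel P"
  shows "(AE x in lborel. AE s in lborel. P (x + s *\<^sub>R e)) \<longleftrightarrow> (AE x in lborel. P x)"
proof -
  have 1: "(AE x in (lborel::(real^'n) measure). AE s in (lborel::real measure). P (x + s *\<^sub>R e)) \<longleftrightarrow> (AE s in lborel. AE x in lborel. P (x + s *\<^sub>R e))"
    by (rule lborel_pair.AE_commute) measurable
  have 2: "(AE x in lborel. P (x + s *\<^sub>R e)) = (AE x in lborel. P x)" for s :: real
  proof
    assume "AE x in lborel. P x"
    from AE_lborel_translate[OF this, of "s *\<^sub>R e"] show "AE x in lborel. P (x + s *\<^sub>R e)" by (simp add: add.commute)
  next
    assume "AE x in lborel. P (x + s *\<^sub>R e)"
    from AE_lborel_translate[OF this, of "- s *\<^sub>R e"] show "AE x in lborel. P x" by (simp add: algebra_simps)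
  qed
  have 3: "(AE s in (lborel::real measure). AE x in lborel. P x) = (AE x in lborel. P x)"
  proof
    assume "AE s in (lborel::real measure). AE x in lborel. P x"
    from AE_lborel_exists[OF this] show "AE x in lborel. P x" by (elim exE)
  next
    assume "AE x in lborel. P x"
    then show "AE s in (lborel::real measure). AE x in lborel. P x" by (rule AE_I2)
  qed
  show ?thesis by (simp only: 1 2 3)
qed

text \<open>\<open>P\<close> need not be measurable, so it is first replaced by the complement of a
  Borel null set; \<open>AE_line_iff\<close> along the coordinate direction does the rest.\<close>

lemma AE_coordinate:
  assumes "AE t in lborel. P t"
  shows "AE x in (lborel :: (real^'n::finite) measure). P (x $ i + c)"
proof -
  obtain N where N [measurable]: "N \<in> sets borel" and N0: "emeasure lborel N = 0" "\<And>t. t \<notin> N \<Longrightarrow> P t"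
    using assms by (rule AE_lborel_E) (rule that)
  have "AE s in lborel. s \<notin> N" by (rule AE_not_in) (use N N0 in \<open>auto simp: null_sets_def\<close>)
  then have "AE s in lborel. (x $ i + c) + s \<notin> N" for x :: "real^'n" by (rule AE_lborel_translate)
  moreover have "(x + s *\<^sub>R axis i 1) $ i + c = (x $ i + c) + s" for x :: "real^'n" and s
    by (simp add: axis_def)
  ultimately have "AE s in lborel. (x + s *\<^sub>R axis i 1) $ i + c \<notin> N" for x :: "real^'n"
    by presburger
  then have "AE x in (lborel :: (real^'n) measure). AE s in lborel. (x + s *\<^sub>R axis i 1) $ i + c \<notin> N"
    by (rule AE_I2)
  then have "AE x in (lborel :: (real^'n) measure). x $ i + c \<notin> N" by (subst (asm) AE_line_iff) measurable
  then show ?thesis by eventually_elim (rule N0(2))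
qed

text \<open>Parallel hyperplanes are disjoint, so a finite measure charges only countably many of
  them.\<close>

lemma AE_hyperplane_null:
  fixes M :: "(real^'n::finite) measure"
  assumes s: "sets M = sets borel" and f: "finite_measure M"
  shows "AE s in lborel. measure M {y. y $ j = s} = 0"
proof -
  interpret finite_measure M by fact
  have sp: "space M = UNIV" using sets_eq_imp_space_eq[OF s] by simp
  have m [measurable]: "(\<lambda>y. y $ j) \<in> M \<rightarrow>\<^sub>M borel" using s by (simp cong: measurable_cong_sets)
  interpret D: finite_measure "distr M borel (\<lambda>y. y $ j)" by (rule finite_measure_distr[OF m])
  have "measure (distr M borel (\<lambda>y. y $ j)) {s} = measure M {y. y $ j = s}" for s
    by (subst measure_distr) (auto simp: sp vimage_def)
  then have "countable {s. measure M {y. y $ j = s} \<noteq> 0}" using D.countable_support by simp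
  then have "{s. measure M {y. y $ j = s} \<noteq> 0} \<in> null_sets lborel" by (rule countable_imp_null_set_lborel)
  from AE_not_in[OF this] show ?thesis by simp
qed

context flux
begin

lemma slab_measure_measurable [measurable]:
  fixes f g :: "'b \<Rightarrow> real"
  assumes [measurable]: "f \<in> borel_measurable M" "g \<in> borel_measurable M"
  shows "(\<lambda>x. measure \<mu> {y. \<bar>y $ i - f x\<bar> \<le> \<epsilon> \<and> \<bar>y $ j - g x\<bar> < \<rho>}) \<in> borel_measurable M"
proof -
  let ?Q = "{p \<in> space (M \<Otimes>\<^sub>M \<mu>). \<bar>snd p $ i - f (fst p)\<bar> \<le> \<epsilon> \<and> \<bar>snd p $ j - g (fst p)\<bar> < \<rho>}"
  have Q: "?Q \<in> sets (M \<Otimes>\<^sub>M \<mu>)" by measurable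
  have "(\<lambda>x. enn2real (emeasure \<mu> (Pair x -` ?Q))) \<in> borel_measurable M"
    by (intro borel_measurable_enn2real \<mu>.measurable_emeasure_Pair Q)
  then show ?thesis
    by (rule measurable_cong[THEN iffD1, rotated])
       (auto simp: measure_def space_pair_measure intro!: arg_cong[where f="\<lambda>S. enn2real (emeasure \<mu> S)"])
qed

lemma hyperplane_measure_measurable [measurable]:
  fixes g :: "'b \<Rightarrow> real"
  assumes [measurable]: "g \<in> borel_measurable M"
  shows "(\<lambda>x. measure \<mu> {y. y $ j = g x}) \<in> borel_measurable M"
proof -
  let ?Q = "{p \<in> space (M \<Otimes>\<^sub>M \<mu>). snd p $ j = g (fst p)}"
  have Q: "?Q \<in> sets (M \<Otimes>\<^sub>M \<mu>)" by measurable
  have "(\<lambda>x. enn2real (emeasure \<mu> (Pair x -` ?Q))) \<in> borel_measurable M"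
    by (intro borel_measurable_enn2real \<mu>.measurable_emeasure_Pair Q)
  then show ?thesis
    by (rule measurable_cong[THEN iffD1, rotated])
       (auto simp: measure_def space_pair_measure intro!: arg_cong[where f="\<lambda>S. enn2real (emeasure \<mu> S)"])
qed

lemma edge_ok_measurable [measurable]:
  fixes f g :: "'b \<Rightarrow> real"
  assumes [measurable]: "f \<in> borel_measurable M" "g \<in> borel_measurable M"
  shows "Measurable.pred M (\<lambda>x. edge_ok i j (f x) (g x))"
  unfolding edge_ok_def by measurable

text \<open>At a bad \<open>t\<close>, the image under coordinate \<open>i\<close> of \<mu>
  restricted to \<open>Q r\<close> has mean density at least \<open>q\<close> on arbitrarily small
  balls, for every \<open>r\<close>. The Vitali bound gives \<open>q\<close> times the length of
  \<open>bad n\<close> at most \<open>measure \<mu> (Q r)\<close>, and this tends to 0 because the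
  hyperplane \<open>{y. y $ j = s}\<close> is null.\<close>

lemma AE_edge_ok:
  assumes null: "measure \<mu> {y. y $ j = s} = 0"
  shows "AE t in lborel. edge_ok i j t s"
proof -
  define bad where "bad n = {t. \<forall>r k0. \<exists>k\<ge>k0. \<not> measure \<mu> {x. \<bar>x $ i - t\<bar> \<le> 1 / real (Suc k) \<and> \<bar>x $ j - s\<bar> < 1 / real (Suc r)} \<le> 1 / (real (Suc n) * real (Suc k))}" for n :: nat
  have badB: "bad n \<in> sets borel" for n unfolding bad_def by measurable
  define Q where "Q r = {x::real^'n. \<bar>x $ j - s\<bar> < 1 / real (Suc r)}" for r
  have Qb [measurable]: "Q r \<in> sets borel" for r unfolding Q_def by measurable
  have "(\<lambda>r. measure \<mu> (Q r)) \<longlonglongrightarrow> measure \<mu> (\<Inter>r. Q r)"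
  proof (rule \<mu>.finite_Lim_measure_decseq)
    show "range Q \<subseteq> sets \<mu>" by auto
    show "decseq Q"
    proof (rule decseq_SucI)
      fix r
      have "1 / real (Suc (Suc r)) \<le> 1 / real (Suc r)" by (intro frac_le) auto
      then show "Q (Suc r) \<subseteq> Q r" unfolding Q_def by (auto intro: less_le_trans)
    qed
  qed
  moreover have "(\<Inter>r. Q r) = {y. y $ j = s}"
  proof (intro equalityI subsetI)
    fix y assume y: "y \<in> (\<Inter>r. Q r)"
    show "y \<in> {y. y $ j = s}"
    proof (rule ccontr)
      assume "y \<notin> {y. y $ j = s}"
      then have "\<bar>y $ j - s\<bar> > 0" by simp
      then obtain r where "1 / real (Suc r) < \<bar>y $ j - s\<bar>" using nat_approx_posE by blast
      then show False using y by (auto simp: Q_def dest!: spec[of _ r])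
    qed
  qed (simp add: Q_def)
  ultimately have Qlim: "(\<lambda>r. measure \<mu> (Q r)) \<longlonglongrightarrow> 0" using null by simp
  have "bad n \<in> null_sets lborel" for n
  proof -
    \<comment> \<open>The factor 4 is the length of \<open>ball t (2 * e)\<close> in units of
      \<open>e = 1 / Suc k\<close>; the radius is doubled so that the closed slab of half-width
      \<open>e\<close> fits into an open ball.\<close>
    define q where "q = 1 / (4 * real (Suc n))"
    have q: "q > 0" by (simp add: q_def)
    have le: "ennreal q * emeasure lborel (bad n) \<le> ennreal (measure \<mu> (Q r))" for r
    proof -
      let ?d = "density \<mu> (indicator (Q r))"
      let ?l = "distr ?d borel (\<lambda>x. x $ i)"
      have mi: "(\<lambda>x. x $ i) \<in> ?d \<rightarrow>\<^sub>M borel" by measurable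
      have lm: "emeasure ?l A = ennreal (measure \<mu> (Q r \<inter> {x. x $ i \<in> A}))" if A: "A \<in> sets borel" for A
      proof -
        have "{x. x $ i \<in> A} = (\<lambda>x. x $ i) -` A" by auto
        then have [measurable]: "{x::real^'n. x $ i \<in> A} \<in> sets borel"
          using measurable_sets_borel[OF borel_measurable_vec_nth A] by simp
        have "emeasure ?l A = emeasure ?d {x. x $ i \<in> A}"
          using A mi by (subst emeasure_distr) (auto simp: vimage_def)
        also have "\<dots> = emeasure \<mu> (Q r \<inter> {x. x $ i \<in> A})" by (rule emeasure_restricted) auto
        finally show ?thesis by (simp add: \<mu>.emeasure_eq_measure)
      qed
      have "ennreal q * emeasure lborel (bad n) \<le> emeasure ?l UNIV"
      proof (rule vitali_lower_bound[OF _ badB])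
        fix t d :: real assume t: "t \<in> bad n" and d: "0 < d"
        obtain k0 where k0: "1 / real (Suc k0) < d / 2" using d nat_approx_posE[of "d / 2"] by auto
        obtain k where k: "k \<ge> k0" "\<not> measure \<mu> {x. \<bar>x $ i - t\<bar> \<le> 1 / real (Suc k) \<and> \<bar>x $ j - s\<bar> < 1 / real (Suc r)} \<le> 1 / (real (Suc n) * real (Suc k))"
          using t unfolding bad_def by blast
        define e where "e = 1 / real (Suc k)"
        have e: "0 < e" "e < d / 2" using k0 k(1) frac_le[of 1 1 "real (Suc k0)" "real (Suc k)"] by (auto simp: e_def simp del: of_nat_Suc)
        have "1 / (real (Suc n) * real (Suc k)) = q * (2 * (2 * e))" by (simp add: q_def e_def field_simps del: of_nat_Suc)
        then have "q * (2 * (2 * e)) \<le> measure \<mu> {x. \<bar>x $ i - t\<bar> \<le> e \<and> \<bar>x $ j - s\<bar> < 1 / real (Suc r)}"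
          using k(2) by (simp add: e_def)
        also have "\<dots> \<le> measure \<mu> (Q r \<inter> {x. x $ i \<in> ball t (2 * e)})"
          using e by (intro \<mu>.finite_measure_mono) (auto simp: Q_def dist_real_def, measurable)
        finally have "ennreal (q * (2 * (2 * e))) \<le> emeasure ?l (ball t (2 * e))"
          by (subst lm) (auto intro: ennreal_leI)
        moreover have "t \<in> ball t (2 * e)" "2 * e < d" using e by auto
        ultimately show "\<exists>a r'. t \<in> ball a r' \<and> r' < d \<and> ennreal (q * (2 * r')) \<le> emeasure ?l (ball a r')" by blast
      qed (use q in auto)
      then show ?thesis by (simp add: lm)
    qed
    have "(\<lambda>r. ennreal (measure \<mu> (Q r))) \<longlonglongrightarrow> ennreal 0" using Qlim by (rule tendsto_ennrealI)
    then have "ennreal q * emeasure lborel (bad n) \<le> ennreal 0" by (rule LIMSEQ_le_const) (use le in blast)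
    then have "emeasure lborel (bad n) = 0" using q by simp
    then show ?thesis using badB by (auto simp: null_sets_def)
  qed
  then have "AE t in lborel. \<forall>n. t \<notin> bad n" unfolding AE_all_countable by (blast intro: AE_not_in)
  then show ?thesis
  proof eventually_elim
    fix t assume "\<forall>n. t \<notin> bad n"
    then show "edge_ok i j t s" unfolding edge_ok_def bad_def by blast
  qed
qed

lemma AE_edge_ok_pair:
  assumes "i \<noteq> j"
  shows "AE x in lborel. edge_ok i j (x $ i + s) (x $ j + s')"
proof -
  let ?P = "\<lambda>x::real^'n. measure \<mu> {y. y $ j = x $ j + s'} \<noteq> 0 \<or> edge_ok i j (x $ i + s) (x $ j + s')"
  have [measurable]: "Measurable.pred borel ?P" by measurable
  have line: "AE \<tau> in lborel. ?P (x + \<tau> *\<^sub>R axis i 1)" for x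
  proof (cases "measure \<mu> {y. y $ j = x $ j + s'} = 0")
    case True
    from AE_lborel_translate[OF AE_edge_ok[OF True, of i], of "x $ i + s"]
    have "AE \<tau> in lborel. edge_ok i j (x $ i + s + \<tau>) (x $ j + s')" .
    then show ?thesis
    proof eventually_elim
      case (elim \<tau>)
      have e: "(x + \<tau> *\<^sub>R axis i 1) $ i + s = x $ i + s + \<tau>" "(x + \<tau> *\<^sub>R axis i 1) $ j + s' = x $ j + s'"
        using assms by (auto simp: axis_def)
      show ?case unfolding e using elim by blast
    qed
  next
    case False
    have e: "(x + \<tau> *\<^sub>R axis i 1) $ j + s' = x $ j + s'" for \<tau> using assms by (auto simp: axis_def)
    show ?thesis unfolding e using False by simp
  qed
  have "AE x in lborel. ?P x" by (subst AE_line_iff[symmetric, of _ "axis i 1"]) (use line in auto)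
  moreover have "AE x in (lborel :: (real^'n) measure). measure \<mu> {y. y $ j = x $ j + s'} = 0"
    by (rule AE_coordinate[OF AE_hyperplane_null[OF sets_\<mu> finite_\<mu>]])
  ultimately show ?thesis by eventually_elim blast
qed

lemma AE_generic: "AE x in lborel. generic x h"
proof -
  let ?O = "{- h, 0, h, 2 * h}"
  note P = finite_radon_onD[OF finite_radon_pos_variation[OF fvm_\<sigma> \<Omega>_borel]]
  note N = finite_radon_onD[OF finite_radon_pos_variation[OF fvm_uminus[OF fvm_\<sigma>] \<Omega>_borel]]
  have "AE x in lborel. \<forall>i. \<forall>s\<in>?O. slab_ok i (x $ i + s)"
    unfolding AE_all_countable by (intro allI AE_ball_countable' AE_coordinate AE_slab_ok) auto
  moreover have "AE x in lborel. \<forall>i j. i \<noteq> j \<longrightarrow> (\<forall>s\<in>?O. \<forall>s'\<in>?O. edge_ok i j (x $ i + s) (x $ j + s'))"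
    unfolding AE_all_countable
  proof (intro allI)
    fix i j :: 'n
    show "AE x in lborel. i \<noteq> j \<longrightarrow> (\<forall>s\<in>?O. \<forall>s'\<in>?O. edge_ok i j (x $ i + s) (x $ j + s'))"
    proof (cases "i = j")
      case False
      have "AE x in lborel. \<forall>s\<in>?O. \<forall>s'\<in>?O. edge_ok i j (x $ i + s) (x $ j + s')"
        by (intro AE_ball_countable' AE_edge_ok_pair[OF False]) auto
      then show ?thesis by eventually_elim blast
    qed simp
  qed
  moreover have "AE x in lborel. \<forall>i. flux_ok i (x $ i + 0) \<and> flux_ok i (x $ i + h)"
    unfolding AE_all_countable by (intro allI AE_conjI AE_coordinate AE_flux_ok)
  moreover have "AE x in (lborel::(real^'n) measure). \<forall>i. measure (pos_variation \<Omega> \<sigma>) {y. y $ i = x $ i + h} = 0 \<and>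
          measure (pos_variation \<Omega> (\<lambda>S. - \<sigma> S)) {y. y $ i = x $ i + h} = 0"
    unfolding AE_all_countable
    by (intro allI AE_conjI AE_coordinate[OF AE_hyperplane_null[OF P(1,3)]] AE_coordinate[OF AE_hyperplane_null[OF N(1,3)]])
  ultimately show ?thesis
    unfolding generic_def by eventually_elim simp
qed

subsection \<open>Measurability of the half-space fluxes\<close>

text \<open>Rational translates of \<open>z\<close> provide dense sets of levels for the faces of
  boxes, such that almost every cut \<open>t\<close> meets them in harmless edges. Both orders of
  \<open>edge_ok\<close> occur because it treats its two coordinates differently.\<close>

definition grid_ok :: "real^'n \<Rightarrow> bool" where
  "grid_ok z \<longleftrightarrow> (\<forall>i. \<forall>p\<in>\<rat>. slab_ok i (z $ i + p)) \<and>
     (\<forall>i j. i \<noteq> j \<longrightarrow> (\<forall>p\<in>\<rat>. (AE t in lborel. edge_ok i j (z $ i + p) t) \<and> (AE t in lborel. edge_ok j i t (z $ i + p))))"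

lemma grid_exists: "\<exists>z. grid_ok z"
proof (rule AE_lborel_exists)
  have "AE x in lborel. \<forall>i. \<forall>p\<in>\<rat>. slab_ok i (x $ i + p)"
    unfolding AE_all_countable by (intro allI AE_ball_countable' countable_rat AE_coordinate AE_slab_ok)
  moreover have "AE x in lborel. \<forall>i j. i \<noteq> j \<longrightarrow> (\<forall>p\<in>\<rat>. (AE t in lborel. edge_ok i j (x $ i + p) t) \<and> (AE t in lborel. edge_ok j i t (x $ i + p)))"
    unfolding AE_all_countable
  proof (intro allI)
    fix i j :: 'n
    show "AE x in lborel. i \<noteq> j \<longrightarrow> (\<forall>p\<in>\<rat>. (AE t in lborel. edge_ok i j (x $ i + p) t) \<and> (AE t in lborel. edge_ok j i t (x $ i + p)))"
    proof (cases "i = j")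
      case False
      have 1: "AE x in lborel. AE t in lborel. edge_ok i j (x $ i + p) t" for p
      proof -
        have "AE x in lborel. edge_ok i j (x $ i + p) (x $ j + 0)" by (rule AE_edge_ok_pair[OF False])
        then have "AE x in lborel. AE s in lborel. edge_ok i j ((x + s *\<^sub>R axis j 1) $ i + p) ((x + s *\<^sub>R axis j 1) $ j + 0)"
          by (subst AE_line_iff) measurable
        then show ?thesis
        proof eventually_elim
          case (elim x)
          then have "AE s in lborel. edge_ok i j (x $ i + p) (x $ j + s)"
          proof eventually_elim
            case (elim s)
            have e: "(x + s *\<^sub>R axis j 1) $ i + p = x $ i + p" "(x + s *\<^sub>R axis j 1) $ j + 0 = x $ j + s"
              using False by (auto simp: axis_def)
            show ?case using elim unfolding e .
          qed
          from AE_lborel_translate[OF this, of "- x $ j"] show ?case by simp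
        qed
      qed
      have 2: "AE x in lborel. AE t in lborel. edge_ok j i t (x $ i + p)" for p
      proof -
        have "AE x in (lborel :: (real^'n) measure). measure \<mu> {y. y $ i = x $ i + p} = 0"
          by (rule AE_coordinate[OF AE_hyperplane_null[OF sets_\<mu> finite_\<mu>]])
        then show ?thesis by eventually_elim (rule AE_edge_ok)
      qed
      have "AE x in lborel. \<forall>p\<in>\<rat>. (AE t in lborel. edge_ok i j (x $ i + p) t) \<and> (AE t in lborel. edge_ok j i t (x $ i + p))"
        by (intro AE_ball_countable' countable_rat AE_conjI 1 2)
      then show ?thesis by eventually_elim blast
    qed simp
  qed
  ultimately show "AE z in lborel. grid_ok z" unfolding grid_ok_def by eventually_elim blast
qed

definition base :: "real^'n" where "base = (SOME z. grid_ok z)"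
text \<open>The face levels are fixed beforehand and are countable in number; so the exceptional
  cuts of all mesh boxes together form a null set.\<close>

definition mesh :: "'n \<Rightarrow> real set" where "mesh i = (\<lambda>p. base $ i + p) ` \<rat>"

lemma grid_ok_base: "grid_ok base"
  unfolding base_def using grid_exists by (rule someI_ex)

lemma mesh_countable: "countable (mesh i)"
  unfolding mesh_def by (intro countable_image countable_rat)

lemma mesh_dense: "s < t \<Longrightarrow> \<exists>d\<in>mesh i. s < d \<and> d < t"
proof -
  assume "s < t"
  then obtain p where "p \<in> \<rat>" "s - base $ i < p" "p < t - base $ i" using rats_dense[of "s - base $ i" "t - base $ i"] by auto
  then show ?thesis by (intro bexI[of _ "base $ i + p"]) (auto simp: mesh_def)
qed

lemma slab_ok_mesh: "u \<in> mesh i \<Longrightarrow> slab_ok i u"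
  using grid_ok_base by (auto simp: grid_ok_def mesh_def)

definition good_level :: "'n \<Rightarrow> real \<Rightarrow> bool" where
  "good_level j t \<longleftrightarrow> slab_ok j t \<and> flux_ok j t \<and> (\<forall>k. k \<noteq> j \<longrightarrow> (\<forall>u\<in>mesh k. edge_ok j k t u \<and> edge_ok k j u t))"

lemma AE_good_level: "AE t in lborel. good_level j t"
proof -
  have "AE t in lborel. \<forall>k. k \<noteq> j \<longrightarrow> (\<forall>u\<in>mesh k. edge_ok j k t u \<and> edge_ok k j u t)"
    unfolding AE_all_countable
  proof (intro allI)
    fix k
    show "AE t in lborel. k \<noteq> j \<longrightarrow> (\<forall>u\<in>mesh k. edge_ok j k t u \<and> edge_ok k j u t)"
    proof (cases "k = j")
      case False
      have "AE t in lborel. edge_ok j k t u \<and> edge_ok k j u t" if "u \<in> mesh k" for u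
        using that grid_ok_base False unfolding grid_ok_def mesh_def by (auto intro!: AE_conjI)
      then have "AE t in lborel. \<forall>u\<in>mesh k. edge_ok j k t u \<and> edge_ok k j u t"
        by (intro AE_ball_countable' mesh_countable)
      then show ?thesis by eventually_elim blast
    qed simp
  qed
  with AE_slab_ok[of j] AE_flux_ok[of j] show ?thesis unfolding good_level_def by eventually_elim blast
qed

text \<open>\<open>good_level\<close> is not known to be a Borel property; a Borel null set outside
  which it holds is fixed once and for all.\<close>

definition bad_levels :: "'n \<Rightarrow> real set" where
  "bad_levels j = (SOME N. N \<in> sets borel \<and> emeasure lborel N = 0 \<and> (\<forall>t. t \<notin> N \<longrightarrow> good_level j t))"

lemma bad_levels: "bad_levels j \<in> sets borel" "emeasure lborel (bad_levels j) = 0" "t \<notin> bad_levels j \<Longrightarrow> good_level j t"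
proof -
  have "\<exists>N. N \<in> sets borel \<and> emeasure lborel N = 0 \<and> (\<forall>t. t \<notin> N \<longrightarrow> good_level j t)"
    using AE_good_level[of j] by (rule AE_lborel_E) blast
  from someI_ex[OF this, folded bad_levels_def]
  show "bad_levels j \<in> sets borel" "emeasure lborel (bad_levels j) = 0" "t \<notin> bad_levels j \<Longrightarrow> good_level j t" by blast+
qed

text \<open>Cut down to the hyperplane in \<Omega> and zero on bad levels, the half-space flux
  becomes a signed measure on the whole space for every \<open>t\<close>, so it can be handled as a
  kernel.\<close>

definition flux_kernel :: "'n \<Rightarrow> real \<Rightarrow> (real^'n) set \<Rightarrow> real" where
  "flux_kernel j t S = (if t \<in> bad_levels j then 0 else hf j t (S \<inter> (\<Omega> \<inter> {x. x $ j = t})))"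

lemma flux_kernel_fvm: "fvm UNIV (flux_kernel j t)"
proof (cases "t \<in> bad_levels j")
  case True then show ?thesis using fvm_zero by (simp add: flux_kernel_def [abs_def])
next
  case False
  then have "flux_ok j t" using bad_levels(3) by (auto simp: good_level_def)
  then have "fvm (\<Omega> \<inter> {x. x $ j = t}) (hf j t)"
    using flux_ok_is_halfspace_flux unfolding is_halfspace_flux_def frontier_halfsp by blast
  then have "fvm UNIV (\<lambda>S. hf j t (S \<inter> (\<Omega> \<inter> {x. x $ j = t})))" by (rule fvm_restrict) auto
  then show ?thesis using False by (simp add: flux_kernel_def [abs_def])
qed

lemma flux_kernel_slice: "flux_kernel j t (S \<inter> {x. x $ j = t}) = flux_kernel j t S"
proof -
  have "S \<inter> {x. x $ j = t} \<inter> (\<Omega> \<inter> {x. x $ j = t}) = S \<inter> (\<Omega> \<inter> {x. x $ j = t})" by auto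
  then show ?thesis by (simp add: flux_kernel_def)
qed

lemma flux_kernel_\<Omega>: "flux_kernel j t (S \<inter> \<Omega>) = flux_kernel j t S"
  by (simp add: flux_kernel_def Int_assoc Int_absorb2 inf.absorb_iff2 flip: Int_assoc)

text \<open>For boxes with corners in the mesh the cut formula leaves upper sections of two signed
  measures, whose Jordan parts are monotone in \<open>t\<close>. Proper differences and disjoint
  unions extend this to all Borel sets.\<close>

lemma flux_kernel_measurable:
  assumes S: "S \<in> sets borel"
  shows "(\<lambda>t. flux_kernel j t S) \<in> borel_measurable borel"
proof -
  have [measurable]: "bad_levels j \<in> sets borel" by (rule bad_levels)
  have "(\<lambda>t. flux_kernel j t (S \<inter> \<Omega>)) \<in> borel_measurable borel"
  proof (rule borel_box_induct[where D=mesh and \<Omega>=\<Omega> and P="\<lambda>S. (\<lambda>t. flux_kernel j t S) \<in> borel_measurable borel",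
        OF mesh_dense mesh_countable open_\<Omega>])
    show "(\<lambda>t. flux_kernel j t {}) \<in> borel_measurable borel" using fvm_empty[OF flux_kernel_fvm] by simp
  next
    fix a b assume ab: "grid_box mesh a b" "cbox a b \<subseteq> \<Omega>" "box a b \<noteq> {}"
    have lt: "a $ i < b $ i" for i
    proof -
      obtain y where "y \<in> box a b" using ab(3) by auto
      then show ?thesis by (meson mem_box_vec order_less_trans)
    qed
    have G: "good_box a b" using ab lt slab_ok_mesh by (auto simp: good_box_def grid_box_def)
    have V\<Omega>: "box a b \<subseteq> \<Omega>" using ab(2) box_subset_cbox[of a b] by auto
    \<comment> \<open>The intersections with \<Omega> and \<open>UNIV\<close> bring both terms into
      the shape \<open>\<Phi> (A \<inter> {x. t < f x})\<close>, with \<Phi> a measure on the whole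
      space, as in \<open>measurable_upper_section\<close>.\<close>
    have eq: "flux_kernel j t (box a b) =
      (if t \<in> bad_levels j then 0 else if a $ j < t \<and> t < b $ j
       then \<sigma> ((box a b \<inter> {x. t < x $ j}) \<inter> \<Omega>) - total_flux (box a b) (UNIV \<inter> {x. t < x $ j}) else 0)" for t
    proof (cases "t \<in> bad_levels j")
      case False
      then have gl: "good_level j t" by (rule bad_levels)
      show ?thesis
      proof (cases "a $ j < t \<and> t < b $ j")
        case True
        have "hf j t (box a b \<inter> {x. x $ j = t}) = \<sigma> (box a b \<inter> {x. t < x $ j}) - total_flux (box a b) {x. t < x $ j}"
        proof (rule halfspace_flux_box[OF G])
          show "edge_ok j k t u \<and> edge_ok k j u t" if k: "k \<noteq> j" "u = a $ k \<or> u = b $ k" for k u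
          proof -
            have "u \<in> mesh k" using k(2) ab(1) by (auto simp: grid_box_def)
            then show ?thesis using gl k(1) unfolding good_level_def by blast
          qed
        qed (use True gl in \<open>auto simp: good_level_def\<close>)
        moreover have "box a b \<inter> (\<Omega> \<inter> {x. x $ j = t}) = box a b \<inter> {x. x $ j = t}" using V\<Omega> by auto
        moreover have "(box a b \<inter> {x. t < x $ j}) \<inter> \<Omega> = box a b \<inter> {x. t < x $ j}" using V\<Omega> by auto
        ultimately show ?thesis using True False by (simp add: flux_kernel_def)
      next
        case out: False
        then have "box a b \<inter> {x. x $ j = t} = {}" by (auto simp: mem_box_vec)
        then have "flux_kernel j t (box a b) = 0"
          using flux_kernel_slice[of j t "box a b"] fvm_empty[OF flux_kernel_fvm[of j t]] by simp
        then show ?thesis unfolding if_not_P[OF out] by simp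
      qed
    qed (simp add: flux_kernel_def)
    have [measurable]: "(\<lambda>t. \<sigma> ((box a b \<inter> {x. t < x $ j}) \<inter> \<Omega>)) \<in> borel_measurable borel"
      by (rule measurable_upper_section[OF fvm_restrict[OF fvm_\<sigma>]]) auto
    have [measurable]: "(\<lambda>t. total_flux (box a b) (UNIV \<inter> {x. t < x $ j})) \<in> borel_measurable borel"
      by (rule measurable_upper_section[OF total_flux_fvm[OF good_box_thin[OF G]]]) auto
    show "(\<lambda>t. flux_kernel j t (box a b)) \<in> borel_measurable borel" unfolding eq by measurable
  next
    fix A B assume A: "A \<in> sets borel" "B \<in> sets borel" "A \<subseteq> B" "(\<lambda>t. flux_kernel j t A) \<in> borel_measurable borel" "(\<lambda>t. flux_kernel j t B) \<in> borel_measurable borel"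
    have "flux_kernel j t (B - A) = flux_kernel j t B - flux_kernel j t A" for t
      using A by (intro fvm_Diff[OF flux_kernel_fvm]) auto
    then show "(\<lambda>t. flux_kernel j t (B - A)) \<in> borel_measurable borel" using A by simp
  next
    fix A :: "nat \<Rightarrow> (real^'n) set"
    assume A: "\<And>i. A i \<in> sets borel" "disjoint_family A" "\<And>i. (\<lambda>t. flux_kernel j t (A i)) \<in> borel_measurable borel"
    have "flux_kernel j t (\<Union>i. A i) = (\<Sum>i. flux_kernel j t (A i))" for t
      using fvmD[OF flux_kernel_fvm A(1) _ A(2), of j t] by (simp add: sums_iff)
    then show "(\<lambda>t. flux_kernel j t (\<Union>i. A i)) \<in> borel_measurable borel" using A(3) by simp
  qed (use S in auto)
  then show ?thesis by (simp add: flux_kernel_\<Omega>)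
qed

text \<open>Joint measurability for a level and a set that both vary with \<open>x\<close>, as they
  do for the faces of a moving cube: rectangles first, then the generated sigma-algebra.\<close>

lemma flux_kernel_measurable_section:
  fixes f :: "'b \<Rightarrow> real"
  assumes f: "f \<in> borel_measurable M" and E: "E \<in> sets (M \<Otimes>\<^sub>M (borel :: (real^'n) measure))"
  shows "(\<lambda>x. flux_kernel j (f x) (Pair x -` E)) \<in> borel_measurable M"
  using Int_stable_pair_measure_generator pair_measure_closed E
  unfolding sets_pair_measure
proof (induct rule: sigma_sets_induct_disjoint)
  case (basic A)
  then obtain X S where A: "A = X \<times> S" and [measurable]: "X \<in> sets M" and S: "S \<in> sets borel" by auto
  have "(\<lambda>x. flux_kernel j (f x) S) \<in> borel_measurable M"
    by (rule measurable_compose[OF f flux_kernel_measurable[OF S]])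
  moreover have "flux_kernel j (f x) (Pair x -` A) = indicator X x * flux_kernel j (f x) S" for x
    using fvm_empty[OF flux_kernel_fvm[of j "f x"]] by (auto simp: A indicator_def)
  ultimately show ?case by simp
next
  case empty
  then show ?case using fvm_empty[OF flux_kernel_fvm] by simp
next
  case (compl A)
  have "(\<lambda>x. flux_kernel j (f x) UNIV - flux_kernel j (f x) (Pair x -` A)) \<in> borel_measurable M"
    using compl measurable_compose[OF f flux_kernel_measurable[of UNIV j]] by simp
  moreover have "flux_kernel j (f x) (Pair x -` (space M \<times> space borel - A)) = flux_kernel j (f x) UNIV - flux_kernel j (f x) (Pair x -` A)"
    if "x \<in> space M" for x
  proof -
    have "Pair x -` (space M \<times> space borel - A) = UNIV - Pair x -` A" using that by auto
    moreover have "Pair x -` A \<in> sets borel" using compl sets_Pair1[of A M borel x] by (simp add: sets_pair_measure)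
    ultimately show ?thesis using fvm_Diff[OF flux_kernel_fvm, of "Pair x -` A" UNIV] by simp
  qed
  ultimately show ?case by (subst measurable_cong) auto
next
  case (union A)
  have "(\<lambda>x. \<Sum>i. flux_kernel j (f x) (Pair x -` A i)) \<in> borel_measurable M" using union by simp
  moreover have "flux_kernel j (f x) (Pair x -` (\<Union>i. A i)) = (\<Sum>i. flux_kernel j (f x) (Pair x -` A i))" for x
  proof -
    have "A i \<in> sets (M \<Otimes>\<^sub>M borel)" for i using union(2) by (auto simp: sets_pair_measure)
    then have "Pair x -` A i \<in> sets borel" for i by (rule sets_Pair1)
    moreover have "disjoint_family (\<lambda>i. Pair x -` A i)" using union(1) by (auto simp: disjoint_family_on_def)
    ultimately have "(\<lambda>i. flux_kernel j (f x) (Pair x -` A i)) sums flux_kernel j (f x) (\<Union>i. Pair x -` A i)"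
      by (intro fvmD[OF flux_kernel_fvm]) auto
    then show ?thesis by (simp add: sums_iff vimage_UN)
  qed
  ultimately show ?case by simp
qed


subsection \<open>The vector measure of the half-space fluxes\<close>

text \<open>It dominates the mass of the slice limit at \<open>t\<close>. Unlike that mass, a liminf
  of explicit quotients is visibly Borel in \<open>t\<close>, and it is integrable by Fatou.\<close>

definition slice_density :: "'n \<Rightarrow> real \<Rightarrow> ennreal" where
  "slice_density j t = liminf (\<lambda>k. ennreal (real (Suc k)) * emeasure \<mu> {y. t < y $ j \<and> y $ j < t + 1 / real (Suc k)})"

lemma slab_emeasure_measurable [measurable]:
  "(\<lambda>t. emeasure \<mu> {y. t < y $ j \<and> y $ j < t + c}) \<in> borel_measurable borel"
proof -
  let ?Q = "{p \<in> space (borel \<Otimes>\<^sub>M \<mu>). fst p < snd p $ j \<and> snd p $ j < fst p + c}"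
  have Q: "?Q \<in> sets (borel \<Otimes>\<^sub>M \<mu>)" by measurable
  have "(\<lambda>t. emeasure \<mu> (Pair t -` ?Q)) \<in> borel_measurable borel"
    by (intro \<mu>.measurable_emeasure_Pair Q)
  moreover have "Pair t -` ?Q = {y. t < y $ j \<and> y $ j < t + c}" for t by (auto simp: space_pair_measure)
  ultimately show ?thesis by simp
qed

lemma slice_density_measurable [measurable]: "slice_density j \<in> borel_measurable borel"
  unfolding slice_density_def [abs_def] by measurable

text \<open>For fixed \<open>y\<close>, the levels \<open>t\<close> whose slice contains
  \<open>y\<close> form an interval as long as the slice is wide. By Fubini every quotient
  integrates to the total mass of \<mu>, and Fatou passes to the liminf.\<close>

lemma slice_density_integral: "(\<integral>\<^sup>+t. slice_density j t \<partial>lborel) \<le> emeasure \<mu> UNIV"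
proof -
  have 1: "(\<integral>\<^sup>+t. ennreal (real (Suc k)) * emeasure \<mu> {y. t < y $ j \<and> y $ j < t + 1 / real (Suc k)} \<partial>lborel) = emeasure \<mu> UNIV" for k
  proof -
    interpret L: pair_sigma_finite lborel \<mu> by unfold_locales
    define e where "e = 1 / real (Suc k)"
    have e: "e \<ge> 0" by (simp add: e_def)
    have "ennreal (real (Suc k)) * ennreal e = ennreal (real (Suc k) * e)" using e by (intro ennreal_mult[symmetric]) auto
    also have "\<dots> = 1" by (simp add: e_def del: of_nat_Suc)
    finally have e1: "ennreal (real (Suc k)) * ennreal e = 1" .
    have "(\<integral>\<^sup>+t. emeasure \<mu> {y. t < y $ j \<and> y $ j < t + e} \<partial>lborel) =
        (\<integral>\<^sup>+t. \<integral>\<^sup>+y. indicator {y. t < y $ j \<and> y $ j < t + e} y \<partial>\<mu> \<partial>lborel)"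
      by (intro nn_integral_cong nn_integral_indicator[symmetric]) measurable
    also have "\<dots> = (\<integral>\<^sup>+t. \<integral>\<^sup>+y. indicator {p. fst p < snd p $ j \<and> snd p $ j < fst p + e} (t, y) \<partial>\<mu> \<partial>lborel)"
      by (simp add: indicator_def)
    also have "\<dots> = (\<integral>\<^sup>+y. \<integral>\<^sup>+t. indicator {p. fst p < snd p $ j \<and> snd p $ j < fst p + e} (t, y) \<partial>lborel \<partial>\<mu>)"
      by (rule L.Fubini'[symmetric]) (simp add: indicator_def, measurable)
    also have "\<dots> = (\<integral>\<^sup>+y. \<integral>\<^sup>+t. indicator {y $ j - e<..<y $ j} t \<partial>lborel \<partial>\<mu>)"
      by (intro nn_integral_cong) (auto simp: indicator_def)
    also have "\<dots> = ennreal e * emeasure \<mu> UNIV" using e by simp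
    finally have I: "(\<integral>\<^sup>+t. emeasure \<mu> {y. t < y $ j \<and> y $ j < t + e} \<partial>lborel) = ennreal e * emeasure \<mu> UNIV" .
    show ?thesis unfolding e_def[symmetric]
      by (subst nn_integral_cmult) (simp_all add: I e1 flip: mult.assoc del: of_nat_Suc)
  qed
  have "(\<integral>\<^sup>+t. slice_density j t \<partial>lborel) \<le> liminf (\<lambda>k. \<integral>\<^sup>+t. ennreal (real (Suc k)) * emeasure \<mu> {y. t < y $ j \<and> y $ j < t + 1 / real (Suc k)} \<partial>lborel)"
    unfolding slice_density_def by (rule nn_integral_liminf) measurable
  also have "\<dots> = emeasure \<mu> UNIV" unfolding 1 by (simp add: Liminf_const)
  finally show ?thesis .
qed

text \<open>The half-space flux is dominated by the slice limit \<nu>. Test functions between 0 and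
  1 show that the total mass of \<nu> is at most the liminf of the masses of the slices.\<close>

lemma flux_kernel_bound:
  assumes S: "S \<in> sets borel"
  shows "ennreal \<bar>flux_kernel j t S\<bar> \<le> slice_density j t"
proof (cases "t \<in> bad_levels j \<or> slice_density j t = \<infinity>")
  case True then show ?thesis by (auto simp: flux_kernel_def)
next
  case False
  then obtain c where c: "c \<ge> 0" "slice_density j t = ennreal c" by (cases "slice_density j t") auto
  have "flux_ok j t" using False bad_levels(3) by (auto simp: good_level_def)
  from flux_ok_is_halfspace_flux[OF this] obtain \<nu> where \<nu>: "slice_limit j t \<nu>"
    "\<And>S. S \<in> sets borel \<Longrightarrow> S \<subseteq> \<Omega> \<inter> {x. x $ j = t} \<Longrightarrow> \<bar>hf j t S\<bar> \<le> measure \<nu> S"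
    unfolding is_halfspace_flux_def frontier_halfsp slice_limit_def by blast
  have r: "finite_radon_on \<Omega> \<nu>" using \<nu>(1) by (simp add: slice_limit_def weak_star_conv_def)
  note r' = finite_radon_onD[OF r]
  interpret \<nu>: finite_measure \<nu> by (rule r'(3))
  have "measure \<nu> \<Omega> \<le> c"
  proof (rule open_measure_leI[OF open_\<Omega> r'(1,3)])
    fix \<psi> assume \<psi>: "\<psi> \<in> Cc \<Omega>" "\<And>x. 0 \<le> \<psi> x \<and> \<psi> x \<le> 1"
    let ?B = "\<lambda>k. {y. t < y $ j \<and> y $ j < t + 1 / real (Suc k)}"
    have [measurable]: "\<psi> \<in> borel_measurable borel" by (rule Cc_measurable[OF \<psi>(1)])
    have B [measurable]: "?B k \<in> sets borel" for k by measurable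
    have "(\<lambda>k. LINT x|scaled_restr \<mu> (?B k) (1 / real (Suc k)). \<psi> x) \<longlonglongrightarrow> (LINT x|\<nu>. \<psi> x)"
      using \<nu>(1) \<psi>(1) inverse_Suc_at_right unfolding slice_limit_def weak_star_conv_def halfsp_layer
      by (auto intro: filterlim_compose)
    then have lim: "(\<lambda>k. ennreal (LINT x|scaled_restr \<mu> (?B k) (1 / real (Suc k)). \<psi> x)) \<longlonglongrightarrow> ennreal (LINT x|\<nu>. \<psi> x)"
      by (rule tendsto_ennrealI)
    have le: "ennreal (LINT x|scaled_restr \<mu> (?B k) (1 / real (Suc k)). \<psi> x) \<le> ennreal (real (Suc k)) * emeasure \<mu> (?B k)" for k
    proof -
      have "(LINT x|\<mu>. indicator (?B k) x * \<psi> x) \<le> (LINT x|\<mu>. indicator (?B k) x)"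
      proof (rule integral_mono)
        show "integrable \<mu> (\<lambda>x. indicator (?B k) x * \<psi> x)"
          using \<psi>(2) by (intro \<mu>.integrable_const_bound[where B=1]) (auto simp: indicator_def)
      qed (use \<psi>(2) in \<open>auto simp: indicator_def intro!: \<mu>.integrable_const_bound[where B=1]\<close>)
      then have "(LINT x|scaled_restr \<mu> (?B k) (1 / real (Suc k)). \<psi> x) \<le> real (Suc k) * measure \<mu> (?B k)"
        by (subst integral_scaled_restr) (auto simp: mult.commute simp del: of_nat_Suc intro: mult_right_mono)
      then show ?thesis
        by (simp add: \<mu>.emeasure_eq_measure flip: ennreal_mult' del: of_nat_Suc)
    qed
    have "ennreal (LINT x|\<nu>. \<psi> x) \<le> slice_density j t"
      unfolding slice_density_def lim_imp_Liminf[OF trivial_limit_sequentially lim, symmetric]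
      by (intro Liminf_mono always_eventually allI le)
    then show "(LINT x|\<nu>. \<psi> x) \<le> c" using c by (simp add: ennreal_le_iff)
  qed
  moreover have "\<bar>flux_kernel j t S\<bar> \<le> measure \<nu> (S \<inter> (\<Omega> \<inter> {x. x $ j = t}))"
    using False S by (auto simp: flux_kernel_def intro!: \<nu>(2))
  moreover have "measure \<nu> (S \<inter> (\<Omega> \<inter> {x. x $ j = t})) \<le> measure \<nu> \<Omega>"
    using r' by (intro \<nu>.finite_measure_mono) auto
  ultimately show ?thesis using c by (auto intro!: ennreal_leI)
qed

lemma flux_kernel_integrable:
  assumes "S \<in> sets borel" shows "integrable lborel (\<lambda>t. flux_kernel j t S)"
proof (rule integrableI_bounded)
  show "(\<lambda>t. flux_kernel j t S) \<in> borel_measurable lborel" using flux_kernel_measurable[OF assms] by simp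
  have "(\<integral>\<^sup>+t. ennreal (norm (flux_kernel j t S)) \<partial>lborel) \<le> (\<integral>\<^sup>+t. slice_density j t \<partial>lborel)"
    by (intro nn_integral_mono) (simp add: flux_kernel_bound[OF assms])
  also have "\<dots> \<le> emeasure \<mu> UNIV" by (rule slice_density_integral)
  also have "\<dots> < \<infinity>" by (simp add: \<mu>.emeasure_eq_measure)
  finally show "(\<integral>\<^sup>+t. ennreal (norm (flux_kernel j t S)) \<partial>lborel) < \<infinity>" .
qed

definition flux_measure :: "'n \<Rightarrow> (real^'n) set \<Rightarrow> real" where
  "flux_measure j S = (LINT t|lborel. flux_kernel j t S)"

lemma flux_measure_\<Omega>: "flux_measure j (S \<inter> \<Omega>) = flux_measure j S"
  by (simp add: flux_measure_def flux_kernel_\<Omega>)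

text \<open>Dominated convergence for the partial unions: \<open>slice_density\<close> bounds the
  kernel uniformly in the set.\<close>

lemma flux_measure_fvm: "fvm UNIV (flux_measure j)"
proof (rule fvmI)
  fix S :: "nat \<Rightarrow> (real^'n) set" assume S: "\<And>i. S i \<in> sets borel" "disjoint_family S"
  have part: "(\<Sum>i<n. flux_kernel j t (S i)) = flux_kernel j t (\<Union>i<n. S i)" for n t
    by (rule fvm_UN[OF flux_kernel_fvm, symmetric]) (use S in \<open>auto simp: disjoint_family_on_def\<close>)
  have fin: "(\<integral>\<^sup>+t. slice_density j t \<partial>lborel) < \<infinity>"
    using slice_density_integral[of j] by (rule le_less_trans) (simp add: \<mu>.emeasure_eq_measure)
  have "(\<lambda>n. LINT t|lborel. flux_kernel j t (\<Union>i<n. S i)) \<longlonglongrightarrow> (LINT t|lborel. flux_kernel j t (\<Union>i. S i))"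
  proof (rule integral_dominated_convergence)
    show "integrable lborel (\<lambda>t. enn2real (slice_density j t))"
    proof (rule integrableI_bounded)
      have "(\<integral>\<^sup>+t. ennreal (norm (enn2real (slice_density j t))) \<partial>lborel) \<le> (\<integral>\<^sup>+t. slice_density j t \<partial>lborel)"
        by (intro nn_integral_mono) (simp add: ennreal_enn2real_if)
      then show "(\<integral>\<^sup>+t. ennreal (norm (enn2real (slice_density j t))) \<partial>lborel) < \<infinity>" using fin by (rule le_less_trans)
    qed simp
    have "AE t in lborel. slice_density j t \<noteq> \<infinity>" by (rule nn_integral_PInf_AE) (use fin in auto)
    then show "AE t in lborel. norm (flux_kernel j t (\<Union>i<n. S i)) \<le> enn2real (slice_density j t)" for n
    proof eventually_elim
      fix t assume t: "slice_density j t \<noteq> \<infinity>"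
      have "ennreal \<bar>flux_kernel j t (\<Union>i<n. S i)\<bar> \<le> slice_density j t" using S by (intro flux_kernel_bound) auto
      then have "enn2real (ennreal \<bar>flux_kernel j t (\<Union>i<n. S i)\<bar>) \<le> enn2real (slice_density j t)"
        using t by (intro enn2real_mono) (auto simp: less_top)
      then show "norm (flux_kernel j t (\<Union>i<n. S i)) \<le> enn2real (slice_density j t)" by simp
    qed
    show "AE t in lborel. (\<lambda>n. flux_kernel j t (\<Union>i<n. S i)) \<longlonglongrightarrow> flux_kernel j t (\<Union>i. S i)"
      using fvmD[OF flux_kernel_fvm S(1) _ S(2), of j] by (intro AE_I2) (simp add: sums_def part)
  qed (use S in \<open>auto intro!: flux_kernel_measurable\<close>)
  moreover have "(LINT t|lborel. flux_kernel j t (\<Union>i<n. S i)) = (\<Sum>i<n. flux_measure j (S i))" for n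
    unfolding flux_measure_def part[symmetric] using S by (intro Bochner_Integration.integral_sum flux_kernel_integrable) auto
  ultimately show "(\<lambda>i. flux_measure j (S i)) sums flux_measure j (\<Union>i. S i)" by (simp add: sums_def flux_measure_def)
qed

text \<open>The integrand on the left agrees with the Borel kernel almost everywhere; with the
  completed measure this gives its measurability as well as the value of the integral.\<close>

lemma flux_measure_eq:
  assumes S: "S \<in> sets borel" "S \<subseteq> \<Omega>"
  shows "(LINT t|lebesgue. hf j t (S \<inter> frontier (halfsp j t))) = flux_measure j S"
proof -
  have m: "(\<lambda>t. flux_kernel j t S) \<in> borel_measurable lborel" using flux_kernel_measurable[OF S(1)] by simp
  have "AE t in lborel. t \<notin> bad_levels j" by (rule AE_not_in) (use bad_levels in \<open>auto simp: null_sets_def\<close>)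
  then have "AE t in lborel. flux_kernel j t S = hf j t (S \<inter> frontier (halfsp j t))"
  proof eventually_elim
    fix t assume "t \<notin> bad_levels j"
    moreover have "S \<inter> (\<Omega> \<inter> {x. x $ j = t}) = S \<inter> {x. x $ j = t}" using S by auto
    ultimately show "flux_kernel j t S = hf j t (S \<inter> frontier (halfsp j t))" by (simp add: flux_kernel_def frontier_halfsp)
  qed
  then have ae: "AE t in lebesgue. flux_kernel j t S = hf j t (S \<inter> frontier (halfsp j t))" by (rule AE_completion)
  have m': "(\<lambda>t. flux_kernel j t S) \<in> borel_measurable lebesgue" using m by (rule measurable_completion)
  have m'': "(\<lambda>t. hf j t (S \<inter> frontier (halfsp j t))) \<in> borel_measurable lebesgue"
    by (rule borel_measurable_AE[OF m' ae])
  have "(LINT t|lebesgue. hf j t (S \<inter> frontier (halfsp j t))) = (LINT t|lebesgue. flux_kernel j t S)"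
    by (rule integral_cong_AE[OF m'' m']) (use ae in eventually_elim, simp)
  also have "\<dots> = flux_measure j S" unfolding flux_measure_def by (rule integral_completion[OF m])
  finally show ?thesis .
qed

end

subsection \<open>Averages over small boxes\<close>

lemma integral_translate:
  fixes f :: "'a::euclidean_space \<Rightarrow> real"
  assumes [measurable]: "f \<in> borel_measurable borel"
  shows "(LINT x|lborel. f (x + c)) = (LINT x|lborel. f x)"
proof -
  have "(LINT x|lborel. f x) = (LINT x|distr lborel borel ((+) c). f x)" by (subst lborel_distr_plus) simp
  also have "\<dots> = (LINT x|lborel. f (c + x))" by (rule integral_distr) auto
  finally show ?thesis by (simp add: add.commute)
qed

lemma nn_integral_translate:
  fixes f :: "'a::euclidean_space \<Rightarrow> ennreal"
  assumes [measurable]: "f \<in> borel_measurable borel"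
  shows "(\<integral>\<^sup>+x. f (x + c) \<partial>lborel) = (\<integral>\<^sup>+x. f x \<partial>lborel)"
proof -
  have "(\<integral>\<^sup>+x. f x \<partial>lborel) = (\<integral>\<^sup>+x. f x \<partial>distr lborel borel ((+) c))" by (subst lborel_distr_plus) simp
  also have "\<dots> = (\<integral>\<^sup>+x. f (c + x) \<partial>lborel)" by (rule nn_integral_distr) auto
  finally show ?thesis by (simp add: add.commute)
qed

lemma integrable_translate:
  fixes f :: "'a::euclidean_space \<Rightarrow> real"
  assumes f: "integrable lborel f"
  shows "integrable lborel (\<lambda>x. f (x + c))"
proof -
  have [measurable]: "f \<in> borel_measurable borel" using borel_measurable_integrable[OF f] by simp
  have "integrable (distr lborel borel ((+) c)) f" using f by (subst lborel_distr_plus)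
  then have "integrable lborel (\<lambda>x. f (c + x))" by (subst (asm) integrable_distr_eq) auto
  then show ?thesis by (simp add: add.commute)
qed

lemma box_shift_measurable:
  fixes P :: "(real^'n::finite) measure"
  assumes s: "sets P = sets borel" and f: "finite_measure P"
  shows "(\<lambda>x. measure P (box x (shift x h))) \<in> borel_measurable borel"
proof -
  interpret finite_measure P by fact
  have [measurable_cong]: "sets P = sets borel" by fact
  let ?Q = "{p \<in> space (borel \<Otimes>\<^sub>M P). \<forall>i. fst p $ i < snd p $ i \<and> snd p $ i < fst p $ i + h}"
  have Q: "?Q \<in> sets (borel \<Otimes>\<^sub>M P)" by measurable
  have "(\<lambda>x. enn2real (emeasure P (Pair x -` ?Q))) \<in> borel_measurable borel"
    by (intro borel_measurable_enn2real measurable_emeasure_Pair Q)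
  moreover have "Pair x -` ?Q = box x (shift x h)" for x
    using sets_eq_imp_space_eq[OF s] by (auto simp: space_pair_measure mem_box_vec shift_def)
  ultimately show ?thesis by (simp add: measure_def)
qed

lemma measure_small_box:
  fixes z :: "real^'n::finite"
  assumes "h \<ge> 0" shows "emeasure lborel (box (shift z (- h)) z) = ennreal (h ^ CARD('n))"
proof -
  have "(z - shift z (- h)) \<bullet> b = h" if b: "b \<in> Basis" for b
  proof -
    obtain i where "b = axis i 1" using b by (auto simp: Basis_vec_def)
    then show ?thesis by (simp add: inner_axis shift_def)
  qed
  moreover have "shift z (- h) \<bullet> b \<le> z \<bullet> b" if b: "b \<in> Basis" for b
  proof -
    obtain i where "b = axis i 1" using b by (auto simp: Basis_vec_def)
    then show ?thesis using assms by (simp add: inner_axis shift_def)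
  qed
  ultimately show ?thesis by (subst emeasure_lborel_box) auto
qed

text \<open>\<open>z\<close> lies in the cube with lower corner \<open>x\<close> exactly if
  \<open>x\<close> lies in the cube with upper corner \<open>z\<close>. After Fubini, the inner
  integral of \<psi> runs over the latter cube, of volume \<open>h ^ CARD('n)\<close>, where \<psi>
  differs from \<open>\<psi> z\<close> by at most \<eta>.\<close>

lemma box_average_close:
  fixes P :: "(real^'n::finite) measure" and \<psi> :: "real^'n \<Rightarrow> real"
  assumes s: "sets P = sets borel" and f: "finite_measure P" and \<psi>: "\<psi> \<in> Cc \<Omega>" and h: "h > 0"
    and osc: "\<And>x y. (\<And>i. \<bar>x $ i - y $ i\<bar> < h) \<Longrightarrow> \<bar>\<psi> x - \<psi> y\<bar> \<le> \<eta>"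
  shows "\<bar>(LINT x|lborel. \<psi> x * measure P (box x (shift x h))) - h ^ CARD('n) * (LINT x|P. \<psi> x)\<bar> \<le> \<eta> * h ^ CARD('n) * measure P UNIV"
proof -
  interpret finite_measure P by fact
  interpret L: pair_sigma_finite lborel P by unfold_locales
  have sP [measurable_cong]: "sets P = sets borel" by fact
  have sp: "space P = UNIV" using sets_eq_imp_space_eq[OF s] by simp
  have [measurable]: "\<psi> \<in> borel_measurable borel" by (rule Cc_measurable[OF \<psi>])
  obtain B where B: "B > 0" "\<And>x. \<bar>\<psi> x\<bar> \<le> B" using Cc_bounded[OF \<psi>] by blast
  define I :: "real^'n \<Rightarrow> real^'n \<Rightarrow> real" where "I x z = indicator {p. \<forall>i. fst p $ i < snd p $ i \<and> snd p $ i < fst p $ i + h} (x, z)" for x z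
  have I1: "I x z = indicator (box x (shift x h)) z" and I2: "I x z = indicator (box (shift z (- h)) z) x" for x z
    by (auto simp: I_def indicator_def mem_box_vec shift_def algebra_simps)
  have Im: "(\<lambda>(x, z). I x z) \<in> borel_measurable (lborel \<Otimes>\<^sub>M P)" unfolding I_def by measurable
  have Im' [measurable]: "(\<lambda>x. I x z) \<in> borel_measurable borel" for z unfolding I2 by measurable
  have Ii: "integrable lborel (\<lambda>x. I x z)" and Iv: "(LINT x|lborel. I x z) = h ^ CARD('n)" for z
  proof -
    show "integrable lborel (\<lambda>x. I x z)" unfolding I2
      using h by (intro integrable_real_indicator) (auto simp: measure_small_box)
    show "(LINT x|lborel. I x z) = h ^ CARD('n)" unfolding I2
      using h by (simp add: measure_def measure_small_box)
  qed
  have int: "integrable (lborel \<Otimes>\<^sub>M P) (case_prod (\<lambda>x z. \<psi> x * I x z))"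
  proof (rule integrableI_bounded)
    show m: "case_prod (\<lambda>x z. \<psi> x * I x z) \<in> borel_measurable (lborel \<Otimes>\<^sub>M P)" using Im by measurable
    have "(\<integral>\<^sup>+p. ennreal (norm (case p of (x, z) \<Rightarrow> \<psi> x * I x z)) \<partial>(lborel \<Otimes>\<^sub>M P)) = (\<integral>\<^sup>+z. \<integral>\<^sup>+x. ennreal (norm (\<psi> x * I x z)) \<partial>lborel \<partial>P)"
      using m by (subst L.nn_integral_snd[symmetric]) (auto, measurable)
    also have "\<dots> \<le> (\<integral>\<^sup>+z. \<integral>\<^sup>+x. ennreal B * indicator (box (shift z (- h)) z) x \<partial>lborel \<partial>P)"
      using B by (intro nn_integral_mono) (auto simp: I2 indicator_def intro!: ennreal_leI)
    also have "\<dots> = ennreal B * ennreal (h ^ CARD('n)) * emeasure P (space P)"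
      using h by (simp add: nn_integral_cmult_indicator measure_small_box)
    also have "\<dots> < \<infinity>" by (simp add: emeasure_eq_measure ennreal_mult_less_top)
    finally show "(\<integral>\<^sup>+p. ennreal (norm (case p of (x, z) \<Rightarrow> \<psi> x * I x z)) \<partial>(lborel \<Otimes>\<^sub>M P)) < \<infinity>" .
  qed
  have Pi: "integrable P \<psi>" by (rule Cc_integrable[OF \<psi> s f])
  have "(LINT x|lborel. \<psi> x * measure P (box x (shift x h))) = (LINT x|lborel. LINT z|P. \<psi> x * I x z)"
  proof (intro Bochner_Integration.integral_cong refl)
    fix x
    have "(LINT z|P. I x z) = measure P (box x (shift x h))" unfolding I1 by (simp add: sp)
    then show "\<psi> x * measure P (box x (shift x h)) = (LINT z|P. \<psi> x * I x z)" by simp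
  qed
  also have "\<dots> = (LINT z|P. LINT x|lborel. \<psi> x * I x z)" by (rule L.Fubini_integral[OF int, symmetric])
  finally have F: "(LINT x|lborel. \<psi> x * measure P (box x (shift x h))) = (LINT z|P. LINT x|lborel. \<psi> x * I x z)" .
  have Fi: "integrable P (\<lambda>z. LINT x|lborel. \<psi> x * I x z)" by (rule L.integrable_snd[OF int])
  have pt: "\<bar>(LINT x|lborel. \<psi> x * I x z) - h ^ CARD('n) * \<psi> z\<bar> \<le> \<eta> * h ^ CARD('n)" for z
  proof -
    have i1: "integrable lborel (\<lambda>x. \<psi> x * I x z)"
      by (rule Bochner_Integration.integrable_bound[OF integrable_mult_right[OF Ii[of z], of B]])
         (use B in \<open>auto simp: I2 indicator_def\<close>)
    have "h ^ CARD('n) * \<psi> z = (LINT x|lborel. \<psi> z * I x z)" using Iv[of z] by simp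
    then have "(LINT x|lborel. \<psi> x * I x z) - h ^ CARD('n) * \<psi> z = (LINT x|lborel. \<psi> x * I x z - \<psi> z * I x z)"
      using i1 Ii[of z] by (subst Bochner_Integration.integral_diff) auto
    also have "\<bar>\<dots>\<bar> \<le> (LINT x|lborel. \<bar>\<psi> x * I x z - \<psi> z * I x z\<bar>)" by (rule integral_abs_bound)
    also have "\<dots> \<le> (LINT x|lborel. \<eta> * I x z)"
    proof (rule integral_mono)
      show "\<bar>\<psi> x * I x z - \<psi> z * I x z\<bar> \<le> \<eta> * I x z" for x
      proof (cases "x \<in> box (shift z (- h)) z")
        case True
        have "\<bar>\<psi> x - \<psi> z\<bar> \<le> \<eta>"
        proof (rule osc)
          fix i
          have "z $ i - h < x $ i \<and> x $ i < z $ i" using True by (auto simp: mem_box_vec shift_def)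
          then show "\<bar>x $ i - z $ i\<bar> < h" by linarith
        qed
        then show ?thesis using True by (simp add: I2)
      qed (simp add: I2)
    qed (use i1 Ii[of z] in auto)
    also have "\<dots> = \<eta> * h ^ CARD('n)" using Iv[of z] by simp
    finally show ?thesis .
  qed
  have "(LINT x|lborel. \<psi> x * measure P (box x (shift x h))) - h ^ CARD('n) * (LINT x|P. \<psi> x) =
      (LINT z|P. (LINT x|lborel. \<psi> x * I x z) - h ^ CARD('n) * \<psi> z)"
    unfolding F using Fi Pi by (subst Bochner_Integration.integral_diff) auto
  also have "\<bar>\<dots>\<bar> \<le> (LINT z|P. \<bar>(LINT x|lborel. \<psi> x * I x z) - h ^ CARD('n) * \<psi> z\<bar>)" by (rule integral_abs_bound)
  also have "\<dots> \<le> (LINT z|P. \<eta> * h ^ CARD('n))"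
    by (rule integral_mono) (use Fi Pi pt in auto)
  also have "\<dots> = \<eta> * h ^ CARD('n) * measure P UNIV" by (simp add: sp)
  finally show ?thesis .
qed

lemma box_average_limit_measure:
  fixes P :: "(real^'n::finite) measure" and \<psi> :: "real^'n \<Rightarrow> real"
  assumes s: "sets P = sets borel" and f: "finite_measure P" and \<psi>: "\<psi> \<in> Cc \<Omega>"
  shows "(\<lambda>k. (LINT x|lborel. \<psi> x * measure P (box x (shift x (1 / real (Suc k))))) * real (Suc k) ^ CARD('n)) \<longlonglongrightarrow> (LINT x|P. \<psi> x)"
proof (rule LIMSEQ_I)
  fix \<epsilon> :: real assume \<epsilon>: "\<epsilon> > 0"
  define \<eta> where "\<eta> = \<epsilon> / (measure P UNIV + 1)"
  have \<eta>: "\<eta> > 0" "\<eta> * measure P UNIV < \<epsilon>"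
  proof -
    have p: "measure P UNIV + 1 > 0" by (rule add_nonneg_pos) auto
    then show "\<eta> > 0" using \<epsilon> by (simp add: \<eta>_def)
    show "\<eta> * measure P UNIV < \<epsilon>" using p \<epsilon> by (simp add: \<eta>_def field_simps)
  qed
  obtain d where d: "d > 0" "\<And>x y. dist x y < d \<Longrightarrow> \<bar>\<psi> x - \<psi> y\<bar> < \<eta>" using Cc_uniformly_continuous[OF \<psi> \<eta>(1)] by blast
  obtain N where N: "1 / real (Suc N) < d / real CARD('n)" using nat_approx_posE[of "d / real CARD('n)"] d(1) by auto
  show "\<exists>N. \<forall>k\<ge>N. norm ((LINT x|lborel. \<psi> x * measure P (box x (shift x (1 / real (Suc k))))) * real (Suc k) ^ CARD('n) - (LINT x|P. \<psi> x)) < \<epsilon>"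
  proof (intro exI allI impI)
    fix k assume k: "k \<ge> N"
    define h where "h = 1 / real (Suc k)"
    have h: "h > 0" "h < d / real CARD('n)"
      using N k frac_le[of 1 1 "real (Suc N)" "real (Suc k)"] by (auto simp: h_def simp del: of_nat_Suc)
    have osc: "\<bar>\<psi> x - \<psi> y\<bar> \<le> \<eta>" if "\<And>i. \<bar>x $ i - y $ i\<bar> < h" for x y
    proof -
      have "dist x y \<le> (\<Sum>i\<in>UNIV. \<bar>(x - y) $ i\<bar>)" unfolding dist_norm by (rule norm_le_l1_cart)
      also have "\<dots> \<le> (\<Sum>i\<in>(UNIV::'n set). h)" using that by (intro sum_mono) (simp add: less_imp_le)
      also have "\<dots> < d" using h by (simp add: field_simps)
      finally show ?thesis using d(2) by (simp add: less_imp_le)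
    qed
    let ?A = "LINT x|lborel. \<psi> x * measure P (box x (shift x h))"
    have hn: "real (Suc k) ^ CARD('n) * h ^ CARD('n) = 1"
      unfolding power_mult_distrib[symmetric] by (simp add: h_def del: of_nat_Suc)
    have "?A * real (Suc k) ^ CARD('n) - (LINT x|P. \<psi> x) = real (Suc k) ^ CARD('n) * (?A - h ^ CARD('n) * (LINT x|P. \<psi> x))"
      unfolding right_diff_distrib mult.assoc[symmetric] hn by (simp only: ac_simps mult_1)
    also have "norm \<dots> \<le> real (Suc k) ^ CARD('n) * (\<eta> * h ^ CARD('n) * measure P UNIV)"
      using box_average_close[OF s f \<psi> h(1) osc] by (simp add: abs_mult mult_left_mono)
    also have "\<dots> = (real (Suc k) ^ CARD('n) * h ^ CARD('n)) * (\<eta> * measure P UNIV)" by (simp only: ac_simps)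
    also have "\<dots> = \<eta> * measure P UNIV" unfolding hn by simp
    finally show "norm ((LINT x|lborel. \<psi> x * measure P (box x (shift x (1 / real (Suc k))))) * real (Suc k) ^ CARD('n) - (LINT x|P. \<psi> x)) < \<epsilon>"
      using \<eta>(2) unfolding h_def by linarith
  qed
qed

lemma Cc_mult_integrable:
  fixes \<psi> f :: "'a::euclidean_space \<Rightarrow> real"
  assumes \<psi>: "\<psi> \<in> Cc \<Omega>" and f [measurable]: "f \<in> borel_measurable borel" and b: "\<And>x. \<bar>f x\<bar> \<le> C"
  shows "integrable lborel (\<lambda>x. \<psi> x * f x)"
proof -
  have [measurable]: "\<psi> \<in> borel_measurable borel" by (rule Cc_measurable[OF \<psi>])
  obtain B where B: "B > 0" "\<And>x. \<bar>\<psi> x\<bar> \<le> B" using Cc_bounded[OF \<psi>] by blast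
  obtain R where R: "\<And>x. \<psi> x \<noteq> 0 \<Longrightarrow> norm x \<le> R" using Cc_bounded_support[OF \<psi>] by (auto simp: bounded_iff)
  show ?thesis
  proof (rule integrableI_bounded_set[where A="cball 0 R" and B="B * C"])
    show "AE x in lborel. x \<in> cball 0 R \<longrightarrow> norm (\<psi> x * f x) \<le> B * C"
      using B b by (intro AE_I2) (auto simp: abs_mult less_imp_le intro!: mult_mono)
    show "AE x in lborel. x \<notin> cball 0 R \<longrightarrow> \<psi> x * f x = 0" using R by (intro AE_I2) auto
  qed (use emeasure_lborel_cball_finite[of "0::'a" R] in auto)
qed

lemma
  fixes \<tau> :: "(real^'n::finite) set \<Rightarrow> real"
  assumes \<Omega>: "\<Omega> \<in> sets borel" and \<tau>: "fvm \<Omega> \<tau>"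
  shows box_shift_measurable_signed: "(\<lambda>x. \<tau> (box x (shift x h) \<inter> \<Omega>)) \<in> borel_measurable borel"
    and box_average_limit: "\<And>\<psi>. \<psi> \<in> Cc \<Omega> \<Longrightarrow>
      (\<lambda>k. (LINT x|lborel. \<psi> x * \<tau> (box x (shift x (1 / real (Suc k))) \<inter> \<Omega>)) * real (Suc k) ^ CARD('n)) \<longlonglongrightarrow> signed_integral \<Omega> \<tau> \<psi>"
proof -
  define P where "P = pos_variation \<Omega> \<tau>"
  define N where "N = pos_variation \<Omega> (\<lambda>S. - \<tau> S)"
  have r: "finite_radon_on \<Omega> P" "finite_radon_on \<Omega> N"
    unfolding P_def N_def by (intro finite_radon_pos_variation fvm_uminus \<tau> \<Omega>)+
  note P = finite_radon_onD[OF r(1)] and N = finite_radon_onD[OF r(2)]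
  interpret P: finite_measure P by (rule P)
  interpret N: finite_measure N by (rule N)
  have eq: "\<tau> (box x (shift x h) \<inter> \<Omega>) = measure P (box x (shift x h)) - measure N (box x (shift x h))" for x h
    using jordan_decomposition[OF \<tau> \<Omega>, of "box x (shift x h) \<inter> \<Omega>"] measure_carrier[OF r(1) \<Omega>] measure_carrier[OF r(2) \<Omega>] \<Omega>
    by (simp add: P_def N_def)
  show "(\<lambda>x. \<tau> (box x (shift x h) \<inter> \<Omega>)) \<in> borel_measurable borel"
    unfolding eq by (intro borel_measurable_diff box_shift_measurable P N)
  fix \<psi> assume \<psi>: "\<psi> \<in> Cc \<Omega>"
  have i: "integrable lborel (\<lambda>x. \<psi> x * measure P (box x (shift x h)))" "integrable lborel (\<lambda>x. \<psi> x * measure N (box x (shift x h)))" for h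
    using P.bounded_measure N.bounded_measure
    by (auto intro!: Cc_mult_integrable[OF \<psi>] box_shift_measurable P N)
  have "(LINT x|lborel. \<psi> x * \<tau> (box x (shift x h) \<inter> \<Omega>)) =
      (LINT x|lborel. \<psi> x * measure P (box x (shift x h))) - (LINT x|lborel. \<psi> x * measure N (box x (shift x h)))" for h
    unfolding eq right_diff_distrib by (rule Bochner_Integration.integral_diff[OF i])
  then show "(\<lambda>k. (LINT x|lborel. \<psi> x * \<tau> (box x (shift x (1 / real (Suc k))) \<inter> \<Omega>)) * real (Suc k) ^ CARD('n)) \<longlonglongrightarrow> signed_integral \<Omega> \<tau> \<psi>"
    using tendsto_diff[OF box_average_limit_measure[OF P(1,3) \<psi>] box_average_limit_measure[OF N(1,3) \<psi>]]
    by (simp add: left_diff_distrib signed_integral_def P_def N_def del: of_nat_Suc)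
qed

context flux
begin

subsection \<open>The averaged balance law\<close>

definition tube :: "real \<Rightarrow> 'n \<Rightarrow> real^'n \<Rightarrow> (real^'n) set" where
  "tube h j x = {y. \<forall>i. i \<noteq> j \<longrightarrow> x $ i < y $ i \<and> y $ i < x $ i + h}"

text \<open>The kernel restricts to the hyperplane through \<open>x\<close> by itself, so this is
  the flux through the lower face orthogonal to \<open>axis j\<close> of the cube at
  \<open>x\<close>. Leaving coordinate \<open>j\<close> free in \<open>tube\<close> makes the set
  constant when \<open>x\<close> moves along \<open>axis j\<close>.\<close>

definition tube_flux :: "real \<Rightarrow> 'n \<Rightarrow> real^'n \<Rightarrow> real" where
  "tube_flux h j x = flux_kernel j (x $ j) (tube h j x)"

lemma tube_borel [measurable]: "tube h j x \<in> sets borel"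
  unfolding tube_def by measurable

lemma tube_axis: "tube h j (x + s *\<^sub>R axis j 1) = tube h j x"
  by (auto simp: tube_def axis_def)

lemma tube_flux_axis: "tube_flux h j (x + s *\<^sub>R axis j 1) = flux_kernel j (x $ j + s) (tube h j x)"
  by (simp add: tube_flux_def tube_axis)

lemma tube_flux_measurable [measurable]: "tube_flux h j \<in> borel_measurable borel"
proof -
  let ?E = "{p \<in> space (borel \<Otimes>\<^sub>M (borel :: (real^'n) measure)). \<forall>i. i \<noteq> j \<longrightarrow> fst p $ i < snd p $ i \<and> snd p $ i < (fst p :: real^'n) $ i + h}"
  have "?E \<in> sets (borel \<Otimes>\<^sub>M borel)" by measurable
  then have "(\<lambda>x::real^'n. flux_kernel j (x $ j) (Pair x -` ?E)) \<in> borel_measurable borel"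
    by (intro flux_kernel_measurable_section) auto
  moreover have "Pair x -` ?E = tube h j x" for x by (auto simp: tube_def space_pair_measure)
  ultimately show ?thesis by (simp add: tube_flux_def [abs_def])
qed

lemma tube_flux_bound: "ennreal \<bar>tube_flux h j x\<bar> \<le> slice_density j (x $ j)"
  unfolding tube_flux_def by (rule flux_kernel_bound) simp

lemma slice_density_coordinate_measurable [measurable]: "(\<lambda>x. slice_density j (x $ j)) \<in> borel_measurable borel"
  by (rule measurable_compose[OF borel_measurable_vec_nth slice_density_measurable])

lemma slice_density_translate: "(\<integral>\<^sup>+s. slice_density j (a + s) \<partial>lborel) \<le> emeasure \<mu> UNIV"
  using nn_integral_translate[OF slice_density_measurable, of j a] slice_density_integral[of j] by (simp add: add.commute)

text \<open>The integral is averaged over translations by \<open>s\<close> in \<open>[0, 1]\<close>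
  along \<open>axis j\<close>. After exchanging the order, the inner integral is at most a whole
  line integral of \<open>slice_density\<close>, bounded by the mass of \<mu>; the outer one runs
  over a ball larger by 1.\<close>

lemma slice_density_locally_finite:
  "(\<integral>\<^sup>+x. indicator (cball 0 R) x * slice_density j (x $ j) \<partial>lborel) < \<infinity>"
proof -
  let ?e = "axis j 1 :: real^'n"
  have [measurable]: "cball (0 :: real^'n) r \<in> sets borel" for r by simp
  let ?g = "\<lambda>x::real^'n. indicator (cball 0 R) x * slice_density j (x $ j)"
  have "(\<integral>\<^sup>+x. ?g x \<partial>lborel) = (\<integral>\<^sup>+s. indicator {0..1::real} s * (\<integral>\<^sup>+x. ?g x \<partial>lborel) \<partial>lborel)"
    by (simp add: nn_integral_multc)
  also have "\<dots> = (\<integral>\<^sup>+s. \<integral>\<^sup>+x. indicator {0..1::real} s * ?g (x + s *\<^sub>R ?e) \<partial>lborel \<partial>lborel)"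
  proof (intro nn_integral_cong)
    fix s :: real
    have "(\<integral>\<^sup>+x. ?g x \<partial>lborel) = (\<integral>\<^sup>+x. ?g (x + s *\<^sub>R ?e) \<partial>lborel)" by (rule nn_integral_translate[symmetric]) measurable
    then show "indicator {0..1} s * (\<integral>\<^sup>+x. ?g x \<partial>lborel) = (\<integral>\<^sup>+x. indicator {0..1} s * ?g (x + s *\<^sub>R ?e) \<partial>lborel)"
      by (subst nn_integral_cmult) auto
  qed
  also have "\<dots> = (\<integral>\<^sup>+x. \<integral>\<^sup>+s. indicator {0..1::real} s * ?g (x + s *\<^sub>R ?e) \<partial>lborel \<partial>lborel)"
    by (rule lborel_pair.Fubini') measurable
  also have "\<dots> \<le> (\<integral>\<^sup>+x. \<integral>\<^sup>+s. indicator (cball 0 (R + 1)) (x :: real^'n) * slice_density j (x $ j + s) \<partial>lborel \<partial>lborel)"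
  proof (intro nn_integral_mono)
    fix x :: "real^'n" and s :: real
    show "indicator {0..1} s * ?g (x + s *\<^sub>R ?e) \<le> indicator (cball 0 (R + 1)) x * slice_density j (x $ j + s)"
    proof (cases "s \<in> {0..1} \<and> x + s *\<^sub>R ?e \<in> cball 0 R")
      case True
      have "norm x \<le> norm (x + s *\<^sub>R ?e) + norm (s *\<^sub>R ?e)" using norm_triangle_ineq4[of "x + s *\<^sub>R ?e" "s *\<^sub>R ?e"] by simp
      also have "\<dots> \<le> R + 1" using True by (intro add_mono) (auto simp: norm_axis_1)
      finally have "x \<in> cball 0 (R + 1)" by simp
      then show ?thesis using True by (simp add: axis_def)
    qed (auto simp: indicator_def)
  qed
  also have "\<dots> \<le> (\<integral>\<^sup>+x. indicator (cball 0 (R + 1)) (x :: real^'n) * emeasure \<mu> UNIV \<partial>lborel)"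
    by (intro nn_integral_mono) (auto simp: nn_integral_cmult intro!: mult_left_mono slice_density_translate)
  also have "\<dots> = emeasure lborel (cball (0 :: real^'n) (R + 1)) * emeasure \<mu> UNIV" by (simp add: nn_integral_multc)
  also have "\<dots> < \<infinity>" using emeasure_lborel_cball_finite[of "0 :: real^'n" "R + 1"]
    by (simp add: \<mu>.emeasure_eq_measure ennreal_mult_less_top)
  finally show ?thesis .
qed

lemma tube_flux_integrable:
  fixes \<psi> :: "real^'n \<Rightarrow> real"
  assumes [measurable]: "\<psi> \<in> borel_measurable borel" and B: "\<And>x. \<bar>\<psi> x\<bar> \<le> B" and R: "\<And>x. \<psi> x \<noteq> 0 \<Longrightarrow> norm x \<le> R"
  shows "integrable lborel (\<lambda>x. \<psi> x * tube_flux h j x)"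
proof (rule integrableI_bounded)
  have [measurable]: "cball (0 :: real^'n) r \<in> sets borel" for r by simp
  have "(\<integral>\<^sup>+x. ennreal (norm (\<psi> x * tube_flux h j x)) \<partial>lborel) \<le> (\<integral>\<^sup>+x. ennreal B * (indicator (cball 0 R) x * slice_density j (x $ j)) \<partial>lborel)"
  proof (intro nn_integral_mono)
    fix x
    have "ennreal (norm (\<psi> x * tube_flux h j x)) = ennreal \<bar>\<psi> x\<bar> * ennreal \<bar>tube_flux h j x\<bar>" by (simp add: abs_mult ennreal_mult)
    also have "\<dots> \<le> (ennreal B * indicator (cball 0 R) x) * slice_density j (x $ j)"
      by (rule mult_mono[OF _ tube_flux_bound]) (use B R in \<open>auto simp: indicator_def intro: ennreal_leI\<close>)
    finally show "ennreal (norm (\<psi> x * tube_flux h j x)) \<le> ennreal B * (indicator (cball 0 R) x * slice_density j (x $ j))"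
      by (simp only: mult.assoc)
  qed
  also have "\<dots> = ennreal B * (\<integral>\<^sup>+x. indicator (cball 0 R) x * slice_density j (x $ j) \<partial>lborel)" by (rule nn_integral_cmult) measurable
  also have "\<dots> < \<infinity>" using slice_density_locally_finite[of R j] by (simp add: ennreal_mult_less_top)
  finally show "(\<integral>\<^sup>+x. ennreal (norm (\<psi> x * tube_flux h j x)) \<partial>lborel) < \<infinity>" .
qed measurable

text \<open>The translation by \<open>s\<close> along \<open>axis j\<close> carries one integrand
  into the other, so only the second is estimated. Both are needed for the two exchanges of
  integrals in \<open>averaged_tube_flux\<close>.\<close>

lemma tube_flux_line_integrable:
  fixes \<psi> :: "real^'n \<Rightarrow> real"
  assumes [measurable]: "\<psi> \<in> borel_measurable borel" and B: "\<And>x. \<bar>\<psi> x\<bar> \<le> B" and R: "\<And>x. \<psi> x \<noteq> 0 \<Longrightarrow> norm x \<le> R"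
  shows "integrable (lborel \<Otimes>\<^sub>M lborel) (\<lambda>(x, s). \<psi> x * (tube_flux h j (x + s *\<^sub>R axis j 1) * indicator {0..h} s))" (is "integrable _ ?f")
    and "integrable (lborel \<Otimes>\<^sub>M lborel) (\<lambda>(x, s). \<psi> (x - s *\<^sub>R axis j 1) * indicator {0..h} s * tube_flux h j x)" (is "integrable _ ?g")
proof -
  have [measurable]: "cball (0 :: real^'n) r \<in> sets borel" for r by simp
  let ?e = "axis j 1 :: real^'n"
  have fm: "?f \<in> borel_measurable (lborel \<Otimes>\<^sub>M lborel)" by measurable
  have gm: "?g \<in> borel_measurable (lborel \<Otimes>\<^sub>M lborel)" by measurable
  have g_fin: "(\<integral>\<^sup>+p. ennreal (norm (?g p)) \<partial>(lborel \<Otimes>\<^sub>M lborel)) < \<infinity>"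
  proof -
    have "(\<integral>\<^sup>+p. ennreal (norm (?g p)) \<partial>(lborel \<Otimes>\<^sub>M lborel)) = (\<integral>\<^sup>+s. \<integral>\<^sup>+x. ennreal (norm (?g (x, s))) \<partial>lborel \<partial>lborel)"
      using gm by (intro lborel_pair.nn_integral_snd[symmetric]) measurable
    also have "\<dots> \<le> (\<integral>\<^sup>+s. \<integral>\<^sup>+x. (indicator {0..h} s * ennreal B) * (indicator (cball 0 (R + h)) x * slice_density j (x $ j)) \<partial>lborel \<partial>lborel)"
    proof (intro nn_integral_mono)
      fix s x
      have sup: "norm x \<le> R + h" if "\<psi> (x - s *\<^sub>R ?e) \<noteq> 0" "s \<in> {0..h}"
      proof -
        have "norm x \<le> norm (x - s *\<^sub>R ?e) + norm (s *\<^sub>R ?e)" using norm_triangle_ineq[of "x - s *\<^sub>R ?e" "s *\<^sub>R ?e"] by simp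
        also have "\<dots> \<le> R + h" using that R by (intro add_mono) (auto simp: norm_axis_1)
        finally show ?thesis .
      qed
      have "ennreal (norm (?g (x, s))) = ennreal \<bar>\<psi> (x - s *\<^sub>R ?e) * indicator {0..h} s\<bar> * ennreal \<bar>tube_flux h j x\<bar>" by (simp add: abs_mult ennreal_mult)
      also have "\<dots> \<le> (indicator {0..h} s * ennreal B * indicator (cball 0 (R + h)) x) * slice_density j (x $ j)"
        by (rule mult_mono[OF _ tube_flux_bound]) (use B sup in \<open>auto simp: indicator_def intro: ennreal_leI\<close>)
      finally show "ennreal (norm (?g (x, s))) \<le> (indicator {0..h} s * ennreal B) * (indicator (cball 0 (R + h)) x * slice_density j (x $ j))"
        by (simp only: mult.assoc)
    qed
    also have "\<dots> = (\<integral>\<^sup>+s. (indicator {0..h} s * ennreal B) * (\<integral>\<^sup>+x. indicator (cball 0 (R + h)) x * slice_density j (x $ j) \<partial>lborel) \<partial>lborel)"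
      by (intro nn_integral_cong nn_integral_cmult) measurable
    also have "\<dots> = (emeasure lborel {0..h} * ennreal B) * (\<integral>\<^sup>+x. indicator (cball 0 (R + h)) x * slice_density j (x $ j) \<partial>lborel)"
      by (simp add: nn_integral_multc del: emeasure_lborel_Icc_eq)
    also have "\<dots> < \<infinity>" using slice_density_locally_finite[of "R + h" j] by (simp add: ennreal_mult_less_top emeasure_lborel_Icc_eq)
    finally show ?thesis .
  qed
  then show "integrable (lborel \<Otimes>\<^sub>M lborel) ?g" by (intro integrableI_bounded gm)
  have "(\<integral>\<^sup>+p. ennreal (norm (?f p)) \<partial>(lborel \<Otimes>\<^sub>M lborel)) = (\<integral>\<^sup>+s. \<integral>\<^sup>+x. ennreal (norm (?f (x, s))) \<partial>lborel \<partial>lborel)"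
    using fm by (intro lborel_pair.nn_integral_snd[symmetric]) measurable
  also have "\<dots> = (\<integral>\<^sup>+s. \<integral>\<^sup>+x. ennreal (norm (?g (x, s))) \<partial>lborel \<partial>lborel)"
  proof (rule nn_integral_cong)
    fix s :: real
    have "(\<lambda>x. ennreal (norm (?g (x, s)))) \<in> borel_measurable borel" by simp
    from nn_integral_translate[OF this, of "s *\<^sub>R ?e"]
    show "(\<integral>\<^sup>+x. ennreal (norm (?f (x, s))) \<partial>lborel) = (\<integral>\<^sup>+x. ennreal (norm (?g (x, s))) \<partial>lborel)"
      by (simp add: mult_ac)
  qed
  also have "\<dots> = (\<integral>\<^sup>+p. ennreal (norm (?g p)) \<partial>(lborel \<Otimes>\<^sub>M lborel))"
    using gm by (intro lborel_pair.nn_integral_snd) measurable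
  finally show "integrable (lborel \<Otimes>\<^sub>M lborel) ?f" using g_fin fm by (intro integrableI_bounded) auto
qed

text \<open>As \<open>s\<close> runs through the open interval, the faces sweep the open cube. Only
  the end points \<open>s = 0\<close> and \<open>s = h\<close> have to be left out, as their faces
  are not in the cube.\<close>

lemma tube_flux_integral:
  assumes "h > 0"
  shows "(LINT s|lborel. tube_flux h j (x + s *\<^sub>R axis j 1) * indicator {0..h} s) = flux_measure j (box x (shift x h))"
proof -
  have [measurable]: "(\<lambda>t. flux_kernel j t (box x (shift x h))) \<in> borel_measurable borel" by (rule flux_kernel_measurable) simp
  have "AE s in lborel. s \<noteq> 0 \<and> s \<noteq> h" using AE_lborel_singleton[of 0] AE_lborel_singleton[of h] by eventually_elim simp
  then have "AE s in lborel. tube_flux h j (x + s *\<^sub>R axis j 1) * indicator {0..h} s = flux_kernel j (x $ j + s) (box x (shift x h))"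
  proof eventually_elim
    fix s assume s: "s \<noteq> 0 \<and> s \<noteq> h"
    show "tube_flux h j (x + s *\<^sub>R axis j 1) * indicator {0..h} s = flux_kernel j (x $ j + s) (box x (shift x h))"
    proof (cases "s \<in> {0..h}")
      case True
      have "y \<in> box x (shift x h) \<longleftrightarrow> y \<in> tube h j x" if "y $ j = x $ j + s" for y
      proof -
        have "x $ j < y $ j \<and> y $ j < x $ j + h" using that True s by auto
        then show ?thesis unfolding mem_box_vec shift_def tube_def by simp metis
      qed
      then have "box x (shift x h) \<inter> {y. y $ j = x $ j + s} = tube h j x \<inter> {y. y $ j = x $ j + s}" by blast
      then have "flux_kernel j (x $ j + s) (box x (shift x h)) = flux_kernel j (x $ j + s) (tube h j x)"
        using flux_kernel_slice[of j "x $ j + s" "box x (shift x h)"] flux_kernel_slice[of j "x $ j + s" "tube h j x"] by simp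
      then show ?thesis using True by (simp add: tube_flux_axis)
    next
      case False
      then have "box x (shift x h) \<inter> {y. y $ j = x $ j + s} = {}" by (auto simp: mem_box_vec shift_def dest!: spec[of _ j])
      then show ?thesis using False flux_kernel_slice[of j "x $ j + s" "box x (shift x h)"] fvm_empty[OF flux_kernel_fvm] by simp
    qed
  qed
  then have "(LINT s|lborel. tube_flux h j (x + s *\<^sub>R axis j 1) * indicator {0..h} s) = (LINT s|lborel. flux_kernel j (s + x $ j) (box x (shift x h)))"
    by (intro integral_cong_AE) (auto simp: add.commute)
  also have "\<dots> = flux_measure j (box x (shift x h))"
    unfolding flux_measure_def by (rule integral_translate) measurable
  finally show ?thesis .
qed

text \<open>The balance of the cube rewritten with the kernel, which is possible when the levels of
  all faces avoid \<open>bad_levels\<close>. The surrounding cube in \<Omega> leaves room for the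
  prolonged boxes.\<close>

lemma AE_box_balance:
  assumes h: "h > 0"
  shows "AE x in lborel. cbox (shift x (- h)) (shift x (2 * h)) \<subseteq> \<Omega> \<longrightarrow>
    \<sigma> (box x (shift x h) \<inter> \<Omega>) = (\<Sum>j\<in>UNIV. tube_flux h j x - tube_flux h j (x + h *\<^sub>R axis j 1))"
proof -
  have bad: "AE t in lborel. t \<notin> bad_levels j" for j by (rule AE_not_in) (use bad_levels in \<open>auto simp: null_sets_def\<close>)
  have "AE x in (lborel :: (real^'n) measure). \<forall>j. x $ j + 0 \<notin> bad_levels j \<and> x $ j + h \<notin> bad_levels j"
    unfolding AE_all_countable by (intro allI AE_conjI AE_coordinate bad)
  with AE_generic[of h] show ?thesis
  proof (eventually_elim, intro impI)
    fix x assume g: "generic x h" and b: "\<forall>j. x $ j + 0 \<notin> bad_levels j \<and> x $ j + h \<notin> bad_levels j"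
      and sub: "cbox (shift x (- h)) (shift x (2 * h)) \<subseteq> \<Omega>"
    have slice: "flux_kernel j (x $ j + s) (tube h j x) = hf j (x $ j + s) (face x h j (x $ j + s))"
      if s: "s = 0 \<or> s = h" for j s
    proof -
      have "face x h j (x $ j + s) \<subseteq> cbox (shift x (- h)) (shift x (2 * h))"
      proof
        fix y assume y: "y \<in> face x h j (x $ j + s)"
        have "x $ i - h \<le> y $ i \<and> y $ i \<le> x $ i + 2 * h" for i
          using y h s by (cases "i = j") (auto simp: face_def dest!: spec[of _ i])
        then show "y \<in> cbox (shift x (- h)) (shift x (2 * h))" by (simp add: mem_cbox_vec shift_def)
      qed
      then have "face x h j (x $ j + s) \<subseteq> \<Omega>" using sub by (rule subset_trans)
      then have "tube h j x \<inter> (\<Omega> \<inter> {y. y $ j = x $ j + s}) = face x h j (x $ j + s)" by (auto simp: tube_def face_def)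
      then show ?thesis using b s by (auto simp: flux_kernel_def)
    qed
    have "box x (shift x h) \<subseteq> cbox (shift x (- h)) (shift x (2 * h))"
    proof
      fix y assume y: "y \<in> box x (shift x h)"
      have "x $ i - h \<le> y $ i \<and> y $ i \<le> x $ i + 2 * h" for i
        using y h by (auto simp: mem_box_vec shift_def dest!: spec[of _ i])
      then show "y \<in> cbox (shift x (- h)) (shift x (2 * h))" by (simp add: mem_cbox_vec shift_def)
    qed
    then have "box x (shift x h) \<inter> \<Omega> = box x (shift x h)" using sub by auto
    then show "\<sigma> (box x (shift x h) \<inter> \<Omega>) = (\<Sum>j\<in>UNIV. tube_flux h j x - tube_flux h j (x + h *\<^sub>R axis j 1))"
      using box_flux_balance[OF h g sub] slice[of 0] slice[of h] by (simp add: tube_flux_axis) (simp add: tube_flux_def)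
  qed
qed

end

section \<open>Test functions along coordinate lines\<close>

lemma partial_test_function:
  assumes \<phi>: "\<phi> \<in> test_functions \<Omega>" shows "partial j \<phi> \<in> test_functions \<Omega>"
proof -
  let ?K = "closure {x. \<phi> x \<noteq> 0}"
  have "partial j \<phi> x = 0" if x: "x \<notin> ?K" for x
  proof -
    have "(\<phi> has_derivative (\<lambda>_. 0)) (at x)"
    proof (rule has_derivative_transform_within_open[OF has_derivative_const[of 0]])
      show "open (- ?K)" by auto
      show "0 = \<phi> y" if "y \<in> - ?K" for y using that closure_subset[of "{x. \<phi> x \<noteq> 0}"] by auto
    qed (use x in auto)
    then show ?thesis by (simp add: partial_eq)
  qed
  then have "{x. partial j \<phi> x \<noteq> 0} \<subseteq> ?K" by auto
  moreover have "compactly_inside ?K \<Omega>" using \<phi> by (simp add: test_functions_def compactly_inside_def)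
  ultimately show ?thesis
    using \<phi> compactly_inside_subset[of ?K \<Omega>] by (simp add: test_functions_def smooth_partial)
qed

lemma smooth_increment:
  fixes \<phi> :: "real^'n::finite \<Rightarrow> real"
  assumes \<phi>: "smooth \<phi>" and h: "0 \<le> h"
  shows "(LINT s|lborel. partial j \<phi> (x - s *\<^sub>R axis j 1) * indicator {0..h} s) = \<phi> x - \<phi> (x - h *\<^sub>R axis j 1)"
proof -
  let ?e = "axis j 1 :: real^'n"
  \<comment> \<open>Increasing \<open>s\<close> moves the point backwards along the axis, hence the
    minus sign in the primitive.\<close>
  have der: "((\<lambda>s. - \<phi> (x - s *\<^sub>R ?e)) has_real_derivative partial j \<phi> (x - s *\<^sub>R ?e)) (at s)" for s
  proof -
    let ?D = "frechet_derivative \<phi> (at (x - s *\<^sub>R ?e))"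
    have D: "(\<phi> has_derivative ?D) (at (x - s *\<^sub>R ?e))"
      using \<phi>[unfolded smooth_def, rule_format, of "[]"] by (simp add: frechet_derivative_works)
    have i: "((\<lambda>s. x - s *\<^sub>R ?e) has_derivative (\<lambda>t. - (t *\<^sub>R ?e))) (at s)"
      by (auto intro!: derivative_eq_intros)
    have "((\<lambda>s. - \<phi> (x - s *\<^sub>R ?e)) has_derivative (\<lambda>t. - ?D (- (t *\<^sub>R ?e)))) (at s)"
      by (intro has_derivative_minus has_derivative_compose[OF i D])
    moreover have "- ?D (- (t *\<^sub>R ?e)) = partial j \<phi> (x - s *\<^sub>R ?e) * t" for t
    proof -
      have l: "linear ?D" using has_derivative_bounded_linear[OF D] by (rule bounded_linear.linear)
      show ?thesis by (simp add: linear_neg[OF l] linear_cmul[OF l] partial_def)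
    qed
    ultimately show ?thesis by (simp add: has_field_derivative_def)
  qed
  have "isCont (\<lambda>s. partial j \<phi> (x - s *\<^sub>R ?e)) s" for s
  proof (rule isCont_o2[where g="partial j \<phi>"])
    show "isCont (partial j \<phi>) (x - s *\<^sub>R ?e)"
      using smooth_continuous[OF smooth_partial[OF \<phi>]] by (simp add: continuous_on_eq_continuous_at)
  qed (intro continuous_intros)
  then show ?thesis using integral_FTC_Icc_real[OF h der] by simp
qed

lemma cube_near_support:
  fixes \<psi> :: "real^'n::finite \<Rightarrow> real"
  assumes \<Omega>: "open \<Omega>" and \<psi>: "\<psi> \<in> Cc \<Omega>"
  shows "\<forall>\<^sub>F k in sequentially. \<forall>x. \<psi> x \<noteq> 0 \<longrightarrow> cbox (shift x (- (1 / real (Suc k)))) (shift x (2 * (1 / real (Suc k)))) \<subseteq> \<Omega>"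
proof (cases "{x. \<psi> x \<noteq> 0} = {}")
  case False
  define K where "K = closure {x. \<psi> x \<noteq> 0}"
  have K: "K \<noteq> {}" "compact K" "K \<subseteq> \<Omega>" "\<And>x. \<psi> x \<noteq> 0 \<Longrightarrow> x \<in> K"
    using False \<psi> closure_subset[of "{x. \<psi> x \<noteq> 0}"] by (auto simp: K_def Cc_def compactly_inside_def)
  obtain e where e: "e > 0" "{x. infdist x K \<le> e} \<subseteq> \<Omega>" using compact_in_open_separated[OF K(1,2) \<Omega> K(3)] .
  \<comment> \<open>Coordinates differ by at most \<open>2 * h\<close>, so the sum norm of the
    difference is at most \<open>2 * h * CARD('n)\<close>, which is below \<open>e\<close>.\<close>
  obtain N where N: "1 / real (Suc N) < e / (2 * real CARD('n))" using nat_approx_posE[of "e / (2 * real CARD('n))"] e(1) by auto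
  show ?thesis
  proof (rule eventually_sequentiallyI[of N], intro allI impI subsetI)
    fix k x y assume k: "N \<le> k" and x: "\<psi> x \<noteq> 0"
    define h where "h = 1 / real (Suc k)"
    assume "y \<in> cbox (shift x (- (1 / real (Suc k)))) (shift x (2 * (1 / real (Suc k))))"
    then have y: "y \<in> cbox (shift x (- h)) (shift x (2 * h))" by (simp add: h_def)
    have h: "0 < h" "h < e / (2 * real CARD('n))"
      using N k frac_le[of 1 1 "real (Suc N)" "real (Suc k)"] by (auto simp: h_def simp del: of_nat_Suc)
    have "dist y x \<le> (\<Sum>i\<in>UNIV. \<bar>(y - x) $ i\<bar>)" unfolding dist_norm by (rule norm_le_l1_cart)
    also have "\<dots> \<le> (\<Sum>i\<in>(UNIV::'n set). 2 * h)"
    proof (rule sum_mono)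
      fix i
      have "x $ i - h \<le> y $ i \<and> y $ i \<le> x $ i + 2 * h" using y by (auto simp: mem_cbox_vec shift_def)
      then show "\<bar>(y - x) $ i\<bar> \<le> 2 * h" using h by (auto simp: abs_le_iff)
    qed
    also have "\<dots> \<le> e" using h by (simp add: field_simps)
    finally have "infdist y K \<le> e" using infdist_le[OF K(4)[OF x], of y] by linarith
    then show "y \<in> \<Omega>" using e(2) by auto
  qed
qed auto

context flux
begin

text \<open>An integration by parts that is exact for every \<open>h\<close>: the translation goes
  onto \<phi>, whose increment is the integral of \<open>partial j \<phi>\<close> over a segment of
  length \<open>h\<close>. After exchanging integrals and translating back, this segment acts on the
  faces, which sweep out the cube.\<close>

lemma averaged_tube_flux:
  assumes \<phi>: "\<phi> \<in> test_functions \<Omega>" and h: "h > 0"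
  shows "integrable lborel (\<lambda>x. \<phi> x * tube_flux h j x)"
    and "integrable lborel (\<lambda>x. \<phi> x * tube_flux h j (x + h *\<^sub>R axis j 1))"
    and "(LINT x|lborel. \<phi> x * tube_flux h j x) - (LINT x|lborel. \<phi> x * tube_flux h j (x + h *\<^sub>R axis j 1)) =
      (LINT x|lborel. partial j \<phi> x * flux_measure j (box x (shift x h)))"
proof -
  let ?e = "axis j 1 :: real^'n"
  let ?T = "tube_flux h j"
  note C = test_function_Cc[OF \<phi>] and C' = test_function_Cc[OF partial_test_function[OF \<phi>, of j]]
  have [measurable]: "\<phi> \<in> borel_measurable borel" "partial j \<phi> \<in> borel_measurable borel"
    using C C' by (auto intro: Cc_measurable)
  obtain B where B: "\<And>x. \<bar>\<phi> x\<bar> \<le> B" using Cc_bounded[OF C] by blast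
  obtain B' where B': "\<And>x. \<bar>partial j \<phi> x\<bar> \<le> B'" using Cc_bounded[OF C'] by blast
  obtain R where R: "\<And>x. \<phi> x \<noteq> 0 \<Longrightarrow> norm x \<le> R" using Cc_bounded_support[OF C] by (auto simp: bounded_iff)
  obtain R' where R': "\<And>x. partial j \<phi> x \<noteq> 0 \<Longrightarrow> norm x \<le> R'" using Cc_bounded_support[OF C'] by (auto simp: bounded_iff)
  show i1: "integrable lborel (\<lambda>x. \<phi> x * ?T x)" by (rule tube_flux_integrable[OF _ B R]) auto
  have i2: "integrable lborel (\<lambda>x. \<phi> (x - h *\<^sub>R ?e) * ?T x)"
  proof (rule tube_flux_integrable[OF _ B])
    fix x assume "\<phi> (x - h *\<^sub>R ?e) \<noteq> 0"
    then have "norm (x - h *\<^sub>R ?e) \<le> R" by (rule R)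
    then show "norm x \<le> R + h" using norm_triangle_ineq[of "x - h *\<^sub>R ?e" "h *\<^sub>R ?e"] h by (simp add: norm_axis_1)
  qed measurable
  show "integrable lborel (\<lambda>x. \<phi> x * ?T (x + h *\<^sub>R ?e))" using integrable_translate[OF i2, of "h *\<^sub>R ?e"] by simp
  have "(LINT x|lborel. \<phi> x * ?T (x + h *\<^sub>R ?e)) = (LINT x|lborel. \<phi> (x - h *\<^sub>R ?e) * ?T x)"
    using integral_translate[of "\<lambda>x. \<phi> (x - h *\<^sub>R ?e) * ?T x" "h *\<^sub>R ?e"] by simp
  then have "(LINT x|lborel. \<phi> x * ?T x) - (LINT x|lborel. \<phi> x * ?T (x + h *\<^sub>R ?e)) =
      (LINT x|lborel. (\<phi> x - \<phi> (x - h *\<^sub>R ?e)) * ?T x)"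
    unfolding left_diff_distrib using i1 i2 by (subst Bochner_Integration.integral_diff) auto
  also have "\<dots> = (LINT x|lborel. LINT s|lborel. partial j \<phi> (x - s *\<^sub>R ?e) * indicator {0..h} s * ?T x)"
  proof (rule Bochner_Integration.integral_cong[OF refl])
    fix x
    show "(\<phi> x - \<phi> (x - h *\<^sub>R ?e)) * ?T x = (LINT s|lborel. partial j \<phi> (x - s *\<^sub>R ?e) * indicator {0..h} s * ?T x)"
      using \<phi> h by (subst integral_mult_left_zero) (simp add: smooth_increment test_functions_def)
  qed
  also have "\<dots> = (LINT s|lborel. LINT x|lborel. partial j \<phi> (x - s *\<^sub>R ?e) * indicator {0..h} s * ?T x)"
    by (rule lborel_pair.Fubini_integral[symmetric]) (rule tube_flux_line_integrable(2)[OF _ B' R'], auto)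
  also have "\<dots> = (LINT s|lborel. LINT x|lborel. partial j \<phi> x * (?T (x + s *\<^sub>R ?e) * indicator {0..h} s))"
  proof (rule Bochner_Integration.integral_cong[OF refl])
    fix s :: real
    have "(\<lambda>x. partial j \<phi> (x - s *\<^sub>R ?e) * indicator {0..h} s * ?T x) \<in> borel_measurable borel" by measurable
    from integral_translate[OF this, of "s *\<^sub>R ?e"]
    show "(LINT x|lborel. partial j \<phi> (x - s *\<^sub>R ?e) * indicator {0..h} s * ?T x) =
        (LINT x|lborel. partial j \<phi> x * (?T (x + s *\<^sub>R ?e) * indicator {0..h} s))"
      by (simp add: mult_ac)
  qed
  also have "\<dots> = (LINT x|lborel. LINT s|lborel. partial j \<phi> x * (?T (x + s *\<^sub>R ?e) * indicator {0..h} s))"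
    by (rule lborel_pair.Fubini_integral) (rule tube_flux_line_integrable(1)[OF _ B' R'], auto)
  also have "\<dots> = (LINT x|lborel. partial j \<phi> x * flux_measure j (box x (shift x h)))"
    by (simp add: tube_flux_integral[OF h])
  finally show "(LINT x|lborel. \<phi> x * ?T x) - (LINT x|lborel. \<phi> x * ?T (x + h *\<^sub>R ?e)) =
      (LINT x|lborel. partial j \<phi> x * flux_measure j (box x (shift x h)))" .
qed

lemma averaged_balance:
  assumes \<phi>: "\<phi> \<in> test_functions \<Omega>" and h: "h > 0"
    and near: "\<And>x. \<phi> x \<noteq> 0 \<Longrightarrow> cbox (shift x (- h)) (shift x (2 * h)) \<subseteq> \<Omega>"
  shows "(LINT x|lborel. \<phi> x * \<sigma> (box x (shift x h) \<inter> \<Omega>)) =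
    (\<Sum>j\<in>UNIV. LINT x|lborel. partial j \<phi> x * flux_measure j (box x (shift x h)))"
proof -
  note A = averaged_tube_flux[OF \<phi> h]
  have [measurable]: "\<phi> \<in> borel_measurable borel" using test_function_Cc[OF \<phi>] by (rule Cc_measurable)
  have [measurable]: "(\<lambda>x. \<sigma> (box x (shift x h) \<inter> \<Omega>)) \<in> borel_measurable borel"
    by (rule box_shift_measurable_signed[OF \<Omega>_borel fvm_\<sigma>])
  have "(LINT x|lborel. \<phi> x * \<sigma> (box x (shift x h) \<inter> \<Omega>)) =
      (LINT x|lborel. (\<Sum>j\<in>UNIV. \<phi> x * tube_flux h j x - \<phi> x * tube_flux h j (x + h *\<^sub>R axis j 1)))"
  proof (rule integral_cong_AE)
    show "AE x in lborel. \<phi> x * \<sigma> (box x (shift x h) \<inter> \<Omega>) =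
        (\<Sum>j\<in>UNIV. \<phi> x * tube_flux h j x - \<phi> x * tube_flux h j (x + h *\<^sub>R axis j 1))"
      using AE_box_balance[OF h]
    proof eventually_elim
      fix x assume b: "cbox (shift x (- h)) (shift x (2 * h)) \<subseteq> \<Omega> \<longrightarrow>
        \<sigma> (box x (shift x h) \<inter> \<Omega>) = (\<Sum>j\<in>UNIV. tube_flux h j x - tube_flux h j (x + h *\<^sub>R axis j 1))"
      show "\<phi> x * \<sigma> (box x (shift x h) \<inter> \<Omega>) =
        (\<Sum>j\<in>UNIV. \<phi> x * tube_flux h j x - \<phi> x * tube_flux h j (x + h *\<^sub>R axis j 1))"
      proof (cases "\<phi> x = 0")
        case False
        then show ?thesis using b near by (simp add: sum_distrib_left right_diff_distrib)
      qed simp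
    qed
  qed measurable
  also have "\<dots> = (\<Sum>j\<in>UNIV. LINT x|lborel. \<phi> x * tube_flux h j x - \<phi> x * tube_flux h j (x + h *\<^sub>R axis j 1))"
    using A(1,2) by (intro Bochner_Integration.integral_sum) auto
  also have "\<dots> = (\<Sum>j\<in>UNIV. LINT x|lborel. partial j \<phi> x * flux_measure j (box x (shift x h)))"
    using A by (intro sum.cong refl) (subst Bochner_Integration.integral_diff, auto)
  finally show ?thesis .
qed

text \<open>Both sides of the averaged balance, scaled by the inverse volume of the cube, converge
  along \<open>h = 1 / Suc k\<close>; they are equal as soon as the enlarged cubes at points of the
  support stay in \<Omega>.\<close>

lemma divergence_flux_measure:
  assumes \<phi>: "\<phi> \<in> test_functions \<Omega>"
  shows "(\<Sum>j\<in>UNIV. signed_integral \<Omega> (flux_measure j) (partial j \<phi>)) = signed_integral \<Omega> \<sigma> \<phi>"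
proof (rule LIMSEQ_unique)
  let ?h = "\<lambda>k. 1 / real (Suc k)"
  let ?S = "\<lambda>k. (LINT x|lborel. \<phi> x * \<sigma> (box x (shift x (?h k)) \<inter> \<Omega>)) * real (Suc k) ^ CARD('n)"
  show "?S \<longlonglongrightarrow> signed_integral \<Omega> \<sigma> \<phi>"
    by (rule box_average_limit[OF \<Omega>_borel fvm_\<sigma> test_function_Cc[OF \<phi>]])
  have fm: "fvm \<Omega> (flux_measure j)" for j by (rule fvm_subset[OF flux_measure_fvm]) simp
  have "(\<lambda>k. \<Sum>j\<in>UNIV. (LINT x|lborel. partial j \<phi> x * flux_measure j (box x (shift x (?h k)) \<inter> \<Omega>)) * real (Suc k) ^ CARD('n))
      \<longlonglongrightarrow> (\<Sum>j\<in>UNIV. signed_integral \<Omega> (flux_measure j) (partial j \<phi>))"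
    by (intro tendsto_sum box_average_limit[OF \<Omega>_borel fm] test_function_Cc partial_test_function \<phi>)
  moreover have "\<forall>\<^sub>F k in sequentially.
      (\<Sum>j\<in>UNIV. (LINT x|lborel. partial j \<phi> x * flux_measure j (box x (shift x (?h k)) \<inter> \<Omega>)) * real (Suc k) ^ CARD('n)) = ?S k"
    using cube_near_support[OF open_\<Omega> test_function_Cc[OF \<phi>]]
  proof eventually_elim
    fix k assume near: "\<forall>x. \<phi> x \<noteq> 0 \<longrightarrow> cbox (shift x (- ?h k)) (shift x (2 * ?h k)) \<subseteq> \<Omega>"
    have "?h k > 0" by simp
    from averaged_balance[OF \<phi> this] near
    show "(\<Sum>j\<in>UNIV. (LINT x|lborel. partial j \<phi> x * flux_measure j (box x (shift x (?h k)) \<inter> \<Omega>)) * real (Suc k) ^ CARD('n)) = ?S k"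
      by (simp add: flux_measure_\<Omega> sum_distrib_right del: of_nat_Suc)
  qed
  ultimately show "?S \<longlonglongrightarrow> (\<Sum>j\<in>UNIV. signed_integral \<Omega> (flux_measure j) (partial j \<phi>))" by (rule Lim_transform_eventually)
qed

end

section \<open>The divergence of \<open>F\<close> and the normal trace\<close>

theorem theorem8p2:
  fixes \<Omega> :: "(real^'n::finite) set"
    and \<F> :: "(real^'n) set \<Rightarrow> (real^'n) set \<Rightarrow> real"
    and \<sigma> :: "(real^'n) set \<Rightarrow> real"
    and \<mu> :: "(real^'n) measure"
    and F :: "(real^'n) set \<Rightarrow> real^'n"
  assumes "CARD('n) \<ge> 2"
    and "open \<Omega>"
    and "cauchy_flux \<Omega> \<F> \<sigma> \<mu>"
    and "\<And>S j. S \<in> sets borel \<Longrightarrow> S \<subseteq> \<Omega> \<Longrightarrow>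
           F S $ j = (LINT t|lebesgue. halfspace_flux \<Omega> \<F> \<mu> j t (S \<inter> frontier (halfsp j t)))"
  shows "F \<in> DM_ext \<Omega> \<and>
     (\<forall>\<phi>\<in>test_functions \<Omega>. - distr_div \<Omega> F \<phi> = signed_integral \<Omega> \<sigma> \<phi>) \<and>
     (\<forall>U. open U \<and> compactly_inside U \<Omega> \<longrightarrow>
        \<F> U (frontier U) = \<sigma> U \<and> \<sigma> U = normal_trace \<Omega> F U (indicator \<Omega>))"
proof -
  interpret flux \<Omega> \<F> \<sigma> \<mu> by (rule flux.intro) (fact assms)+
  have F: "F S $ j = flux_measure j S" if "S \<in> sets borel" "S \<subseteq> \<Omega>" for S j
    using assms(4)[OF that] flux_measure_eq[OF that] by simp
  have fvm_F: "fvm \<Omega> F"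
  proof (rule fvmI)
    fix S :: "nat \<Rightarrow> (real^'n) set" assume S: "\<And>i. S i \<in> sets borel" "\<And>i. S i \<subseteq> \<Omega>" "disjoint_family S"
    have "(\<lambda>n. (\<Sum>i<n. F (S i)) $ j) \<longlonglongrightarrow> F (\<Union>i. S i) $ j" for j
    proof -
      have "(\<lambda>i. flux_measure j (S i)) sums flux_measure j (\<Union>i. S i)" using S by (intro fvmD[OF flux_measure_fvm]) auto
      moreover have "F (\<Union>i. S i) $ j = flux_measure j (\<Union>i. S i)" using S by (intro F) auto
      ultimately show ?thesis using F S by (simp add: sums_def)
    qed
    then show "(\<lambda>i. F (S i)) sums F (\<Union>i. S i)" unfolding sums_def by (rule vec_tendstoI)
  qed
  have div: "- distr_div \<Omega> F \<phi> = signed_integral \<Omega> \<sigma> \<phi>" if \<phi>: "\<phi> \<in> test_functions \<Omega>" for \<phi>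
  proof -
    have "signed_integral \<Omega> (\<lambda>S. F S $ j) (partial j \<phi>) = signed_integral \<Omega> (flux_measure j) (partial j \<phi>)" for j
      by (rule signed_integral_cong_measure) (rule F)
    then show ?thesis using divergence_flux_measure[OF \<phi>] by (simp add: distr_div_def)
  qed
  have div_\<sigma>: "is_div_measure \<Omega> F (\<lambda>S. - \<sigma> S)"
    unfolding is_div_measure_def
  proof (intro conjI ballI)
    fix \<phi> assume "\<phi> \<in> test_functions \<Omega>"
    from div[OF this] show "distr_div \<Omega> F \<phi> = signed_integral \<Omega> (\<lambda>S. - \<sigma> S) \<phi>"
      unfolding signed_integral_uminus by simp
  qed (rule fvm_uminus[OF fvm_\<sigma>])
  have div_F: "is_div_measure \<Omega> F (div_measure \<Omega> F)"
    unfolding div_measure_def by (rule someI[of "is_div_measure \<Omega> F"]) (rule div_\<sigma>)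
  \<comment> \<open>\<open>div_measure\<close> is a choice; uniqueness by test functions pins it
    down on Borel subsets of \<Omega>, which is all that the trace evaluates.\<close>
  have eq: "div_measure \<Omega> F S = - \<sigma> S" if "S \<in> sets borel" "S \<subseteq> \<Omega>" for S
  proof (rule signed_measure_eq_of_test_functions[OF open_\<Omega> _ _ _ that])
    fix \<phi> assume "\<phi> \<in> test_functions \<Omega>"
    then show "signed_integral \<Omega> (div_measure \<Omega> F) \<phi> = signed_integral \<Omega> (\<lambda>S. - \<sigma> S) \<phi>"
      using div_F div_\<sigma> by (simp add: is_div_measure_def)
  qed (use div_F div_\<sigma> in \<open>auto simp: is_div_measure_def\<close>)
  have trace: "\<sigma> U = normal_trace \<Omega> F U (indicator \<Omega>)" if U: "open U" "compactly_inside U \<Omega>" for U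
  proof -
    have sub: "U \<subseteq> \<Omega>" using U(2) closure_subset[of U] by (auto simp: compactly_inside_def)
    have Ub: "U \<in> sets borel" using U(1) by auto
    have ind: "(\<lambda>x. indicator U x * indicator \<Omega> x) = (indicator U :: real^'n \<Rightarrow> real)"
      using sub by (auto simp: indicator_def fun_eq_iff)
    have "fvm \<Omega> (div_measure \<Omega> F)" using div_F by (simp add: is_div_measure_def)
    from signed_integral_indicator[OF this \<Omega>_borel Ub sub] eq[OF Ub sub]
    show ?thesis by (simp add: normal_trace_def ind pairing_indicator[OF open_\<Omega> Ub sub])
  qed
  have "F \<in> DM_ext \<Omega>" using fvm_F div_\<sigma> by (auto simp: DM_ext_def)
  then show ?thesis using div balance trace by blast
qed

end
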